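(* For each $t\in[0,T]$ let $\varphi^t:H\to(-\infty,\infty]$ be a proper lower-semicontinuous convex functional, suppose that conditions (A1) and (A2) (stated in the context) hold, and let $u_0\in D(\varphi^0)$. Call $(u,g)$ an admissible pair if $u,g\in L^2(0,T;H)$, $\varphi^\bullet(u(\bullet))\in L^1(0,T)$, $u(t)\in D(\partial\varphi^t)$ and $g(t)\in\partial\varphi^t(u(t))$ for a.e. $t\in(0,T)$. For $k\in L^1(0,T)$ and an admissible pair $(u,g)$, and for $c\in[0,\infty)$, consider the inequality $$\begin{aligned}\int_0^t\bigl(\partial_t[k*(u-u_0)](s),g(s)\bigr)_H\,ds\ \ge\ &\bigl[k*\varphi^\bullet(u(\bullet))\bigr](t)-\varphi^0(u_0)\int_0^tk(s)\,ds-\varepsilon c\|k\|_{L^1(0,T)}\int_0^t\|g(s)\|_H^2\,ds\\&-\frac c\varepsilon\,t\,\|k\|_{L^1(0,T)}\bigl(1+|\varphi^0(u_0)|\bigr)-\frac c\varepsilon\|k\|_{L^1(0,T)}\int_0^t|\varphi^s(u(s))|\,ds.\end{aligned}\tag{$*$}$$ There exists a constant $c\in[0,\infty)$, independent of $u,g,k$ and $\varepsilon$, for which $( * )$ holds for all $\varepsilon\in(0,1)$ and all $t\in(0,T]$ whenever $(u,g)$ is an admissible pair and $k\in W^{1,1}(0,T)$ is nonnegative and nonincreasing, and with this same constant $c$ the following is true: if $(k,\ell)\in PC$ and $(u,g)$ is an admissible pair with $u-u_0\in D(\mathcal B)$, then $( * )$ holds for all $\varepsilon\in(0,1)$ and all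 $t\in(0,T]$. In particular, given $(k,\ell)\in PC$, there exists a constant $C\in[0,\infty)$ independent of $u$ and $g$ such that, for every admissible pair $(u,g)$ with $u-u_0\in D(\mathcal B)$ and all $\varepsilon\in(0,1)$, $$\begin{aligned}\int_0^t\bigl(\partial_t[k*(u-u_0)](s),g(s)\bigr)_H\,ds\ \ge\ &\bigl[k*\varphi^\bullet(u(\bullet))\bigr](t)-\varphi^0(u_0)\int_0^tk(s)\,ds-\varepsilon C\int_0^t\|g(s)\|_H^2\,ds\\&-\frac C\varepsilon\left[T\bigl(1+|\varphi^0(u_0)|\bigr)+\int_0^t|\varphi^s(u(s))|\,ds\right]\end{aligned}$$ for all $t\in(0,T]$.
   Context: $T\in(0,\infty)$ is fixed and $H$ is a real Hilbert space with inner product $(\cdot,\cdot)_H$ and norm $\|\cdot\|_H$. Proper means $\varphi^t\not\equiv\infty$. $D(\varphi^t)=\{w\in H:\varphi^t(w)<\infty\}$; the subdifferential is $\partial\varphi^t(z)=\{\xi\in H:\varphi^t(v)-\varphi^t(z)\ge(\xi,v-z)_H\ \text{for all }v\in D(\varphi^t)\}$ for $z \in H$; $D(\partial\varphi^t)=\{w\in D(\varphi^t):\partial\varphi^t(w)\ne\emptyset\}$. The symbol $\varphi^\bullet(u(\bullet))$ denotes the function $t\mapsto\varphi^t(u(t))$. Convolution: $(k*w)(t)=\int_0^tk(t-s)w(s)\,ds$. $(k,\ell)\in PC$ means: $k,\ell\in L^1_{\mathrm{loc}}([0,\infty))$ are both nonnegative and nonincreasing, and $(k*\ell)(t)=\int_0^tk(t-s)\ell(s)\,ds=1$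 for all $t\in(0,\infty)$. For such $k$, $D(\mathcal B)=\{w\in L^2(0,T;H):k*w\in W^{1,2}(0,T;H),\ (k*w)(0)=0\}$ is the domain of the operator $\mathcal B(w)=\partial_t(k*w)$. Condition (A1): there is a constant $c_1\in[0,\infty)$ such that for each $s,t\in[0,T]$ with $s\le t$ and each $z_s\in D(\varphi^s)$ there exists $z_{s,t}\in D(\varphi^t)$ with $$\|z_{s,t}-z_s\|_H\le c_1|t-s|\bigl(1+|\varphi^s(z_s)|\bigr)^{1/2},\qquad \varphi^t(z_{s,t})\le\varphi^s(z_s)+c_1|t-s|\bigl(1+|\varphi^s(z_s)|\bigr).$$ Condition (A2): there is a constant $c_2\in[0,\infty)$ such that for each $u\in L^2(0,T;H)$ satisfying $\varphi^\bullet(u(\bullet))\in L^1(0,T)$ and for each $t\in(0,T)$ there exists a function $w_t\in L^2(0,t;H)$ such that, for a.e. $s\in(0,t)$, $$\|w_t(s)-u(s)\|_H\le c_2|t-s|\bigl(1+|\varphi^s(u(s))|\bigr)^{1/2},\qquad \varphi^t(w_t(s))\le\varphi^s(u(s))+c_2|t-s|\bigl(1+|\varphi^s(u(s))|\bigr).$$ *)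

theory Defs
  imports "HOL-Analysis.Analysis"
begin

text \<open>
  The Hilbert space \<open>H\<close> is the universe of a type of class \<open>real_inner\<close> and \<open>complete_space\<close>.
  It is not assumed separable, whereas the library's Bochner integral requires the codomain to
  be second countable. The Bochner integral of strongly measurable functions is therefore defined
  here, by the same approximation with simple functions. Scalar integrals are those of the library.
\<close>

section \<open>Lebesgue-Bochner and Sobolev spaces of vector-valued functions\<close>

definition strongly_measurable :: "'x measure \<Rightarrow> ('x \<Rightarrow> 'b::real_normed_vector) \<Rightarrow> bool" where
  "strongly_measurable M f \<longleftrightarrow>
     (\<exists>s. (\<forall>i::nat. simple_function M (s i)) \<and> (AE x in M. (\<lambda>i. s i x) \<longlonglongrightarrow> f x))"

definition has_vec_integral :: "'x measure \<Rightarrow> ('x \<Rightarrow> 'b::real_normed_vector) \<Rightarrow> 'b \<Rightarrow> bool" where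
  "has_vec_integral M f y \<longleftrightarrow> strongly_measurable M f \<and>
     (\<exists>s. (\<forall>i::nat. Bochner_Integration.simple_bochner_integrable M (s i)) \<and>
          (\<lambda>i. \<integral>\<^sup>+x. ennreal (norm (f x - s i x)) \<partial>M) \<longlonglongrightarrow> 0 \<and>
          (\<lambda>i. Bochner_Integration.simple_bochner_integral M (s i)) \<longlonglongrightarrow> y)"

definition vec_integral :: "'x measure \<Rightarrow> ('x \<Rightarrow> 'b::real_normed_vector) \<Rightarrow> 'b" where
  "vec_integral M f = (THE y. has_vec_integral M f y)"

definition Lp :: "nat \<Rightarrow> real set \<Rightarrow> (real \<Rightarrow> 'b::real_normed_vector) set" where
  "Lp p S = {f. strongly_measurable (lebesgue_on S) f \<and>
                integrable (lebesgue_on S) (\<lambda>x. norm (f x) ^ p)}"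

definition L1_norm :: "real \<Rightarrow> (real \<Rightarrow> real) \<Rightarrow> real" where
  "L1_norm T k = (\<integral>s. \<bar>k s\<bar> \<partial>lebesgue_on {0<..<T})"

definition test_function :: "real \<Rightarrow> (real \<Rightarrow> real) \<Rightarrow> bool" where
  "test_function T \<eta> \<longleftrightarrow> \<eta> C1_differentiable_on UNIV \<and>
     (\<exists>K. compact K \<and> K \<subseteq> {0<..<T} \<and> (\<forall>s. s \<notin> K \<longrightarrow> \<eta> s = 0))"

definition has_weak_derivative ::
  "real \<Rightarrow> (real \<Rightarrow> 'b::real_normed_vector) \<Rightarrow> (real \<Rightarrow> 'b) \<Rightarrow> bool" where
  "has_weak_derivative T f v \<longleftrightarrow>
     (\<forall>\<eta>. test_function T \<eta> \<longrightarrow>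
        vec_integral (lebesgue_on {0<..<T}) (\<lambda>s. deriv \<eta> s *\<^sub>R f s) =
        - vec_integral (lebesgue_on {0<..<T}) (\<lambda>s. \<eta> s *\<^sub>R v s))"

text \<open>The weak derivative on \<open>(0,T)\<close>, unique up to null sets whenever it exists.\<close>

definition weak_derivative :: "real \<Rightarrow> (real \<Rightarrow> 'b::real_normed_vector) \<Rightarrow> real \<Rightarrow> 'b" where
  "weak_derivative T f = (SOME v. v \<in> Lp 1 {0<..<T} \<and> has_weak_derivative T f v)"

definition W1p :: "nat \<Rightarrow> real \<Rightarrow> (real \<Rightarrow> 'b::real_normed_vector) set" where
  "W1p p T = {f \<in> Lp p {0<..<T}. \<exists>v \<in> Lp p {0<..<T}. has_weak_derivative T f v}"

section \<open>Convolution and kernels\<close>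

definition conv :: "(real \<Rightarrow> real) \<Rightarrow> (real \<Rightarrow> real) \<Rightarrow> real \<Rightarrow> real" where
  "conv k f t = (\<integral>s. k (t - s) * f s \<partial>lebesgue_on {0<..<t})"

definition vec_conv ::
  "(real \<Rightarrow> real) \<Rightarrow> (real \<Rightarrow> 'b::real_normed_vector) \<Rightarrow> real \<Rightarrow> 'b" where
  "vec_conv k w t = vec_integral (lebesgue_on {0<..<t}) (\<lambda>s. k (t - s) *\<^sub>R w s)"

text \<open>
  Kernels may be singular at the origin, so sign and monotonicity are imposed on the open half-line.
\<close>

definition PC :: "(real \<Rightarrow> real) \<Rightarrow> (real \<Rightarrow> real) \<Rightarrow> bool" where
  "PC k l \<longleftrightarrow>
     (\<forall>R>0. integrable (lebesgue_on {0<..<R}) k) \<and> (\<forall>R>0. integrable (lebesgue_on {0<..<R}) l) \<and>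
     (\<forall>t>0. 0 \<le> k t) \<and> (\<forall>t>0. 0 \<le> l t) \<and>
     antimono_on {0<..} k \<and> antimono_on {0<..} l \<and>
     (\<forall>t>0. conv k l t = 1)"

text \<open>
  The integral defining \<open>(k * w)(0)\<close> is over the empty set; the initial condition in \<open>D(B)\<close> concerns
  the continuous representative of the \<open>W\<^sup>1\<^sup>,\<^sup>2\<close> function \<open>k * w\<close>.
\<close>

definition dom_B :: "real \<Rightarrow> (real \<Rightarrow> real) \<Rightarrow> (real \<Rightarrow> 'b::real_normed_vector) set" where
  "dom_B T k = {w \<in> Lp 2 {0<..<T}. vec_conv k w \<in> W1p 2 T \<and>
     (\<exists>f. continuous_on {0..T} f \<and> (AE t in lebesgue_on {0<..<T}. f t = vec_conv k w t) \<and> f 0 = 0)}"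

section \<open>Convex functionals\<close>

definition eff_dom :: "('a \<Rightarrow> ereal) \<Rightarrow> 'a set" where
  "eff_dom \<phi> = {w. \<phi> w < \<infinity>}"

definition proper_lsc_convex :: "('a::real_normed_vector \<Rightarrow> ereal) \<Rightarrow> bool" where
  "proper_lsc_convex \<phi> \<longleftrightarrow>
     (\<forall>z. \<phi> z \<noteq> -\<infinity>) \<and> (\<exists>z. \<phi> z \<noteq> \<infinity>) \<and>
     (\<forall>z. \<phi> z \<le> Liminf (at z) \<phi>) \<and>
     (\<forall>x y. \<forall>a\<in>{0<..<1}. \<phi> ((1 - a) *\<^sub>R x + a *\<^sub>R y) \<le> ereal (1 - a) * \<phi> x + ereal a * \<phi> y)"

definition subdiff :: "('a::real_inner \<Rightarrow> ereal) \<Rightarrow> 'a \<Rightarrow> 'a set" where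
  "subdiff \<phi> z = {\<xi>. \<forall>v\<in>eff_dom \<phi>. \<phi> v - \<phi> z \<ge> ereal (\<xi> \<bullet> (v - z))}"

definition dom_subdiff :: "('a::real_inner \<Rightarrow> ereal) \<Rightarrow> 'a set" where
  "dom_subdiff \<phi> = {w \<in> eff_dom \<phi>. subdiff \<phi> w \<noteq> {}}"

text \<open>
  The function \<open>t \<mapsto> \<phi>\<^sup>t(u(t))\<close> takes values in the extended reals. As \<open>real_of_ereal\<close> sends infinite
  values to \<open>0\<close>, finiteness almost everywhere is a separate clause of integrability.
\<close>

definition energy :: "(real \<Rightarrow> 'a \<Rightarrow> ereal) \<Rightarrow> (real \<Rightarrow> 'a) \<Rightarrow> real \<Rightarrow> real" where
  "energy \<phi> u s = real_of_ereal (\<phi> s (u s))"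

definition energy_L1 :: "real \<Rightarrow> (real \<Rightarrow> 'a \<Rightarrow> ereal) \<Rightarrow> (real \<Rightarrow> 'a) \<Rightarrow> bool" where
  "energy_L1 T \<phi> u \<longleftrightarrow>
     (AE s in lebesgue_on {0<..<T}. \<bar>\<phi> s (u s)\<bar> \<noteq> \<infinity>) \<and>
     integrable (lebesgue_on {0<..<T}) (energy \<phi> u)"

definition cond_A1 :: "real \<Rightarrow> (real \<Rightarrow> 'a::real_normed_vector \<Rightarrow> ereal) \<Rightarrow> bool" where
  "cond_A1 T \<phi> \<longleftrightarrow> (\<exists>c1\<ge>0. \<forall>s\<in>{0..T}. \<forall>t\<in>{0..T}. s \<le> t \<longrightarrow>
     (\<forall>z\<in>eff_dom (\<phi> s). \<exists>z'\<in>eff_dom (\<phi> t).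
        norm (z' - z) \<le> c1 * \<bar>t - s\<bar> * sqrt (1 + \<bar>real_of_ereal (\<phi> s z)\<bar>) \<and>
        \<phi> t z' \<le> \<phi> s z + ereal (c1 * \<bar>t - s\<bar> * (1 + \<bar>real_of_ereal (\<phi> s z)\<bar>))))"

definition cond_A2 :: "real \<Rightarrow> (real \<Rightarrow> 'a::real_normed_vector \<Rightarrow> ereal) \<Rightarrow> bool" where
  "cond_A2 T \<phi> \<longleftrightarrow> (\<exists>c2\<ge>0. \<forall>u\<in>Lp 2 {0<..<T}. energy_L1 T \<phi> u \<longrightarrow>
     (\<forall>t\<in>{0<..<T}. \<exists>w\<in>Lp 2 {0<..<t}. AE s in lebesgue_on {0<..<t}.
        norm (w s - u s) \<le> c2 * \<bar>t - s\<bar> * sqrt (1 + \<bar>energy \<phi> u s\<bar>) \<and>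
        \<phi> t (w s) \<le> \<phi> s (u s) + ereal (c2 * \<bar>t - s\<bar> * (1 + \<bar>energy \<phi> u s\<bar>))))"

definition admissible ::
  "real \<Rightarrow> (real \<Rightarrow> 'a::real_inner \<Rightarrow> ereal) \<Rightarrow> (real \<Rightarrow> 'a) \<Rightarrow> (real \<Rightarrow> 'a) \<Rightarrow> bool" where
  "admissible T \<phi> u g \<longleftrightarrow>
     u \<in> Lp 2 {0<..<T} \<and> g \<in> Lp 2 {0<..<T} \<and> energy_L1 T \<phi> u \<and>
     (AE t in lebesgue_on {0<..<T}. u t \<in> dom_subdiff (\<phi> t) \<and> g t \<in> subdiff (\<phi> t) (u t))"

section \<open>The chain-rule inequalities\<close>

text \<open>
  The convolution \<open>[k * \<phi>(u)](t)\<close> is evaluated at every \<open>t\<close>, not just almost every \<open>t\<close>, also for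
  singular \<open>k\<close>. An inequality with finite left-hand side asserts that it is finite there. Library
  integrals of non-integrable functions are \<open>0\<close>, so this part of the claim is spelled out.
\<close>

definition terms_exist ::
  "real \<Rightarrow> (real \<Rightarrow> 'a::real_inner \<Rightarrow> ereal) \<Rightarrow> 'a \<Rightarrow> (real \<Rightarrow> real) \<Rightarrow>
   (real \<Rightarrow> 'a) \<Rightarrow> (real \<Rightarrow> 'a) \<Rightarrow> real \<Rightarrow> bool" where
  "terms_exist T \<phi> u0 k u g t \<longleftrightarrow>
     vec_conv k (\<lambda>s. u s - u0) \<in> W1p 2 T \<and>
     integrable (lebesgue_on {0<..<t})
       (\<lambda>s. weak_derivative T (vec_conv k (\<lambda>s. u s - u0)) s \<bullet> g s) \<and>
     integrable (lebesgue_on {0<..<t}) (\<lambda>s. k (t - s) * energy \<phi> u s)"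

definition star_ineq ::
  "real \<Rightarrow> (real \<Rightarrow> 'a::real_inner \<Rightarrow> ereal) \<Rightarrow> 'a \<Rightarrow> real \<Rightarrow> (real \<Rightarrow> real) \<Rightarrow>
   (real \<Rightarrow> 'a) \<Rightarrow> (real \<Rightarrow> 'a) \<Rightarrow> real \<Rightarrow> real \<Rightarrow> bool" where
  "star_ineq T \<phi> u0 c k u g \<epsilon> t \<longleftrightarrow>
     terms_exist T \<phi> u0 k u g t \<and>
     (\<integral>s. weak_derivative T (vec_conv k (\<lambda>s. u s - u0)) s \<bullet> g s \<partial>lebesgue_on {0<..<t}) \<ge>
       conv k (energy \<phi> u) t
       - real_of_ereal (\<phi> 0 u0) * (\<integral>s. k s \<partial>lebesgue_on {0<..<t})
       - \<epsilon> * c * L1_norm T k * (\<integral>s. (norm (g s))\<^sup>2 \<partial>lebesgue_on {0<..<t})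
       - c / \<epsilon> * t * L1_norm T k * (1 + \<bar>real_of_ereal (\<phi> 0 u0)\<bar>)
       - c / \<epsilon> * L1_norm T k * (\<integral>s. \<bar>energy \<phi> u s\<bar> \<partial>lebesgue_on {0<..<t})"

end

theory Submission
  imports Defs
begin

text \<open>
  Let \<open>w = u - u\<^sub>0\<close>. Consider first a bounded nonnegative kernel \<open>k(r) = a - \<integral>\<^sub>0\<^sup>r m\<close> with \<open>m \<ge> 0\<close> integrable;
  every nonnegative nonincreasing \<open>W\<^sup>1\<^sup>,\<^sup>1\<close> kernel has this form. The derivative of \<open>k * w\<close> at time \<open>s\<close> is then
  \<open>k(s) (u(s) - u\<^sub>0) + \<integral>\<^sub>0\<^sup>s m(s - r) (u(s) - u(r)) dr\<close>, a combination with nonnegative weights of the increments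
  of \<open>u\<close> from time \<open>0\<close> and from the earlier times \<open>r\<close>. Condition (A1) moves \<open>u(r)\<close> to a nearby point of
  \<open>D(\<phi>\<^sup>s)\<close>, where the subgradient inequality at \<open>u(s)\<close> applies; with Young's inequality,
  \<open>(u(s) - u(r), g(s))\<close> is at least \<open>\<phi>\<^sup>s(u(s)) - \<phi>\<^sup>r(u(r))\<close> up to an error proportional to the time lag \<open>s - r\<close>
  (\<open>subgradient_inequality_moving_time\<close>). Integrating over \<open>(0,t)\<close> and applying Fubini, the energy differences
  sum to \<open>[k * \<phi>(u)](t) - \<phi>\<^sup>0(u\<^sub>0) \<integral>\<^sub>0\<^sup>t k\<close>, and the weighted lags sum to \<open>k(s) s + \<integral>\<^sub>0\<^sup>s r m(r) dr = \<integral>\<^sub>0\<^sup>s k\<close>,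
  so that only the \<open>L\<^sup>1\<close> norm of \<open>k\<close> enters the error (\<open>chain_rule_inequality\<close>). With the constant \<open>c\<close> of (A1), the
  constant \<open>2 c\<close> works.

  A kernel with \<open>(k,l) \<in> PC\<close> may be singular at \<open>0\<close> and is replaced by its forward averages
  \<open>k\<^sub>\<delta>(r) = (1/\<delta>) \<integral>\<^sub>r\<^sup>r\<^sup>+\<^sup>\<delta> k\<close>. They are bounded, nonincreasing and absolutely continuous, lie below \<open>k\<close> and converge
  to \<open>k\<close> as \<open>\<delta> \<rightarrow> 0\<close>, so the inequality holds for them with errors that do not depend on \<open>\<delta>\<close>.
  Let \<open>f\<close> be the derivative of \<open>k * w\<close>. Since \<open>k * w = 1 * f\<close> and \<open>k * l = 1\<close>, one has \<open>w = l * f\<close>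
  (\<open>invert_convolution\<close>), and the derivative of \<open>k\<^sub>\<delta> * w\<close> becomes \<open>\<theta>\<^sub>\<delta> * f\<close> with a weight \<open>\<theta>\<^sub>\<delta>\<close> determined by \<open>k\<close> and
  \<open>l\<close>. This weight is nonnegative and \<open>\<integral>\<^sub>0\<^sup>\<tau> \<theta>\<^sub>\<delta> = (k\<^sub>\<delta> * l)(\<tau>) \<rightarrow> (k * l)(\<tau>) = 1\<close> for every \<open>\<tau> > 0\<close>: it is an
  approximate identity, and the left-hand sides converge because translation is continuous in \<open>L\<^sup>2\<close>. On the
  right, (A1) and convexity give \<open>\<phi>\<^sup>s(z) \<ge> -L (1 + \<parallel>z\<parallel>)\<close> uniformly in \<open>s\<close> (\<open>uniform_linear_lower_bound\<close>), and
  \<open>k * \<parallel>w\<parallel> \<le> k * l * \<parallel>f\<parallel> = 1 * \<parallel>f\<parallel>\<close> is finite at every \<open>t\<close>, not only at almost every one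
  (\<open>kernel_times_resolvent_integrable\<close>). Fatou's lemma then shows that \<open>[k * \<phi>(u)](t)\<close> exists and that the
  inequality survives the limit.

  As \<open>H\<close> need not be separable, each function on \<open>(0,T)\<close> is replaced by a Borel function on the line
  that vanishes outside \<open>(0,T)\<close> and is everywhere a limit of simple functions. Vector-valued integrals are handled
  through their inner products with fixed vectors \<open>c\<close>. To pair with \<open>g(s)\<close> one takes \<open>c = g(s)\<close>; this is why such
  identities are proved for all \<open>c\<close> simultaneously outside one null set of times.
\<close>

section \<open>Pointwise limits of simple functions\<close>

text \<open>
  The convergence is required at every point, unlike in strong measurability. Such functions are Borel
  measurable and compose with every measurable map, without any care about null sets; this is what Fubini
  arguments on product measures need.
\<close>

definition simple_limit :: "'x measure \<Rightarrow> ('x \<Rightarrow> 'b::metric_space) \<Rightarrow> bool" where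
  "simple_limit M f \<longleftrightarrow>
     (\<exists>s. (\<forall>i::nat. simple_function M (s i)) \<and> (\<forall>x\<in>space M. (\<lambda>i. s i x) \<longlonglongrightarrow> f x))"

lemma simple_limitI:
  assumes "\<And>i::nat. simple_function M (s i)" "\<And>x. x \<in> space M \<Longrightarrow> (\<lambda>i. s i x) \<longlonglongrightarrow> f x"
  shows "simple_limit M f"
  using assms unfolding simple_limit_def by blast

lemma simple_limitE:
  assumes "simple_limit M f"
  obtains s where "\<And>i::nat. simple_function M (s i)" "\<And>x. x \<in> space M \<Longrightarrow> (\<lambda>i. s i x) \<longlonglongrightarrow> f x"
  using assms unfolding simple_limit_def by blast

lemma simple_limit_borel_measurable:
  assumes "simple_limit M f" shows "f \<in> borel_measurable M"
proof -
  obtain s where s: "\<And>i::nat. simple_function M (s i)"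
    and lim: "\<And>x. x \<in> space M \<Longrightarrow> (\<lambda>i. s i x) \<longlonglongrightarrow> f x"
    using assms by (rule simple_limitE) blast
  show ?thesis
    by (rule borel_measurable_LIMSEQ_metric[OF borel_measurable_simple_function[OF s] lim])
qed

lemma simple_limit_real:
  fixes f :: "'x \<Rightarrow> real"
  assumes "f \<in> borel_measurable M" shows "simple_limit M f"
  using borel_measurable_implies_sequence_metric[OF assms, of 0] by (auto intro: simple_limitI)

lemma simple_limit_const: "simple_limit M (\<lambda>x. c)"
  by (rule simple_limitI[where s="\<lambda>_ _. c"]) auto

text \<open>
  On a space that is not second countable, the product of the Borel algebras may be too small for a continuous binary
  operation such as the difference or the inner product to be measurable. Passing through simple functions avoids the problem.
\<close>

lemma simple_limit_compose2:
  assumes "simple_limit M f" "simple_limit M g"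
    and h: "\<And>x y X Y. X \<longlonglongrightarrow> x \<Longrightarrow> Y \<longlonglongrightarrow> y \<Longrightarrow> (\<lambda>i::nat. h (X i) (Y i)) \<longlonglongrightarrow> h x y"
  shows "simple_limit M (\<lambda>x. h (f x) (g x))"
proof -
  obtain s where s: "\<And>i::nat. simple_function M (s i)" "\<And>x. x \<in> space M \<Longrightarrow> (\<lambda>i. s i x) \<longlonglongrightarrow> f x"
    using assms(1) by (rule simple_limitE) blast
  obtain t where t: "\<And>i::nat. simple_function M (t i)" "\<And>x. x \<in> space M \<Longrightarrow> (\<lambda>i. t i x) \<longlonglongrightarrow> g x"
    using assms(2) by (rule simple_limitE) blast
  show ?thesis
    by (rule simple_limitI[where s="\<lambda>i x. h (s i x) (t i x)"])
       (use s t in \<open>auto intro: simple_function_compose2 h\<close>)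
qed

lemma simple_limit_add:
  fixes f g :: "'x \<Rightarrow> 'b::real_normed_vector"
  shows "simple_limit M f \<Longrightarrow> simple_limit M g \<Longrightarrow> simple_limit M (\<lambda>x. f x + g x)"
  by (rule simple_limit_compose2) (auto intro: tendsto_add)

lemma simple_limit_diff:
  fixes f g :: "'x \<Rightarrow> 'b::real_normed_vector"
  shows "simple_limit M f \<Longrightarrow> simple_limit M g \<Longrightarrow> simple_limit M (\<lambda>x. f x - g x)"
  by (rule simple_limit_compose2) (auto intro: tendsto_diff)

lemma simple_limit_scaleR:
  fixes f :: "'x \<Rightarrow> 'b::real_normed_vector"
  assumes "a \<in> borel_measurable M" "simple_limit M f"
  shows "simple_limit M (\<lambda>x. a x *\<^sub>R f x)"
  by (rule simple_limit_compose2[OF simple_limit_real[OF assms(1)] assms(2)]) (auto intro: tendsto_scaleR)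

lemma borel_measurable_inner_simple_limit:
  fixes f g :: "'x \<Rightarrow> 'b::real_inner"
  assumes "simple_limit M f" "simple_limit M g"
  shows "(\<lambda>x. f x \<bullet> g x) \<in> borel_measurable M"
  by (intro simple_limit_borel_measurable simple_limit_compose2[OF assms] tendsto_inner)

lemma borel_measurable_norm_simple_limit:
  fixes f :: "'x \<Rightarrow> 'b::real_normed_vector"
  assumes "simple_limit M f"
  shows "(\<lambda>x. norm (f x)) \<in> borel_measurable M"
  using simple_limit_borel_measurable[OF assms] by measurable

lemma simple_limit_comp:
  assumes T: "T \<in> measurable M N" and f: "simple_limit N f"
  shows "simple_limit M (\<lambda>x. f (T x))"
proof -
  obtain s where s: "\<And>i::nat. simple_function N (s i)" "\<And>x. x \<in> space N \<Longrightarrow> (\<lambda>i. s i x) \<longlonglongrightarrow> f x"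
    using f by (rule simple_limitE) blast
  show ?thesis
    by (rule simple_limitI[where s="\<lambda>i x. s i (T x)"])
       (use s measurable_space[OF T] in \<open>auto intro: simple_function_comp[OF T]\<close>)
qed

text \<open>
  Approximants larger than twice the limit are replaced by \<open>0\<close>. The resulting bound makes dominated
  convergence available.
\<close>

lemma simple_limit_dominatedE:
  fixes f :: "'x \<Rightarrow> 'b::real_normed_vector"
  assumes "simple_limit M f"
  obtains s where "\<And>i::nat. simple_function M (s i)" "\<And>x. x \<in> space M \<Longrightarrow> (\<lambda>i. s i x) \<longlonglongrightarrow> f x"
    "\<And>i x. x \<in> space M \<Longrightarrow> norm (s i x) \<le> 2 * norm (f x)"
proof -
  obtain s where s: "\<And>i::nat. simple_function M (s i)"
    and lim: "\<And>x. x \<in> space M \<Longrightarrow> (\<lambda>i. s i x) \<longlonglongrightarrow> f x"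
    using assms by (rule simple_limitE) blast
  note [measurable] = borel_measurable_norm_simple_limit[OF assms] borel_measurable_simple_function[OF s]
  define t where "t = (\<lambda>i x. if norm (s i x) \<le> 2 * norm (f x) then s i x else 0)"
  have "simple_function M (t i)" for i
    unfolding t_def by (intro simple_function_If s simple_function_const) measurable
  moreover have "(\<lambda>i. t i x) \<longlonglongrightarrow> f x" if x: "x \<in> space M" for x
  proof (cases "f x = 0")
    case True
    then show ?thesis unfolding t_def by (auto intro!: tendsto_eventually)
  next
    case False
    then have "\<forall>\<^sub>F i in sequentially. norm (s i x) < 2 * norm (f x)"
      by (intro order_tendstoD(2)[OF tendsto_norm[OF lim[OF x]]]) auto
    then have "\<forall>\<^sub>F i in sequentially. s i x = t i x"
      by eventually_elim (auto simp: t_def)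
    then show ?thesis using lim[OF x] by (simp cong: filterlim_cong)
  qed
  moreover have "norm (t i x) \<le> 2 * norm (f x)" for i x by (auto simp: t_def)
  ultimately show thesis by (rule that)
qed

lemma simple_limit_separable:
  assumes "simple_limit M f"
  obtains D where "countable D" "\<And>x. x \<in> space M \<Longrightarrow> f x \<in> closure D"
proof -
  obtain s where s: "\<And>i::nat. simple_function M (s i)"
    and lim: "\<And>x. x \<in> space M \<Longrightarrow> (\<lambda>i. s i x) \<longlonglongrightarrow> f x"
    using assms by (rule simple_limitE) blast
  let ?D = "\<Union>i. s i ` space M"
  have "countable ?D"
    using simple_functionD(1)[OF s] by (auto intro: countable_finite)
  moreover have "f x \<in> closure ?D" if "x \<in> space M" for x
    unfolding closure_sequential using lim[OF that] that by (intro exI[of _ "\<lambda>i. s i x"]) auto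
  ultimately show thesis by (rule that)
qed

text \<open>
  At stage \<open>n\<close> the value \<open>f x\<close> is replaced by the nearest of the first \<open>n + 1\<close> members of a dense
  sequence.
\<close>

lemma simple_limit_if_separable:
  assumes f[measurable]: "f \<in> borel_measurable M"
    and D: "countable D" "\<And>x. x \<in> space M \<Longrightarrow> f x \<in> closure D"
  shows "simple_limit M f"
proof (cases "space M = {}")
  case True
  then show ?thesis by (intro simple_limitI[where s="\<lambda>_. f"]) (auto simp: simple_function_def)
next
  case False
  then have "D \<noteq> {}" using D(2) by fastforce
  define d where "d = from_nat_into D"
  have rd: "range d = D" unfolding d_def using range_from_nat_into[OF \<open>D \<noteq> {}\<close> D(1)] .
  define idx where "idx n x = (LEAST i. i \<le> n \<and> (\<forall>j\<le>n. dist (f x) (d i) \<le> dist (f x) (d j)))" for n x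
  have ex: "\<exists>i. i \<le> n \<and> (\<forall>j\<le>n. dist (f x) (d i) \<le> dist (f x) (d j))" for n x
  proof -
    have "finite ((\<lambda>j. dist (f x) (d j)) ` {..n})" "(\<lambda>j. dist (f x) (d j)) ` {..n} \<noteq> {}" by auto
    from Min_in[OF this] obtain i where i: "i \<le> n" "dist (f x) (d i) = Min ((\<lambda>j. dist (f x) (d j)) ` {..n})"
      by (metis (no_types, lifting) atMost_iff imageE)
    show ?thesis using i by (intro exI[of _ i]) (auto intro: Min_le)
  qed
  have idx: "idx n x \<le> n" "j \<le> n \<Longrightarrow> dist (f x) (d (idx n x)) \<le> dist (f x) (d j)" for n x j
    using LeastI_ex[OF ex[of n x]] unfolding idx_def by auto
  have dm[measurable]: "(\<lambda>x. dist (f x) c) \<in> borel_measurable M" for c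
    by (rule borel_measurable_continuous_on[OF _ f]) (intro continuous_intros)
  have idxm: "idx n \<in> measurable M (count_space UNIV)" for n
    unfolding idx_def by measurable
  have "finite (idx n ` space M)" for n
    by (rule finite_subset[of _ "{..n}"]) (use idx(1) in auto)
  then have "simple_function M (idx n)" for n
    unfolding simple_function_eq_measurable using idxm by blast
  then have sf: "simple_function M (\<lambda>x. d (idx n x))" for n
    by (rule simple_function_compose1)
  show ?thesis
  proof (rule simple_limitI[OF sf])
    fix x assume x: "x \<in> space M"
    show "(\<lambda>i. d (idx i x)) \<longlonglongrightarrow> f x"
    proof (rule metric_LIMSEQ_I)
      fix e :: real assume "0 < e"
      then obtain y where "y \<in> D" "dist y (f x) < e"
        using D(2)[OF x] unfolding closure_approachable by blast
      then obtain j where j: "dist (f x) (d j) < e" using rd by (metis dist_commute rangeE)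
      show "\<exists>no. \<forall>n\<ge>no. dist (d (idx n x)) (f x) < e"
        using idx(2) j by (intro exI[of _ j]) (metis dist_commute le_less_trans)
    qed
  qed
qed

text \<open>
  Limits of simple functions are exactly the measurable functions with separable range, and this class is
  visibly closed under sequential limits.
\<close>

lemma simple_limit_limit:
  assumes "\<And>n. simple_limit M (f n)" "\<And>x. x \<in> space M \<Longrightarrow> (\<lambda>n. f n x) \<longlonglongrightarrow> F x"
  shows "simple_limit M F"
proof -
  have "\<exists>D. countable D \<and> (\<forall>x\<in>space M. f n x \<in> closure D)" for n
    using simple_limit_separable[OF assms(1)] by metis
  then obtain D where D: "\<And>n. countable (D n)" "\<And>n x. x \<in> space M \<Longrightarrow> f n x \<in> closure (D n)"
    by metis
  show ?thesis
  proof (rule simple_limit_if_separable)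
    show "F \<in> borel_measurable M"
      by (rule borel_measurable_LIMSEQ_metric[OF simple_limit_borel_measurable[OF assms(1)] assms(2)])
    show "countable (\<Union>n. D n)" using D(1) by auto
    fix x assume x: "x \<in> space M"
    have "f n x \<in> closure (\<Union>n. D n)" for n
      using D(2)[OF x, of n] closure_mono[of "D n" "\<Union>n. D n"] by auto
    then show "F x \<in> closure (\<Union>n. D n)"
      by (rule closed_sequentially[OF closed_closure _ assms(2)[OF x]])
  qed
qed

section \<open>Borel representatives and vector-valued integrals\<close>

lemma AE_lebesgue_on_iff:
  assumes "S \<in> sets borel"
  shows "(AE x in lebesgue_on S. P x) \<longleftrightarrow> (AE x in lborel. x \<in> S \<longrightarrow> P x)"
  using assms by (subst AE_restrict_space_iff) (auto simp: AE_completion_iff)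

text \<open>
  Each approximating simple function is measurable only for the completed measure and is first corrected on a
  null set to a Borel one. The set where the corrected sequence is Cauchy is Borel, and by completeness of the space the
  limit exists on all of it; elsewhere the representative is \<open>0\<close>.
\<close>

lemma strongly_measurable_representative:
  fixes f :: "real \<Rightarrow> 'b::{real_normed_vector,complete_space}"
  assumes S: "S \<in> sets borel" and f: "strongly_measurable (lebesgue_on S) f"
  obtains f' where "simple_limit lborel f'" "\<And>x. x \<notin> S \<Longrightarrow> f' x = 0"
    "AE x in lborel. x \<in> S \<longrightarrow> f x = f' x"
proof -
  obtain s where s: "\<And>i::nat. simple_function (lebesgue_on S) (s i)"
    and lim: "AE x in lborel. x \<in> S \<longrightarrow> (\<lambda>i. s i x) \<longlonglongrightarrow> f x"
    using f unfolding strongly_measurable_def AE_lebesgue_on_iff[OF S] by blast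
  have Sl: "S \<in> sets lebesgue" using S by auto
  have "\<exists>t. simple_function lborel t \<and> (AE x in lborel. x \<in> S \<longrightarrow> s i x = t x)" for i
  proof -
    have "simple_function lebesgue (\<lambda>x. if x \<in> S then s i x else 0)"
      unfolding simple_function_eq_measurable
    proof
      have "finite (s i ` S)" using simple_functionD(1)[OF s[of i]] by simp
      then show "finite ((\<lambda>x. if x \<in> S then s i x else 0) ` space lebesgue)"
        by (rule finite_subset[rotated, of "insert 0 (s i ` S)", OF finite.insertI]) auto
      have "s i \<in> measurable (lebesgue_on S) (count_space UNIV)"
        using s by (rule measurable_simple_function)
      then show "(\<lambda>x. if x \<in> S then s i x else 0) \<in> lebesgue \<rightarrow>\<^sub>M count_space UNIV"
        using Sl by (subst measurable_If_restrict_space_iff) auto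
    qed
    from completion_ex_simple_function[OF this] obtain t where t: "simple_function lborel t"
      "AE x in lborel. (if x \<in> S then s i x else 0) = t x" by blast
    have "AE x in lborel. x \<in> S \<longrightarrow> s i x = t x"
      using t(2) by eventually_elim auto
    with t(1) show ?thesis by blast
  qed
  then obtain t where t: "\<And>i. simple_function lborel (t i)"
    and st: "\<And>i. AE x in lborel. x \<in> S \<longrightarrow> s i x = t i x" by metis
  define C where "C = {x. x \<in> S \<and> Cauchy (\<lambda>i. t i x)}"
  have dm: "(\<lambda>x. dist (t m x) (t n x)) \<in> borel_measurable lborel" for m n
    by (rule borel_measurable_simple_function[OF simple_function_compose2[OF t t]])
  have "{x. dist (t m x) (t n x) < e} \<in> sets borel" for m n e
    using borel_measurable_less[OF dm[of m n] measurable_const, of e] by simp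
  then have "S \<inter> (\<Inter>j. \<Union>M. \<Inter>m\<in>{M..}. \<Inter>n\<in>{M..}. {x. dist (t m x) (t n x) < inverse (real (Suc j))}) \<in> sets borel"
    using S by (intro sets.Int sets.countable_INT'' sets.countable_UN'') auto
  also have "S \<inter> (\<Inter>j. \<Union>M. \<Inter>m\<in>{M..}. \<Inter>n\<in>{M..}. {x. dist (t m x) (t n x) < inverse (real (Suc j))}) = C"
    unfolding C_def metric_Cauchy_iff2
    by (simp only: set_eq_iff Int_iff INT_iff UN_iff mem_Collect_eq atLeast_iff UNIV_I Ball_def Bex_def simp_thms)
  finally have C: "C \<in> sets lborel" by simp
  define f' where "f' x = (if x \<in> C then lim (\<lambda>i. t i x) else 0)" for x
  have "simple_limit lborel f'"
  proof (rule simple_limitI)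
    show "simple_function lborel (\<lambda>x. if x \<in> C then t i x else 0)" for i
      using C by (intro simple_function_If t simple_function_const) simp
    show "(\<lambda>i. if x \<in> C then t i x else 0) \<longlonglongrightarrow> f' x" for x
      unfolding f'_def using Cauchy_convergent[of "\<lambda>i. t i x"]
      by (auto simp: C_def convergent_LIMSEQ_iff)
  qed
  moreover have "x \<notin> S \<Longrightarrow> f' x = 0" for x by (simp add: f'_def C_def)
  moreover have "AE x in lborel. x \<in> S \<longrightarrow> f x = f' x"
  proof -
    have "AE x in lborel. \<forall>i. x \<in> S \<longrightarrow> s i x = t i x" unfolding AE_all_countable using st by blast
    with lim show ?thesis
    proof eventually_elim
      case (elim x)
      show ?case
      proof
        assume "x \<in> S"
        then have "(\<lambda>i. t i x) \<longlonglongrightarrow> f x" using elim by simp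
        then show "f x = f' x"
          using \<open>x \<in> S\<close> by (auto simp: f'_def C_def limI intro: LIMSEQ_imp_Cauchy)
      qed
    qed
  qed
  ultimately show thesis by (rule that)
qed

lemma strongly_measurable_if_representative:
  assumes S: "S \<in> sets borel" and f: "simple_limit lborel f'" "AE x in lborel. x \<in> S \<longrightarrow> f x = f' x"
  shows "strongly_measurable (lebesgue_on S) f"
proof -
  obtain s where s: "\<And>i::nat. simple_function lborel (s i)" "\<And>x. x \<in> space lborel \<Longrightarrow> (\<lambda>i. s i x) \<longlonglongrightarrow> f' x"
    using f(1) by (rule simple_limitE) blast
  have id: "(\<lambda>x. x) \<in> measurable (lebesgue_on S) lborel"
    by (intro measurable_restrict_space1 measurable_completion) simp
  show ?thesis unfolding strongly_measurable_def AE_lebesgue_on_iff[OF S]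
    using s simple_function_comp[OF id s(1)] f(2)
    by (intro exI[of _ s]) (auto elim!: eventually_mono)
qed

lemma integral_lebesgue_on_borel:
  fixes f :: "real \<Rightarrow> real"
  assumes S: "S \<in> sets borel" and f: "f' \<in> borel_measurable lborel" "AE x in lborel. x \<in> S \<longrightarrow> f x = f' x"
  shows "integrable (lebesgue_on S) f \<longleftrightarrow> integrable lborel (\<lambda>x. indicator S x * f' x)"
    and "integral\<^sup>L (lebesgue_on S) f = (LBINT x. indicator S x * f' x)"
proof -
  have ae: "AE x in lebesgue_on S. f x = f' x" using f(2) AE_lebesgue_on_iff[OF S] by blast
  have m: "f' \<in> borel_measurable (lebesgue_on S)"
    using f(1) by (intro measurable_restrict_space1 measurable_completion)
  have Sl: "S \<inter> space lebesgue \<in> sets lebesgue" using S by simp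
  have m': "(\<lambda>x. indicator S x * f' x) \<in> borel_measurable lborel" using f(1) S by simp
  have fm: "f \<in> borel_measurable (lebesgue_on S)"
  proof -
    have "(\<lambda>x. indicator S x * f x) \<in> borel_measurable lebesgue"
      by (rule borel_measurable_AE[OF measurable_completion[OF m']])
        (use f(2) in \<open>unfold AE_completion_iff, eventually_elim, auto simp: indicator_def\<close>)
    then show ?thesis using borel_measurable_restrict_space_iff[OF Sl, of f] by simp
  qed
  have "integrable (lebesgue_on S) f \<longleftrightarrow> integrable (lebesgue_on S) f'"
    by (rule integrable_cong_AE[OF fm m ae])
  also have "\<dots> \<longleftrightarrow> integrable lebesgue (\<lambda>x. indicator S x *\<^sub>R f' x)"
    using integrable_restrict_space[OF Sl, of f'] by simp
  also have "\<dots> \<longleftrightarrow> integrable lborel (\<lambda>x. indicator S x * f' x)"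
    using integrable_completion[OF m'] by simp
  finally show "integrable (lebesgue_on S) f \<longleftrightarrow> integrable lborel (\<lambda>x. indicator S x * f' x)" .
  have "integral\<^sup>L (lebesgue_on S) f = integral\<^sup>L (lebesgue_on S) f'"
    by (rule integral_cong_AE[OF fm m ae])
  also have "\<dots> = integral\<^sup>L lebesgue (\<lambda>x. indicator S x *\<^sub>R f' x)"
    using integral_restrict_space[OF Sl, of f'] by simp
  also have "\<dots> = (LBINT x. indicator S x * f' x)"
    using integral_completion[OF m'] by simp
  finally show "integral\<^sup>L (lebesgue_on S) f = (LBINT x. indicator S x * f' x)" .
qed

text \<open>
  The map \<open>v \<mapsto> v \<bullet> c\<close> sends the approximating simple integrals of \<open>f\<close> to those of the real function \<open>f \<bullet> c\<close>, and
  Cauchy-Schwarz preserves the \<open>L\<^sup>1\<close> convergence.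
\<close>

lemma has_vec_integral_inner:
  fixes f :: "'x \<Rightarrow> 'b::real_inner"
  assumes "has_vec_integral M f y" and f': "simple_limit M f'" and ae: "AE x in M. f x = f' x"
  shows "integrable M (\<lambda>x. f' x \<bullet> c)" "y \<bullet> c = (\<integral>x. f' x \<bullet> c \<partial>M)"
proof -
  obtain s where s: "\<And>i::nat. Bochner_Integration.simple_bochner_integrable M (s i)"
    and lim: "(\<lambda>i. \<integral>\<^sup>+x. ennreal (norm (f x - s i x)) \<partial>M) \<longlonglongrightarrow> 0"
    and sy: "(\<lambda>i. Bochner_Integration.simple_bochner_integral M (s i)) \<longlonglongrightarrow> y"
    using assms(1) unfolding has_vec_integral_def by blast
  have sf: "simple_function M (s i)" for i using s[of i] by (rule simple_bochner_integrable.cases)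
  have sl: "simple_limit M (s i)" for i by (rule simple_limitI[where s="\<lambda>_. s i"]) (auto simp: sf)
  have "has_bochner_integral M (\<lambda>x. f' x \<bullet> c) (y \<bullet> c)"
  proof (rule has_bochner_integral.intros)
    show "(\<lambda>x. f' x \<bullet> c) \<in> borel_measurable M"
      by (rule borel_measurable_inner_simple_limit[OF f' simple_limit_const])
    show "Bochner_Integration.simple_bochner_integrable M (\<lambda>x. s i x \<bullet> c)" for i
      by (rule simple_bochner_integrable_compose2[OF _ s s, where p="\<lambda>u v. u \<bullet> c"]) simp
    show "(\<lambda>i. Bochner_Integration.simple_bochner_integral M (\<lambda>x. s i x \<bullet> c)) \<longlonglongrightarrow> y \<bullet> c"
    proof -
      have "Bochner_Integration.simple_bochner_integral M (\<lambda>x. s i x \<bullet> c) = Bochner_Integration.simple_bochner_integral M (s i) \<bullet> c" for i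
        by (rule simple_bochner_integral_linear[OF _ s])
          (intro bounded_linear.linear bounded_linear_inner_left)
      then show ?thesis using sy by (auto intro!: tendsto_inner)
    qed
    show "(\<lambda>i. \<integral>\<^sup>+x. ennreal (norm (f' x \<bullet> c - s i x \<bullet> c)) \<partial>M) \<longlonglongrightarrow> 0"
    proof (rule tendsto_sandwich[OF _ _ tendsto_const])
      show "\<forall>\<^sub>F i in sequentially. 0 \<le> (\<integral>\<^sup>+x. ennreal (norm (f' x \<bullet> c - s i x \<bullet> c)) \<partial>M)" by simp
      show "(\<lambda>i. ennreal (norm c) * (\<integral>\<^sup>+x. ennreal (norm (f x - s i x)) \<partial>M)) \<longlonglongrightarrow> 0"
        using ennreal_tendsto_cmult[OF _ lim, of "ennreal (norm c)"] by simp
      show "\<forall>\<^sub>F i in sequentially. (\<integral>\<^sup>+x. ennreal (norm (f' x \<bullet> c - s i x \<bullet> c)) \<partial>M)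
          \<le> ennreal (norm c) * (\<integral>\<^sup>+x. ennreal (norm (f x - s i x)) \<partial>M)"
      proof (intro always_eventually allI)
        fix i
        have "(\<integral>\<^sup>+x. ennreal (norm (f x - s i x)) \<partial>M) = (\<integral>\<^sup>+x. ennreal (norm (f' x - s i x)) \<partial>M)"
          by (rule nn_integral_cong_AE) (use ae in \<open>eventually_elim, simp\<close>)
        moreover have "(\<integral>\<^sup>+x. ennreal (norm (f' x \<bullet> c - s i x \<bullet> c)) \<partial>M)
            \<le> (\<integral>\<^sup>+x. ennreal (norm c) * ennreal (norm (f' x - s i x)) \<partial>M)"
          by (intro nn_integral_mono)
            (auto simp: inner_diff_left[symmetric] ennreal_mult[symmetric] mult.commute[of "norm c"]
              intro!: ennreal_leI Cauchy_Schwarz_ineq2)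
        moreover have "\<dots> = ennreal (norm c) * (\<integral>\<^sup>+x. ennreal (norm (f' x - s i x)) \<partial>M)"
          using borel_measurable_norm_simple_limit[OF simple_limit_diff[OF f' sl[of i]]]
          by (intro nn_integral_cmult) auto
        ultimately show "(\<integral>\<^sup>+x. ennreal (norm (f' x \<bullet> c - s i x \<bullet> c)) \<partial>M)
          \<le> ennreal (norm c) * (\<integral>\<^sup>+x. ennreal (norm (f x - s i x)) \<partial>M)" by simp
      qed
    qed
  qed
  then show "integrable M (\<lambda>x. f' x \<bullet> c)" "y \<bullet> c = (\<integral>x. f' x \<bullet> c \<partial>M)"
    by (auto simp: has_bochner_integral_iff)
qed

lemma has_vec_integral_exists:
  fixes f :: "'x \<Rightarrow> 'b::{real_inner,complete_space}"
  assumes f: "simple_limit M f" and int: "integrable M (\<lambda>x. norm (f x))"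
  shows "\<exists>y. has_vec_integral M f y"
proof -
  obtain s where s: "\<And>i::nat. simple_function M (s i)"
    and lim: "\<And>x. x \<in> space M \<Longrightarrow> (\<lambda>i. s i x) \<longlonglongrightarrow> f x"
    and bnd: "\<And>i x. x \<in> space M \<Longrightarrow> norm (s i x) \<le> 2 * norm (f x)"
    using f by (rule simple_limit_dominatedE) blast
  have sl: "simple_limit M (s i)" for i by (rule simple_limitI[where s="\<lambda>_. s i"]) (auto simp: s)
  have fin: "(\<integral>\<^sup>+x. ennreal (2 * norm (f x)) \<partial>M) < \<infinity>"
    using int integrable_mult_right[OF int, of 2] unfolding integrable_iff_bounded by simp
  have sb: "Bochner_Integration.simple_bochner_integrable M (s i)" for i
    by (rule simple_bochner_integrableI_bounded[OF s])
      (rule le_less_trans[OF nn_integral_mono fin], simp add: bnd ennreal_leI)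
  have nm: "(\<lambda>x. norm (f x - s i x)) \<in> borel_measurable M" for i
    by (rule borel_measurable_norm_simple_limit[OF simple_limit_diff[OF f sl]])
  have l1: "(\<lambda>i. \<integral>\<^sup>+x. ennreal (norm (f x - s i x)) \<partial>M) \<longlonglongrightarrow> 0"
  proof -
    have "(\<lambda>i. \<integral>\<^sup>+x. ennreal (norm (f x - s i x)) \<partial>M) \<longlonglongrightarrow> (\<integral>\<^sup>+x. ennreal 0 \<partial>M)"
    proof (rule nn_integral_dominated_convergence[where w="\<lambda>x. ennreal (3 * norm (f x))"])
      show "(\<integral>\<^sup>+x. ennreal (3 * norm (f x)) \<partial>M) < \<infinity>"
        using int integrable_mult_right[OF int, of 3] unfolding integrable_iff_bounded by simp
      show "AE x in M. ennreal (norm (f x - s i x)) \<le> ennreal (3 * norm (f x))" for i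
      proof (rule AE_I2, rule ennreal_leI)
        fix x assume "x \<in> space M"
        with bnd[of x i] show "norm (f x - s i x) \<le> 3 * norm (f x)"
          using norm_triangle_ineq4[of "f x" "s i x"] by linarith
      qed
      show "AE x in M. (\<lambda>i. ennreal (norm (f x - s i x))) \<longlonglongrightarrow> ennreal 0"
      proof (rule AE_I2)
        fix x assume "x \<in> space M"
        then have "(\<lambda>i. norm (f x - s i x)) \<longlonglongrightarrow> norm (f x - f x)"
          by (intro tendsto_intros lim)
        then show "(\<lambda>i. ennreal (norm (f x - s i x))) \<longlonglongrightarrow> ennreal 0"
          by (intro tendsto_ennrealI) simp
      qed
    qed (use nm borel_measurable_norm_simple_limit[OF f] in auto)
    then show ?thesis by simp
  qed
  have "Cauchy (\<lambda>i. Bochner_Integration.simple_bochner_integral M (s i))"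
  proof (rule metric_CauchyI)
    fix e :: real assume e: "0 < e"
    then obtain N where N: "\<And>n. n \<ge> N \<Longrightarrow> (\<integral>\<^sup>+x. ennreal (norm (f x - s n x)) \<partial>M) < ennreal (e / 2)"
      using order_tendstoD(2)[OF l1, of "ennreal (e/2)"] by (auto simp: eventually_sequentially)
    show "\<exists>N. \<forall>m\<ge>N. \<forall>n\<ge>N. dist (Bochner_Integration.simple_bochner_integral M (s m)) (Bochner_Integration.simple_bochner_integral M (s n)) < e"
    proof (intro exI[of _ N] allI impI)
      fix m n assume mn: "N \<le> m" "N \<le> n"
      have sd: "Bochner_Integration.simple_bochner_integrable M (\<lambda>x. s m x - s n x)"
        by (rule simple_bochner_integrable_compose2[OF _ sb sb]) simp
      have "ennreal (dist (Bochner_Integration.simple_bochner_integral M (s m)) (Bochner_Integration.simple_bochner_integral M (s n)))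
          = norm (Bochner_Integration.simple_bochner_integral M (\<lambda>x. s m x - s n x))"
        by (simp add: dist_norm simple_bochner_integral_diff[OF sb sb])
      also have "\<dots> \<le> Bochner_Integration.simple_bochner_integral M (\<lambda>x. norm (s m x - s n x))"
        by (intro ennreal_leI simple_bochner_integral_norm_bound sd)
      also have "\<dots> = (\<integral>\<^sup>+x. norm (s m x - s n x) \<partial>M)"
        by (rule simple_bochner_integral_eq_nn_integral)
          (use simple_bochner_integrable_compose2[of "\<lambda>x y. norm (x - y)" M "s m" "s n"] sb in auto)
      also have "\<dots> \<le> (\<integral>\<^sup>+x. ennreal (norm (f x - s m x)) + ennreal (norm (f x - s n x)) \<partial>M)"
        by (intro nn_integral_mono)
          (auto simp flip: ennreal_plus intro!: ennreal_leI,
           metis norm_minus_commute norm_diff_triangle_le order_refl)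
      also have "\<dots> = (\<integral>\<^sup>+x. ennreal (norm (f x - s m x)) \<partial>M) + (\<integral>\<^sup>+x. ennreal (norm (f x - s n x)) \<partial>M)"
        by (rule nn_integral_add) (use nm in auto)
      also have "\<dots> < ennreal (e / 2) + ennreal (e / 2)"
        by (intro add_strict_mono N mn)
      also have "\<dots> = ennreal e" using e by (simp flip: ennreal_plus)
      finally show "dist (Bochner_Integration.simple_bochner_integral M (s m)) (Bochner_Integration.simple_bochner_integral M (s n)) < e"
        using e by (simp add: ennreal_less_iff)
    qed
  qed
  then obtain y where "(\<lambda>i. Bochner_Integration.simple_bochner_integral M (s i)) \<longlonglongrightarrow> y"
    using Cauchy_convergent convergent_def by blast
  then have "has_vec_integral M f y"
    unfolding has_vec_integral_def strongly_measurable_def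
    using s lim sb l1 by (intro conjI exI[of _ s]) auto
  then show ?thesis ..
qed

lemma simple_limit_lebesgue_on: "simple_limit lborel f \<Longrightarrow> simple_limit (lebesgue_on S) f"
  by (rule simple_limit_comp[of "\<lambda>x. x"])
    (auto intro!: measurable_restrict_space1 measurable_completion)

text \<open>
  The interface to the vector-valued integral: tested with a fixed vector, it becomes the scalar integral of a Borel
  function. Uniqueness of the value of the integral follows in the same way.
\<close>

lemma vec_integral_inner:
  fixes f :: "real \<Rightarrow> 'b::{real_inner,complete_space}"
  assumes S: "S \<in> sets borel" and f': "simple_limit lborel f'"
    and ae: "AE x in lborel. x \<in> S \<longrightarrow> f x = f' x"
    and int: "integrable lborel (\<lambda>x. indicator S x * norm (f' x))"
  shows "vec_integral (lebesgue_on S) f \<bullet> c = (LBINT x. indicator S x * (f' x \<bullet> c))"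
proof -
  let ?M = "lebesgue_on S"
  have sl: "simple_limit ?M f'" by (rule simple_limit_lebesgue_on[OF f'])
  have ae': "AE x in ?M. f x = f' x" using ae AE_lebesgue_on_iff[OF S] by blast
  have "integrable ?M (\<lambda>x. norm (f' x))"
    using integral_lebesgue_on_borel(1)[OF S borel_measurable_norm_simple_limit[OF f']] int by auto
  from has_vec_integral_exists[OF sl this] obtain y where y: "has_vec_integral ?M f' y" by blast
  have eq: "has_vec_integral ?M f z \<longleftrightarrow> has_vec_integral ?M f' z" for z
  proof -
    have "strongly_measurable ?M f" "strongly_measurable ?M f'"
      using strongly_measurable_if_representative[OF S f'] ae by auto
    moreover have "(\<integral>\<^sup>+x. ennreal (norm (f x - s x)) \<partial>?M) = (\<integral>\<^sup>+x. ennreal (norm (f' x - s x)) \<partial>?M)" for s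
      by (rule nn_integral_cong_AE) (use ae' in \<open>eventually_elim, simp\<close>)
    ultimately show ?thesis unfolding has_vec_integral_def by simp
  qed
  have uniq: "z = y" if "has_vec_integral ?M f' z" for z
  proof (rule inner_eq_zero_iff[THEN iffD1, of "z - y", THEN eq_iff_diff_eq_0[THEN iffD2]])
    have "z \<bullet> d = y \<bullet> d" for d
      using has_vec_integral_inner(2)[OF that sl] has_vec_integral_inner(2)[OF y sl] by simp
    then show "(z - y) \<bullet> (z - y) = 0" by (simp add: inner_diff_left)
  qed
  have "vec_integral ?M f = y"
    unfolding vec_integral_def eq using y uniq by (rule the_equality)
  moreover have "y \<bullet> c = (\<integral>x. f' x \<bullet> c \<partial>?M)"
    using has_vec_integral_inner(2)[OF y sl] by simp
  moreover have "\<dots> = (LBINT x. indicator S x * (f' x \<bullet> c))"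
    by (rule integral_lebesgue_on_borel(2)[OF S])
      (use borel_measurable_inner_simple_limit[OF f' simple_limit_const, of c] ae in auto)
  ultimately show ?thesis by simp
qed

section \<open>Continuity of translation\<close>

text \<open>
  Regularity traps \<open>A\<close> between a compact \<open>K\<close> and an open \<open>U\<close> of nearly equal measure. A shift smaller than the
  distance from \<open>K\<close> to the complement of \<open>U\<close> changes membership in \<open>A\<close> only for points that lie in \<open>U - K\<close> before or after the
  shift.
\<close>

lemma translate_indicator:
  fixes A :: "real set"
  assumes A: "A \<in> sets borel" "bounded A" and e: "0 < e"
  obtains d where "d > 0"
    "\<And>r. \<bar>r\<bar> < d \<Longrightarrow> (\<integral>\<^sup>+x. (if (x + r \<in> A) = (x \<in> A) then 0 else 1) \<partial>lborel) \<le> ennreal e"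
proof -
  have pos: "0 < e / 4" and Al: "A \<in> sets lebesgue" using e A by auto
  obtain K where K: "closed K" "K \<subseteq> A" "emeasure lebesgue (A - K) < ennreal (e/4)"
    by (rule sets_lebesgue_inner_closed[OF Al pos]) blast
  obtain U where U: "open U" "A \<subseteq> U" "emeasure lborel (U - A) < ennreal (e/4)"
    by (rule outer_regular_lborel[OF A(1) pos]) blast
  have cK: "compact K" using K A(2) by (simp add: bounded_subset compact_eq_bounded_closed)
  have sK[measurable]: "K \<in> sets borel" "U \<in> sets borel" "A \<in> sets borel" using K U A by auto
  have m: "emeasure lborel (U - K) \<le> ennreal (e/2)"
  proof -
    have "U - K = (U - A) \<union> (A - K)" using K U by auto
    then have "emeasure lborel (U - K) \<le> emeasure lborel (U - A) + emeasure lborel (A - K)"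
      using emeasure_subadditive[of "U - A" lborel "A - K"] sK by simp
    also have "emeasure lborel (A - K) = emeasure lebesgue (A - K)" using sK by simp
    also have "emeasure lborel (U - A) + emeasure lebesgue (A - K) \<le> ennreal (e/4) + ennreal (e/4)"
      by (intro add_mono) (use U K in auto)
    finally show ?thesis using e by (simp flip: ennreal_plus)
  qed
  obtain d where d: "d > 0" "\<And>x y. x \<in> K \<Longrightarrow> y \<in> - U \<Longrightarrow> d \<le> dist x y"
    using separate_compact_closed[OF cK closed_Compl[OF U(1)]] U(2) K(2) by blast
  show thesis
  proof (rule that[OF d(1)])
    fix r :: real assume r: "\<bar>r\<bar> < d"
    have "(if (x + r \<in> A) = (x \<in> A) then 0 else 1)
        \<le> indicator (U - K) (r + 1 * x) + (indicator (U - K) x :: ennreal)" for x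
      using d(2)[of x "r + x"] d(2)[of "r + x" x] r K(2) U(2)
      by (auto simp: indicator_def dist_real_def add.commute)
    then have "(\<integral>\<^sup>+x. (if (x + r \<in> A) = (x \<in> A) then 0 else 1) \<partial>lborel)
        \<le> (\<integral>\<^sup>+x. indicator (U - K) (r + 1 * x) + indicator (U - K) x \<partial>lborel)"
      by (intro nn_integral_mono)
    also have "\<dots> = (\<integral>\<^sup>+x. indicator (U - K) (r + 1 * x) \<partial>lborel) + (\<integral>\<^sup>+x. indicator (U - K) x \<partial>lborel)"
      by (rule nn_integral_add) auto
    also have "(\<integral>\<^sup>+x. indicator (U - K) (r + 1 * x) \<partial>lborel) = (\<integral>\<^sup>+x. indicator (U - K) x \<partial>lborel)"
      using nn_integral_real_affine[of "indicator (U - K)" 1 r] by simp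
    also have "(\<integral>\<^sup>+x. indicator (U - K) x \<partial>lborel) = emeasure lborel (U - K)"
      by simp
    also have "\<dots> + \<dots> \<le> ennreal (e/2) + ennreal (e/2)" by (intro add_mono m)
    also have "\<dots> = ennreal e" using e by (simp flip: ennreal_plus)
    finally show "(\<integral>\<^sup>+x. (if (x + r \<in> A) = (x \<in> A) then 0 else 1) \<partial>lborel) \<le> ennreal e" .
  qed
qed

lemma translate_simple:
  fixes s :: "real \<Rightarrow> 'b::real_normed_vector"
  assumes s: "simple_function lborel s" and R: "\<And>x. \<bar>x\<bar> > R \<Longrightarrow> s x = 0" and e: "0 < e" and p: "p \<noteq> 0"
  obtains d where "d > 0"
    "\<And>r. \<bar>r\<bar> < d \<Longrightarrow> (\<integral>\<^sup>+x. ennreal (norm (s (x + r) - s x) ^ p) \<partial>lborel) \<le> ennreal e"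
proof -
  define C where "C = range s - {0}"
  have fin: "finite (range s)" using simple_functionD(1)[OF s] by simp
  then have finC: "finite C" by (simp add: C_def)
  define M where "M = Max (insert 0 (norm ` range s))"
  have M: "norm (s x) \<le> M" "0 \<le> M" for x unfolding M_def using fin by (auto intro!: Max_ge simp del: Max_insert)
  define A where "A c = s -` {c}" for c
  have Ab: "A c \<in> sets borel" for c using simple_functionD(2)[OF s, of "{c}"] by (simp add: A_def)
  have Abd: "bounded (A c)" if "c \<in> C" for c
  proof -
    have "A c \<subseteq> {-R..R}"
    proof
      fix x assume "x \<in> A c"
      then have "s x \<noteq> 0" using that by (simp add: A_def C_def)
      then have "\<not> R < \<bar>x\<bar>" using R by blast
      then show "x \<in> {-R..R}" by auto
    qed
    then show ?thesis by (rule bounded_subset[rotated]) simp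
  qed
  define e' where "e' = e / ((2 * M) ^ p * card C + 1)"
  have pos: "(2 * M) ^ p * card C + 1 > 0" using M(2) by (simp add: add_nonneg_pos)
  have e': "e' > 0" unfolding e'_def using e pos by (rule divide_pos_pos)
  have "\<forall>c\<in>C. \<exists>d>0. \<forall>r. \<bar>r\<bar> < d \<longrightarrow>
      (\<integral>\<^sup>+x. (if (x + r \<in> A c) = (x \<in> A c) then 0 else 1) \<partial>lborel) \<le> ennreal e'"
    by (intro ballI, rule translate_indicator[OF Ab Abd e']) blast+
  from bchoice[OF this] obtain dd where dd0: "\<forall>c\<in>C. dd c > 0 \<and> (\<forall>r. \<bar>r\<bar> < dd c \<longrightarrow>
      (\<integral>\<^sup>+x. (if (x + r \<in> A c) = (x \<in> A c) then 0 else 1) \<partial>lborel) \<le> ennreal e')" ..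
  then have dd: "\<And>c. c \<in> C \<Longrightarrow> dd c > 0"
    "\<And>c r. c \<in> C \<Longrightarrow> \<bar>r\<bar> < dd c \<Longrightarrow>
      (\<integral>\<^sup>+x. (if (x + r \<in> A c) = (x \<in> A c) then 0 else 1) \<partial>lborel) \<le> ennreal e'"
    by blast+
  define d where "d = Min (insert 1 (dd ` C))"
  have d: "d > 0" "\<And>c. c \<in> C \<Longrightarrow> d \<le> dd c"
    unfolding d_def using finC dd(1) by (auto intro: Min_le)
  show thesis
  proof (rule that[OF d(1)])
    fix r assume r: "\<bar>r\<bar> < d"
    have bd: "ennreal (norm (s (x + r) - s x) ^ p)
        \<le> ennreal ((2 * M) ^ p) * (\<Sum>c\<in>C. if (x + r \<in> A c) = (x \<in> A c) then 0 else 1)" for x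
    proof (cases "s (x + r) = s x")
      case True
      then show ?thesis using p by (simp add: power_0_left)
    next
      case False
      then obtain c where c: "c \<in> C" "(x + r \<in> A c) \<noteq> (x \<in> A c)"
        by (cases "s x = 0") (auto simp: C_def A_def)
      have "1 = (if (x + r \<in> A c) = (x \<in> A c) then 0 else (1::ennreal))" using c by simp
      also have "\<dots> \<le> (\<Sum>c\<in>C. if (x + r \<in> A c) = (x \<in> A c) then 0 else 1)"
        by (rule member_le_sum[OF c(1) _ finC]) simp
      finally have 1: "1 \<le> (\<Sum>c\<in>C. if (x + r \<in> A c) = (x \<in> A c) then 0 else (1::ennreal))" .
      have "norm (s (x + r) - s x) \<le> 2 * M"
        using norm_triangle_ineq4[of "s (x + r)" "s x"] M(1)[of x] M(1)[of "x + r"] by linarith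
      then have "norm (s (x + r) - s x) ^ p \<le> (2 * M) ^ p" by (rule power_mono) simp
      then have "ennreal (norm (s (x + r) - s x) ^ p) \<le> ennreal ((2 * M) ^ p) * 1"
        by (simp add: ennreal_leI)
      also have "\<dots> \<le> ennreal ((2 * M) ^ p) * (\<Sum>c\<in>C. if (x + r \<in> A c) = (x \<in> A c) then 0 else 1)"
        by (rule mult_left_mono[OF 1]) simp
      finally show ?thesis .
    qed
    have meas: "(\<lambda>x. if (x + r \<in> A c) = (x \<in> A c) then 0 else (1::ennreal)) \<in> borel_measurable lborel" for c
    proof -
      note [measurable] = Ab[of c]
      show ?thesis by measurable
    qed
    have "(\<integral>\<^sup>+x. ennreal (norm (s (x + r) - s x) ^ p) \<partial>lborel)
      \<le> (\<integral>\<^sup>+x. ennreal ((2 * M) ^ p) * (\<Sum>c\<in>C. if (x + r \<in> A c) = (x \<in> A c) then 0 else 1) \<partial>lborel)"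
      by (intro nn_integral_mono bd)
    also have "\<dots> = ennreal ((2 * M) ^ p) * (\<Sum>c\<in>C. (\<integral>\<^sup>+x. (if (x + r \<in> A c) = (x \<in> A c) then 0 else 1) \<partial>lborel))"
      using meas by (subst nn_integral_cmult, force) (subst nn_integral_sum, auto)
    also have "\<dots> \<le> ennreal ((2 * M) ^ p) * (\<Sum>c\<in>C. ennreal e')"
      using r d(2) by (intro mult_left_mono sum_mono dd(2)) fastforce+
    also have "\<dots> = ennreal ((2 * M) ^ p * card C * e')"
      using e' M(2) by (simp add: ennreal_mult[symmetric] ennreal_of_nat_eq_real_of_nat mult.assoc)
    also have "\<dots> \<le> ennreal e"
    proof (rule ennreal_leI)
      have "e = ((2 * M) ^ p * card C + 1) * e'" unfolding e'_def using pos by simp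
      also have "\<dots> = (2 * M) ^ p * card C * e' + e'" by (simp add: algebra_simps)
      finally show "(2 * M) ^ p * card C * e' \<le> e" using e' by linarith
    qed
    finally show "(\<integral>\<^sup>+x. ennreal (norm (s (x + r) - s x) ^ p) \<partial>lborel) \<le> ennreal e" .
  qed
qed

text \<open>
  Continuity of translation in \<open>L\<^sup>p\<close>, by the usual \<open>3 \<epsilon>\<close> argument: \<open>f\<close> is close to a simple function, for which
  the statement reduces to finitely many indicators.
\<close>

lemma translate_Lp:
  fixes f :: "real \<Rightarrow> 'b::real_normed_vector"
  assumes f: "simple_limit lborel f" and R: "\<And>x. \<bar>x\<bar> > R \<Longrightarrow> f x = 0"
    and int: "integrable lborel (\<lambda>x. norm (f x) ^ p)" and e: "0 < e" and p: "p \<noteq> 0"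
  obtains d where "d > 0"
    "\<And>r. \<bar>r\<bar> < d \<Longrightarrow> (\<integral>\<^sup>+x. ennreal (norm (f (x + r) - f x) ^ p) \<partial>lborel) \<le> ennreal e"
proof -
  obtain s where s: "\<And>i::nat. simple_function lborel (s i)"
    and lim: "\<And>x. (\<lambda>i. s i x) \<longlonglongrightarrow> f x"
    and bnd: "\<And>i x. norm (s i x) \<le> 2 * norm (f x)"
    by (rule simple_limit_dominatedE[OF f]) (rule that, simp_all)
  have sl: "simple_limit lborel (s i)" for i by (rule simple_limitI[where s="\<lambda>_. s i"]) (auto simp: s)
  have nm: "(\<lambda>x. norm (f x - s i x) ^ p) \<in> borel_measurable lborel" for i
    using borel_measurable_norm_simple_limit[OF simple_limit_diff[OF f sl]] by measurable
  have fm: "(\<lambda>x. norm (f x)) \<in> borel_measurable lborel" by (rule borel_measurable_norm_simple_limit[OF f])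
  have "(\<lambda>i. \<integral>\<^sup>+x. ennreal (norm (f x - s i x) ^ p) \<partial>lborel) \<longlonglongrightarrow> (\<integral>\<^sup>+x. ennreal (0 ^ p) \<partial>(lborel::real measure))"
  proof (rule nn_integral_dominated_convergence[where w="\<lambda>x. ennreal (3 ^ p * norm (f x) ^ p)"])
    show "(\<integral>\<^sup>+x. ennreal (3 ^ p * norm (f x) ^ p) \<partial>lborel) < \<infinity>"
      using integrable_mult_right[OF int, of "3 ^ p"] unfolding integrable_iff_bounded by (simp add: abs_mult)
    show "AE x in lborel. ennreal (norm (f x - s i x) ^ p) \<le> ennreal (3 ^ p * norm (f x) ^ p)" for i
    proof (rule AE_I2, rule ennreal_leI)
      fix x
      have "norm (f x - s i x) \<le> 3 * norm (f x)"
        using norm_triangle_ineq4[of "f x" "s i x"] bnd[of i x] by linarith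
      from power_mono[OF this, of p] show "norm (f x - s i x) ^ p \<le> 3 ^ p * norm (f x) ^ p"
        by (simp add: power_mult_distrib)
    qed
    show "AE x in lborel. (\<lambda>i. ennreal (norm (f x - s i x) ^ p)) \<longlonglongrightarrow> ennreal (0 ^ p)"
    proof (rule AE_I2)
      fix x
      have "(\<lambda>i. norm (f x - s i x) ^ p) \<longlonglongrightarrow> norm (f x - f x) ^ p"
        by (intro tendsto_intros lim)
      then show "(\<lambda>i. ennreal (norm (f x - s i x) ^ p)) \<longlonglongrightarrow> ennreal (0 ^ p)"
        by (intro tendsto_ennrealI) simp
    qed
  qed (use nm fm in auto)
  then have l0: "(\<lambda>i. \<integral>\<^sup>+x. ennreal (norm (f x - s i x) ^ p) \<partial>lborel) \<longlonglongrightarrow> 0"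
    using p by (simp add: power_0_left)
  define e' where "e' = e / (3 * 3 ^ p)"
  have e': "e' > 0" using e by (simp add: e'_def)
  obtain i where i: "(\<integral>\<^sup>+x. ennreal (norm (f x - s i x) ^ p) \<partial>lborel) < ennreal e'"
    using order_tendstoD(2)[OF l0, of "ennreal e'"] e' by (auto simp: eventually_sequentially)
  have "s i x = 0" if "\<bar>x\<bar> > R" for x using bnd[of i x] R[OF that] by simp
  from translate_simple[OF s this e' p] obtain d where d: "d > 0"
    "\<And>r. \<bar>r\<bar> < d \<Longrightarrow> (\<integral>\<^sup>+x. ennreal (norm (s i (x + r) - s i x) ^ p) \<partial>lborel) \<le> ennreal e'" by blast
  show thesis
  proof (rule that[OF d(1)])
    fix r assume r: "\<bar>r\<bar> < d"
    define a where "a = (\<lambda>x. norm (f x - s i x) ^ p)"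
    define b where "b = (\<lambda>x. norm (s i (x + r) - s i x) ^ p)"
    have am: "a \<in> borel_measurable borel" using nm by (simp add: a_def)
    have slr: "simple_limit lborel (\<lambda>x. s i (x + r))"
      by (rule simple_limit_comp[OF _ sl]) simp
    have bm: "b \<in> borel_measurable borel"
      using borel_measurable_norm_simple_limit[OF simple_limit_diff[OF slr sl[of i]]] by (simp add: b_def)
    have ab0: "0 \<le> a x" "0 \<le> b x" for x by (auto simp: a_def b_def)
    have tri: "norm (f (x + r) - f x) ^ p \<le> 3 ^ p * (a (x + r) + b x + a x)" for x
    proof -
      define X where "X = norm (f (x + r) - s i (x + r))"
      define Y where "Y = norm (s i (x + r) - s i x)"
      define Z where "Z = norm (f x - s i x)"
      define m where "m = max X (max Y Z)"
      have "norm (f (x + r) - f x) \<le> X + Y + Z"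
        unfolding X_def Y_def Z_def by (smt (verit) norm_diff_triangle_ineq norm_minus_commute norm_triangle_le_diff norm_diff_triangle_le order_refl)
      also have "\<dots> \<le> 3 * m" by (simp add: m_def)
      finally have "norm (f (x + r) - f x) ^ p \<le> (3 * m) ^ p" by (rule power_mono) simp
      also have "\<dots> = 3 ^ p * m ^ p" by (simp add: power_mult_distrib)
      also have "m ^ p \<le> X ^ p + Y ^ p + Z ^ p"
        unfolding m_def X_def Y_def Z_def by (auto simp: max_def add_increasing)
      finally show ?thesis by (simp add: a_def b_def X_def Y_def Z_def)
    qed
    have "(\<integral>\<^sup>+x. ennreal (norm (f (x + r) - f x) ^ p) \<partial>lborel)
      \<le> (\<integral>\<^sup>+x. ennreal (3 ^ p) * (ennreal (a (r + 1 * x)) + ennreal (b x) + ennreal (a x)) \<partial>lborel)"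
    proof (intro nn_integral_mono)
      fix x
      have "ennreal (norm (f (x + r) - f x) ^ p) \<le> ennreal (3 ^ p * (a (x + r) + b x + a x))"
        by (rule ennreal_leI[OF tri])
      also have "\<dots> = ennreal (3 ^ p) * (ennreal (a (r + 1 * x)) + ennreal (b x) + ennreal (a x))"
        using ab0 by (subst ennreal_mult) (auto simp: add.commute)
      finally show "ennreal (norm (f (x + r) - f x) ^ p)
        \<le> ennreal (3 ^ p) * (ennreal (a (r + 1 * x)) + ennreal (b x) + ennreal (a x))" .
    qed
    also have "\<dots> = ennreal (3 ^ p) * ((\<integral>\<^sup>+x. ennreal (a (r + 1 * x)) \<partial>lborel) + (\<integral>\<^sup>+x. ennreal (b x) \<partial>lborel)
        + (\<integral>\<^sup>+x. ennreal (a x) \<partial>lborel))"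
      using am bm by (simp add: nn_integral_cmult nn_integral_add)
    also have "(\<integral>\<^sup>+x. ennreal (a (r + 1 * x)) \<partial>lborel) = (\<integral>\<^sup>+x. ennreal (a x) \<partial>lborel)"
      using nn_integral_real_affine[of "\<lambda>x. ennreal (a x)" 1 r] am by simp
    also have "ennreal (3 ^ p) * ((\<integral>\<^sup>+x. ennreal (a x) \<partial>lborel) + (\<integral>\<^sup>+x. ennreal (b x) \<partial>lborel)
        + (\<integral>\<^sup>+x. ennreal (a x) \<partial>lborel)) \<le> ennreal (3 ^ p) * (ennreal e' + ennreal e' + ennreal e')"
      using i d(2)[OF r] by (intro mult_left_mono add_mono) (auto simp: a_def b_def)
    also have "\<dots> = ennreal e"
      using e e' by (simp add: e'_def ennreal_mult[symmetric] flip: ennreal_plus)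
    finally show "(\<integral>\<^sup>+x. ennreal (norm (f (x + r) - f x) ^ p) \<partial>lborel) \<le> ennreal e" .
  qed
qed

section \<open>Convolution on the line\<close>

lemma integrable_indicator_interval[simp]:
  fixes a b :: real
  shows "integrable lborel (indicat_real {a<..<b})" "integrable lborel (indicat_real {a..b})"
  by (auto intro!: integrable_real_indicator emeasure_bounded_finite)

text \<open>
  The bounded factor \<open>c\<close> makes one Fubini argument serve all double integrals of convolution type below.
\<close>

lemma convolution_integrand_integrable:
  fixes a b :: "real \<Rightarrow> real"
  assumes a: "integrable lborel a" and b: "integrable lborel b"
    and c: "(\<lambda>p. c (fst p) (snd p)) \<in> borel_measurable (lborel \<Otimes>\<^sub>M lborel)"
    and bd: "\<And>s r. \<bar>c s r\<bar> \<le> K"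
  shows "integrable (lborel \<Otimes>\<^sub>M lborel) (\<lambda>(s, r). c s r * (a (s - r) * b r))"
proof -
  have [measurable]: "a \<in> borel_measurable borel" "b \<in> borel_measurable borel"
    using a b by (auto dest: borel_measurable_integrable)
  have "integrable (lborel \<Otimes>\<^sub>M lborel) (\<lambda>(s, r). a (s - r) * b r)"
    unfolding integrable_iff_bounded
  proof
    show "(\<lambda>(s, r). a (s - r) * b r) \<in> borel_measurable (lborel \<Otimes>\<^sub>M lborel)" by measurable
    have "(\<integral>\<^sup>+p. ennreal (norm (case p of (s, r) \<Rightarrow> a (s - r) * b r)) \<partial>(lborel \<Otimes>\<^sub>M lborel))
      = (\<integral>\<^sup>+r. (\<integral>\<^sup>+s. ennreal \<bar>a (s - r)\<bar> * ennreal \<bar>b r\<bar> \<partial>lborel) \<partial>lborel)"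
      by (subst lborel_pair.nn_integral_snd[symmetric]) (auto simp: abs_mult ennreal_mult split: prod.split)
    also have "\<dots> = (\<integral>\<^sup>+r. (\<integral>\<^sup>+s. ennreal \<bar>a s\<bar> \<partial>lborel) * ennreal \<bar>b r\<bar> \<partial>lborel)"
    proof (rule nn_integral_cong)
      fix r :: real
      have "(\<integral>\<^sup>+s. ennreal \<bar>a s\<bar> \<partial>lborel) = (\<integral>\<^sup>+s. ennreal \<bar>a (s - r)\<bar> \<partial>lborel)"
        using nn_integral_real_affine[of "\<lambda>s. ennreal \<bar>a s\<bar>" 1 "-r"] by simp
      then show "(\<integral>\<^sup>+s. ennreal \<bar>a (s - r)\<bar> * ennreal \<bar>b r\<bar> \<partial>lborel)
          = (\<integral>\<^sup>+s. ennreal \<bar>a s\<bar> \<partial>lborel) * ennreal \<bar>b r\<bar>"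
        by (simp add: nn_integral_multc)
    qed
    also have "\<dots> = (\<integral>\<^sup>+s. ennreal \<bar>a s\<bar> \<partial>lborel) * (\<integral>\<^sup>+r. ennreal \<bar>b r\<bar> \<partial>lborel)"
      by (rule nn_integral_cmult) measurable
    also have "\<dots> < \<infinity>"
      using a b unfolding integrable_iff_bounded by (simp add: ennreal_mult_less_top)
    finally show "(\<integral>\<^sup>+p. ennreal (norm (case p of (s, r) \<Rightarrow> a (s - r) * b r)) \<partial>(lborel \<Otimes>\<^sub>M lborel)) < \<infinity>" .
  qed
  then have "integrable (lborel \<Otimes>\<^sub>M lborel) (\<lambda>p. K * (case p of (s, r) \<Rightarrow> a (s - r) * b r))"
    by (rule integrable_mult_right)
  then show ?thesis
  proof (rule Bochner_Integration.integrable_bound)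
    show "(\<lambda>(s, r). c s r * (a (s - r) * b r)) \<in> borel_measurable (lborel \<Otimes>\<^sub>M lborel)"
      using c by (simp add: split_beta' case_prod_beta)
    show "AE x in lborel \<Otimes>\<^sub>M lborel. norm (case x of (s, r) \<Rightarrow> c s r * (a (s - r) * b r))
         \<le> norm (K * (case x of (s, r) \<Rightarrow> a (s - r) * b r))"
    proof (rule AE_I2, clarify)
      fix s r
      show "norm (c s r * (a (s - r) * b r)) \<le> norm (K * (a (s - r) * b r))"
        using bd[of s r] by (auto simp: abs_mult intro!: mult_right_mono)
    qed
  qed
qed

text \<open>
  The convolution on \<open>(0,s)\<close> of functions on the half-line is this full-line convolution of their extensions by
  \<open>0\<close>; the latter commutes, associates and is translation covariant.
\<close>

definition line_conv :: "(real \<Rightarrow> real) \<Rightarrow> (real \<Rightarrow> real) \<Rightarrow> real \<Rightarrow> real" where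
  "line_conv a b s = (LBINT r. a (s - r) * b r)"

lemma line_conv_integrable:
  fixes a b :: "real \<Rightarrow> real"
  assumes a: "integrable lborel a" and b: "integrable lborel b"
  shows "integrable lborel (line_conv a b)" "AE s in lborel. integrable lborel (\<lambda>r. a (s - r) * b r)"
proof -
  have "integrable (lborel \<Otimes>\<^sub>M lborel) (\<lambda>(s, r). a (s - r) * b r)"
    using convolution_integrand_integrable[OF a b, of "\<lambda>_ _. 1" 1] by simp
  from lborel_pair.integrable_fst'[OF this] lborel_pair.AE_integrable_fst'[OF this]
  show "integrable lborel (line_conv a b)" "AE s in lborel. integrable lborel (\<lambda>r. a (s - r) * b r)"
    unfolding line_conv_def by simp_all
qed

lemma line_conv_borel[measurable (raw)]:
  assumes [measurable]: "a \<in> borel_measurable borel" "b \<in> borel_measurable borel"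
  shows "line_conv a b \<in> borel_measurable borel"
  unfolding line_conv_def by measurable

lemma integral_mult_line_conv:
  fixes a b :: "real \<Rightarrow> real"
  assumes a: "integrable lborel a" and b: "integrable lborel b"
    and c[measurable]: "c \<in> borel_measurable borel" and bd: "\<And>s. \<bar>c s\<bar> \<le> K"
  shows "(LBINT s. c s * line_conv a b s) = (LBINT r. (LBINT x. c (x + r) * a x) * b r)"
proof -
  have [measurable]: "a \<in> borel_measurable borel" "b \<in> borel_measurable borel"
    using a b by (auto dest: borel_measurable_integrable)
  have I: "integrable (lborel \<Otimes>\<^sub>M lborel) (\<lambda>(s, r). c s * (a (s - r) * b r))"
    by (rule convolution_integrand_integrable[OF a b _ bd]) measurable
  have "(LBINT s. c s * line_conv a b s) = (LBINT s. (LBINT r. c s * (a (s - r) * b r)))"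
    unfolding line_conv_def by simp
  also have "\<dots> = (LBINT r. (LBINT s. c s * (a (s - r) * b r)))"
    by (rule lborel_pair.Fubini_integral[OF I, symmetric])
  also have "\<dots> = (LBINT r. (LBINT x. c (x + r) * a x) * b r)"
  proof (rule Bochner_Integration.integral_cong[OF refl])
    fix r
    have "(LBINT s. c s * (a (s - r) * b r)) = (LBINT x. c (r + x) * (a x * b r))"
      using lborel_integral_real_affine[of 1 "\<lambda>s. c s * (a (s - r) * b r)" r] by simp
    also have "\<dots> = (LBINT x. (c (x + r) * a x) * b r)" by (simp add: add.commute mult.assoc)
    finally show "(LBINT s. c s * (a (s - r) * b r)) = (LBINT x. c (x + r) * a x) * b r" by simp
  qed
  finally show ?thesis .
qed

section \<open>Functions determined by interval integrals or inner products\<close>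

text \<open>
  Let \<open>A = {h < 0}\<close> and \<open>\<Psi>(r) = \<integral>\<^sub>A h(s - r) ds\<close>. By Fubini, the integral of \<open>\<Psi>\<close> over \<open>(0,d)\<close> is the integral over \<open>A\<close> of
  interval integrals of \<open>h\<close>, hence nonnegative. Continuity of translation turns this into \<open>\<Psi>(0) \<ge> 0\<close>, which forces \<open>A\<close> to be
  a null set.
\<close>

lemma AE_nonneg_if_interval_integrals_nonneg:
  fixes h :: "real \<Rightarrow> real"
  assumes h: "integrable lborel h" and R: "\<And>x. \<bar>x\<bar> > R \<Longrightarrow> h x = 0"
    and pos: "\<And>a b. a < b \<Longrightarrow> 0 \<le> (LBINT x. indicator {a<..<b} x * h x)"
  shows "AE x in lborel. 0 \<le> h x"
proof -
  have [measurable]: "h \<in> borel_measurable borel" using h by auto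
  define A where "A = {x. h x < 0}"
  have [measurable]: "A \<in> sets borel" unfolding A_def by measurable
  define \<Psi> where "\<Psi> r = (LBINT s. indicator A s * h (s - r))" for r
  have hr: "integrable lborel (\<lambda>s. h (s - r))" for r
    using lborel_integrable_real_affine[OF h, of 1 "-r"] by simp
  have Ah: "integrable lborel (\<lambda>s. indicator A s * h (s - r))" for r
    by (rule Bochner_Integration.integrable_bound[OF hr[of r]]) (auto simp: indicator_def)
  have \<Psi>m[measurable]: "\<Psi> \<in> borel_measurable borel" unfolding \<Psi>_def by measurable
  have \<Psi>bd: "\<bar>\<Psi> r\<bar> \<le> (LBINT s. \<bar>h s\<bar>)" for r
  proof -
    have "\<bar>\<Psi> r\<bar> \<le> (LBINT s. \<bar>indicator A s * h (s - r)\<bar>)"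
      unfolding \<Psi>_def using integral_norm_bound[of lborel "\<lambda>s. indicator A s * h (s - r)"] by simp
    also have "\<dots> \<le> (LBINT s. \<bar>h (s - r)\<bar>)"
      by (rule integral_mono) (use Ah hr in \<open>auto simp: indicator_def\<close>)
    also have "\<dots> = (LBINT s. \<bar>h s\<bar>)"
      using lborel_integral_real_affine[of 1 "\<lambda>s. \<bar>h s\<bar>" "-r"] by simp
    finally show ?thesis .
  qed
  have avg: "0 \<le> (LBINT r. indicator {0<..<d} r * \<Psi> r)" if d: "d > 0" for d
  proof -
    define i where "i = (\<lambda>r::real. indicator {0<..<d} r :: real)"
    have im[measurable]: "i \<in> borel_measurable borel" by (simp add: i_def)
    have ii: "integrable lborel i" unfolding i_def using d by (intro integrable_real_indicator) simp_all
    have I: "integrable (lborel \<Otimes>\<^sub>M lborel) (\<lambda>(s, r). indicator A s * h (s - r) * i r)"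
      using convolution_integrand_integrable[OF h ii, of "\<lambda>s r. indicator A s" 1]
      by (simp add: mult.assoc abs_indicator)
    have "(LBINT r. i r * \<Psi> r) = (LBINT r. (LBINT s. indicator A s * h (s - r) * i r))"
      unfolding \<Psi>_def by (simp add: mult.commute)
    also have "\<dots> = (LBINT s. (LBINT r. indicator A s * h (s - r) * i r))"
      by (rule lborel_pair.Fubini_integral[OF I])
    also have "\<dots> \<ge> 0"
    proof (rule Bochner_Integration.integral_nonneg)
      fix s
      have "(LBINT r. indicator A s * h (s - r) * i r) = indicator A s * (LBINT r. i r * h (s - r))"
        by (subst integral_mult_right_zero[symmetric]) (simp only: ac_simps)
      also have "(LBINT r. i r * h (s - r)) = (LBINT x. indicator {s - d<..<s} x * h x)"
        using lborel_integral_real_affine[of "-1" "\<lambda>x. indicator {s - d<..<s} x * h x" s]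
        by (simp add: i_def indicator_def conj_commute cong: if_cong)
      finally show "0 \<le> (LBINT r. indicator A s * h (s - r) * i r)"
        using pos[of "s - d" s] d by (auto simp: indicator_def)
    qed
    finally show ?thesis by (simp add: i_def)
  qed
  have "0 \<le> \<Psi> 0 + e" if e: "e > 0" for e
  proof -
    obtain d where d: "d > 0"
      "\<And>r. \<bar>r\<bar> < d \<Longrightarrow> (\<integral>\<^sup>+x. ennreal (norm (h (x + r) - h x) ^ 1) \<partial>lborel) \<le> ennreal e"
      by (rule translate_Lp[where R=R and p=1, OF simple_limit_real R _ e one_neq_zero])
        (use h in \<open>auto intro: that\<close>)
    have le: "\<Psi> r \<le> \<Psi> 0 + e" if "\<bar>r\<bar> < d" for r
    proof -
      have "\<Psi> r - \<Psi> 0 = (LBINT s. indicator A s * (h (s - r) - h s))"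
        unfolding \<Psi>_def using Ah[of r] Ah[of 0] by (simp add: right_diff_distrib)
      also have "\<dots> \<le> (LBINT s. \<bar>h (s - r) - h s\<bar>)"
        using Ah[of r] Ah[of 0] hr[of r] h
        by (intro integral_mono) (auto simp: indicator_def right_diff_distrib)
      also have "\<dots> \<le> e"
      proof -
        have "ennreal (LBINT s. \<bar>h (s - r) - h s\<bar>) = (\<integral>\<^sup>+s. ennreal \<bar>h (s - r) - h s\<bar> \<partial>lborel)"
          using hr[of r] h by (intro nn_integral_eq_integral[symmetric]) auto
        also have "\<dots> \<le> ennreal e" using d(2)[of "-r"] that by simp
        finally show ?thesis using e by simp
      qed
      finally show ?thesis by simp
    qed
    have "0 \<le> (LBINT r. indicator {0<..<d} r * \<Psi> r)" by (rule avg[OF d(1)])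
    also have "\<dots> \<le> (LBINT r. indicator {0<..<d} r * (\<Psi> 0 + e))"
    proof (rule integral_mono)
      show "integrable lborel (\<lambda>r. indicator {0<..<d} r * \<Psi> r)"
      proof (rule Bochner_Integration.integrable_bound)
        show "integrable lborel (\<lambda>r. indicator {0<..<d} r * (LBINT s. \<bar>h s\<bar>))" by simp
      qed (use \<Psi>bd in \<open>auto simp: indicator_def\<close>)
      show "indicator {0<..<d} r * \<Psi> r \<le> indicator {0<..<d} r * (\<Psi> 0 + e)" for r
        using le[of r] by (auto simp: indicator_def)
    qed simp
    also have "\<dots> = d * (\<Psi> 0 + e)" using d(1) by simp
    finally show "0 \<le> \<Psi> 0 + e" using d(1) by (simp add: zero_le_mult_iff)
  qed
  then have "0 \<le> \<Psi> 0" by (meson field_le_epsilon)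
  have int: "integrable lborel (\<lambda>s. - (indicator A s * h s))" using Ah[of 0] by simp
  have "(LBINT s. - (indicator A s * h s)) \<le> 0" using \<open>0 \<le> \<Psi> 0\<close> by (simp add: \<Psi>_def)
  moreover have nn: "0 \<le> - (indicator A s * h s)" for s by (auto simp: A_def indicator_def)
  ultimately have "(LBINT s. - (indicator A s * h s)) = 0"
    using Bochner_Integration.integral_nonneg[of lborel "\<lambda>s. - (indicator A s * h s)"] nn by (meson antisym)
  then have "AE s in lborel. - (indicator A s * h s) = 0"
    using integral_nonneg_eq_0_iff_AE[OF int] nn by simp
  then show ?thesis by eventually_elim (auto simp: A_def indicator_def split: if_splits)
qed

lemma AE_zero_if_interval_integrals_zero:
  fixes h :: "real \<Rightarrow> real"
  assumes h: "integrable lborel h" and R: "\<And>x. \<bar>x\<bar> > R \<Longrightarrow> h x = 0"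
    and z: "\<And>a b. a < b \<Longrightarrow> (LBINT x. indicator {a<..<b} x * h x) = 0"
  shows "AE x in lborel. h x = 0"
proof -
  have "AE x in lborel. 0 \<le> h x"
    by (rule AE_nonneg_if_interval_integrals_nonneg[OF h R]) (auto simp: z)
  moreover have "AE x in lborel. 0 \<le> - h x"
    by (rule AE_nonneg_if_interval_integrals_nonneg[where h="\<lambda>x. - h x" and R=R]) (auto simp: z h R)
  ultimately show ?thesis by eventually_elim auto
qed

text \<open>
  The exceptional null set may depend on \<open>c\<close>, and there are uncountably many \<open>c\<close>. It suffices to test with a countable
  set whose closure contains the range.
\<close>

lemma AE_vector_zero_if_inner_zero:
  fixes z :: "'x \<Rightarrow> 'b::real_inner"
  assumes z: "simple_limit M z" and 0: "\<And>c. AE x in M. z x \<bullet> c = 0"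
  shows "AE x in M. z x = 0"
proof -
  obtain D where D: "countable D" "\<And>x. x \<in> space M \<Longrightarrow> z x \<in> closure D"
    by (rule simple_limit_separable[OF z]) blast
  have "AE x in M. \<forall>c\<in>D. z x \<bullet> c = 0"
    using D(1) 0 by (subst AE_ball_countable) auto
  with AE_space show ?thesis
  proof eventually_elim
    case (elim x)
    have "closed {c. z x \<bullet> c = 0}" by (intro closed_Collect_eq continuous_intros)
    then have "closure D \<subseteq> {c. z x \<bullet> c = 0}" using elim by (intro closure_minimal) auto
    then show "z x = 0" using D(2)[of x] elim by auto
  qed
qed

lemma integrable_inner_simple_limit:
  fixes f :: "'x \<Rightarrow> 'b::real_inner"
  assumes "simple_limit M f" "integrable M (\<lambda>x. norm (f x))"
  shows "integrable M (\<lambda>x. f x \<bullet> c)"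
proof (rule Bochner_Integration.integrable_bound)
  show "integrable M (\<lambda>x. norm (f x) * norm c)" using assms(2) by simp
  show "(\<lambda>x. f x \<bullet> c) \<in> borel_measurable M"
    by (rule borel_measurable_inner_simple_limit[OF assms(1) simple_limit_const])
  show "AE x in M. norm (f x \<bullet> c) \<le> norm (norm (f x) * norm c)"
    using Cauchy_Schwarz_ineq2 by (auto simp: abs_mult)
qed

section \<open>Test functions, primitives and weak derivatives\<close>

lemma test_functionD:
  assumes \<eta>: "test_function T \<eta>"
  shows "\<And>x. (\<eta> has_real_derivative deriv \<eta> x) (at x)" "continuous_on UNIV (deriv \<eta>)"
    "\<And>x. x \<notin> {0<..<T} \<Longrightarrow> \<eta> x = 0" "\<And>x. x \<notin> {0<..<T} \<Longrightarrow> deriv \<eta> x = 0"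
    "\<exists>K. \<forall>x. \<bar>\<eta> x\<bar> \<le> K \<and> \<bar>deriv \<eta> x\<bar> \<le> K"
proof -
  obtain D where D: "\<And>x. (\<eta> has_vector_derivative D x) (at x)" "continuous_on UNIV D"
    using \<eta> unfolding test_function_def C1_differentiable_on_def by auto
  have dD: "deriv \<eta> = D"
    using D(1) by (auto simp: has_real_derivative_iff_has_vector_derivative[symmetric] intro!: DERIV_imp_deriv ext)
  show d: "\<And>x. (\<eta> has_real_derivative deriv \<eta> x) (at x)"
    using D(1) by (simp add: dD has_real_derivative_iff_has_vector_derivative)
  show c: "continuous_on UNIV (deriv \<eta>)" using D(2) by (simp add: dD)
  obtain K where K: "compact K" "K \<subseteq> {0<..<T}" "\<And>s. s \<notin> K \<Longrightarrow> \<eta> s = 0"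
    using \<eta> unfolding test_function_def by blast
  show z: "\<And>x. x \<notin> {0<..<T} \<Longrightarrow> \<eta> x = 0" using K by blast
  have zK: "deriv \<eta> x = 0" if "x \<notin> K" for x
  proof -
    have "\<forall>\<^sub>F y in nhds x. y \<in> - K"
      using K(1) that by (intro eventually_nhds_in_open) (auto intro: compact_imp_closed)
    then have "\<forall>\<^sub>F y in nhds x. \<eta> y = 0" by eventually_elim (use K(3) in auto)
    then have "deriv \<eta> x = deriv (\<lambda>_. 0) x" by (intro deriv_cong_ev) auto
    then show ?thesis by simp
  qed
  then show "\<And>x. x \<notin> {0<..<T} \<Longrightarrow> deriv \<eta> x = 0" using K by blast
  have ce: "continuous_on K \<eta>"
    using d by (intro continuous_at_imp_continuous_on ballI DERIV_isCont)
  have "bounded (\<eta> ` K)" "bounded (deriv \<eta> ` K)"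
    using K(1) ce continuous_on_subset[OF c, of K]
    by (auto intro!: compact_imp_bounded compact_continuous_image)
  then obtain B1 B2 where "\<And>x. x \<in> K \<Longrightarrow> \<bar>\<eta> x\<bar> \<le> B1" "\<And>x. x \<in> K \<Longrightarrow> \<bar>deriv \<eta> x\<bar> \<le> B2"
    unfolding bounded_iff by auto
  then have "\<bar>\<eta> x\<bar> \<le> max 0 (max B1 B2) \<and> \<bar>deriv \<eta> x\<bar> \<le> max 0 (max B1 B2)" for x
    using K(3)[of x] zK[of x] by (cases "x \<in> K") (auto simp: le_max_iff_disj)
  then show "\<exists>K. \<forall>x. \<bar>\<eta> x\<bar> \<le> K \<and> \<bar>deriv \<eta> x\<bar> \<le> K" by blast
qed

lemma test_function_borel:
  assumes "test_function T \<eta>"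
  shows "\<eta> \<in> borel_measurable borel" "deriv \<eta> \<in> borel_measurable borel"
  using test_functionD(1,2)[OF assms]
  by (auto intro!: borel_measurable_continuous_onI continuous_at_imp_continuous_on DERIV_isCont)

text \<open>
  A continuous function with support inside \<open>(0,T)\<close> is the derivative of a test function as soon as its integral
  vanishes.
\<close>

lemma test_function_antiderivative:
  fixes p :: "real \<Rightarrow> real"
  assumes p: "continuous_on UNIV p" and lu: "0 < l" "u < T" "l \<le> u" "\<And>x. x \<notin> {l..u} \<Longrightarrow> p x = 0"
    and z: "(LBINT x. p x) = 0"
  obtains \<eta> where "test_function T \<eta>" "deriv \<eta> = p"
proof -
  have pc: "isCont p x" for x using p by (simp add: continuous_on_eq_continuous_at)
  have "\<exists>F. \<forall>x :: real. -\<infinity> < ereal x \<longrightarrow> ereal x < \<infinity> \<longrightarrow> (F has_vector_derivative p x) (at x)"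
    by (rule einterval_antiderivative) (use pc in auto)
  then obtain P where P: "\<And>x. (P has_real_derivative p x) (at x)"
    by (auto simp: has_real_derivative_iff_has_vector_derivative)
  have ftc: "(LBINT s. p s * indicator {x..y} s) = P y - P x" if "x \<le> y" for x y
    by (rule integral_FTC_Icc_real[OF that P]) (use pc in auto)
  define \<eta> where "\<eta> x = P x - P 0" for x
  have d: "(\<eta> has_real_derivative p x) (at x)" for x
    unfolding \<eta>_def using DERIV_diff[OF P DERIV_const] by simp
  have z0: "\<eta> x = 0" if "x \<notin> {l..u}" for x
  proof (cases "x \<le> 0")
    case True
    have "(LBINT s. p s * indicator {x..0} s) = (\<integral>s. 0 \<partial>(lborel :: real measure))"
      using lu by (intro Bochner_Integration.integral_cong) (auto simp: indicator_def)
    then show ?thesis using ftc[OF True] by (simp add: \<eta>_def)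
  next
    case False
    have "(LBINT s. p s * indicator {0..x} s) = 0"
    proof (cases "x < l")
      case True
      then have "(LBINT s. p s * indicator {0..x} s) = (\<integral>s. 0 \<partial>(lborel :: real measure))"
        using lu by (intro Bochner_Integration.integral_cong) (auto simp: indicator_def)
      then show ?thesis by simp
    next
      case False
      then have "x > u" using that by auto
      have "(LBINT s. p s * indicator {0..x} s) = (LBINT s. p s)"
      proof (rule Bochner_Integration.integral_cong[OF refl])
        fix y
        show "p y * indicator {0..x} y = p y"
          using lu(1) lu(4)[of y] \<open>x > u\<close> by (cases "y \<in> {l..u}") auto
      qed
      then show ?thesis using z by simp
    qed
    then show ?thesis using ftc[of 0 x] False by (simp add: \<eta>_def)
  qed
  have "test_function T \<eta>"
    unfolding test_function_def C1_differentiable_on_def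
    using d p z0 lu
    by (auto simp: has_real_derivative_iff_has_vector_derivative intro!: exI[of _ p] exI[of _ "{l..u}"])
  moreover have "deriv \<eta> = p" using d by (auto intro: DERIV_imp_deriv)
  ultimately show thesis by (rule that)
qed

text \<open>
  The absolutely continuous function with derivative \<open>v\<close> that vanishes at \<open>0\<close>, that is \<open>1 * v\<close>.
\<close>

definition primitive :: "(real \<Rightarrow> real) \<Rightarrow> real \<Rightarrow> real" where
  "primitive v s = (LBINT r. indicator {0<..<s} r * v r)"

lemma primitive_eq_line_conv:
  fixes v :: "real \<Rightarrow> real"
  assumes v: "integrable lborel v" "\<And>x. x \<notin> {0<..<T} \<Longrightarrow> v x = 0" and s: "0 < s" "s \<le> T"
  shows "primitive v s = line_conv (indicator {0..T}) v s"
proof -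
  have "AE r in lborel. indicator {0<..<s} r * v r = indicator {0..T} (s - r) * v r"
    using AE_lborel_singleton[of s]
    by eventually_elim (use s v(2) in \<open>auto simp: indicator_def\<close>)
  then show ?thesis
    using v(1) unfolding primitive_def line_conv_def by (intro integral_cong_AE) auto
qed

text \<open>
  Integration by parts: after Fubini, \<open>\<eta>'\<close> is integrated over an interval of length \<open>T\<close> that starts at a point of
  \<open>(0,T)\<close> and so ends beyond the support of \<open>\<eta>\<close>.
\<close>

lemma integral_test_function_primitive:
  fixes v :: "real \<Rightarrow> real"
  assumes \<eta>: "test_function T \<eta>" and v: "integrable lborel v" "\<And>x. x \<notin> {0<..<T} \<Longrightarrow> v x = 0" and T: "0 < T"
  shows "(LBINT s. deriv \<eta> s * primitive v s) = - (LBINT s. \<eta> s * v s)"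
proof -
  note D = test_functionD[OF \<eta>]
  obtain K where K: "\<And>x. \<bar>deriv \<eta> x\<bar> \<le> K" using D(5) by blast
  define a where "a = (\<lambda>x::real. indicator {0..T} x :: real)"
  have a: "integrable lborel a" unfolding a_def by simp
  have "(LBINT s. deriv \<eta> s * primitive v s) = (LBINT s. deriv \<eta> s * line_conv a v s)"
  proof (rule Bochner_Integration.integral_cong[OF refl])
    fix s
    have "primitive v s = line_conv a v s" if s: "0 < s" "s < T"
      using primitive_eq_line_conv[OF v] s by (simp add: a_def)
    then show "deriv \<eta> s * primitive v s = deriv \<eta> s * line_conv a v s"
      using D(4)[of s] by (cases "0 < s \<and> s < T") auto
  qed
  also have "\<dots> = (LBINT r. (LBINT x. deriv \<eta> (x + r) * a x) * v r)"
    by (rule integral_mult_line_conv[OF a v(1) test_function_borel(2)[OF \<eta>] K])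
  also have "\<dots> = (LBINT r. - (\<eta> r * v r))"
  proof (rule Bochner_Integration.integral_cong[OF refl])
    fix r
    have "(LBINT x. deriv \<eta> (x + r) * a x) = \<eta> (T + r) - \<eta> (0 + r)"
      unfolding a_def
    proof (rule integral_FTC_Icc_real)
      show "((\<lambda>x. \<eta> (x + r)) has_real_derivative deriv \<eta> (x + r)) (at x)" for x
        using DERIV_shift D(1) by blast
      show "isCont (\<lambda>x. deriv \<eta> (x + r)) x" for x
        using D(2) by (intro isCont_o2[where g="deriv \<eta>" and f="\<lambda>x. x + r"]) (auto simp: continuous_on_eq_continuous_at)
    qed (use T in auto)
    then show "(LBINT x. deriv \<eta> (x + r) * a x) * v r = - (\<eta> r * v r)"
      using D(3)[of "T + r"] v(2)[of r] by (cases "r \<in> {0<..<T}") auto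
  qed
  finally show ?thesis by simp
qed

text \<open>
  Continuous plateau functions \<open>\<zeta>\<close> approximate indicators of intervals. Subtracting a multiple of a fixed bump \<open>\<psi>0\<close> makes
  the integral zero and the difference the derivative of a test function. Hence \<open>z - C\<close> is orthogonal to every plateau function, in the
  limit to every interval indicator, where \<open>C\<close> is the mean of \<open>z\<close> with respect to the bump.
\<close>

lemma du_Bois_Reymond:
  fixes z :: "real \<Rightarrow> real"
  assumes T: "0 < T" and z: "integrable lborel z" "\<And>x. x \<notin> {0<..<T} \<Longrightarrow> z x = 0"
    and 0: "\<And>\<eta>. test_function T \<eta> \<Longrightarrow> (LBINT s. deriv \<eta> s * z s) = 0"
  shows "\<exists>C. AE s\<in>{0<..<T} in lborel. z s = C"
proof -
  \<comment> \<open>A plateau function: \<open>1\<close> at distance at least \<open>2/n\<close> inside \<open>(a,b)\<close>, and \<open>0\<close> within \<open>1/n\<close> of the end points.\<close>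
  define \<zeta> where "\<zeta> n a b s = max 0 (min 1 (n * min (s - a) (b - s) - 1))" for n a b s :: real
  have \<zeta>c: "continuous_on UNIV (\<zeta> n a b)" for n a b
    unfolding \<zeta>_def by (intro continuous_intros)
  have \<zeta>m[measurable]: "\<zeta> n a b \<in> borel_measurable borel" for n a b
    by (intro borel_measurable_continuous_onI \<zeta>c)
  have \<zeta>01: "0 \<le> \<zeta> n a b s" "\<zeta> n a b s \<le> 1" for n a b s by (auto simp: \<zeta>_def)
  have \<zeta>0: "\<zeta> n a b s = 0" if "n > 0" "s \<notin> {a + 1/n..b - 1/n}" for n a b s
  proof -
    have "min (s - a) (b - s) < 1/n" using that(2) by auto
    then have "n * min (s - a) (b - s) < 1" using that(1) by (simp add: field_simps)
    then show ?thesis by (simp add: \<zeta>_def)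
  qed
  have \<zeta>out: "\<zeta> n a b s = 0" if "n > 0" "s \<notin> {a<..<b}" for n a b s
  proof (rule \<zeta>0[OF that(1)])
    have "1 / n > 0" using that(1) by simp
    then show "s \<notin> {a + 1/n..b - 1/n}" using that(2) by (smt (verit) atLeastAtMost_iff greaterThanLessThan_iff)
  qed
  have \<zeta>ind: "\<zeta> n a b s \<le> indicator {a..b} s" if "n > 0" for n a b s
    using \<zeta>01[of n a b s] \<zeta>out[OF that, of s a b] by (cases "s \<in> {a<..<b}") (auto simp: indicator_def)
  have \<zeta>int: "integrable lborel (\<zeta> n a b)" if "n > 0" for n a b
    by (rule Bochner_Integration.integrable_bound[where f="\<lambda>s. indicator {a..b} s :: real"])
      (use \<zeta>ind[OF that] \<zeta>01 in \<open>auto intro!: integrable_real_indicator simp: abs_of_nonneg\<close>)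
  \<comment> \<open>The bump equals \<open>1\<close> on the middle third of the interval.\<close>
  define \<psi>0 where "\<psi>0 = \<zeta> (6/T) 0 T"
  have n6: "6/T > 0" using T by simp
  define I0 where "I0 = (LBINT s. \<psi>0 s)"
  have I0: "I0 > 0"
  proof -
    have "(LBINT s. indicator {T/3..2*T/3} s) \<le> I0"
      unfolding I0_def
    proof (rule integral_mono)
      show "integrable lborel \<psi>0" unfolding \<psi>0_def by (rule \<zeta>int[OF n6])
      fix s show "indicator {T/3..2*T/3} s \<le> \<psi>0 s"
      proof (cases "s \<in> {T/3..2*T/3}")
        case True
        then have "2 * T \<le> 6 * min (s - 0) (T - s)" by (auto simp: min_def)
        then have "2 \<le> 6 * min (s - 0) (T - s) / T" using T by (subst pos_le_divide_eq) auto
        then have "2 \<le> 6/T * min (s - 0) (T - s)" by simp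
        then show ?thesis using True by (simp add: \<psi>0_def \<zeta>_def)
      qed (simp add: \<psi>0_def \<zeta>01)
    qed (simp add: integrable_real_indicator)
    then show ?thesis using T by (simp add: measure_def)
  qed
  define C where "C = (LBINT s. \<psi>0 s * z s) / I0"
  have bz: "integrable lborel (\<lambda>s. \<zeta> n a b s * z s)" for n a b
    by (rule Bochner_Integration.integrable_bound[OF z(1)])
      (use z(1) \<zeta>01 in \<open>auto simp: abs_mult abs_of_nonneg intro!: mult_left_le_one_le\<close>)
  have key: "(LBINT s. \<zeta> n a b s * (z s - C)) = 0" if n: "n > 0" and ab: "0 \<le> a" "b \<le> T" for n a b
  proof -
    define J where "J = (LBINT s. \<zeta> n a b s)"
    define p where "p s = \<zeta> n a b s - J / I0 * \<psi>0 s" for s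
    define m where "m = min (1/n) (T/6)"
    have m: "m > 0" "m \<le> 1/n" "m \<le> T/6" using n T by (auto simp: m_def)
    obtain \<eta> where \<eta>: "test_function T \<eta>" "deriv \<eta> = p"
    proof (rule test_function_antiderivative[of p m "T - m" T])
      show "continuous_on UNIV p" unfolding p_def \<psi>0_def by (intro continuous_intros \<zeta>c)
      show "(LBINT x. p x) = 0"
        unfolding p_def using \<zeta>int[OF n] \<zeta>int[OF n6] I0 by (simp add: J_def I0_def \<psi>0_def)
      show "p x = 0" if x: "x \<notin> {m..T - m}" for x
      proof -
        have "x \<notin> {a + 1/n..b - 1/n}" "x \<notin> {0 + 1/(6/T)..T - 1/(6/T)}" using x ab m by auto
        from \<zeta>0[OF n this(1)] \<zeta>0[OF n6 this(2)] show ?thesis by (simp add: p_def \<psi>0_def)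
      qed
    qed (use m T in auto)
    have "0 = (LBINT s. p s * z s)" using 0[OF \<eta>(1)] \<eta>(2) by simp
    also have "\<dots> = (LBINT s. \<zeta> n a b s * z s - J / I0 * (\<psi>0 s * z s))"
      by (simp add: p_def algebra_simps)
    also have "\<dots> = (LBINT s. \<zeta> n a b s * z s) - J * C"
      using bz by (simp add: \<psi>0_def C_def)
    also have "\<dots> = (LBINT s. \<zeta> n a b s * (z s - C))"
      using bz \<zeta>int[OF n] by (simp add: right_diff_distrib J_def)
    finally show ?thesis by simp
  qed
  define h where "h s = z s - indicator {0<..<T} s * C" for s
  have h: "integrable lborel h"
    unfolding h_def using z(1) by (intro Bochner_Integration.integrable_diff) simp_all
  have hint: "(LBINT s. indicator {a<..<b} s * h s) = 0" if ab: "0 \<le> a" "b \<le> T" for a b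
  proof -
    have "(\<lambda>n. LBINT s. \<zeta> (real (Suc n)) a b s * h s) \<longlonglongrightarrow> (LBINT s. indicator {a<..<b} s * h s)"
    proof (rule integral_dominated_convergence[where w="\<lambda>s. \<bar>h s\<bar>"])
      show "AE s in lborel. (\<lambda>n. \<zeta> (real (Suc n)) a b s * h s) \<longlonglongrightarrow> indicator {a<..<b} s * h s"
      proof (intro AE_I2 tendsto_mult tendsto_const)
        fix s
        show "(\<lambda>n. \<zeta> (real (Suc n)) a b s) \<longlonglongrightarrow> indicator {a<..<b} s"
        proof (cases "s \<in> {a<..<b}")
          case True
          then have q: "min (s - a) (b - s) > 0" by auto
          obtain N :: nat where N: "real N > 2 / min (s - a) (b - s)" using reals_Archimedean2 by blast
          have "\<forall>\<^sub>F n in sequentially. \<zeta> (real (Suc n)) a b s = 1"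
            using eventually_ge_at_top[of N]
          proof eventually_elim
            case (elim n)
            have "2 \<le> real N * min (s - a) (b - s)" using N q by (simp add: field_simps)
            also have "\<dots> \<le> real (Suc n) * min (s - a) (b - s)"
              using elim q by (intro mult_right_mono) auto
            finally show ?case by (simp add: \<zeta>_def)
          qed
          then show ?thesis using True by (auto intro: tendsto_eventually)
        next
          case False
          have "\<zeta> (real (Suc n)) a b s = 0" for n by (rule \<zeta>out[OF _ False]) simp
          then show ?thesis using False by simp
        qed
      qed
      show "AE s in lborel. norm (\<zeta> (real (Suc n)) a b s * h s) \<le> \<bar>h s\<bar>" for n
        using \<zeta>01 by (auto simp: abs_mult abs_of_nonneg intro!: mult_left_le_one_le)
    qed (use h in auto)
    moreover have "(LBINT s. \<zeta> (real (Suc n)) a b s * h s) = 0" for n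
    proof -
      have "\<zeta> (real (Suc n)) a b s * h s = \<zeta> (real (Suc n)) a b s * (z s - C)" for s
      proof (cases "s \<in> {0<..<T}")
        case False
        have "\<zeta> (real (Suc n)) a b s = 0" by (rule \<zeta>out) (use False ab in auto)
        then show ?thesis by simp
      qed (simp add: h_def)
      then have "(LBINT s. \<zeta> (real (Suc n)) a b s * h s) = (LBINT s. \<zeta> (real (Suc n)) a b s * (z s - C))"
        by (rule Bochner_Integration.integral_cong[OF refl])
      also have "\<dots> = 0" by (rule key) (use ab in auto)
      finally show ?thesis .
    qed
    ultimately show ?thesis by (simp add: LIMSEQ_const_iff)
  qed
  have "AE s in lborel. h s = 0"
  proof (rule AE_zero_if_interval_integrals_zero[OF h, of T])
    show "h x = 0" if "\<bar>x\<bar> > T" for x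
    proof -
      have "x \<notin> {0<..<T}" using that T by auto
      then show ?thesis using z(2)[of x] by (simp add: h_def)
    qed
    show "(LBINT x. indicator {a<..<b} x * h x) = 0" if "a < b" for a b
    proof -
      have "indicator {a<..<b} x * h x = indicator {max a 0<..<min b T} x * h x" for x
        using z(2)[of x] by (auto simp: h_def indicator_def)
      then have "(LBINT x. indicator {a<..<b} x * h x) = (LBINT x. indicator {max a 0<..<min b T} x * h x)"
        by (rule Bochner_Integration.integral_cong[OF refl])
      also have "\<dots> = 0" by (rule hint) auto
      finally show ?thesis .
    qed
  qed
  then have "AE s\<in>{0<..<T} in lborel. z s = C"
    by eventually_elim (auto simp: h_def indicator_def)
  then show ?thesis by blast
qed

lemma primitive_borel[measurable]:
  assumes "integrable lborel v" shows "primitive v \<in> borel_measurable borel"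
proof -
  have [measurable]: "v \<in> borel_measurable borel" using assms by auto
  have eq: "primitive v s = (LBINT r. (if 0 < r \<and> r < s then 1 else 0) * v r)" for s
    unfolding primitive_def by (intro Bochner_Integration.integral_cong) (auto simp: indicator_def)
  show ?thesis unfolding eq[abs_def] by measurable
qed

lemma primitive_bound:
  assumes "integrable lborel v" shows "\<bar>primitive v s\<bar> \<le> (LBINT r. \<bar>v r\<bar>)"
proof -
  have i: "integrable lborel (\<lambda>r. indicator {0<..<s} r * v r)"
    by (rule Bochner_Integration.integrable_bound[OF assms]) (use assms in \<open>auto simp: indicator_def\<close>)
  have "\<bar>primitive v s\<bar> \<le> (LBINT r. \<bar>indicator {0<..<s} r * v r\<bar>)"
    unfolding primitive_def using integral_norm_bound[of lborel "\<lambda>r. indicator {0<..<s} r * v r"] by simp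
  also have "\<dots> \<le> (LBINT r. \<bar>v r\<bar>)"
    by (rule integral_mono) (use i assms in \<open>auto simp: indicator_def\<close>)
  finally show ?thesis .
qed

lemma primitive_continuous:
  assumes v: "integrable lborel v" shows "continuous_on UNIV (primitive v)"
  unfolding continuous_on_eq_continuous_at[OF open_UNIV]
proof
  fix s :: real
  show "isCont (primitive v) s"
  proof (rule continuous_at_sequentiallyI)
    fix X :: "nat \<Rightarrow> real" assume X: "X \<longlonglongrightarrow> s"
    show "(\<lambda>n. primitive v (X n)) \<longlonglongrightarrow> primitive v s"
      unfolding primitive_def
    proof (rule integral_dominated_convergence[where w="\<lambda>r. \<bar>v r\<bar>"])
      show "AE r in lborel. (\<lambda>n. indicator {0<..<X n} r * v r) \<longlonglongrightarrow> indicator {0<..<s} r * v r"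
        using AE_lborel_singleton[of s]
      proof eventually_elim
        case (elim r)
        have "\<forall>\<^sub>F n in sequentially. (r < X n) = (r < s)"
        proof (cases "r < s")
          case True then show ?thesis using order_tendstoD(1)[OF X True] by (auto elim: eventually_mono)
        next
          case False
          then have "s < r" using elim by auto
          then show ?thesis using order_tendstoD(2)[OF X, of r] False by (auto elim: eventually_mono)
        qed
        then have "\<forall>\<^sub>F n in sequentially. indicator {0<..<X n} r * v r = indicator {0<..<s} r * v r"
          by eventually_elim (auto simp: indicator_def)
        then show ?case by (rule tendsto_eventually)
      qed
    qed (use v in \<open>auto simp: indicator_def\<close>)
  qed
qed

lemma weak_derivative_primitive:
  fixes f v :: "real \<Rightarrow> real"
  assumes T: "0 < T" and f: "integrable lborel f" "\<And>x. x \<notin> {0<..<T} \<Longrightarrow> f x = 0"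
    and v: "integrable lborel v" "\<And>x. x \<notin> {0<..<T} \<Longrightarrow> v x = 0"
    and wd: "\<And>\<eta>. test_function T \<eta> \<Longrightarrow> (LBINT s. deriv \<eta> s * f s) = - (LBINT s. \<eta> s * v s)"
  shows "\<exists>C. AE s\<in>{0<..<T} in lborel. f s = C + primitive v s"
proof -
  note [measurable] = primitive_borel[OF v(1)]
  let ?P = "\<lambda>s. indicator {0<..<T} s * primitive v s"
  have P: "integrable lborel ?P"
  proof (rule Bochner_Integration.integrable_bound)
    show "integrable lborel (\<lambda>s. indicator {0<..<T} s * (LBINT r. \<bar>v r\<bar>))"
      by simp
  qed (use primitive_bound[OF v(1)] in \<open>auto simp: indicator_def\<close>)
  have "\<exists>C. AE s\<in>{0<..<T} in lborel. f s - ?P s = C"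
  proof (rule du_Bois_Reymond[OF T])
    fix \<eta> assume \<eta>: "test_function T \<eta>"
    obtain K where K: "\<And>x. \<bar>deriv \<eta> x\<bar> \<le> K" using test_functionD(5)[OF \<eta>] by blast
    note [measurable] = test_function_borel[OF \<eta>]
    have bi: "integrable lborel (\<lambda>s. deriv \<eta> s * g s)" if "integrable lborel g" for g :: "real \<Rightarrow> real"
    proof (rule Bochner_Integration.integrable_bound[OF integrable_mult_right[OF that, of K]])
      have "\<bar>deriv \<eta> x\<bar> * \<bar>g x\<bar> \<le> \<bar>K\<bar> * \<bar>g x\<bar>" for x
        using K[of x] by (intro mult_right_mono) auto
      then show "AE x in lborel. norm (deriv \<eta> x * g x) \<le> norm (K * g x)" by (simp add: abs_mult)
    qed (use that in simp)
    have "(LBINT s. deriv \<eta> s * (f s - ?P s)) = (LBINT s. deriv \<eta> s * f s) - (LBINT s. deriv \<eta> s * ?P s)"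
      using bi[OF f(1)] bi[OF P] by (simp add: right_diff_distrib)
    also have "(LBINT s. deriv \<eta> s * ?P s) = (LBINT s. deriv \<eta> s * primitive v s)"
      by (rule Bochner_Integration.integral_cong[OF refl])
        (use test_functionD(4)[OF \<eta>] in \<open>auto simp: indicator_def\<close>)
    finally show "(LBINT s. deriv \<eta> s * (f s - ?P s)) = 0"
      using wd[OF \<eta>] integral_test_function_primitive[OF \<eta> v T] by simp
  qed (use f P in auto)
  then obtain C where "AE s\<in>{0<..<T} in lborel. f s - ?P s = C" by blast
  then have "AE s\<in>{0<..<T} in lborel. f s = C + primitive v s"
    by eventually_elim (auto simp: indicator_def)
  then show ?thesis by blast
qed

lemma integrable_indicator_mult:
  fixes f :: "real \<Rightarrow> real"
  assumes "integrable lborel f" "A \<in> sets borel"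
  shows "integrable lborel (\<lambda>x. indicator A x * f x)"
  using integrable_mult_indicator[OF _ assms(1), of A] assms(2) by simp

section \<open>The scalar chain-rule inequality for a bounded kernel\<close>

text \<open>
  Fubini on the triangle \<open>r < x < s\<close>. For \<open>\<kappa> = a - primitive m\<close> it yields \<open>\<integral>\<^sub>0\<^sup>s \<kappa> = \<kappa>(s) s + \<integral>\<^sub>0\<^sup>s r m(r) dr\<close>, the identity
  that keeps the total error below the \<open>L\<^sup>1\<close> norm of the kernel.
\<close>

lemma integral_primitive:
  fixes m :: "real \<Rightarrow> real"
  assumes m: "integrable lborel m" "\<And>r. r \<notin> {0<..<t} \<Longrightarrow> m r = 0" and s: "0 < s" "s \<le> t"
  shows "(LBINT x. indicator {0<..<s} x * primitive m x) = s * primitive m s - primitive (\<lambda>r. r * m r) s"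
proof -
  let ?a = "indicat_real {0..t}"
  have mi: "integrable lborel (\<lambda>r. r * m r)"
  proof (rule Bochner_Integration.integrable_bound[OF integrable_mult_right[OF m(1), of t]])
    show "AE x in lborel. norm (x * m x) \<le> norm (t * m x)"
    proof (rule AE_I2)
      fix x
      show "norm (x * m x) \<le> norm (t * m x)"
        using m(2)[of x] by (cases "x \<in> {0<..<t}") (auto simp: abs_mult intro!: mult_right_mono)
    qed
  qed (use m in auto)
  have "(LBINT x. indicator {0<..<s} x * primitive m x) = (LBINT x. indicator {0<..<s} x * line_conv ?a m x)"
    by (rule Bochner_Integration.integral_cong[OF refl])
      (use primitive_eq_line_conv[OF m] s in \<open>auto simp: indicator_def\<close>)
  also have "\<dots> = (LBINT r. (LBINT x. indicator {0<..<s} (x + r) * ?a x) * m r)"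
    by (rule integral_mult_line_conv[OF _ m(1), of _ _ 1]) (auto simp: indicator_def)
  also have "\<dots> = (LBINT r. s * (indicator {0<..<s} r * m r) - indicator {0<..<s} r * (r * m r))"
  proof (rule Bochner_Integration.integral_cong[OF refl])
    fix r
    have eq: "(LBINT x. indicator {0<..<s} (x + r) * ?a x) = indicator {0<..<s} r * (s - r)" if r: "r \<in> {0<..<t}"
    proof (cases "r < s")
      case True
      have "(LBINT x. indicator {0<..<s} (x + r) * ?a x) = (LBINT x. indicator {0..<s - r} x)"
        by (rule Bochner_Integration.integral_cong[OF refl]) (use r s in \<open>auto simp: indicator_def\<close>)
      then show ?thesis using True r by simp
    next
      case False
      have "(LBINT x. indicator {0<..<s} (x + r) * ?a x) = (\<integral>x. 0 \<partial>(lborel :: real measure))"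
        by (rule Bochner_Integration.integral_cong[OF refl]) (use False r s in \<open>auto simp: indicator_def\<close>)
      then show ?thesis using False by simp
    qed
    show "(LBINT x. indicator {0<..<s} (x + r) * ?a x) * m r
        = s * (indicator {0<..<s} r * m r) - indicator {0<..<s} r * (r * m r)"
    proof (cases "r \<in> {0<..<t}")
      case True
      show ?thesis unfolding eq[OF True] by (simp add: algebra_simps)
    qed (simp add: m(2))
  qed
  also have "\<dots> = s * primitive m s - primitive (\<lambda>r. r * m r) s"
    unfolding primitive_def using integrable_indicator_mult[OF m(1)] integrable_indicator_mult[OF mi] by simp
  finally show ?thesis .
qed

lemma primitive_nonneg: "(\<And>r. 0 \<le> m r) \<Longrightarrow> 0 \<le> primitive m s"
  unfolding primitive_def by (intro Bochner_Integration.integral_nonneg) (auto simp: indicator_def)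

lemma indicator_line_conv:
  fixes m E :: "real \<Rightarrow> real"
  assumes m: "integrable lborel m" "\<And>r. r \<le> 0 \<Longrightarrow> m r = 0"
    and E: "integrable lborel E" "\<And>r. r \<le> 0 \<Longrightarrow> E r = 0"
  shows "(LBINT s. indicator {0<..<t} s * line_conv m E s) = (LBINT r. primitive m (t - r) * E r)"
proof -
  have "(LBINT s. indicator {0<..<t} s * line_conv m E s)
      = (LBINT r. (LBINT x. indicator {0<..<t} (x + r) * m x) * E r)"
    by (rule integral_mult_line_conv[OF m(1) E(1), of _ 1]) (auto simp: indicator_def)
  also have "\<dots> = (LBINT r. primitive m (t - r) * E r)"
  proof (rule Bochner_Integration.integral_cong[OF refl])
    fix r
    have "(LBINT x. indicator {0<..<t} (x + r) * m x) = primitive m (t - r)" if "0 < r"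
      unfolding primitive_def
    proof (rule Bochner_Integration.integral_cong[OF refl])
      fix x
      show "indicator {0<..<t} (x + r) * m x = indicator {0<..<t - r} x * m x"
        using that m(2)[of x] by (cases "x > 0") (auto simp: indicator_def)
    qed
    then show "(LBINT x. indicator {0<..<t} (x + r) * m x) * E r = primitive m (t - r) * E r"
      using E(2)[of r] by (cases "0 < r") auto
  qed
  finally show ?thesis .
qed

text \<open>
  The heart of the estimate, stated for real-valued data. \<open>X s\<close> and \<open>Y s r\<close> stand for \<open>(w(s), g(s))\<close> and \<open>(w(r), g(s))\<close>,
  \<open>E\<close> for the energy along \<open>u\<close>, \<open>E0\<close> for its initial value, \<open>G\<close> for \<open>\<parallel>g\<parallel>\<^sup>2\<close> and \<open>b\<close> for the pairing of the derivative of
  \<open>\<kappa> * w\<close> with \<open>g\<close>.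

  Because \<open>a0 = \<kappa>(s) + \<integral>\<^sub>0\<^sup>s m\<close>, the pairing \<open>b(s)\<close> equals \<open>\<kappa>(s) X(s) + \<integral>\<^sub>0\<^sup>s m(s - r) (X(s) - Y(s,r)) dr\<close>, and the
  assumed lower bounds can be inserted with the nonnegative weights \<open>\<kappa>(s)\<close> and \<open>m(s - r)\<close>. The factors \<open>s\<close> and \<open>s - r\<close> in the errors
  combine to \<open>\<kappa>(s) s + \<integral>\<^sub>0\<^sup>s r m(r) dr = \<integral>\<^sub>0\<^sup>s \<kappa> \<le> N\<close>.
\<close>

lemma chain_rule_inequality:
  fixes a0 E0 C \<epsilon> N t :: real and m E G X b :: "real \<Rightarrow> real" and Y :: "real \<Rightarrow> real \<Rightarrow> real"
  defines "\<kappa> \<equiv> \<lambda>r. a0 - primitive m r"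
  assumes t: "0 < t" and m: "integrable lborel m" "\<And>r. r \<notin> {0<..<t} \<Longrightarrow> m r = 0" "\<And>r. 0 \<le> m r"
    and \<kappa>: "\<And>r. 0 < r \<Longrightarrow> r < t \<Longrightarrow> 0 \<le> \<kappa> r"
    and N: "(LBINT r. indicator {0<..<t} r * \<kappa> r) \<le> N"
    and E: "integrable lborel E" "\<And>r. r \<notin> {0<..<t} \<Longrightarrow> E r = 0"
    and G: "integrable lborel G" "\<And>r. r \<notin> {0<..<t} \<Longrightarrow> G r = 0" "\<And>r. 0 \<le> G r"
    and C: "0 \<le> C" and \<epsilon>: "0 < \<epsilon>"
    and b: "integrable lborel (\<lambda>s. indicator {0<..<t} s * b s)"
    and Y0: "\<And>s r. r \<le> 0 \<Longrightarrow> Y s r = 0"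
    and rep: "AE s\<in>{0<..<t} in lborel. integrable lborel (\<lambda>r. m (s - r) * Y s r) \<and>
        b s = a0 * X s - (LBINT r. m (s - r) * Y s r)"
    and X: "AE s\<in>{0<..<t} in lborel. X s \<ge> E s - E0 - C * s * (\<epsilon> * G s + (1 + \<bar>E0\<bar>) / \<epsilon>)"
    and XY: "AE s\<in>{0<..<t} in lborel. (AE r in lborel. 0 < r \<and> r < s \<longrightarrow>
        X s - Y s r \<ge> E s - E r - C * (s - r) * (\<epsilon> * G s + (1 + \<bar>E r\<bar>) / \<epsilon>))"
  shows "(LBINT s. indicator {0<..<t} s * b s) \<ge>
      (LBINT r. \<kappa> (t - r) * E r) - E0 * (LBINT r. indicator {0<..<t} r * \<kappa> r)
      - \<epsilon> * C * N * (LBINT s. G s) - C / \<epsilon> * t * N * (1 + \<bar>E0\<bar>) - C / \<epsilon> * N * (LBINT s. \<bar>E s\<bar>)"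
proof -
  define m1 where "m1 r = r * m r" for r
  have m1: "integrable lborel m1" "\<And>r. r \<notin> {0<..<t} \<Longrightarrow> m1 r = 0" "\<And>r. 0 \<le> m1 r" "\<And>r. m1 r \<le> t * m r"
  proof -
    show le: "m1 r \<le> t * m r" for r
      using m(2)[of r] m(3)[of r] unfolding m1_def by (cases "r \<in> {0<..<t}") (auto intro: mult_right_mono)
    show ge: "0 \<le> m1 r" for r
      using m(2)[of r] m(3)[of r] unfolding m1_def by (cases "r \<in> {0<..<t}") auto
    show "integrable lborel m1"
    proof (rule Bochner_Integration.integrable_bound[OF integrable_mult_right[OF m(1), of t]])
      show "m1 \<in> borel_measurable lborel" unfolding m1_def[abs_def] using m(1) by auto
      have "norm (m1 r) \<le> norm (t * m r)" for r using le[of r] ge[of r] by simp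
      then show "AE r in lborel. norm (m1 r) \<le> norm (t * m r)" by simp
    qed
    show "\<And>r. r \<notin> {0<..<t} \<Longrightarrow> m1 r = 0" using m(2) by (simp add: m1_def)
  qed
  note [measurable] = borel_measurable_integrable[OF m(1)] borel_measurable_integrable[OF E(1)]
    borel_measurable_integrable[OF G(1)] borel_measurable_integrable[OF m1(1)] primitive_borel[OF m(1)]
  have \<kappa>m[measurable]: "\<kappa> \<in> borel_measurable borel" unfolding \<kappa>_def by measurable
  define q where "q s = (LBINT r. indicator {0<..<s} r * \<kappa> r)" for s
  have \<kappa>i: "integrable lborel (\<lambda>r. indicator {0<..<t} r * \<kappa> r)"
  proof (rule Bochner_Integration.integrable_bound)
    show "integrable lborel (\<lambda>r. indicator {0<..<t} r * (\<bar>a0\<bar> + (LBINT r. \<bar>m r\<bar>)))" by simp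
    have "\<bar>\<kappa> r\<bar> \<le> \<bar>a0\<bar> + (LBINT r. \<bar>m r\<bar>)" for r
      unfolding \<kappa>_def using primitive_bound[OF m(1), of r] by linarith
    then show "AE x in lborel. norm (indicat_real {0<..<t} x * \<kappa> x)
        \<le> norm (indicator {0<..<t} x * (\<bar>a0\<bar> + (LBINT r. \<bar>m r\<bar>)))"
      by (auto simp: indicator_def intro!: AE_I2 order_trans[OF _ abs_ge_self])
  qed simp
  have q_eq: "q s = \<kappa> s * s + primitive m1 s" if s: "0 < s" "s \<le> t" for s
  proof -
    have pi: "integrable lborel (\<lambda>r. indicator {0<..<s} r * primitive m r)"
    proof (rule Bochner_Integration.integrable_bound)
      show "integrable lborel (\<lambda>r. indicator {0<..<s} r * (LBINT r. \<bar>m r\<bar>))" by simp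
    qed (use primitive_bound[OF m(1)] in \<open>auto simp: indicator_def\<close>)
    have "q s = (LBINT r. a0 * indicator {0<..<s} r - indicator {0<..<s} r * primitive m r)"
      unfolding q_def \<kappa>_def by (simp add: algebra_simps)
    also have "\<dots> = a0 * s - (s * primitive m s - primitive m1 s)"
      using pi integral_primitive[OF m(1,2) s] s by (simp add: m1_def[abs_def])
    finally show ?thesis by (simp add: \<kappa>_def algebra_simps)
  qed
  have q_le: "q s \<le> N" if s: "0 < s" "s \<le> t" for s
  proof -
    have "q s \<le> q t"
      unfolding q_def
    proof (rule integral_mono[OF _ \<kappa>i])
      have "integrable lborel (\<lambda>r. indicator {0<..<s} r * (indicator {0<..<t} r * \<kappa> r))"
        by (rule integrable_indicator_mult[OF \<kappa>i]) simp
      moreover have "indicat_real {0<..<s} r * (indicator {0<..<t} r * \<kappa> r) = indicator {0<..<s} r * \<kappa> r" for r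
        using s by (auto simp: indicator_def)
      ultimately show "integrable lborel (\<lambda>r. indicator {0<..<s} r * \<kappa> r)" by simp
      fix r show "indicat_real {0<..<s} r * \<kappa> r \<le> indicator {0<..<t} r * \<kappa> r"
        using s \<kappa>[of r] by (auto simp: indicator_def)
    qed
    then show ?thesis using N by (simp add: q_def)
  qed
  have N0: "0 \<le> N"
    using q_le[of t] t \<kappa> unfolding q_def
    by (intro order_trans[OF Bochner_Integration.integral_nonneg q_le[of t, unfolded q_def]]) (auto simp: indicator_def)
  have p1_le: "primitive m1 s \<le> N" if "0 < s" "s < t" for s
    using q_eq[of s] q_le[of s] \<kappa>[of s] that by (auto simp: mult_nonneg_nonneg intro: order_trans[rotated])
  let ?L = "\<lambda>s. a0 * E s - line_conv m E s - \<kappa> s * E0 - C * \<epsilon> * N * G s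
      - C / \<epsilon> * ((1 + \<bar>E0\<bar>) * N + line_conv m1 (\<lambda>r. \<bar>E r\<bar>) s)"
  have Ei: "integrable lborel (\<lambda>r. \<bar>E r\<bar>)" using E(1) by simp
  have lower: "AE s\<in>{0<..<t} in lborel. ?L s \<le> b s"
    using rep X XY line_conv_integrable(2)[OF m(1) E(1)] line_conv_integrable(2)[OF m1(1) Ei]
  proof eventually_elim
    case (elim s)
    show ?case
    proof
      assume s: "s \<in> {0<..<t}"
      have s0: "0 < s" "s \<le> t" using s by auto
      have iY: "integrable lborel (\<lambda>r. m (s - r) * Y s r)"
        and bs: "b s = a0 * X s - (LBINT r. m (s - r) * Y s r)" using elim(1) s by auto
      have Xs: "X s \<ge> E s - E0 - C * s * (\<epsilon> * G s + (1 + \<bar>E0\<bar>) / \<epsilon>)" using elim(2) s by auto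
      have XYs: "AE r in lborel. 0 < r \<and> r < s \<longrightarrow>
        X s - Y s r \<ge> E s - E r - C * (s - r) * (\<epsilon> * G s + (1 + \<bar>E r\<bar>) / \<epsilon>)" using elim(3) s by auto
      have ref: "integrable lborel (\<lambda>r. indicator {0<..<s} r * v (s - r))
          \<and> (LBINT r. indicator {0<..<s} r * v (s - r)) = primitive v s"
        if "integrable lborel v" for v :: "real \<Rightarrow> real"
      proof -
        have "integrable lborel (\<lambda>r. indicator {0<..<s} r * v r)" by (rule integrable_indicator_mult[OF that]) simp
        from lborel_integrable_real_affine[OF this, of "-1" s]
          lborel_integral_real_affine[of "-1" "\<lambda>r. indicator {0<..<s} r * v r" s]
        show ?thesis unfolding primitive_def by (simp add: indicator_def conj_commute cong: if_cong)
      qed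
      note rm = ref[OF m(1)] and rm1 = ref[OF m1(1)]
      have Yind: "m (s - r) * Y s r = indicator {0<..<s} r * m (s - r) * Y s r" for r
        using Y0[of r s] m(2)[of "s - r"] by (cases "r \<le> 0") (auto simp: indicator_def)
      have Eind: "m (s - r) * E r = indicator {0<..<s} r * m (s - r) * E r"
        "m1 (s - r) * \<bar>E r\<bar> = indicator {0<..<s} r * m1 (s - r) * \<bar>E r\<bar>" for r
        using E(2)[of r] m(2)[of "s - r"] m1(2)[of "s - r"] by (cases "r \<le> 0"; auto simp: indicator_def)+
      let ?i = "\<lambda>r. indicat_real {0<..<s} r * m (s - r)"
      let ?i1 = "\<lambda>r. indicat_real {0<..<s} r * m1 (s - r)"
      have I1: "integrable lborel (\<lambda>r. X s * ?i r - m (s - r) * Y s r)" using rm iY by simp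
      have I2: "integrable lborel (\<lambda>r. E s * ?i r - m (s - r) * E r - C * \<epsilon> * G s * ?i1 r
           - C / \<epsilon> * ?i1 r - C / \<epsilon> * (m1 (s - r) * \<bar>E r\<bar>))"
        using rm rm1 elim(4,5) by simp
      have "E s * primitive m s - line_conv m E s - C * \<epsilon> * G s * primitive m1 s
          - C / \<epsilon> * primitive m1 s - C / \<epsilon> * line_conv m1 (\<lambda>r. \<bar>E r\<bar>) s
        = (LBINT r. E s * ?i r - m (s - r) * E r - C * \<epsilon> * G s * ?i1 r
           - C / \<epsilon> * ?i1 r - C / \<epsilon> * (m1 (s - r) * \<bar>E r\<bar>))"
        using rm rm1 elim(4,5) by (simp add: line_conv_def)
      also have "\<dots> \<le> (LBINT r. X s * ?i r - m (s - r) * Y s r)"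
      proof (rule integral_mono_AE[OF I2 I1])
        show "AE r in lborel. E s * ?i r - m (s - r) * E r - C * \<epsilon> * G s * ?i1 r
           - C / \<epsilon> * ?i1 r - C / \<epsilon> * (m1 (s - r) * \<bar>E r\<bar>) \<le> X s * ?i r - m (s - r) * Y s r"
          using XYs
        proof eventually_elim
          case (elim r)
          show ?case
          proof (cases "r \<in> {0<..<s}")
            case True
            have "m (s - r) * (E s - E r - C * (s - r) * (\<epsilon> * G s + (1 + \<bar>E r\<bar>) / \<epsilon>)) \<le> m (s - r) * (X s - Y s r)"
              using elim True m(3) by (intro mult_left_mono) auto
            moreover have "m (s - r) * (E s - E r - C * (s - r) * (\<epsilon> * G s + (1 + \<bar>E r\<bar>) / \<epsilon>))
              = E s * m (s - r) - m (s - r) * E r - C * \<epsilon> * G s * m1 (s - r)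
           - C / \<epsilon> * m1 (s - r) - C / \<epsilon> * (m1 (s - r) * \<bar>E r\<bar>)"
              by (simp add: m1_def algebra_simps add_divide_distrib)
            ultimately show ?thesis using True by (simp add: algebra_simps)
          qed (simp add: Yind Eind)
        qed
      qed
      also have "\<dots> = X s * primitive m s - (LBINT r. m (s - r) * Y s r)"
        using rm iY by simp
      finally have int: "E s * primitive m s - line_conv m E s - C * \<epsilon> * G s * primitive m1 s
          - C / \<epsilon> * primitive m1 s - C / \<epsilon> * line_conv m1 (\<lambda>r. \<bar>E r\<bar>) s
          \<le> X s * primitive m s - (LBINT r. m (s - r) * Y s r)" .
      have bs': "b s = \<kappa> s * X s + (X s * primitive m s - (LBINT r. m (s - r) * Y s r))"
        unfolding bs \<kappa>_def by (simp add: algebra_simps)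
      \<comment> \<open>Now \<open>b\<close> is regrouped as in the derivative formula with increments, and the two error sums are merged.\<close>
      have \<kappa>s: "0 \<le> \<kappa> s" using \<kappa> s by simp
      have p1: "0 \<le> primitive m1 s" by (rule primitive_nonneg[OF m1(3)])
      have 1: "\<kappa> s * (E s - E0 - C * s * (\<epsilon> * G s + (1 + \<bar>E0\<bar>) / \<epsilon>)) \<le> \<kappa> s * X s"
        by (rule mult_left_mono[OF Xs \<kappa>s])
      have q1: "\<kappa> s * s + primitive m1 s \<le> N" using q_eq[OF s0] q_le[OF s0] by simp
      have 2: "C * \<epsilon> * G s * (\<kappa> s * s + primitive m1 s) \<le> C * \<epsilon> * G s * N"
        using q1 C \<epsilon> G(3)[of s] by (intro mult_left_mono) auto
      have "(1 + \<bar>E0\<bar>) * (\<kappa> s * s) + primitive m1 s \<le> (1 + \<bar>E0\<bar>) * (\<kappa> s * s + primitive m1 s)"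
        using p1 by (simp add: distrib_left distrib_right)
      also have "\<dots> \<le> (1 + \<bar>E0\<bar>) * N" by (rule mult_left_mono[OF q1]) simp
      finally have 3: "C / \<epsilon> * ((1 + \<bar>E0\<bar>) * (\<kappa> s * s) + primitive m1 s) \<le> C / \<epsilon> * ((1 + \<bar>E0\<bar>) * N)"
        using C \<epsilon> by (intro mult_left_mono) auto
      have "?L s \<le> \<kappa> s * (E s - E0 - C * s * (\<epsilon> * G s + (1 + \<bar>E0\<bar>) / \<epsilon>))
          + (E s * primitive m s - line_conv m E s - C * \<epsilon> * G s * primitive m1 s
          - C / \<epsilon> * primitive m1 s - C / \<epsilon> * line_conv m1 (\<lambda>r. \<bar>E r\<bar>) s)"
      proof -
        have f1: "\<kappa> s * (E s - E0 - C * s * (\<epsilon> * G s + (1 + \<bar>E0\<bar>) / \<epsilon>))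
          + (E s * primitive m s - line_conv m E s - C * \<epsilon> * G s * primitive m1 s
          - C / \<epsilon> * primitive m1 s - C / \<epsilon> * line_conv m1 (\<lambda>r. \<bar>E r\<bar>) s)
          = (\<kappa> s + primitive m s) * E s - line_conv m E s - \<kappa> s * E0
            - C * \<epsilon> * G s * (\<kappa> s * s + primitive m1 s)
            - C / \<epsilon> * ((1 + \<bar>E0\<bar>) * (\<kappa> s * s) + primitive m1 s) - C / \<epsilon> * line_conv m1 (\<lambda>r. \<bar>E r\<bar>) s"
          by (simp add: algebra_simps add_divide_distrib)
        have f2: "\<kappa> s + primitive m s = a0" by (simp add: \<kappa>_def)
        have f3: "?L s = a0 * E s - line_conv m E s - \<kappa> s * E0 - C * \<epsilon> * G s * N
            - C / \<epsilon> * ((1 + \<bar>E0\<bar>) * N) - C / \<epsilon> * line_conv m1 (\<lambda>r. \<bar>E r\<bar>) s"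
          by (simp add: algebra_simps add_divide_distrib)
        have f4: "\<dots> \<le> a0 * E s - line_conv m E s - \<kappa> s * E0
            - C * \<epsilon> * G s * (\<kappa> s * s + primitive m1 s)
            - C / \<epsilon> * ((1 + \<bar>E0\<bar>) * (\<kappa> s * s) + primitive m1 s) - C / \<epsilon> * line_conv m1 (\<lambda>r. \<bar>E r\<bar>) s"
          by (intro diff_mono order_refl 2 3)
        show ?thesis unfolding f1 f2 by (rule order_trans[OF eq_refl[OF f3] f4])
      qed
      also have "\<dots> \<le> b s" unfolding bs' using 1 int by linarith
      finally show "?L s \<le> b s" .
    qed
  qed
  let ?I = "\<lambda>s. indicat_real {0<..<t} s"
  note lc = line_conv_integrable(1)[OF m(1) E(1)] line_conv_integrable(1)[OF m1(1) Ei]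
  note J = integrable_indicator_mult[OF E(1), of "{0<..<t}", simplified] integrable_indicator_mult[OF lc(1), of "{0<..<t}", simplified] \<kappa>i
    integrable_indicator_mult[OF G(1), of "{0<..<t}", simplified] integrable_indicator_mult[OF lc(2), of "{0<..<t}", simplified]
  have Leq: "?I s * ?L s = a0 * (?I s * E s) - ?I s * line_conv m E s - E0 * (?I s * \<kappa> s)
     - C * \<epsilon> * N * (?I s * G s) - C / \<epsilon> * ((1 + \<bar>E0\<bar>) * N) * ?I s - C / \<epsilon> * (?I s * line_conv m1 (\<lambda>r. \<bar>E r\<bar>) s)" for s
    by (simp add: algebra_simps)
  have iL: "integrable lborel (\<lambda>s. ?I s * ?L s)" unfolding Leq using J by simp
  have EG: "(LBINT s. ?I s * E s) = (LBINT s. E s)" "(LBINT s. ?I s * G s) = (LBINT s. G s)"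
    by (rule Bochner_Integration.integral_cong[OF refl], use E(2) G(2) in \<open>auto simp: indicator_def\<close>)+
  have supp: "r \<le> 0 \<Longrightarrow> m r = 0" "r \<le> 0 \<Longrightarrow> m1 r = 0" "r \<le> 0 \<Longrightarrow> E r = 0" "r \<le> 0 \<Longrightarrow> \<bar>E r\<bar> = 0" for r
    using m(2) m1(2) E(2) by auto
  have "(LBINT s. ?I s * b s) \<ge> (LBINT s. ?I s * ?L s)"
    by (rule integral_mono_AE[OF iL b]) (use lower in \<open>eventually_elim, auto simp: indicator_def\<close>)
  moreover have "(LBINT s. ?I s * ?L s) = a0 * (LBINT s. E s) - (LBINT s. ?I s * line_conv m E s)
     - E0 * (LBINT s. ?I s * \<kappa> s) - C * \<epsilon> * N * (LBINT s. G s)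
     - C / \<epsilon> * ((1 + \<bar>E0\<bar>) * N) * t - C / \<epsilon> * (LBINT s. ?I s * line_conv m1 (\<lambda>r. \<bar>E r\<bar>) s)"
    unfolding Leq EG[symmetric] using J t by simp
  moreover have "a0 * (LBINT s. E s) - (LBINT s. ?I s * line_conv m E s) = (LBINT r. \<kappa> (t - r) * E r)"
  proof -
    have "integrable lborel (\<lambda>r. primitive m (t - r) * E r)"
      by (rule Bochner_Integration.integrable_bound[OF integrable_mult_right[OF E(1), of "LBINT r. \<bar>m r\<bar>"]])
        (use primitive_bound[OF m(1)] in \<open>auto simp: abs_mult intro!: AE_I2 mult_right_mono\<close>)
    then show ?thesis
      using indicator_line_conv[OF m(1) supp(1) E(1) supp(3)] E(1) unfolding \<kappa>_def by (simp add: left_diff_distrib)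
  qed
  moreover have "(LBINT s. ?I s * line_conv m1 (\<lambda>r. \<bar>E r\<bar>) s) \<le> N * (LBINT s. \<bar>E s\<bar>)"
  proof -
    have "(LBINT s. ?I s * line_conv m1 (\<lambda>r. \<bar>E r\<bar>) s) = (LBINT r. primitive m1 (t - r) * \<bar>E r\<bar>)"
      by (rule indicator_line_conv[OF m1(1) supp(2) Ei supp(4)])
    also have "\<dots> \<le> (LBINT r. N * \<bar>E r\<bar>)"
    proof (rule Bochner_Integration.integral_mono')
      show "integrable lborel (\<lambda>r. N * \<bar>E r\<bar>)" using Ei by simp
      fix r
      show "primitive m1 (t - r) * \<bar>E r\<bar> \<le> N * \<bar>E r\<bar>"
        using p1_le[of "t - r"] E(2)[of r] by (cases "r \<in> {0<..<t}") (auto intro: mult_right_mono)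
      show "0 \<le> N * \<bar>E r\<bar>" using N0 by simp
    qed
    finally show ?thesis by simp
  qed
  then have "C / \<epsilon> * (LBINT s. ?I s * line_conv m1 (\<lambda>r. \<bar>E r\<bar>) s) \<le> C / \<epsilon> * (N * (LBINT s. \<bar>E s\<bar>))"
    using C \<epsilon> by (intro mult_left_mono) auto
  moreover have "C * \<epsilon> * N * (LBINT s. G s) = \<epsilon> * C * N * (LBINT s. G s)"
    "C / \<epsilon> * ((1 + \<bar>E0\<bar>) * N) * t = C / \<epsilon> * t * N * (1 + \<bar>E0\<bar>)"
    "C / \<epsilon> * (N * (LBINT s. \<bar>E s\<bar>)) = C / \<epsilon> * N * (LBINT s. \<bar>E s\<bar>)"
    by (simp_all add: mult_ac)
  ultimately show ?thesis by linarith
qed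

section \<open>Convex functionals that vary in time\<close>

text \<open>
  Near a point \<open>z0\<close> of the domain, \<open>\<phi>\<close> exceeds \<open>\<phi> z0 - 1\<close> by lower semicontinuity. If \<open>z\<close> is far away, the segment from
  \<open>z0\<close> to \<open>z\<close> meets the sphere of radius \<open>r\<close> around \<open>z0\<close>, and convexity transports the bound at that point to \<open>z\<close> with a loss
  proportional to \<open>norm (z - z0)\<close>.
\<close>

lemma proper_lsc_convex_linear_lower_bound:
  fixes \<phi> :: "'a::real_normed_vector \<Rightarrow> ereal"
  assumes \<phi>: "proper_lsc_convex \<phi>"
  shows "\<exists>C\<ge>0. \<forall>z. ereal (- C * (1 + norm z)) \<le> \<phi> z"
proof -
  have ninf: "\<phi> z \<noteq> -\<infinity>" for z using \<phi> by (simp add: proper_lsc_convex_def)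
  obtain z0 where z0: "\<phi> z0 \<noteq> \<infinity>" using \<phi> by (auto simp: proper_lsc_convex_def)
  then obtain a where a: "\<phi> z0 = ereal a" using ninf by (cases "\<phi> z0") auto
  have "ereal (a - 1) < Liminf (at z0) \<phi>"
    using \<phi> a unfolding proper_lsc_convex_def by (metis less_ereal.simps(1) diff_less_eq less_add_one less_le_trans)
  then have "\<forall>\<^sub>F x in at z0. ereal (a - 1) < \<phi> x" by (rule less_LiminfD)
  then obtain d where d: "d > 0" "\<And>x. x \<noteq> z0 \<Longrightarrow> dist x z0 < d \<Longrightarrow> ereal (a - 1) < \<phi> x"
    unfolding eventually_at by auto
  define r where "r = d / 2"
  have r: "r > 0" "r < d" using d by (auto simp: r_def)
  define C where "C = \<bar>a\<bar> + 1 + norm z0 / r + 1 / r"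
  have C: "C \<ge> 0" using r by (simp add: C_def)
  have "ereal (- C * (1 + norm z)) \<le> \<phi> z" for z
  proof -
    have base: "ereal (a - 1 - norm (z - z0) / r) \<le> \<phi> z"
    proof (cases "norm (z - z0) < d")
      case True
      then have "ereal (a - 1) \<le> \<phi> z"
        using d(2)[of z] a by (cases "z = z0") (auto simp: dist_norm intro: less_imp_le)
      moreover have "0 \<le> norm (z - z0) / r" using r by simp
      then have "ereal (a - 1 - norm (z - z0) / r) \<le> ereal (a - 1)" by simp
      ultimately show ?thesis by (rule order_trans[rotated])
    next
      case False
      then have n: "norm (z - z0) > r" using r by simp
      show ?thesis
      proof (cases "\<phi> z")
        case (real p)
        define \<alpha> where "\<alpha> = r / norm (z - z0)"
        have n0: "0 < norm (z - z0)" using r n by linarith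
        have \<alpha>: "0 < \<alpha>" "\<alpha> < 1" using r n n0 unfolding \<alpha>_def by (auto simp only: divide_pos_pos divide_less_eq_1_pos)
        let ?y = "(1 - \<alpha>) *\<^sub>R z0 + \<alpha> *\<^sub>R z"
        have yz: "?y - z0 = \<alpha> *\<^sub>R (z - z0)" by (simp add: algebra_simps)
        have ny: "norm (?y - z0) = r" unfolding yz using \<alpha> n0 r by (simp add: \<alpha>_def)
        have "ereal (a - 1) < \<phi> ?y"
          by (rule d(2)) (use ny r in \<open>auto simp: dist_norm\<close>)
        also have "\<dots> \<le> ereal (1 - \<alpha>) * \<phi> z0 + ereal \<alpha> * \<phi> z"
          using \<phi> \<alpha> by (simp add: proper_lsc_convex_def)
        finally have "a - 1 < (1 - \<alpha>) * a + \<alpha> * p" by (simp add: a real)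
        then have "\<alpha> * (a - p) < 1" by (simp add: algebra_simps)
        then have "a - p < 1 / \<alpha>" using \<alpha> by (simp add: field_simps)
        also have "1 / \<alpha> = norm (z - z0) / r" by (simp add: \<alpha>_def)
        finally show ?thesis using real by simp
      qed (use ninf in auto)
    qed
    define Q where "Q = (\<bar>a\<bar> + 1 + norm z0 / r) * (1 + norm z)"
    have "norm (z - z0) / r \<le> (norm z + norm z0) / r"
      using r norm_triangle_ineq4[of z z0] by (intro divide_right_mono) auto
    then have "norm (z - z0) / r \<le> norm z / r + norm z0 / r" by (simp add: add_divide_distrib)
    moreover have "\<bar>a\<bar> + 1 + norm z0 / r \<le> Q"
      unfolding Q_def using r mult_left_mono[of 1 "1 + norm z" "\<bar>a\<bar> + 1 + norm z0 / r"] by simp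
    moreover have CQ: "C * (1 + norm z) = Q + 1 / r + norm z / r"
      by (simp add: C_def Q_def algebra_simps)
    moreover have "1 / r > 0" using r by simp
    ultimately have "- C * (1 + norm z) \<le> a - 1 - norm (z - z0) / r"
      unfolding mult_minus_left CQ by linarith
    then have "ereal (- C * (1 + norm z)) \<le> ereal (a - 1 - norm (z - z0) / r)" by (simp only: ereal_less_eq)
    then show ?thesis using base by (rule order_trans)
  qed
  then show ?thesis using C by blast
qed

text \<open>
  On a finite grid of times the bounds are uniform. By (A1), a point \<open>z\<close> with \<open>\<phi>\<^sup>s(z) = -P\<close> moves forward to a grid time while
  its energy becomes at most \<open>-P + (1 + P)/2\<close> and its norm grows by at most \<open>sqrt (1 + P) / 2\<close>, if the mesh is so fine that the
  constant of (A1) times the mesh is at most \<open>1/2\<close>. The square root is absorbed by \<open>P\<close>.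
\<close>

lemma uniform_linear_lower_bound:
  fixes \<phi> :: "real \<Rightarrow> 'a::real_normed_vector \<Rightarrow> ereal"
  assumes T: "0 < T" and \<phi>: "\<And>t. t \<in> {0..T} \<Longrightarrow> proper_lsc_convex (\<phi> t)" and A1: "cond_A1 T \<phi>"
  shows "\<exists>C\<ge>0. \<forall>s\<in>{0..T}. \<forall>z\<in>eff_dom (\<phi> s). - C * (1 + norm z) \<le> real_of_ereal (\<phi> s z)"
proof -
  obtain c where c: "c \<ge> 0" and A: "\<And>s t z. s \<in> {0..T} \<Longrightarrow> t \<in> {0..T} \<Longrightarrow> s \<le> t \<Longrightarrow> z \<in> eff_dom (\<phi> s) \<Longrightarrow>
     \<exists>z'\<in>eff_dom (\<phi> t).
        norm (z' - z) \<le> c * \<bar>t - s\<bar> * sqrt (1 + \<bar>real_of_ereal (\<phi> s z)\<bar>) \<and>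
        \<phi> t z' \<le> \<phi> s z + ereal (c * \<bar>t - s\<bar> * (1 + \<bar>real_of_ereal (\<phi> s z)\<bar>))"
    using A1 unfolding cond_A1_def by blast
  \<comment> \<open>Mesh size, chosen so that \<open>c * \<delta> \<le> 1/2\<close>.\<close>
  define \<delta> where "\<delta> = 1 / (2 * c + 1)"
  have \<delta>: "\<delta> > 0" "c * \<delta> \<le> 1/2" using c by (auto simp: \<delta>_def field_simps)
  define N where "N = nat \<lceil>T / \<delta>\<rceil>"
  define \<tau> where "\<tau> i = min T (real i * \<delta>)" for i :: nat
  have \<tau>: "\<tau> i \<in> {0..T}" for i using T \<delta> by (auto simp: \<tau>_def)
  have "\<forall>i. \<exists>C\<ge>0. \<forall>z. ereal (- C * (1 + norm z)) \<le> \<phi> (\<tau> i) z"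
    using proper_lsc_convex_linear_lower_bound[OF \<phi>[OF \<tau>]] by blast
  from choice[OF this] obtain K where K: "\<And>i. K i \<ge> 0" "\<And>i z. ereal (- K i * (1 + norm z)) \<le> \<phi> (\<tau> i) z"
    by blast
  define L where "L = (\<Sum>i\<le>N. K i)"
  have L: "L \<ge> 0" unfolding L_def by (intro sum_nonneg K(1))
  have KL: "K i \<le> L" if "i \<le> N" for i unfolding L_def using that K(1) by (intro member_le_sum) auto
  show ?thesis
  proof (intro exI[of _ "3 + L\<^sup>2 + 4 * L"] conjI ballI)
    show "0 \<le> 3 + L\<^sup>2 + 4 * L" using L by simp
    fix s z assume s: "s \<in> {0..T}" and z: "z \<in> eff_dom (\<phi> s)"
    define i where "i = nat \<lceil>s / \<delta>\<rceil>"
    have iN: "i \<le> N" unfolding i_def N_def using s \<delta> by (intro nat_mono ceiling_mono divide_right_mono) auto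
    have sd0: "0 \<le> s / \<delta>" using s \<delta> by simp
    have ri: "real i = of_int \<lceil>s / \<delta>\<rceil>" unfolding i_def using sd0 by (simp add: order_trans[OF _ le_of_int_ceiling])
    have "s / \<delta> \<le> real i" "real i \<le> s / \<delta> + 1" unfolding ri by linarith+
    then have "s \<le> real i * \<delta>" "real i * \<delta> \<le> s + \<delta>" using \<delta> by (auto simp: field_simps)
    then have t: "s \<le> \<tau> i" "\<tau> i - s \<le> \<delta>" using s \<delta> by (auto simp: \<tau>_def)
    define h where "h = c * \<bar>\<tau> i - s\<bar>"
    have h: "0 \<le> h" "h \<le> 1/2"
    proof -
      show "0 \<le> h" using c by (simp add: h_def)
      have "h \<le> c * \<delta>" unfolding h_def using c t by (intro mult_left_mono) auto
      then show "h \<le> 1/2" using \<delta> by simp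
    qed
    have "\<phi> s z \<noteq> \<infinity>" "\<phi> s z \<noteq> -\<infinity>" using z \<phi>[OF s] by (auto simp: eff_dom_def proper_lsc_convex_def)
    then obtain p where p: "\<phi> s z = ereal p" by (cases "\<phi> s z") auto
    obtain z' where z': "norm (z' - z) \<le> h * sqrt (1 + \<bar>p\<bar>)" "\<phi> (\<tau> i) z' \<le> ereal (p + h * (1 + \<bar>p\<bar>))"
      using A[OF s \<tau> t(1) z] unfolding p h_def by auto
    have "ereal (- K i * (1 + norm z')) \<le> ereal (p + h * (1 + \<bar>p\<bar>))"
      by (rule order_trans[OF K(2) z'(2)])
    then have 1: "- K i * (1 + norm z') \<le> p + h * (1 + \<bar>p\<bar>)" by (simp only: ereal_less_eq)
    have 2: "norm z' \<le> norm z + 1/2 * sqrt (1 + \<bar>p\<bar>)"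
    proof -
      have "norm z' \<le> norm z + norm (z' - z)" using norm_triangle_ineq[of z "z' - z"] by simp
      moreover have "h * sqrt (1 + \<bar>p\<bar>) \<le> 1/2 * sqrt (1 + \<bar>p\<bar>)" using h by (intro mult_right_mono) auto
      ultimately show ?thesis using z'(1) by linarith
    qed
    show "- (3 + L\<^sup>2 + 4 * L) * (1 + norm z) \<le> real_of_ereal (\<phi> s z)"
    proof (cases "p \<ge> 0")
      case True
      have "0 \<le> (3 + L\<^sup>2 + 4 * L) * (1 + norm z)" using L by (intro mult_nonneg_nonneg) auto
      then have "- (3 + L\<^sup>2 + 4 * L) * (1 + norm z) \<le> 0" by (simp only: mult_minus_left neg_le_0_iff_le)
      then show ?thesis using True p by simp
    next
      case False
      define P where "P = - p"
      define S where "S = sqrt (1 + P)"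
      have P: "P > 0" "\<bar>p\<bar> = P" using False by (auto simp: P_def)
      have S2: "S\<^sup>2 = 1 + P" using P by (simp add: S_def)
      have "h * (1 + \<bar>p\<bar>) \<le> 1/2 * (1 + P)" using h P by (intro mult_mono) auto
      moreover have "K i * (1 + norm z') \<le> L * (1 + (norm z + 1/2 * S))"
        using KL[OF iN] K(1)[of i] 2 L unfolding S_def P(2) by (intro mult_mono add_left_mono) auto
      ultimately have "- (L * (1 + (norm z + 1/2 * S))) \<le> p + 1/2 * (1 + P)" using 1 by linarith
      then have "P / 2 \<le> 1/2 + L * (1 + norm z) + L * S / 2" by (simp add: P_def field_simps)
      moreover have "L * S / 2 \<le> S\<^sup>2 / 4 + L\<^sup>2 / 4"
        using zero_le_power2[of "S - L"] by (simp add: power2_diff algebra_simps)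
      ultimately have 3: "P \<le> 3 + L\<^sup>2 + 4 * (L * (1 + norm z))" unfolding S2 by (simp add: field_simps)
      have "(3 + L\<^sup>2) * 1 \<le> (3 + L\<^sup>2) * (1 + norm z)" by (intro mult_left_mono) auto
      then have "P \<le> (3 + L\<^sup>2) * (1 + norm z) + 4 * (L * (1 + norm z))"
        by (intro order_trans[OF 3] add_right_mono) simp
      also have "\<dots> = (3 + L\<^sup>2 + 4 * L) * (1 + norm z)" by (simp add: algebra_simps)
      finally have "P \<le> (3 + L\<^sup>2 + 4 * L) * (1 + norm z)" .
      then have "- (3 + L\<^sup>2 + 4 * L) * (1 + norm z) \<le> p" unfolding P_def mult_minus_left by linarith
      then show ?thesis using p by simp
    qed
  qed
qed

text \<open>
  The point \<open>z\<close> of the domain at the earlier time \<open>r\<close> is replaced by the neighbour \<open>z'\<close> in the domain at time \<open>s\<close>, which is a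
  competitor in the subgradient inequality. The cost is \<open>h (1 + \<bar>p\<bar>)\<close> in energy and \<open>norm \<xi> * h * sqrt (1 + \<bar>p\<bar>)\<close> in the inner product,
  where \<open>h = c (s - r)\<close> and \<open>p\<close> is the energy of \<open>z\<close>. Each is at most \<open>h (\<epsilon> \<parallel>\<xi>\<parallel>\<^sup>2 + (1 + \<bar>p\<bar>)/\<epsilon>)\<close>, hence the factor \<open>2\<close>.
\<close>

lemma subgradient_inequality_moving_time:
  fixes \<phi> :: "real \<Rightarrow> 'a::real_inner \<Rightarrow> ereal"
  assumes c: "0 \<le> c"
    and A: "\<exists>z'\<in>eff_dom (\<phi> s).
        norm (z' - z) \<le> c * \<bar>s - r\<bar> * sqrt (1 + \<bar>real_of_ereal (\<phi> r z)\<bar>) \<and>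
        \<phi> s z' \<le> \<phi> r z + ereal (c * \<bar>s - r\<bar> * (1 + \<bar>real_of_ereal (\<phi> r z)\<bar>))"
    and rs: "r \<le> s" and z: "\<bar>\<phi> r z\<bar> \<noteq> \<infinity>" and v: "\<bar>\<phi> s v\<bar> \<noteq> \<infinity>" and \<xi>: "\<xi> \<in> subdiff (\<phi> s) v"
    and \<epsilon>: "0 < \<epsilon>" "\<epsilon> < 1"
  shows "(v - z) \<bullet> \<xi> \<ge> real_of_ereal (\<phi> s v) - real_of_ereal (\<phi> r z)
    - 2 * c * (s - r) * (\<epsilon> * (norm \<xi>)\<^sup>2 + (1 + \<bar>real_of_ereal (\<phi> r z)\<bar>) / \<epsilon>)"
proof -
  obtain p where p: "\<phi> r z = ereal p" using z by auto
  obtain e where e: "\<phi> s v = ereal e" using v by auto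
  define h where "h = c * (s - r)"
  have h: "0 \<le> h" using c rs by (simp add: h_def)
  define S where "S = sqrt (1 + \<bar>p\<bar>)"
  have S: "S\<^sup>2 = 1 + \<bar>p\<bar>" "S \<ge> 0" by (auto simp: S_def)
  obtain z' where z': "z' \<in> eff_dom (\<phi> s)" "norm (z' - z) \<le> h * S" "\<phi> s z' \<le> ereal (p + h * (1 + \<bar>p\<bar>))"
    using A rs unfolding p h_def S_def by auto
  have 1: "\<phi> s z' - ereal e \<ge> ereal (\<xi> \<bullet> (z' - v))"
    using \<xi> z'(1) e by (auto simp: subdiff_def)
  have "\<xi> \<bullet> (z' - v) \<le> p + h * (1 + \<bar>p\<bar>) - e"
    using 1 z'(3) by (cases "\<phi> s z'") auto
  moreover have "(v - z) \<bullet> \<xi> = \<xi> \<bullet> (z' - z) - \<xi> \<bullet> (z' - v)"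
    by (simp add: inner_diff_right inner_commute)
  moreover have "- (norm \<xi> * (h * S)) \<le> \<xi> \<bullet> (z' - z)"
  proof -
    have "\<bar>\<xi> \<bullet> (z' - z)\<bar> \<le> norm \<xi> * norm (z' - z)" by (rule Cauchy_Schwarz_ineq2)
    also have "\<dots> \<le> norm \<xi> * (h * S)" by (intro mult_left_mono z') auto
    finally show ?thesis by linarith
  qed
  moreover have "norm \<xi> * (h * S) \<le> h * (\<epsilon> * (norm \<xi>)\<^sup>2 + S\<^sup>2 / \<epsilon>)"
  proof -
    have "0 \<le> (\<epsilon> * norm \<xi> - S)\<^sup>2" by simp
    then have "2 * (\<epsilon> * norm \<xi> * S) \<le> \<epsilon>\<^sup>2 * (norm \<xi>)\<^sup>2 + S\<^sup>2" by (simp add: power2_diff power_mult_distrib)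
    moreover have "0 \<le> \<epsilon> * norm \<xi> * S" using \<epsilon> S by simp
    ultimately have "\<epsilon> * (norm \<xi> * S) \<le> \<epsilon> * (\<epsilon> * (norm \<xi>)\<^sup>2 + S\<^sup>2 / \<epsilon>)"
      using \<epsilon> by (simp add: algebra_simps power2_eq_square)
    then have "norm \<xi> * S \<le> \<epsilon> * (norm \<xi>)\<^sup>2 + S\<^sup>2 / \<epsilon>" using \<epsilon> by simp
    then have "h * (norm \<xi> * S) \<le> h * (\<epsilon> * (norm \<xi>)\<^sup>2 + S\<^sup>2 / \<epsilon>)" using h by (rule mult_left_mono)
    then show ?thesis by (simp add: mult_ac)
  qed
  moreover have "h * (1 + \<bar>p\<bar>) \<le> h * (\<epsilon> * (norm \<xi>)\<^sup>2 + S\<^sup>2 / \<epsilon>)"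
  proof (rule mult_left_mono[OF _ h])
    have "S\<^sup>2 * 1 \<le> S\<^sup>2 * (1 / \<epsilon>)" using \<epsilon> by (intro mult_left_mono) auto
    moreover have "0 \<le> \<epsilon> * (norm \<xi>)\<^sup>2" using \<epsilon> by simp
    ultimately show "1 + \<bar>p\<bar> \<le> \<epsilon> * (norm \<xi>)\<^sup>2 + S\<^sup>2 / \<epsilon>" using S(1) by simp
  qed
  ultimately have "(v - z) \<bullet> \<xi> \<ge> e - p - 2 * (h * (\<epsilon> * (norm \<xi>)\<^sup>2 + S\<^sup>2 / \<epsilon>))" by linarith
  moreover have "2 * (h * (\<epsilon> * (norm \<xi>)\<^sup>2 + S\<^sup>2 / \<epsilon>)) = 2 * c * (s - r) * (\<epsilon> * (norm \<xi>)\<^sup>2 + (1 + \<bar>p\<bar>) / \<epsilon>)"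
    unfolding S(1) h_def by simp
  ultimately show ?thesis unfolding p e by simp
qed

section \<open>Lebesgue and Sobolev classes in terms of Borel representatives\<close>

text \<open>
  Extension by \<open>0\<close> makes convolutions, translations and primitives of functions on \<open>(0,T)\<close> operations on the whole line.
\<close>

definition interval_function :: "real \<Rightarrow> (real \<Rightarrow> 'b::real_normed_vector) \<Rightarrow> bool" where
  "interval_function T f \<longleftrightarrow> simple_limit lborel f \<and> (\<forall>x. x \<notin> {0<..<T} \<longrightarrow> f x = 0)"

lemma interval_functionD:
  assumes "interval_function T f"
  shows "simple_limit lborel f" "\<And>x. x \<notin> {0<..<T} \<Longrightarrow> f x = 0"
    "f \<in> borel_measurable borel" "(\<lambda>x. norm (f x)) \<in> borel_measurable borel"
  using assms simple_limit_borel_measurable[of lborel f] borel_measurable_norm_simple_limit[of lborel f]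
  unfolding interval_function_def by auto

lemma Lp_representative:
  fixes f :: "real \<Rightarrow> 'b::{real_normed_vector,complete_space}"
  assumes f: "f \<in> Lp p {0<..<T}" and p: "p \<noteq> 0"
  obtains f' where "interval_function T f'" "AE x\<in>{0<..<T} in lborel. f x = f' x"
    "integrable lborel (\<lambda>x. norm (f' x) ^ p)"
proof -
  have sm: "strongly_measurable (lebesgue_on {0<..<T}) f" using f by (simp add: Lp_def)
  obtain f' where f': "simple_limit lborel f'" "\<And>x. x \<notin> {0<..<T} \<Longrightarrow> f' x = 0"
    "AE x\<in>{0<..<T} in lborel. f x = f' x"
    by (rule strongly_measurable_representative[OF _ sm]) auto
  have ae: "AE x\<in>{0<..<T} in lborel. norm (f x) ^ p = norm (f' x) ^ p"
    using f'(3) by eventually_elim auto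
  have "(\<lambda>x. norm (f' x) ^ p) \<in> borel_measurable lborel"
    using borel_measurable_norm_simple_limit[OF f'(1)] by measurable
  from integral_lebesgue_on_borel(1)[OF _ this ae]
  have "integrable lborel (\<lambda>x. indicator {0<..<T} x * norm (f' x) ^ p)"
    using f by (simp add: Lp_def)
  moreover have "indicator {0<..<T} x * norm (f' x) ^ p = norm (f' x) ^ p" for x
    using f'(2)[of x] p by (cases "x \<in> {0<..<T}") (auto simp: power_0_left)
  ultimately have "integrable lborel (\<lambda>x. norm (f' x) ^ p)" by simp
  then show thesis using that f' unfolding interval_function_def by blast
qed

lemma Lp_if_representative:
  fixes f :: "real \<Rightarrow> 'b::{real_normed_vector,complete_space}"
  assumes f': "interval_function T f'" and ae: "AE x\<in>{0<..<T} in lborel. f x = f' x"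
    and int: "integrable lborel (\<lambda>x. norm (f' x) ^ p)"
  shows "f \<in> Lp p {0<..<T}"
proof -
  note D = interval_functionD[OF f']
  have ae': "AE x\<in>{0<..<T} in lborel. norm (f x) ^ p = norm (f' x) ^ p"
    using ae by eventually_elim auto
  have "(\<lambda>x. norm (f' x) ^ p) \<in> borel_measurable lborel" using D(4) by measurable
  from integral_lebesgue_on_borel(1)[OF _ this ae'] integrable_indicator_mult[OF int, of "{0<..<T}"]
  have "integrable (lebesgue_on {0<..<T}) (\<lambda>x. norm (f x) ^ p)" by simp
  moreover have "strongly_measurable (lebesgue_on {0<..<T}) f"
    by (rule strongly_measurable_if_representative[OF _ D(1) ae]) simp
  ultimately show ?thesis by (simp add: Lp_def)
qed

lemma interval_function_L1_if_L2:
  assumes f: "interval_function T f" and int: "integrable lborel (\<lambda>x. (norm (f x))\<^sup>2)"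
  shows "integrable lborel (\<lambda>x. norm (f x))"
proof (rule Bochner_Integration.integrable_bound)
  show "integrable lborel (\<lambda>x. indicator {0<..<T} x + (norm (f x))\<^sup>2)" using int by simp
  have "norm (f x) \<le> indicator {0<..<T} x + (norm (f x))\<^sup>2" for x
  proof (cases "x \<in> {0<..<T}")
    case True
    have "0 \<le> (norm (f x) - 1/2)\<^sup>2" by simp
    then show ?thesis using True by (simp add: power2_diff power_divide)
  qed (use interval_functionD(2)[OF f] in auto)
  then show "AE x in lborel. norm (norm (f x)) \<le> norm (indicator {0<..<T} x + (norm (f x))\<^sup>2)"
    by (auto intro!: AE_I2 order_trans[OF _ abs_ge_self])
qed (use interval_functionD(4)[OF f] in simp)

lemma inner_interval_function:
  fixes f :: "real \<Rightarrow> 'b::real_inner"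
  assumes f: "interval_function T f" and int: "integrable lborel (\<lambda>x. norm (f x))"
  shows "integrable lborel (\<lambda>x. f x \<bullet> c)" "\<And>x. x \<notin> {0<..<T} \<Longrightarrow> f x \<bullet> c = 0"
  using integrable_inner_simple_limit[OF interval_functionD(1)[OF f] int] interval_functionD(2)[OF f] by auto

text \<open>
  Weak differentiability is a scalar property, checked against each fixed vector.
\<close>

lemma has_weak_derivative_iff_inner:
  fixes f v :: "real \<Rightarrow> 'b::{real_inner,complete_space}"
  assumes f': "interval_function T f'" "AE x\<in>{0<..<T} in lborel. f x = f' x" "integrable lborel (\<lambda>x. norm (f' x))"
    and v': "interval_function T v'" "AE x\<in>{0<..<T} in lborel. v x = v' x" "integrable lborel (\<lambda>x. norm (v' x))"
  shows "has_weak_derivative T f v \<longleftrightarrow> (\<forall>\<eta>. test_function T \<eta> \<longrightarrow> (\<forall>c.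
     (LBINT s. deriv \<eta> s * (f' s \<bullet> c)) = - (LBINT s. \<eta> s * (v' s \<bullet> c))))"
proof -
  have eq: "vec_integral (lebesgue_on {0<..<T}) (\<lambda>s. h s *\<^sub>R F s) \<bullet> c = (LBINT s. h s * (F' s \<bullet> c))"
    if F': "interval_function T F'" "AE x\<in>{0<..<T} in lborel. F x = F' x" "integrable lborel (\<lambda>x. norm (F' x))"
      and h: "h \<in> borel_measurable borel" "\<And>x. \<bar>h x\<bar> \<le> K" for F F' :: "real \<Rightarrow> 'b" and h :: "real \<Rightarrow> real" and K c
  proof -
    note D = interval_functionD[OF F'(1)]
    have sl: "simple_limit lborel (\<lambda>s. h s *\<^sub>R F' s)" by (rule simple_limit_scaleR[OF _ D(1)]) (use h in simp)
    have ae: "AE x\<in>{0<..<T} in lborel. h x *\<^sub>R F x = h x *\<^sub>R F' x"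
      using F'(2) by eventually_elim auto
    have i: "integrable lborel (\<lambda>x. norm (h x *\<^sub>R F' x))"
    proof (rule Bochner_Integration.integrable_bound[OF integrable_mult_right[OF F'(3), of K]])
      have "\<bar>h x\<bar> * norm (F' x) \<le> \<bar>K\<bar> * norm (F' x)" for x
        using h(2)[of x] by (intro mult_right_mono) auto
      then show "AE x in lborel. norm (norm (h x *\<^sub>R F' x)) \<le> norm (K * norm (F' x))"
        by (simp add: abs_mult)
    qed (use borel_measurable_norm_simple_limit[OF sl] in simp)
    have "vec_integral (lebesgue_on {0<..<T}) (\<lambda>s. h s *\<^sub>R F s) \<bullet> c
        = (LBINT s. indicator {0<..<T} s * (h s *\<^sub>R F' s \<bullet> c))"
      by (rule vec_integral_inner[OF _ sl ae integrable_indicator_mult[OF i]]) auto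
    also have "\<dots> = (LBINT s. h s * (F' s \<bullet> c))"
    proof (rule Bochner_Integration.integral_cong[OF refl])
      fix x
      show "indicator {0<..<T} x * (h x *\<^sub>R F' x \<bullet> c) = h x * (F' x \<bullet> c)"
        using D(2)[of x] by (cases "x \<in> {0<..<T}") auto
    qed
    finally show ?thesis .
  qed
  have "(vec_integral (lebesgue_on {0<..<T}) (\<lambda>s. deriv \<eta> s *\<^sub>R f s) =
        - vec_integral (lebesgue_on {0<..<T}) (\<lambda>s. \<eta> s *\<^sub>R v s)) \<longleftrightarrow>
      (\<forall>c. (LBINT s. deriv \<eta> s * (f' s \<bullet> c)) = - (LBINT s. \<eta> s * (v' s \<bullet> c)))"
    (is "?a = - ?b \<longleftrightarrow> ?R") if \<eta>: "test_function T \<eta>" for \<eta>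
  proof -
    obtain K where K: "\<And>x. \<bar>\<eta> x\<bar> \<le> K" "\<And>x. \<bar>deriv \<eta> x\<bar> \<le> K" using test_functionD(5)[OF \<eta>] by blast
    have "?R \<longleftrightarrow> (\<forall>c. ?a \<bullet> c = (- ?b) \<bullet> c)"
      unfolding inner_minus_left eq[OF f' test_function_borel(2)[OF \<eta>] K(2)] eq[OF v' test_function_borel(1)[OF \<eta>] K(1)] ..
    also have "\<dots> \<longleftrightarrow> ?a = - ?b"
      by (rule vector_eq_rdot)
    finally show ?thesis ..
  qed
  then show ?thesis unfolding has_weak_derivative_def by simp
qed

lemma AE_interval_witness:
  fixes l r T :: real
  assumes ae: "AE s\<in>{0<..<T} in lborel. P s" and lr: "0 \<le> l" "l < r" "r \<le> T"
  obtains y where "l < y" "y < r" "P y"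
proof -
  have "\<exists>y. y \<in> {l<..<r} \<and> P y"
  proof (rule ccontr)
    assume n: "\<not> ?thesis"
    have "AE y in lborel. y \<notin> {l<..<r}" using ae by eventually_elim (use n lr in auto)
    then have "{l<..<r} \<in> null_sets lborel" by (subst AE_iff_null_sets) auto
    then have "emeasure lborel {l<..<r} = 0" by (rule null_setsD1)
    then show False using lr by simp
  qed
  then show thesis using that by auto
qed

lemma continuous_AE_const:
  fixes d :: "real \<Rightarrow> real"
  assumes d: "continuous_on {0..T} d" and ae: "AE s\<in>{0<..<T} in lborel. d s = C"
    and T: "0 < T" and s: "s \<in> {0..T}"
  shows "d s = C"
proof (rule ccontr)
  assume "d s \<noteq> C"
  then have "0 < \<bar>d s - C\<bar>" by simp
  then obtain \<delta> where \<delta>: "\<delta> > 0" "\<And>x. x \<in> {0..T} \<Longrightarrow> dist x s < \<delta> \<Longrightarrow> dist (d x) (d s) < \<bar>d s - C\<bar>"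
    using d s unfolding continuous_on_iff by blast
  obtain y where y: "max 0 (s - \<delta>) < y" "y < min T (s + \<delta>)" "d y = C"
    by (rule AE_interval_witness[OF ae, of "max 0 (s - \<delta>)" "min T (s + \<delta>)"]) (use s T \<delta>(1) in auto)
  have "dist (d y) (d s) < \<bar>d s - C\<bar>" by (rule \<delta>(2)) (use y in \<open>auto simp: dist_real_def\<close>)
  then show False using y(3) by (simp add: dist_real_def abs_minus_commute)
qed

lemma interval_integral_eq_primitive_diff:
  fixes v :: "real \<Rightarrow> real"
  assumes T: "0 < T" and v: "integrable lborel v" "\<And>x. x \<notin> {0<..<T} \<Longrightarrow> v x = 0" and ab: "a < b"
  shows "(LBINT x. indicator {a<..<b} x * v x) = primitive v (min T (max 0 b)) - primitive v (min T (max 0 a))"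
proof -
  define a' b' where "a' = min T (max 0 a)" and "b' = min T (max 0 b)"
  have "AE x in lborel. indicator {a<..<b} x * v x = indicator {0<..<b'} x * v x - indicator {0<..<a'} x * v x"
    using AE_lborel_singleton[of a']
  proof eventually_elim
    case (elim x)
    show ?case
    proof (cases "x \<in> {0<..<T}")
      case True
      then have "x < b' \<longleftrightarrow> x < b" "x < a' \<longleftrightarrow> x < a" "x \<noteq> a" using elim by (auto simp: a'_def b'_def)
      then show ?thesis using True ab by (auto simp: indicator_def)
    qed (use v(2) in auto)
  qed
  then have "(LBINT x. indicator {a<..<b} x * v x)
      = (LBINT x. indicator {0<..<b'} x * v x - indicator {0<..<a'} x * v x)"
    using v(1) by (intro integral_cong_AE) auto
  then show ?thesis
    unfolding primitive_def a'_def[symmetric] b'_def[symmetric] using integrable_indicator_mult[OF v(1)] by simp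
qed

text \<open>
  Uniqueness in the fundamental theorem of calculus: a continuous function that is constant almost everywhere is constant, so
  all interval integrals of \<open>v\<close> vanish.
\<close>

lemma primitive_determined:
  fixes v :: "real \<Rightarrow> real"
  assumes T: "0 < T" and v: "integrable lborel v" "\<And>x. x \<notin> {0<..<T} \<Longrightarrow> v x = 0"
    and c: "AE s\<in>{0<..<T} in lborel. primitive v s = C"
  shows "AE s in lborel. v s = 0"
proof (rule AE_zero_if_interval_integrals_zero[OF v(1), of T])
  have const: "primitive v s = C" if "s \<in> {0..T}" for s
    by (rule continuous_AE_const[OF continuous_on_subset[OF primitive_continuous[OF v(1)]] c T that]) simp
  show "v x = 0" if "\<bar>x\<bar> > T" for x using that T by (intro v(2)) auto
  show "(LBINT x. indicator {a<..<b} x * v x) = 0" if "a < b" for a b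
    using interval_integral_eq_primitive_diff[OF T v that] const[of "min T (max 0 a)"] const[of "min T (max 0 b)"] T by simp
qed

lemma weak_derivative_unique:
  fixes f :: "real \<Rightarrow> 'b::{real_inner,complete_space}"
  assumes T: "0 < T" and f: "f \<in> Lp 1 {0<..<T}"
    and v1: "interval_function T v1" "integrable lborel (\<lambda>x. norm (v1 x))" "has_weak_derivative T f v1"
    and v2: "interval_function T v2" "integrable lborel (\<lambda>x. norm (v2 x))" "has_weak_derivative T f v2"
  shows "AE x in lborel. v1 x = v2 x"
proof -
  obtain f' where f': "interval_function T f'" "AE x\<in>{0<..<T} in lborel. f x = f' x"
    "integrable lborel (\<lambda>x. norm (f' x))"
    by (rule Lp_representative[OF f]) auto
  have z: "simple_limit lborel (\<lambda>x. v1 x - v2 x)"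
    by (intro simple_limit_diff interval_functionD(1)[OF v1(1)] interval_functionD(1)[OF v2(1)])
  have "AE x in lborel. v1 x - v2 x = 0"
  proof (rule AE_vector_zero_if_inner_zero[OF z])
    fix c
    note i1 = inner_interval_function[OF v1(1,2), where c=c] and i2 = inner_interval_function[OF v2(1,2), where c=c]
      and i = inner_interval_function[OF f'(1,3), where c=c]
    have "\<exists>C. AE s\<in>{0<..<T} in lborel. f' s \<bullet> c = C + primitive (\<lambda>r. v1 r \<bullet> c) s"
      by (rule weak_derivative_primitive[OF T i i1])
        (use has_weak_derivative_iff_inner[OF f' v1(1) _ v1(2), of v1] v1(3) in auto)
    then obtain C1 where C1: "AE s\<in>{0<..<T} in lborel. f' s \<bullet> c = C1 + primitive (\<lambda>r. v1 r \<bullet> c) s" by blast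
    have "\<exists>C. AE s\<in>{0<..<T} in lborel. f' s \<bullet> c = C + primitive (\<lambda>r. v2 r \<bullet> c) s"
      by (rule weak_derivative_primitive[OF T i i2])
        (use has_weak_derivative_iff_inner[OF f' v2(1) _ v2(2), of v2] v2(3) in auto)
    then obtain C2 where C2: "AE s\<in>{0<..<T} in lborel. f' s \<bullet> c = C2 + primitive (\<lambda>r. v2 r \<bullet> c) s" by blast
    have pd: "primitive (\<lambda>r. (v1 r - v2 r) \<bullet> c) s = primitive (\<lambda>r. v1 r \<bullet> c) s - primitive (\<lambda>r. v2 r \<bullet> c) s" for s
      unfolding primitive_def inner_diff_left right_diff_distrib
      using integrable_indicator_mult[OF i1(1)] integrable_indicator_mult[OF i2(1)] by simp
    show "AE x in lborel. (v1 x - v2 x) \<bullet> c = 0"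
    proof (rule primitive_determined[OF T])
      show "integrable lborel (\<lambda>x. (v1 x - v2 x) \<bullet> c)" using i1(1) i2(1) by (simp add: inner_diff_left)
      show "(v1 x - v2 x) \<bullet> c = 0" if "x \<notin> {0<..<T}" for x
        using i1(2)[OF that] i2(2)[OF that] by (simp add: inner_diff_left)
      show "AE s\<in>{0<..<T} in lborel. primitive (\<lambda>x. (v1 x - v2 x) \<bullet> c) s = C2 - C1"
        using C1 C2 by eventually_elim (auto simp: pd)
    qed
  qed
  then show ?thesis by eventually_elim simp
qed

text \<open>
  The weak derivative is chosen by Hilbert's choice operator. By uniqueness, every candidate agrees with it
  almost everywhere.
\<close>

lemma weak_derivative_representative:
  fixes f :: "real \<Rightarrow> 'b::{real_inner,complete_space}"
  assumes T: "0 < T" and f: "f \<in> Lp 1 {0<..<T}"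
    and v: "interval_function T v" "integrable lborel (\<lambda>x. norm (v x))" "has_weak_derivative T f v"
  shows "AE x\<in>{0<..<T} in lborel. weak_derivative T f x = v x"
proof -
  have "v \<in> Lp 1 {0<..<T}" by (rule Lp_if_representative[OF v(1)]) (use v(2) in auto)
  then have "weak_derivative T f \<in> Lp 1 {0<..<T} \<and> has_weak_derivative T f (weak_derivative T f)"
    unfolding weak_derivative_def using v(3) by (intro someI[of "\<lambda>v. v \<in> Lp 1 {0<..<T} \<and> has_weak_derivative T f v"]) simp
  then have w: "weak_derivative T f \<in> Lp 1 {0<..<T}" "has_weak_derivative T f (weak_derivative T f)" by auto
  obtain f' where f': "interval_function T f'" "AE x\<in>{0<..<T} in lborel. f x = f' x"
    "integrable lborel (\<lambda>x. norm (f' x))"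
    by (rule Lp_representative[OF f]) auto
  obtain w' where w': "interval_function T w'" "AE x\<in>{0<..<T} in lborel. weak_derivative T f x = w' x"
    "integrable lborel (\<lambda>x. norm (w' x))"
    by (rule Lp_representative[OF w(1)]) auto
  have "has_weak_derivative T f w'"
    using w(2) has_weak_derivative_iff_inner[OF f' w'] has_weak_derivative_iff_inner[OF f' w'(1) _ w'(3), of w'] by simp
  from weak_derivative_unique[OF T f w'(1,3) this v]
  have "AE x in lborel. w' x = v x" .
  with w'(2) show ?thesis by eventually_elim auto
qed

text \<open>
  The way in which membership in \<open>W\<^sup>1\<^sup>,\<^sup>2\<close> is established and the weak derivative computed.
\<close>

lemma W1p_if_primitive:
  fixes f :: "real \<Rightarrow> 'b::{real_inner,complete_space}"
  assumes T: "0 < T" and f': "interval_function T f'" "AE x\<in>{0<..<T} in lborel. f x = f' x"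
      "integrable lborel (\<lambda>x. (norm (f' x))\<^sup>2)"
    and v: "interval_function T v" "integrable lborel (\<lambda>x. (norm (v x))\<^sup>2)"
    and prim: "\<And>c. AE s\<in>{0<..<T} in lborel. f' s \<bullet> c = primitive (\<lambda>r. v r \<bullet> c) s"
  shows "f \<in> W1p 2 T" "AE x\<in>{0<..<T} in lborel. weak_derivative T f x = v x"
proof -
  have f1: "integrable lborel (\<lambda>x. norm (f' x))" by (rule interval_function_L1_if_L2[OF f'(1,3)])
  have v1: "integrable lborel (\<lambda>x. norm (v x))" by (rule interval_function_L1_if_L2[OF v])
  have wd: "has_weak_derivative T f v"
    unfolding has_weak_derivative_iff_inner[OF f'(1,2) f1 v(1) _ v1, of v, simplified]
  proof (intro allI impI)
    fix \<eta> c assume \<eta>: "test_function T \<eta>"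
    note i = inner_interval_function[OF v(1) v1, where c=c]
    note [measurable] = primitive_borel[OF i(1)] test_function_borel[OF \<eta>]
      borel_measurable_integrable[OF inner_interval_function(1)[OF f'(1) f1, where c=c]]
    have "(LBINT s. deriv \<eta> s * (f' s \<bullet> c)) = (LBINT s. deriv \<eta> s * primitive (\<lambda>r. v r \<bullet> c) s)"
    proof (rule integral_cong_AE)
      show "AE s in lborel. deriv \<eta> s * (f' s \<bullet> c) = deriv \<eta> s * primitive (\<lambda>r. v r \<bullet> c) s"
        using prim[of c]
      proof eventually_elim
        case (elim s)
        then show ?case using test_functionD(4)[OF \<eta>, of s] by (cases "s \<in> {0<..<T}") auto
      qed
    qed measurable
    then show "(LBINT s. deriv \<eta> s * (f' s \<bullet> c)) = - (LBINT s. \<eta> s * (v s \<bullet> c))"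
      using integral_test_function_primitive[OF \<eta> i T] by simp
  qed
  have "v \<in> Lp 2 {0<..<T}" by (rule Lp_if_representative[OF v(1)]) (use v(2) in auto)
  moreover have "f \<in> Lp 2 {0<..<T}" by (rule Lp_if_representative[OF f'])
  ultimately show "f \<in> W1p 2 T" unfolding W1p_def using wd by blast
  have "f \<in> Lp 1 {0<..<T}" by (rule Lp_if_representative[OF f'(1,2)]) (use f1 in simp)
  then show "AE x\<in>{0<..<T} in lborel. weak_derivative T f x = v x"
    by (rule weak_derivative_representative[OF T _ v(1) v1 wd])
qed

lemma W1p_representatives:
  fixes f :: "real \<Rightarrow> 'b::{real_inner,complete_space}"
  assumes T: "0 < T" and f: "f \<in> W1p p T" and p: "p = 1 \<or> p = 2"
  obtains f' v where "interval_function T f'" "AE x\<in>{0<..<T} in lborel. f x = f' x"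
    "integrable lborel (\<lambda>x. norm (f' x) ^ p)"
    "interval_function T v" "AE x\<in>{0<..<T} in lborel. weak_derivative T f x = v x"
    "integrable lborel (\<lambda>x. norm (v x) ^ p)"
    "\<And>c. \<exists>C. AE s\<in>{0<..<T} in lborel. f' s \<bullet> c = C + primitive (\<lambda>r. v r \<bullet> c) s"
proof -
  have p0: "p \<noteq> 0" using p by auto
  obtain v0 where v0: "v0 \<in> Lp p {0<..<T}" "has_weak_derivative T f v0" and fp: "f \<in> Lp p {0<..<T}"
    using f unfolding W1p_def by blast
  obtain f' where f': "interval_function T f'" "AE x\<in>{0<..<T} in lborel. f x = f' x"
    "integrable lborel (\<lambda>x. norm (f' x) ^ p)"
    by (rule Lp_representative[OF fp p0])
  obtain v where v: "interval_function T v" "AE x\<in>{0<..<T} in lborel. v0 x = v x"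
    "integrable lborel (\<lambda>x. norm (v x) ^ p)"
    by (rule Lp_representative[OF v0(1) p0])
  have f1: "integrable lborel (\<lambda>x. norm (f' x))" using p f' interval_function_L1_if_L2[of T f'] by auto
  have v1: "integrable lborel (\<lambda>x. norm (v x))" using p v interval_function_L1_if_L2[of T v] by auto
  have wd: "has_weak_derivative T f v"
    using v0(2) has_weak_derivative_iff_inner[OF f'(1,2) f1 v(1,2) v1]
      has_weak_derivative_iff_inner[OF f'(1,2) f1 v(1) _ v1, of v] by simp
  have "f \<in> Lp 1 {0<..<T}" by (rule Lp_if_representative[OF f'(1,2)]) (use f1 in simp)
  then have "AE x\<in>{0<..<T} in lborel. weak_derivative T f x = v x"
    by (rule weak_derivative_representative[OF T _ v(1) v1 wd])
  moreover have "\<exists>C. AE s\<in>{0<..<T} in lborel. f' s \<bullet> c = C + primitive (\<lambda>r. v r \<bullet> c) s" for c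
    by (rule weak_derivative_primitive[OF T inner_interval_function[OF f'(1) f1, where c=c] inner_interval_function[OF v(1) v1, where c=c]])
      (use has_weak_derivative_iff_inner[OF f'(1,2) f1 v(1) _ v1, of v] wd in auto)
  ultimately show thesis using that f' v(1,3) by blast
qed

section \<open>Convolution of a scalar kernel with a vector-valued function\<close>

lemma simple_limit_sum:
  fixes f :: "'i \<Rightarrow> 'x \<Rightarrow> 'b::real_normed_vector"
  assumes "finite I" "\<And>i. i \<in> I \<Longrightarrow> simple_limit M (f i)"
  shows "simple_limit M (\<lambda>x. \<Sum>i\<in>I. f i x)"
  using assms by (induction I) (auto intro: simple_limit_const simple_limit_add)

lemma simple_limit_indicator:
  fixes f :: "real \<Rightarrow> 'b::real_normed_vector"
  assumes "simple_limit lborel f" "A \<in> sets borel"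
  shows "simple_limit lborel (\<lambda>x. indicator A x *\<^sub>R f x)"
  using assms by (intro simple_limit_scaleR) simp_all

text \<open>
  For almost every \<open>s\<close> the vector \<open>V s\<close> is the integral of \<open>m(s - r) w(r)\<close>. The point is the measurability of \<open>V\<close>: it
  is the pointwise limit of the convolutions of \<open>m\<close> with simple approximations of \<open>w\<close>, which are finite combinations of fixed vectors
  with real coefficient functions.
\<close>

lemma vector_convolution:
  fixes w :: "real \<Rightarrow> 'b::{real_inner,complete_space}" and m :: "real \<Rightarrow> real"
  assumes m: "integrable lborel m" and w: "simple_limit lborel w" "integrable lborel (\<lambda>x. norm (w x))"
  obtains V where "simple_limit lborel V"
    "AE s in lborel. integrable lborel (\<lambda>r. \<bar>m (s - r)\<bar> * norm (w r)) \<and>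
       (\<forall>c. V s \<bullet> c = (LBINT r. m (s - r) * (w r \<bullet> c)))"
proof -
  note [measurable] = borel_measurable_integrable[OF m] borel_measurable_norm_simple_limit[OF w(1)]
  obtain u where u: "\<And>i::nat. simple_function lborel (u i)" and lim: "\<And>x. (\<lambda>i. u i x) \<longlonglongrightarrow> w x"
    and bnd: "\<And>i x. norm (u i x) \<le> 2 * norm (w x)"
    by (rule simple_limit_dominatedE[OF w(1)]) (rule that, simp_all)
  have su: "simple_limit lborel (u i)" for i by (rule simple_limitI[where s="\<lambda>_. u i"]) (auto simp: u)
  have fin: "finite (range (u i))" for i using simple_functionD(1)[OF u[of i]] by simp
  define A where "A i x = u i -` {x}" for i x
  have A[measurable]: "A i x \<in> sets borel" for i x using simple_functionD(2)[OF u[of i], of "{x}"] by (simp add: A_def)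
  define S where "S i = range (u i) - {0}" for i
  have finS: "finite (S i)" for i using fin by (simp add: S_def)
  have urep: "u i r = (\<Sum>x\<in>S i. indicator (A i x) r *\<^sub>R x)" for i r
  proof -
    have "(\<Sum>x\<in>S i. indicator (A i x) r *\<^sub>R x) = (\<Sum>x\<in>S i. if x = u i r then u i r else 0)"
      by (intro sum.cong) (auto simp: A_def indicator_def)
    also have "\<dots> = (if u i r \<in> S i then u i r else 0)" using finS[of i] by (simp add: sum.delta)
    also have "\<dots> = u i r" by (auto simp: S_def)
    finally show ?thesis ..
  qed
  \<comment> \<open>The convolution is set to \<open>0\<close> at the remaining times. This set is Borel, so the limit below holds at every time.\<close>
  define G where "G = {s. (\<integral>\<^sup>+r. ennreal (\<bar>m (s - r)\<bar> * norm (w r)) \<partial>lborel) < \<infinity>}"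
  have Gm[measurable]: "G \<in> sets borel" unfolding G_def by measurable
  have Gint: "integrable lborel (\<lambda>r. \<bar>m (s - r)\<bar> * norm (w r))" if "s \<in> G" for s
    using that unfolding G_def integrable_iff_bounded by simp
  have AEG: "AE s in lborel. s \<in> G"
  proof -
    have "AE s in lborel. integrable lborel (\<lambda>r. \<bar>m (s - r)\<bar> * norm (w r))"
      using line_conv_integrable(2)[of "\<lambda>r. \<bar>m r\<bar>"] m w(2) by simp
    then show ?thesis by eventually_elim (auto simp: G_def integrable_iff_bounded abs_mult)
  qed
  have "\<exists>y. \<forall>c. y \<bullet> c = (LBINT r. m (s - r) * (w r \<bullet> c))" if s: "s \<in> G" for s
  proof -
    have sl: "simple_limit lborel (\<lambda>r. m (s - r) *\<^sub>R w r)" by (rule simple_limit_scaleR[OF _ w(1)]) measurable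
    have "integrable lborel (\<lambda>r. norm (m (s - r) *\<^sub>R w r))" using Gint[OF s] by simp
    from has_vec_integral_exists[OF sl this] obtain y where "has_vec_integral lborel (\<lambda>r. m (s - r) *\<^sub>R w r) y" by blast
    from has_vec_integral_inner(2)[OF this sl] show ?thesis by auto
  qed
  then obtain V0 where V0: "\<And>s c. s \<in> G \<Longrightarrow> V0 s \<bullet> c = (LBINT r. m (s - r) * (w r \<bullet> c))" by metis
  define Vn where "Vn i s = indicator G s *\<^sub>R (\<Sum>x\<in>S i. line_conv m (indicator (A i x)) s *\<^sub>R x)" for i s
  define V where "V s = indicator G s *\<^sub>R V0 s" for s
  have "simple_limit lborel V"
  proof (rule simple_limit_limit)
    show "simple_limit lborel (Vn i)" for i
      unfolding Vn_def
      by (intro simple_limit_indicator simple_limit_sum finS simple_limit_scaleR simple_limit_const) measurable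
    fix s
    show "(\<lambda>i. Vn i s) \<longlonglongrightarrow> V s"
    proof (cases "s \<in> G")
      case True
      have iA: "integrable lborel (\<lambda>r. m (s - r) * indicator (A i x) r)" for i x
      proof -
        have "integrable lborel (\<lambda>r. m (s - r))" using lborel_integrable_real_affine[OF m, of "-1" s] by simp
        from integrable_indicator_mult[OF this, of "A i x"] show ?thesis by (simp add: mult.commute)
      qed
      have Vc: "Vn i s \<bullet> c = (LBINT r. m (s - r) * (u i r \<bullet> c))" for i c
      proof -
        have "Vn i s \<bullet> c = (\<Sum>x\<in>S i. (LBINT r. m (s - r) * indicator (A i x) r) * (x \<bullet> c))"
          using True by (simp add: Vn_def inner_sum_left line_conv_def)
        also have "\<dots> = (LBINT r. (\<Sum>x\<in>S i. m (s - r) * indicator (A i x) r * (x \<bullet> c)))"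
          using iA by (subst Bochner_Integration.integral_sum) auto
        also have "\<dots> = (LBINT r. m (s - r) * (u i r \<bullet> c))"
          by (rule Bochner_Integration.integral_cong[OF refl])
            (simp add: urep inner_sum_left sum_distrib_left mult.assoc)
        finally show ?thesis .
      qed
      have mu: "(\<lambda>r. norm (u i r - w r)) \<in> borel_measurable borel" for i
        using borel_measurable_norm_simple_limit[OF simple_limit_diff[OF su w(1)]] by simp
      have ui: "integrable lborel (\<lambda>r. m (s - r) * (u i r \<bullet> c))" "integrable lborel (\<lambda>r. m (s - r) * (w r \<bullet> c))"
        "integrable lborel (\<lambda>r. \<bar>m (s - r)\<bar> * norm (u i r - w r))" for i c
      proof -
        have big: "integrable lborel (\<lambda>r. (3 + 2 * norm c) * (\<bar>m (s - r)\<bar> * norm (w r)))" for c :: 'b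
          using Gint[OF True] by simp
        have [measurable]: "(\<lambda>r. u i r \<bullet> c) \<in> borel_measurable borel" "(\<lambda>r. w r \<bullet> c) \<in> borel_measurable borel"
          using borel_measurable_inner_simple_limit[OF su simple_limit_const, of i c]
            borel_measurable_inner_simple_limit[OF w(1) simple_limit_const, of c] by auto
        note [measurable] = mu[of i]
        have b1: "\<bar>u i r \<bullet> c\<bar> \<le> (3 + 2 * norm c) * norm (w r)" for r
        proof -
          have "\<bar>u i r \<bullet> c\<bar> \<le> norm (u i r) * norm c" by (rule Cauchy_Schwarz_ineq2)
          also have "\<dots> \<le> 2 * norm (w r) * norm c" by (intro mult_right_mono bnd) auto
          also have "\<dots> \<le> (3 + 2 * norm c) * norm (w r)" by (simp add: algebra_simps)
          finally show ?thesis .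
        qed
        have b2: "\<bar>w r \<bullet> c\<bar> \<le> (3 + 2 * norm c) * norm (w r)" for r
        proof -
          have "\<bar>w r \<bullet> c\<bar> \<le> norm (w r) * norm c" by (rule Cauchy_Schwarz_ineq2)
          also have "\<dots> \<le> (3 + 2 * norm c) * norm (w r)" by (simp add: algebra_simps)
          finally show ?thesis .
        qed
        have b3: "norm (u i r - w r) \<le> (3 + 2 * norm (0::'b)) * norm (w r)" for r
          using norm_triangle_ineq4[of "u i r" "w r"] bnd[of i r] by simp
        have mono: "integrable lborel (\<lambda>r. m (s - r) * h r)"
          if h: "h \<in> borel_measurable borel" "\<And>r. \<bar>h r\<bar> \<le> (3 + 2 * norm d) * norm (w r)" for h :: "real \<Rightarrow> real" and d :: 'b
        proof (rule Bochner_Integration.integrable_bound[OF big[of d]])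
          show "(\<lambda>r. m (s - r) * h r) \<in> borel_measurable lborel" using h(1) by measurable
          have "\<bar>m (s - r)\<bar> * \<bar>h r\<bar> \<le> \<bar>m (s - r)\<bar> * ((3 + 2 * norm d) * norm (w r))" for r
            by (intro mult_left_mono h) auto
          then show "AE r in lborel. norm (m (s - r) * h r) \<le> norm ((3 + 2 * norm d) * (\<bar>m (s - r)\<bar> * norm (w r)))"
            by (auto simp: abs_mult mult_ac intro!: AE_I2)
        qed
        show "integrable lborel (\<lambda>r. m (s - r) * (u i r \<bullet> c))" by (rule mono[OF _ b1]) measurable
        show "integrable lborel (\<lambda>r. m (s - r) * (w r \<bullet> c))" by (rule mono[OF _ b2]) measurable
        have "integrable lborel (\<lambda>r. m (s - r) * norm (u i r - w r))"
          by (rule mono[of _ "0::'b"]) (use b3 mu in auto)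
        from integrable_norm[OF this] show "integrable lborel (\<lambda>r. \<bar>m (s - r)\<bar> * norm (u i r - w r))" by (simp add: abs_mult)
      qed
      have le: "norm (Vn i s - V s) \<le> (LBINT r. \<bar>m (s - r)\<bar> * norm (u i r - w r))" for i
      proof -
        let ?c = "Vn i s - V s"
        have "norm ?c * norm ?c = Vn i s \<bullet> ?c - V s \<bullet> ?c"
          by (simp add: inner_diff_left[symmetric] power2_norm_eq_inner[symmetric] power2_eq_square)
        also have "\<dots> = (LBINT r. m (s - r) * (u i r \<bullet> ?c) - m (s - r) * (w r \<bullet> ?c))"
          using True Vc V0[OF True] ui(1,2) by (simp add: V_def)
        also have "\<dots> \<le> (LBINT r. (\<bar>m (s - r)\<bar> * norm (u i r - w r)) * norm ?c)"
        proof (rule integral_mono)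
          fix r
          have "m (s - r) * ((u i r - w r) \<bullet> ?c) \<le> \<bar>m (s - r)\<bar> * \<bar>(u i r - w r) \<bullet> ?c\<bar>"
            using abs_ge_self[of "m (s - r) * ((u i r - w r) \<bullet> ?c)"] by (simp add: abs_mult)
          also have "\<dots> \<le> \<bar>m (s - r)\<bar> * (norm (u i r - w r) * norm ?c)"
            by (intro mult_left_mono Cauchy_Schwarz_ineq2) auto
          finally show "m (s - r) * (u i r \<bullet> ?c) - m (s - r) * (w r \<bullet> ?c) \<le> (\<bar>m (s - r)\<bar> * norm (u i r - w r)) * norm ?c"
            by (simp add: inner_diff_left right_diff_distrib mult.assoc)
        qed (use ui in auto)
        also have "\<dots> = (LBINT r. \<bar>m (s - r)\<bar> * norm (u i r - w r)) * norm ?c" by simp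
        finally show ?thesis
          using Bochner_Integration.integral_nonneg[of lborel "\<lambda>r. \<bar>m (s - r)\<bar> * norm (u i r - w r)"]
          by (cases "norm ?c = 0") (auto simp: mult_le_cancel_right)
      qed
      have "(\<lambda>i. LBINT r. \<bar>m (s - r)\<bar> * norm (u i r - w r)) \<longlonglongrightarrow> (\<integral>r. 0 \<partial>(lborel::real measure))"
      proof (rule integral_dominated_convergence[where w="\<lambda>r. 3 * (\<bar>m (s - r)\<bar> * norm (w r))"])
        show "AE r in lborel. (\<lambda>i. \<bar>m (s - r)\<bar> * norm (u i r - w r)) \<longlonglongrightarrow> 0"
        proof (rule AE_I2)
          fix r
          have "(\<lambda>i. \<bar>m (s - r)\<bar> * norm (u i r - w r)) \<longlonglongrightarrow> \<bar>m (s - r)\<bar> * norm (w r - w r)"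
            by (intro tendsto_intros lim)
          then show "(\<lambda>i. \<bar>m (s - r)\<bar> * norm (u i r - w r)) \<longlonglongrightarrow> 0" by simp
        qed
        show "AE r in lborel. norm (\<bar>m (s - r)\<bar> * norm (u i r - w r)) \<le> 3 * (\<bar>m (s - r)\<bar> * norm (w r))" for i
        proof (rule AE_I2)
          fix r
          have "norm (u i r - w r) \<le> 3 * norm (w r)" using norm_triangle_ineq4[of "u i r" "w r"] bnd[of i r] by simp
          then have "\<bar>m (s - r)\<bar> * norm (u i r - w r) \<le> \<bar>m (s - r)\<bar> * (3 * norm (w r))" by (rule mult_left_mono) simp
          then show "norm (\<bar>m (s - r)\<bar> * norm (u i r - w r)) \<le> 3 * (\<bar>m (s - r)\<bar> * norm (w r))" by (simp add: abs_mult)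
        qed
        show "(\<lambda>r. \<bar>m (s - r)\<bar> * norm (u i r - w r)) \<in> borel_measurable lborel" for i
          using mu[of i] by measurable
      qed (use Gint[OF True] in auto)
      then have "(\<lambda>i. LBINT r. \<bar>m (s - r)\<bar> * norm (u i r - w r)) \<longlonglongrightarrow> 0" by simp
      then have "(\<lambda>i. norm (Vn i s - V s)) \<longlonglongrightarrow> 0"
        by (rule tendsto_sandwich[OF _ _ tendsto_const, rotated 2]) (use le in auto)
      then show ?thesis by (simp add: tendsto_norm_zero_iff LIM_zero_iff)
    qed (simp add: Vn_def V_def)
  qed
  moreover have "AE s in lborel. integrable lborel (\<lambda>r. \<bar>m (s - r)\<bar> * norm (w r)) \<and>
       (\<forall>c. V s \<bullet> c = (LBINT r. m (s - r) * (w r \<bullet> c)))"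
    using AEG by eventually_elim (use Gint V0 in \<open>auto simp: V_def\<close>)
  ultimately show thesis by (rule that)
qed

lemma weighted_Cauchy_Schwarz:
  fixes m h :: "real \<Rightarrow> real"
  assumes m: "integrable lborel m" "\<And>x. 0 \<le> m x" and h: "\<And>x. 0 \<le> h x" "h \<in> borel_measurable borel"
    and mh: "integrable lborel (\<lambda>x. m x * h x)" and mh2: "integrable lborel (\<lambda>x. m x * (h x)\<^sup>2)"
  shows "(LBINT x. m x * h x)\<^sup>2 \<le> (LBINT x. m x) * (LBINT x. m x * (h x)\<^sup>2)"
proof -
  have [measurable]: "m \<in> borel_measurable borel" using m by auto
  have "(\<integral>\<^sup>+x. ennreal (sqrt (m x)) * ennreal (sqrt (m x) * h x) \<partial>lborel)\<^sup>2
      \<le> (\<integral>\<^sup>+x. (ennreal (sqrt (m x)))\<^sup>2 \<partial>lborel) * (\<integral>\<^sup>+x. (ennreal (sqrt (m x) * h x))\<^sup>2 \<partial>lborel)"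
    using h(2) by (intro Cauchy_Schwarz_nn_integral) measurable
  also have "(\<lambda>x. ennreal (sqrt (m x)) * ennreal (sqrt (m x) * h x)) = (\<lambda>x. ennreal (m x * h x))"
    using m(2) h(1) by (simp add: ennreal_mult[symmetric] mult.assoc[symmetric] fun_eq_iff)
  also have "(\<lambda>x. (ennreal (sqrt (m x)))\<^sup>2) = (\<lambda>x. ennreal (m x))"
    using m(2) by (simp add: ennreal_power fun_eq_iff)
  also have "(\<lambda>x. (ennreal (sqrt (m x) * h x))\<^sup>2) = (\<lambda>x. ennreal (m x * (h x)\<^sup>2))"
    using m(2) h(1) by (simp add: ennreal_power power_mult_distrib fun_eq_iff)
  finally have "(ennreal (LBINT x. m x * h x))\<^sup>2 \<le> ennreal (LBINT x. m x) * ennreal (LBINT x. m x * (h x)\<^sup>2)"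
    using m h mh mh2 by (simp add: nn_integral_eq_integral)
  then show ?thesis
    using m h by (simp add: ennreal_power ennreal_mult[symmetric] Bochner_Integration.integral_nonneg)
qed

text \<open>
  Young's inequality \<open>\<parallel>m * w\<parallel>\<^sub>2 \<le> \<parallel>m\<parallel>\<^sub>1 \<parallel>w\<parallel>\<^sub>2\<close>, here for its qualitative conclusion, from Cauchy-Schwarz with respect to the
  measure with density \<open>\<bar>m(s - r)\<bar>\<close>.
\<close>

lemma Young_inequality_L2:
  fixes w V :: "real \<Rightarrow> 'b::{real_inner,complete_space}"
  assumes m: "integrable lborel m" and w: "simple_limit lborel w" "integrable lborel (\<lambda>x. (norm (w x))\<^sup>2)"
    and V: "simple_limit lborel V"
      "AE s in lborel. integrable lborel (\<lambda>r. \<bar>m (s - r)\<bar> * norm (w r)) \<and>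
       (\<forall>c. V s \<bullet> c = (LBINT r. m (s - r) * (w r \<bullet> c)))"
  shows "integrable lborel (\<lambda>s. (norm (V s))\<^sup>2)"
proof -
  note [measurable] = borel_measurable_integrable[OF m] borel_measurable_norm_simple_limit[OF w(1)]
     borel_measurable_norm_simple_limit[OF V(1)]
  have am: "integrable lborel (\<lambda>r. \<bar>m r\<bar>)" using m by simp
  define M where "M = (LBINT r. \<bar>m r\<bar>)"
  have "integrable lborel (\<lambda>s. M * line_conv (\<lambda>r. \<bar>m r\<bar>) (\<lambda>r. (norm (w r))\<^sup>2) s)"
    using line_conv_integrable(1)[OF am w(2)] by simp
  then show ?thesis
  proof (rule Bochner_Integration.integrable_bound)
    show "AE s in lborel. norm ((norm (V s))\<^sup>2) \<le> norm (M * line_conv (\<lambda>r. \<bar>m r\<bar>) (\<lambda>r. (norm (w r))\<^sup>2) s)"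
      using V(2) line_conv_integrable(2)[OF am w(2)]
    proof eventually_elim
      case (elim s)
      have i1: "integrable lborel (\<lambda>r. \<bar>m (s - r)\<bar> * norm (w r))"
        and Vc: "V s \<bullet> V s = (LBINT r. m (s - r) * (w r \<bullet> V s))" using elim(1) by auto
      have ms: "integrable lborel (\<lambda>r. \<bar>m (s - r)\<bar>)"
        using lborel_integrable_real_affine[OF am, of "-1" s] by simp
      have "norm (V s) * norm (V s) \<le> (LBINT r. (\<bar>m (s - r)\<bar> * norm (w r)) * norm (V s))"
      proof -
        have le: "\<bar>m (s - r) * (w r \<bullet> V s)\<bar> \<le> (\<bar>m (s - r)\<bar> * norm (w r)) * norm (V s)" for r
          unfolding abs_mult mult.assoc by (intro mult_left_mono Cauchy_Schwarz_ineq2) auto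
        have "\<bar>\<integral>r. m (s - r) * (w r \<bullet> V s) \<partial>lborel\<bar> \<le> (LBINT r. \<bar>m (s - r) * (w r \<bullet> V s)\<bar>)"
          using integral_norm_bound[of lborel "\<lambda>r. m (s - r) * (w r \<bullet> V s)"] by simp
        also have "\<dots> \<le> (LBINT r. (\<bar>m (s - r)\<bar> * norm (w r)) * norm (V s))"
          by (rule Bochner_Integration.integral_mono') (use i1 le in auto)
        finally show ?thesis using Vc by (simp add: power2_norm_eq_inner[symmetric] power2_eq_square)
      qed
      also have "\<dots> = (LBINT r. \<bar>m (s - r)\<bar> * norm (w r)) * norm (V s)" by simp
      finally have le: "norm (V s) \<le> (LBINT r. \<bar>m (s - r)\<bar> * norm (w r))"
        using Bochner_Integration.integral_nonneg[of lborel "\<lambda>r. \<bar>m (s - r)\<bar> * norm (w r)"]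
        by (cases "norm (V s) = 0") (auto simp: mult_le_cancel_right)
      then have "(norm (V s))\<^sup>2 \<le> (LBINT r. \<bar>m (s - r)\<bar> * norm (w r))\<^sup>2"
        by (rule power_mono) simp
      also have "\<dots> \<le> (LBINT r. \<bar>m (s - r)\<bar>) * (LBINT r. \<bar>m (s - r)\<bar> * (norm (w r))\<^sup>2)"
        by (rule weighted_Cauchy_Schwarz) (use ms i1 elim(2) in auto)
      also have "(LBINT r. \<bar>m (s - r)\<bar>) = M"
        unfolding M_def using lborel_integral_real_affine[of "-1" "\<lambda>r. \<bar>m r\<bar>" s] by simp
      finally show ?case by (simp add: line_conv_def)
    qed
  qed measurable
qed

text \<open>
  The product rule for \<open>k = a - 1 * m\<close>: the convolution \<open>k * w\<close> is the primitive of \<open>B = a w - m * w\<close>. By Young's inequality both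
  are square integrable.
\<close>

lemma absolutely_continuous_kernel_W1p:
  fixes w :: "real \<Rightarrow> 'b::{real_inner,complete_space}"
  assumes T: "0 < T" and m: "integrable lborel m" "\<And>r. r \<notin> {0<..<T} \<Longrightarrow> m r = 0"
    and k: "\<And>s. s \<in> {0<..<T} \<Longrightarrow> k s = a - primitive m s"
    and w': "interval_function T w'" "AE x\<in>{0<..<T} in lborel. w x = w' x"
      "integrable lborel (\<lambda>x. (norm (w' x))\<^sup>2)"
  obtains B where "interval_function T B" "integrable lborel (\<lambda>x. (norm (B x))\<^sup>2)"
    "vec_conv k w \<in> W1p 2 T"
    "AE x\<in>{0<..<T} in lborel. weak_derivative T (vec_conv k w) x = B x"
    "AE s\<in>{0<..<T} in lborel. integrable lborel (\<lambda>r. \<bar>m (s - r)\<bar> * norm (w' r)) \<and>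
       (\<forall>c. B s \<bullet> c = a * (w' s \<bullet> c) - (LBINT r. m (s - r) * (w' r \<bullet> c)))"
proof -
  note W = interval_functionD[OF w'(1)]
  note [measurable] = borel_measurable_integrable[OF m(1)] W(4) primitive_borel[OF m(1)]
  have w1: "integrable lborel (\<lambda>x. norm (w' x))" by (rule interval_function_L1_if_L2[OF w'(1,3)])
  have wc: "integrable lborel (\<lambda>x. w' x \<bullet> c)" "\<And>x. x \<le> 0 \<Longrightarrow> w' x \<bullet> c = 0" for c
    using inner_interval_function(1)[OF w'(1) w1] W(2) by auto
  define \<kappa> where "\<kappa> s = indicator {0<..<T} s * (a - primitive m s)" for s
  have \<kappa>: "integrable lborel \<kappa>"
  proof (rule Bochner_Integration.integrable_bound)
    show "integrable lborel (\<lambda>s. indicator {0<..<T} s * (\<bar>a\<bar> + (LBINT r. \<bar>m r\<bar>)))" by simp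
    have "\<bar>a - primitive m s\<bar> \<le> \<bar>a\<bar> + (LBINT r. \<bar>m r\<bar>)" for s
      using primitive_bound[OF m(1), of s] by linarith
    then show "AE x in lborel. norm (\<kappa> x) \<le> norm (indicat_real {0<..<T} x * (\<bar>a\<bar> + (LBINT r. \<bar>m r\<bar>)))"
      by (auto simp: \<kappa>_def indicator_def intro!: AE_I2 order_trans[OF _ abs_ge_self])
  qed (simp add: \<kappa>_def[abs_def])
  note [measurable] = borel_measurable_integrable[OF \<kappa>]
  obtain V where V: "simple_limit lborel V"
    "AE s in lborel. integrable lborel (\<lambda>r. \<bar>m (s - r)\<bar> * norm (w' r)) \<and>
       (\<forall>c. V s \<bullet> c = (LBINT r. m (s - r) * (w' r \<bullet> c)))"
    by (rule vector_convolution[OF m(1) W(1) w1])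
  obtain F where F: "simple_limit lborel F"
    "AE s in lborel. integrable lborel (\<lambda>r. \<bar>\<kappa> (s - r)\<bar> * norm (w' r)) \<and>
       (\<forall>c. F s \<bullet> c = (LBINT r. \<kappa> (s - r) * (w' r \<bullet> c)))"
    by (rule vector_convolution[OF \<kappa> W(1) w1])
  have V2: "integrable lborel (\<lambda>x. (norm (V x))\<^sup>2)" by (rule Young_inequality_L2[OF m(1) W(1) w'(3) V])
  have F2: "integrable lborel (\<lambda>x. (norm (F x))\<^sup>2)" by (rule Young_inequality_L2[OF \<kappa> W(1) w'(3) F])
  define B where "B s = indicator {0<..<T} s *\<^sub>R (a *\<^sub>R w' s - V s)" for s
  define F' where "F' s = indicator {0<..<T} s *\<^sub>R F s" for s
  have Bi: "interval_function T B"
    unfolding interval_function_def B_def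
    by (intro conjI simple_limit_indicator simple_limit_diff simple_limit_scaleR W(1) V(1)) auto
  have F'i: "interval_function T F'"
    unfolding interval_function_def F'_def by (intro conjI simple_limit_indicator F(1)) auto
  note [measurable] = interval_functionD(4)[OF Bi] interval_functionD(4)[OF F'i]
  have B2: "integrable lborel (\<lambda>x. (norm (B x))\<^sup>2)"
  proof (rule Bochner_Integration.integrable_bound)
    show "integrable lborel (\<lambda>x. 2 * (a\<^sup>2 * (norm (w' x))\<^sup>2) + 2 * (norm (V x))\<^sup>2)" using w'(3) V2 by simp
    have "(norm (B x))\<^sup>2 \<le> 2 * (a\<^sup>2 * (norm (w' x))\<^sup>2) + 2 * (norm (V x))\<^sup>2" for x
    proof -
      have "norm (B x) \<le> norm (a *\<^sub>R w' x) + norm (V x)"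
        unfolding B_def by (auto simp: indicator_def norm_triangle_ineq4 simp del: norm_scaleR)
      then have "(norm (B x))\<^sup>2 \<le> (norm (a *\<^sub>R w' x) + norm (V x))\<^sup>2" by (rule power_mono) simp
      also have "\<dots> \<le> 2 * (norm (a *\<^sub>R w' x))\<^sup>2 + 2 * (norm (V x))\<^sup>2"
        using zero_le_power2[of "norm (a *\<^sub>R w' x) - norm (V x)"]
        by (simp add: power2_diff power2_sum del: norm_scaleR zero_le_power2)
      finally show ?thesis by (simp add: power_mult_distrib)
    qed
    then show "AE x in lborel. norm ((norm (B x))\<^sup>2) \<le> norm (2 * (a\<^sup>2 * (norm (w' x))\<^sup>2) + 2 * (norm (V x))\<^sup>2)"
      by (auto intro!: AE_I2 order_trans[OF _ abs_ge_self])
  qed simp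
  have F'2: "integrable lborel (\<lambda>x. (norm (F' x))\<^sup>2)"
  proof (rule Bochner_Integration.integrable_bound[OF F2])
    show "AE x in lborel. norm ((norm (F' x))\<^sup>2) \<le> norm ((norm (F x))\<^sup>2)" by (auto simp: F'_def indicator_def)
  qed simp
  have B1: "integrable lborel (\<lambda>x. norm (B x))" by (rule interval_function_L1_if_L2[OF Bi B2])
  have Brep: "AE s\<in>{0<..<T} in lborel. integrable lborel (\<lambda>r. \<bar>m (s - r)\<bar> * norm (w' r)) \<and>
       (\<forall>c. B s \<bullet> c = a * (w' s \<bullet> c) - (LBINT r. m (s - r) * (w' r \<bullet> c)))"
    using V(2) by eventually_elim (auto simp: B_def inner_diff_left)
  have conv_eq: "\<kappa> (s - r) * h r = indicator {0<..<s} r * ((a - primitive m (s - r)) * h r)"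
    if s: "s \<in> {0<..<T}" and h: "\<And>r. r \<le> 0 \<Longrightarrow> h r = 0" for s r and h :: "real \<Rightarrow> real"
    using that h[of r] by (cases "r \<le> 0") (auto simp: \<kappa>_def indicator_def)
  have vc: "vec_conv k w s \<bullet> c = (LBINT r. \<kappa> (s - r) * (w' r \<bullet> c))"
    if s: "s \<in> {0<..<T}" and i: "integrable lborel (\<lambda>r. \<bar>\<kappa> (s - r)\<bar> * norm (w' r))" for s c
  proof -
    have sl: "simple_limit lborel (\<lambda>r. (a - primitive m (s - r)) *\<^sub>R w' r)"
      by (rule simple_limit_scaleR[OF _ W(1)]) measurable
    have "vec_conv k w s \<bullet> c = (LBINT r. indicator {0<..<s} r * ((a - primitive m (s - r)) *\<^sub>R w' r \<bullet> c))"
      unfolding vec_conv_def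
    proof (rule vec_integral_inner[OF _ sl])
      show "AE x\<in>{0<..<s} in lborel. k (s - x) *\<^sub>R w x = (a - primitive m (s - x)) *\<^sub>R w' x"
        using w'(2) by eventually_elim (use s k in auto)
      have eqn: "indicator {0<..<s} r * norm ((a - primitive m (s - r)) *\<^sub>R w' r) = \<bar>\<kappa> (s - r)\<bar> * norm (w' r)" for r
        using s W(2)[of r] by (cases "r \<le> 0") (auto simp: \<kappa>_def indicator_def)
      show "integrable lborel (\<lambda>x. indicator {0<..<s} x * norm ((a - primitive m (s - x)) *\<^sub>R w' x))"
        unfolding eqn by (rule i)
    qed simp
    also have "\<dots> = (LBINT r. \<kappa> (s - r) * (w' r \<bullet> c))"
      unfolding inner_scaleR_left
      by (rule Bochner_Integration.integral_cong[OF refl], rule conv_eq[OF s, of "\<lambda>r. w' r \<bullet> c", symmetric], rule wc(2))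
    finally show ?thesis .
  qed
  have ae1: "AE s\<in>{0<..<T} in lborel. vec_conv k w s = F' s"
    using F(2)
  proof eventually_elim
    case (elim s)
    show ?case
    proof
      assume s: "s \<in> {0<..<T}"
      have "\<forall>c. vec_conv k w s \<bullet> c = F' s \<bullet> c"
        using vc[OF s] elim s by (simp add: F'_def)
      then show "vec_conv k w s = F' s" by (simp only: vector_eq_rdot)
    qed
  qed
  have prim: "AE s\<in>{0<..<T} in lborel. F' s \<bullet> c = primitive (\<lambda>r. B r \<bullet> c) s" for c
    using F(2)
  proof eventually_elim
    case (elim s)
    show ?case
    proof
      assume s: "s \<in> {0<..<T}"
      let ?W = "\<lambda>r. w' r \<bullet> c"
      have Bc: "AE r in lborel. indicator {0<..<s} r * (B r \<bullet> c)
          = a * (indicator {0<..<s} r * ?W r) - indicator {0<..<s} r * line_conv m ?W r"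
        using Brep by eventually_elim (use s in \<open>auto simp: indicator_def line_conv_def\<close>)
      note lc = line_conv_integrable(1)[OF m(1) wc(1)[of c]]
      have "primitive (\<lambda>r. B r \<bullet> c) s
          = (LBINT r. a * (indicator {0<..<s} r * ?W r) - indicator {0<..<s} r * line_conv m ?W r)"
        unfolding primitive_def
        using Bc wc(1)[of c] lc inner_interval_function(1)[OF Bi B1, where c=c] by (intro integral_cong_AE) auto
      also have "\<dots> = a * (LBINT r. indicator {0<..<s} r * ?W r) - (LBINT r. indicator {0<..<s} r * line_conv m ?W r)"
        using integrable_indicator_mult[OF wc(1)[of c], of "{0<..<s}"] integrable_indicator_mult[OF lc, of "{0<..<s}"] by simp
      also have "(LBINT r. indicator {0<..<s} r * line_conv m ?W r) = (LBINT r. primitive m (s - r) * ?W r)"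
        by (rule indicator_line_conv[OF m(1) _ wc]) (use m(2) in auto)
      also have "(LBINT r. primitive m (s - r) * ?W r) = (LBINT r. indicator {0<..<s} r * (primitive m (s - r) * ?W r))"
      proof (rule Bochner_Integration.integral_cong[OF refl])
        fix r
        have "primitive m (s - r) = 0" if "s \<le> r" using that by (simp add: primitive_def)
        then show "primitive m (s - r) * ?W r = indicator {0<..<s} r * (primitive m (s - r) * ?W r)"
          using wc(2)[of r c] by (cases "r \<le> 0"; cases "s \<le> r") auto
      qed
      also have "a * (LBINT r. indicator {0<..<s} r * ?W r) - \<dots>
          = (LBINT r. indicator {0<..<s} r * ((a - primitive m (s - r)) * ?W r))"
      proof -
        have "integrable lborel (\<lambda>r. primitive m (s - r) * ?W r)"
        proof (rule Bochner_Integration.integrable_bound[OF integrable_mult_right[OF wc(1)[of c], of "LBINT r. \<bar>m r\<bar>"]])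
          show "(\<lambda>r. primitive m (s - r) * ?W r) \<in> borel_measurable lborel" using wc(1)[of c] by measurable
          have "\<bar>primitive m (s - r)\<bar> * \<bar>?W r\<bar> \<le> (LBINT r. \<bar>m r\<bar>) * \<bar>?W r\<bar>" for r
            by (intro mult_right_mono primitive_bound[OF m(1)]) auto
          then show "AE r in lborel. norm (primitive m (s - r) * ?W r) \<le> norm ((LBINT r. \<bar>m r\<bar>) * ?W r)"
            by (simp add: abs_mult)
        qed
        from integrable_indicator_mult[OF this, of "{0<..<s}"] integrable_indicator_mult[OF wc(1)[of c], of "{0<..<s}"]
        show ?thesis by (simp add: left_diff_distrib right_diff_distrib mult.left_commute)
      qed
      also have "\<dots> = (LBINT r. \<kappa> (s - r) * ?W r)"
        by (rule Bochner_Integration.integral_cong[OF refl], rule conv_eq[OF s, of ?W, symmetric], rule wc(2))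
      also have "\<dots> = F' s \<bullet> c" using elim s by (simp add: F'_def)
      finally show "F' s \<bullet> c = primitive (\<lambda>r. B r \<bullet> c) s" ..
    qed
  qed
  show thesis
    by (rule that[OF Bi B2 W1p_if_primitive[OF T F'i ae1 F'2 Bi B2 prim] Brep])
qed

section \<open>The inequality for nonincreasing Sobolev kernels\<close>

text \<open>
  Everything that the estimates use about an admissible pair: \<open>w\<close>, \<open>g\<close> and \<open>E\<close> are Borel representatives of \<open>u - u\<^sub>0\<close>, of \<open>g\<close>
  and of the energy along \<open>u\<close>, and the two inequalities compare time \<open>s\<close> with time \<open>0\<close> and with almost every earlier time \<open>r\<close>.
\<close>

definition chain_rule_pair ::
  "real \<Rightarrow> real \<Rightarrow> real \<Rightarrow> (real \<Rightarrow> 'a::real_inner) \<Rightarrow> (real \<Rightarrow> 'a) \<Rightarrow> (real \<Rightarrow> real) \<Rightarrow> bool" where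
  "chain_rule_pair T C E0 w g E \<longleftrightarrow>
     interval_function T w \<and> integrable lborel (\<lambda>s. (norm (w s))\<^sup>2) \<and>
     interval_function T g \<and> integrable lborel (\<lambda>s. (norm (g s))\<^sup>2) \<and>
     integrable lborel E \<and> (\<forall>s. s \<notin> {0<..<T} \<longrightarrow> E s = 0) \<and>
     (\<forall>\<epsilon>\<in>{0<..<1}.
       (AE s in lborel. s \<in> {0<..<T} \<longrightarrow>
          w s \<bullet> g s \<ge> E s - E0 - C * s * (\<epsilon> * (norm (g s))\<^sup>2 + (1 + \<bar>E0\<bar>) / \<epsilon>)) \<and>
       (AE s\<in>{0<..<T} in lborel. (AE r in lborel. 0 < r \<and> r < s \<longrightarrow>
          w s \<bullet> g s - w r \<bullet> g s \<ge> E s - E r - C * (s - r) * (\<epsilon> * (norm (g s))\<^sup>2 + (1 + \<bar>E r\<bar>) / \<epsilon>))))"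

lemma chain_rule_pairD:
  assumes "chain_rule_pair T C E0 w g E"
  shows "interval_function T w" "integrable lborel (\<lambda>s. (norm (w s))\<^sup>2)"
     "interval_function T g" "integrable lborel (\<lambda>s. (norm (g s))\<^sup>2)"
     "integrable lborel E" "\<And>s. s \<notin> {0<..<T} \<Longrightarrow> E s = 0"
     "\<And>\<epsilon>. \<epsilon> \<in> {0<..<1} \<Longrightarrow> AE s in lborel. s \<in> {0<..<T} \<longrightarrow>
          w s \<bullet> g s \<ge> E s - E0 - C * s * (\<epsilon> * (norm (g s))\<^sup>2 + (1 + \<bar>E0\<bar>) / \<epsilon>)"
     "\<And>\<epsilon>. \<epsilon> \<in> {0<..<1} \<Longrightarrow> AE s\<in>{0<..<T} in lborel. (AE r in lborel. 0 < r \<and> r < s \<longrightarrow>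
          w s \<bullet> g s - w r \<bullet> g s \<ge> E s - E r - C * (s - r) * (\<epsilon> * (norm (g s))\<^sup>2 + (1 + \<bar>E r\<bar>) / \<epsilon>))"
  using assms unfolding chain_rule_pair_def by blast+

lemma admissible_chain_rule_pair:
  fixes \<phi> :: "real \<Rightarrow> 'a::{real_inner,complete_space} \<Rightarrow> ereal"
  assumes T: "0 < T" and \<phi>: "\<And>t. t \<in> {0..T} \<Longrightarrow> proper_lsc_convex (\<phi> t)" and c: "0 \<le> c"
    and A: "\<And>s t z. s \<in> {0..T} \<Longrightarrow> t \<in> {0..T} \<Longrightarrow> s \<le> t \<Longrightarrow> z \<in> eff_dom (\<phi> s) \<Longrightarrow>
     \<exists>z'\<in>eff_dom (\<phi> t).
        norm (z' - z) \<le> c * \<bar>t - s\<bar> * sqrt (1 + \<bar>real_of_ereal (\<phi> s z)\<bar>) \<and>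
        \<phi> t z' \<le> \<phi> s z + ereal (c * \<bar>t - s\<bar> * (1 + \<bar>real_of_ereal (\<phi> s z)\<bar>))"
    and L: "\<And>s z. s \<in> {0..T} \<Longrightarrow> z \<in> eff_dom (\<phi> s) \<Longrightarrow> - L * (1 + norm z) \<le> real_of_ereal (\<phi> s z)"
    and u0: "u0 \<in> eff_dom (\<phi> 0)" and adm: "admissible T \<phi> u g"
  obtains w g' E where
    "chain_rule_pair T (2 * c) (real_of_ereal (\<phi> 0 u0)) w g' E"
    "AE s\<in>{0<..<T} in lborel. u s - u0 = w s"
    "AE s\<in>{0<..<T} in lborel. g s = g' s"
    "AE s\<in>{0<..<T} in lborel. energy \<phi> u s = E s"
    "AE s\<in>{0<..<T} in lborel. - L * (1 + norm (u0 + w s)) \<le> E s"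
proof -
  let ?I = "{0<..<T}"
  have Ib: "?I \<in> sets borel" by simp
  have uL: "u \<in> Lp 2 ?I" and gL: "g \<in> Lp 2 ?I" and en: "energy_L1 T \<phi> u"
    and ad: "AE t in lebesgue_on ?I. u t \<in> dom_subdiff (\<phi> t) \<and> g t \<in> subdiff (\<phi> t) (u t)"
    using adm by (auto simp: admissible_def)
  obtain u' where u': "interval_function T u'" "AE x in lborel. x \<in> ?I \<longrightarrow> u x = u' x"
    "integrable lborel (\<lambda>x. (norm (u' x))\<^sup>2)" by (rule Lp_representative[OF uL]) auto
  obtain g' where g': "interval_function T g'" "AE x in lborel. x \<in> ?I \<longrightarrow> g x = g' x"
    "integrable lborel (\<lambda>x. (norm (g' x))\<^sup>2)" by (rule Lp_representative[OF gL]) auto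
  have "energy \<phi> u \<in> borel_measurable (lebesgue_on ?I)"
    using en unfolding energy_L1_def by auto
  then have "simple_limit (lebesgue_on ?I) (energy \<phi> u)" by (rule simple_limit_real)
  then obtain \<sigma> where "\<And>i::nat. simple_function (lebesgue_on ?I) (\<sigma> i)"
    "\<And>x. x \<in> space (lebesgue_on ?I) \<Longrightarrow> (\<lambda>i. \<sigma> i x) \<longlonglongrightarrow> energy \<phi> u x"
    by (rule simple_limitE) blast
  then have "strongly_measurable (lebesgue_on ?I) (energy \<phi> u)"
    unfolding strongly_measurable_def by (intro exI[of _ \<sigma>] conjI allI AE_I2)
  then obtain E where E0: "simple_limit lborel E" and E: "\<And>x. x \<notin> ?I \<Longrightarrow> E x = 0"
    "AE x in lborel. x \<in> ?I \<longrightarrow> energy \<phi> u x = E x"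
    by (rule strongly_measurable_representative[OF Ib]) blast
  have Em: "E \<in> borel_measurable lborel" by (rule simple_limit_borel_measurable[OF E0])
  have Eind: "indicator ?I x * E x = E x" for x using E(1)[of x] by (auto simp: indicator_def)
  have Ei: "integrable lborel E"
    using integral_lebesgue_on_borel(1)[OF Ib Em E(2)] en unfolding energy_L1_def Eind by simp
  define w where "w s = indicator ?I s *\<^sub>R (u' s - u0)" for s
  have w: "interval_function T w"
    unfolding interval_function_def w_def
    by (intro conjI simple_limit_indicator simple_limit_diff simple_limit_const interval_functionD(1)[OF u'(1)]) auto
  have w2: "integrable lborel (\<lambda>s. (norm (w s))\<^sup>2)"
  proof (rule Bochner_Integration.integrable_bound)
    show "integrable lborel (\<lambda>s. 2 * (norm (u' s))\<^sup>2 + indicator ?I s * (2 * (norm u0)\<^sup>2))" using u'(3) by simp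
    have "(norm (w s))\<^sup>2 \<le> 2 * (norm (u' s))\<^sup>2 + indicator ?I s * (2 * (norm u0)\<^sup>2)" for s
    proof (cases "s \<in> ?I")
      case True
      have "(norm (u' s - u0))\<^sup>2 \<le> (norm (u' s) + norm u0)\<^sup>2" by (intro power_mono norm_triangle_ineq4) simp
      also have "\<dots> \<le> 2 * (norm (u' s))\<^sup>2 + 2 * (norm u0)\<^sup>2"
        using zero_le_power2[of "norm (u' s) - norm u0"]
        by (simp add: power2_diff power2_sum del: zero_le_power2)
      finally show ?thesis using True by (simp add: w_def)
    qed (simp add: w_def)
    then show "AE s in lborel. norm ((norm (w s))\<^sup>2) \<le> norm (2 * (norm (u' s))\<^sup>2 + indicator ?I s * (2 * (norm u0)\<^sup>2))"
      by (auto intro!: AE_I2 order_trans[OF _ abs_ge_self])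
  qed (use interval_functionD(4)[OF w] in simp)
  \<comment> \<open>All almost-everywhere properties are collected in one predicate, because two times \<open>s\<close> and \<open>r\<close> must be good simultaneously.\<close>
  define good where "good s \<longleftrightarrow> u s = u' s \<and> g s = g' s \<and> energy \<phi> u s = E s \<and> \<bar>\<phi> s (u s)\<bar> \<noteq> \<infinity> \<and>
    u s \<in> eff_dom (\<phi> s) \<and> g s \<in> subdiff (\<phi> s) (u s)" for s
  have ad': "AE s in lborel. s \<in> ?I \<longrightarrow> u s \<in> dom_subdiff (\<phi> s) \<and> g s \<in> subdiff (\<phi> s) (u s)"
    using ad unfolding AE_lebesgue_on_iff[OF Ib] .
  have fin': "AE s in lborel. s \<in> ?I \<longrightarrow> \<bar>\<phi> s (u s)\<bar> \<noteq> \<infinity>"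
    using en unfolding energy_L1_def AE_lebesgue_on_iff[OF Ib] by (rule conjunct1)
  have good: "AE s in lborel. s \<in> ?I \<longrightarrow> good s"
    using u'(2) g'(2) E(2) ad' fin' by eventually_elim (auto simp: good_def dom_subdiff_def)
  have Eg: "E s = real_of_ereal (\<phi> s (u s))" if "good s" for s using that by (auto simp: good_def energy_def)
  have wg: "w s = u s - u0" if "good s" "s \<in> ?I" for s using that by (auto simp: good_def w_def)
  have X: "AE s in lborel. s \<in> ?I \<longrightarrow>
          w s \<bullet> g' s \<ge> E s - real_of_ereal (\<phi> 0 u0) - 2 * c * s * (\<epsilon> * (norm (g' s))\<^sup>2 + (1 + \<bar>real_of_ereal (\<phi> 0 u0)\<bar>) / \<epsilon>)"
    if \<epsilon>: "\<epsilon> \<in> {0<..<1}" for \<epsilon>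
    using good
  proof eventually_elim
    case (elim s)
    show ?case
    proof
      assume s: "s \<in> ?I"
      then have gs: "good s" using elim by simp
      have "\<bar>\<phi> 0 u0\<bar> \<noteq> \<infinity>" using u0 \<phi>[of 0] T by (auto simp: eff_dom_def proper_lsc_convex_def)
      then have "(u s - u0) \<bullet> g s \<ge> real_of_ereal (\<phi> s (u s)) - real_of_ereal (\<phi> 0 u0)
         - 2 * c * (s - 0) * (\<epsilon> * (norm (g s))\<^sup>2 + (1 + \<bar>real_of_ereal (\<phi> 0 u0)\<bar>) / \<epsilon>)"
        by (intro subgradient_inequality_moving_time[OF c A]) (use s gs u0 \<epsilon> in \<open>auto simp: good_def\<close>)
      then show "w s \<bullet> g' s \<ge> E s - real_of_ereal (\<phi> 0 u0) - 2 * c * s * (\<epsilon> * (norm (g' s))\<^sup>2 + (1 + \<bar>real_of_ereal (\<phi> 0 u0)\<bar>) / \<epsilon>)"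
        using gs wg[OF gs s] Eg[OF gs] by (simp add: good_def)
    qed
  qed
  have XY: "AE s\<in>{0<..<T} in lborel. (AE r in lborel. 0 < r \<and> r < s \<longrightarrow>
          w s \<bullet> g' s - w r \<bullet> g' s \<ge> E s - E r - 2 * c * (s - r) * (\<epsilon> * (norm (g' s))\<^sup>2 + (1 + \<bar>E r\<bar>) / \<epsilon>))"
    if \<epsilon>: "\<epsilon> \<in> {0<..<1}" for \<epsilon>
    using good
  proof eventually_elim
    case (elim s)
    show ?case
    proof
      assume s: "s \<in> ?I"
      then have gs: "good s" using elim by simp
      show "AE r in lborel. 0 < r \<and> r < s \<longrightarrow>
          w s \<bullet> g' s - w r \<bullet> g' s \<ge> E s - E r - 2 * c * (s - r) * (\<epsilon> * (norm (g' s))\<^sup>2 + (1 + \<bar>E r\<bar>) / \<epsilon>)"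
        using good
      proof eventually_elim
        case (elim r)
        show ?case
        proof
          assume r: "0 < r \<and> r < s"
          then have rI: "r \<in> ?I" and gr: "good r" using elim s by auto
          have "(u s - u r) \<bullet> g s \<ge> real_of_ereal (\<phi> s (u s)) - real_of_ereal (\<phi> r (u r))
             - 2 * c * (s - r) * (\<epsilon> * (norm (g s))\<^sup>2 + (1 + \<bar>real_of_ereal (\<phi> r (u r))\<bar>) / \<epsilon>)"
            by (intro subgradient_inequality_moving_time[OF c A]) (use s r rI gs gr \<epsilon> in \<open>auto simp: good_def\<close>)
          moreover have "w s \<bullet> g' s - w r \<bullet> g' s = (u s - u r) \<bullet> g s"
            using gs wg[OF gs s] wg[OF gr rI] by (simp add: good_def inner_diff_left)
          ultimately show "w s \<bullet> g' s - w r \<bullet> g' s \<ge> E s - E r - 2 * c * (s - r) * (\<epsilon> * (norm (g' s))\<^sup>2 + (1 + \<bar>E r\<bar>) / \<epsilon>)"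
            using gs Eg[OF gs] Eg[OF gr] by (simp add: good_def)
        qed
      qed
    qed
  qed
  have "chain_rule_pair T (2 * c) (real_of_ereal (\<phi> 0 u0)) w g' E"
    unfolding chain_rule_pair_def using w w2 g'(1,3) Ei E(1) X XY by blast
  moreover have "AE s in lborel. s \<in> ?I \<longrightarrow> u s - u0 = w s"
    using good by eventually_elim (use wg in auto)
  moreover have "AE s in lborel. s \<in> ?I \<longrightarrow> - L * (1 + norm (u0 + w s)) \<le> E s"
    using good
  proof eventually_elim
    case (elim s)
    show ?case
    proof
      assume s: "s \<in> ?I"
      then have gs: "good s" using elim by simp
      have "- L * (1 + norm (u s)) \<le> real_of_ereal (\<phi> s (u s))"
        by (rule L) (use gs s in \<open>auto simp: good_def\<close>)
      then show "- L * (1 + norm (u0 + w s)) \<le> E s" using Eg[OF gs] wg[OF gs s] by simp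
    qed
  qed
  ultimately show thesis using that g'(2) E(2) by blast
qed

text \<open>
  The scalar inequality applies on \<open>(0,t)\<close> with all data cut off at \<open>t\<close>; causality of the convolution makes the cut-off
  harmless. The pairing \<open>b\<close> is left abstract because it will come from different representations of the derivative.
\<close>

lemma absolutely_continuous_kernel_inequality:
  fixes w g :: "real \<Rightarrow> 'a::real_inner"
  assumes pair: "chain_rule_pair T C E0 w g E" and C: "0 \<le> C"
    and m: "integrable lborel m" "\<And>r. r \<notin> {0<..<T} \<Longrightarrow> m r = 0" "\<And>r. 0 \<le> m r"
    and \<kappa>: "\<And>r. r \<in> {0<..<T} \<Longrightarrow> \<kappa> r = a - primitive m r" "\<And>r. r \<in> {0<..<T} \<Longrightarrow> 0 \<le> \<kappa> r"
    and t: "t \<in> {0<..T}" and \<epsilon>: "\<epsilon> \<in> {0<..<1}"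
    and N: "(LBINT r. indicator {0<..<t} r * \<kappa> r) \<le> N"
    and b: "integrable lborel (\<lambda>s. indicator {0<..<t} s * b s)"
    and rep: "AE s\<in>{0<..<t} in lborel. integrable lborel (\<lambda>r. m (s - r) * (w r \<bullet> g s)) \<and>
        b s = a * (w s \<bullet> g s) - (LBINT r. m (s - r) * (w r \<bullet> g s))"
  shows "(LBINT s. indicator {0<..<t} s * b s) \<ge>
      (LBINT r. indicator {0<..<t} r * (\<kappa> (t - r) * E r)) - E0 * (LBINT r. indicator {0<..<t} r * \<kappa> r)
      - \<epsilon> * C * N * (LBINT s. indicator {0<..<t} s * (norm (g s))\<^sup>2) - C / \<epsilon> * t * N * (1 + \<bar>E0\<bar>)
      - C / \<epsilon> * N * (LBINT s. indicator {0<..<t} s * \<bar>E s\<bar>)"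
proof -
  note P = chain_rule_pairD[OF pair]
  let ?i = "indicat_real {0<..<t}"
  define m' where "m' r = ?i r * m r" for r
  define E' where "E' r = ?i r * E r" for r
  define G where "G r = ?i r * (norm (g r))\<^sup>2" for r
  have prim: "primitive m' r = primitive m r" if "r \<le> t" for r
    unfolding primitive_def m'_def
    by (rule Bochner_Integration.integral_cong[OF refl]) (use that in \<open>auto simp: indicator_def\<close>)
  have ind\<kappa>: "?i r * (a - primitive m' r) = ?i r * \<kappa> r" for r
    using prim[of r] \<kappa>(1)[of r] t by (auto simp: indicator_def)
  have mY: "m' (s - r) * (w r \<bullet> g s) = m (s - r) * (w r \<bullet> g s)" if "s \<in> {0<..<t}" for s r
    using interval_functionD(2)[OF P(1), of r] m(2)[of "s - r"] that
    by (cases "r \<le> 0"; cases "s \<le> r") (auto simp: m'_def indicator_def)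
  have abs: "(LBINT s. \<bar>E' s\<bar>) = (LBINT s. ?i s * \<bar>E s\<bar>)"
    unfolding E'_def by (simp add: abs_mult)
  have conv: "(a - primitive m' (t - r)) * E' r = ?i r * (\<kappa> (t - r) * E r)" for r
    using prim[of "t - r"] \<kappa>(1)[of "t - r"] t by (auto simp: E'_def indicator_def)
  have "(LBINT s. indicator {0<..<t} s * b s) \<ge>
      (LBINT r. (a - primitive m' (t - r)) * E' r) - E0 * (LBINT r. indicator {0<..<t} r * (a - primitive m' r))
      - \<epsilon> * C * N * (LBINT s. G s) - C / \<epsilon> * t * N * (1 + \<bar>E0\<bar>) - C / \<epsilon> * N * (LBINT s. \<bar>E' s\<bar>)"
  proof (rule chain_rule_inequality[where X="\<lambda>s. w s \<bullet> g s" and Y="\<lambda>s r. w r \<bullet> g s"])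
    show "0 < t" "0 < \<epsilon>" "0 \<le> C" using t \<epsilon> C by auto
    show "integrable lborel m'" unfolding m'_def by (rule integrable_indicator_mult[OF m(1)]) simp
    show "integrable lborel E'" unfolding E'_def by (rule integrable_indicator_mult[OF P(5)]) simp
    show "integrable lborel G" unfolding G_def by (rule integrable_indicator_mult[OF P(4)]) simp
    show "m' r = 0" "E' r = 0" "G r = 0" if "r \<notin> {0<..<t}" for r
      using that by (simp_all add: m'_def E'_def G_def)
    show "0 \<le> m' r" "0 \<le> G r" for r using m(3) by (simp_all add: m'_def G_def)
    show "0 \<le> a - primitive m' r" if "0 < r" "r < t" for r
      using prim[of r] \<kappa>[of r] t that by simp
    show "(LBINT r. indicator {0<..<t} r * (a - primitive m' r)) \<le> N" unfolding ind\<kappa> by (rule N)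
    show "integrable lborel (\<lambda>s. indicator {0<..<t} s * b s)" by (rule b)
    show "w r \<bullet> g s = 0" if "r \<le> 0" for r s using interval_functionD(2)[OF P(1), of r] that by simp
    show "AE s\<in>{0<..<t} in lborel. integrable lborel (\<lambda>r. m' (s - r) * (w r \<bullet> g s)) \<and>
        b s = a * (w s \<bullet> g s) - (LBINT r. m' (s - r) * (w r \<bullet> g s))"
      using rep
    proof eventually_elim
      case (elim s)
      have "(\<lambda>r. m' (s - r) * (w r \<bullet> g s)) = (\<lambda>r. m (s - r) * (w r \<bullet> g s))" if "s \<in> {0<..<t}"
        using mY[OF that] by (rule ext)
      then show ?case using elim by simp
    qed
    show "AE s\<in>{0<..<t} in lborel. w s \<bullet> g s \<ge> E' s - E0 - C * s * (\<epsilon> * G s + (1 + \<bar>E0\<bar>) / \<epsilon>)"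
      using P(7)[OF \<epsilon>] by eventually_elim (use t in \<open>auto simp: E'_def G_def\<close>)
    show "AE s\<in>{0<..<t} in lborel. (AE r in lborel. 0 < r \<and> r < s \<longrightarrow>
        w s \<bullet> g s - w r \<bullet> g s \<ge> E' s - E' r - C * (s - r) * (\<epsilon> * G s + (1 + \<bar>E' r\<bar>) / \<epsilon>))"
      using P(8)[OF \<epsilon>]
    proof eventually_elim
      case (elim s)
      show ?case
      proof
        assume s: "s \<in> {0<..<t}"
        then have "AE r in lborel. 0 < r \<and> r < s \<longrightarrow>
          w s \<bullet> g s - w r \<bullet> g s \<ge> E s - E r - C * (s - r) * (\<epsilon> * (norm (g s))\<^sup>2 + (1 + \<bar>E r\<bar>) / \<epsilon>)"
          using elim t by auto
        then show "AE r in lborel. 0 < r \<and> r < s \<longrightarrow>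
          w s \<bullet> g s - w r \<bullet> g s \<ge> E' s - E' r - C * (s - r) * (\<epsilon> * G s + (1 + \<bar>E' r\<bar>) / \<epsilon>)"
          by eventually_elim (use s in \<open>auto simp: E'_def G_def\<close>)
      qed
    qed
  qed
  then show ?thesis unfolding conv ind\<kappa> abs G_def .
qed

lemma interval_functions_inner_integrable:
  fixes f g :: "real \<Rightarrow> 'a::real_inner"
  assumes f: "interval_function T f" "integrable lborel (\<lambda>s. (norm (f s))\<^sup>2)"
    and g: "interval_function T g" "integrable lborel (\<lambda>s. (norm (g s))\<^sup>2)"
  shows "integrable lborel (\<lambda>s. f s \<bullet> g s)"
proof (rule Bochner_Integration.integrable_bound)
  show "integrable lborel (\<lambda>s. (norm (f s))\<^sup>2 + (norm (g s))\<^sup>2)" using f g by simp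
  show "(\<lambda>s. f s \<bullet> g s) \<in> borel_measurable lborel"
    by (rule borel_measurable_inner_simple_limit[OF interval_functionD(1)[OF f(1)] interval_functionD(1)[OF g(1)]])
  have "\<bar>f s \<bullet> g s\<bar> \<le> (norm (f s))\<^sup>2 + (norm (g s))\<^sup>2" for s
  proof -
    have "\<bar>f s \<bullet> g s\<bar> \<le> norm (f s) * norm (g s)" by (rule Cauchy_Schwarz_ineq2)
    also have "\<dots> \<le> (norm (f s))\<^sup>2 + (norm (g s))\<^sup>2"
      using zero_le_power2[of "norm (f s) - norm (g s)"] mult_nonneg_nonneg[OF norm_ge_zero norm_ge_zero, of "f s" "g s"]
      unfolding power2_diff by linarith
    finally show ?thesis .
  qed
  then show "AE s in lborel. norm (f s \<bullet> g s) \<le> norm ((norm (f s))\<^sup>2 + (norm (g s))\<^sup>2)"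
    by (auto intro!: AE_I2 order_trans[OF _ abs_ge_self])
qed

text \<open>
  The inequality involves \<open>u\<close>, \<open>g\<close> and the energy only through their equivalence classes, so it may be verified for the representatives.
\<close>

lemma star_ineq_from_representatives:
  fixes \<phi> :: "real \<Rightarrow> 'a::{real_inner,complete_space} \<Rightarrow> ereal"
  assumes t: "t \<in> {0<..T}"
    and g: "interval_function T g'" "integrable lborel (\<lambda>s. (norm (g' s))\<^sup>2)" "AE s\<in>{0<..<T} in lborel. g s = g' s"
    and E: "E \<in> borel_measurable borel" "AE s\<in>{0<..<T} in lborel. energy \<phi> u s = E s"
    and k: "integrable lborel kb" "\<And>r. r \<in> {0<..<T} \<Longrightarrow> k r = kb r" "\<And>r. r \<notin> {0<..<T} \<Longrightarrow> kb r = 0" "\<And>r. 0 \<le> kb r"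
    and W: "vec_conv k (\<lambda>s. u s - u0) \<in> W1p 2 T"
    and B: "interval_function T B" "integrable lborel (\<lambda>s. (norm (B s))\<^sup>2)"
      "AE s\<in>{0<..<T} in lborel. weak_derivative T (vec_conv k (\<lambda>s. u s - u0)) s = B s"
    and kE: "integrable lborel (\<lambda>s. indicator {0<..<t} s * (kb (t - s) * E s))"
    and ineq: "(LBINT s. indicator {0<..<t} s * (B s \<bullet> g' s)) \<ge>
      (LBINT r. indicator {0<..<t} r * (kb (t - r) * E r))
      - real_of_ereal (\<phi> 0 u0) * (LBINT r. indicator {0<..<t} r * kb r)
      - \<epsilon> * c * (LBINT r. kb r) * (LBINT s. indicator {0<..<t} s * (norm (g' s))\<^sup>2)
      - c / \<epsilon> * t * (LBINT r. kb r) * (1 + \<bar>real_of_ereal (\<phi> 0 u0)\<bar>)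
      - c / \<epsilon> * (LBINT r. kb r) * (LBINT s. indicator {0<..<t} s * \<bar>E s\<bar>)"
  shows "star_ineq T \<phi> u0 c k u g \<epsilon> t"
proof -
  have tb: "{0<..<t} \<in> sets borel" "{0<..<T} \<in> sets borel" by auto
  have [measurable]: "kb \<in> borel_measurable borel" using k(1) by auto
  note [measurable] = E(1) interval_functionD(4)[OF g(1)]
  note Bg = interval_functions_inner_integrable[OF B(1,2) g(1,2)]
  have T': "s \<in> {0<..<T}" if "s \<in> {0<..<t}" for s using that t by auto
  have a1: "AE s\<in>{0<..<t} in lborel. weak_derivative T (vec_conv k (\<lambda>s. u s - u0)) s \<bullet> g s = B s \<bullet> g' s"
    using B(3) g(3) by eventually_elim (use T' in auto)
  note i1 = integral_lebesgue_on_borel[OF tb(1) borel_measurable_integrable[OF Bg] a1]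
  have a2: "AE s\<in>{0<..<t} in lborel. k (t - s) * energy \<phi> u s = kb (t - s) * E s"
    using E(2) by eventually_elim (use T' k(2) t in auto)
  have i2: "integrable (lebesgue_on {0<..<t}) (\<lambda>s. k (t - s) * energy \<phi> u s)
        = integrable lborel (\<lambda>s. indicator {0<..<t} s * (kb (t - s) * E s))"
    "conv k (energy \<phi> u) t = (LBINT s. indicator {0<..<t} s * (kb (t - s) * E s))"
    unfolding conv_def by (rule integral_lebesgue_on_borel[OF tb(1) _ a2], measurable)+
  have a3: "AE s\<in>{0<..<t} in lborel. k s = kb s" using T' k(2) by auto
  have i3: "(\<integral>s. k s \<partial>lebesgue_on {0<..<t}) = (LBINT s. indicator {0<..<t} s * kb s)"
    by (rule integral_lebesgue_on_borel(2)[OF tb(1) _ a3]) measurable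
  have a4: "AE s\<in>{0<..<T} in lborel. \<bar>k s\<bar> = kb s" using k(2,4) by auto
  have "L1_norm T k = (LBINT s. indicator {0<..<T} s * kb s)"
    unfolding L1_norm_def by (rule integral_lebesgue_on_borel(2)[OF tb(2) _ a4]) measurable
  also have "\<dots> = (LBINT r. kb r)"
    by (rule Bochner_Integration.integral_cong[OF refl]) (use k(3) in \<open>auto simp: indicator_def\<close>)
  finally have i4: "L1_norm T k = (LBINT r. kb r)" .
  have a5: "AE s\<in>{0<..<t} in lborel. (norm (g s))\<^sup>2 = (norm (g' s))\<^sup>2"
    using g(3) by eventually_elim (use T' in auto)
  have i5: "(\<integral>s. (norm (g s))\<^sup>2 \<partial>lebesgue_on {0<..<t}) = (LBINT s. indicator {0<..<t} s * (norm (g' s))\<^sup>2)"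
    by (rule integral_lebesgue_on_borel(2)[OF tb(1) _ a5]) measurable
  have a6: "AE s\<in>{0<..<t} in lborel. \<bar>energy \<phi> u s\<bar> = \<bar>E s\<bar>"
    using E(2) by eventually_elim (use T' in auto)
  have i6: "(\<integral>s. \<bar>energy \<phi> u s\<bar> \<partial>lebesgue_on {0<..<t}) = (LBINT s. indicator {0<..<t} s * \<bar>E s\<bar>)"
    by (rule integral_lebesgue_on_borel(2)[OF tb(1) _ a6]) measurable
  have "terms_exist T \<phi> u0 k u g t"
    unfolding terms_exist_def i1(1) i2(1) using W kE integrable_indicator_mult[OF Bg tb(1)] by blast
  then show "star_ineq T \<phi> u0 c k u g \<epsilon> t"
    unfolding star_ineq_def i1(2) i2(2) i3 i4 i5 i6 using ineq by blast
qed

text \<open>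
  A Sobolev kernel equals its continuous representative almost everywhere; monotonicity upgrades this to every
  point of the open interval.
\<close>

lemma antimono_AE_eq_continuous:
  fixes k P :: "real \<Rightarrow> real"
  assumes k: "antimono_on {0<..<T} k" and P: "continuous_on UNIV P"
    and ae: "AE s\<in>{0<..<T} in lborel. k s = P s" and s: "s \<in> {0<..<T}"
  shows "k s = P s"
proof -
  have Pc: "isCont P s" using P by (simp add: continuous_on_eq_continuous_at)
  have "\<not> P s < k s"
  proof
    assume "P s < k s"
    then obtain d where d: "d > 0" "\<And>y. dist y s < d \<Longrightarrow> dist (P y) (P s) < k s - P s"
      using Pc unfolding continuous_at_eps_delta by (metis diff_gt_0_iff_gt)
    obtain y where y: "max 0 (s - d) < y" "y < s" "k y = P y"
      by (rule AE_interval_witness[OF ae, of "max 0 (s - d)" s]) (use s d(1) in auto)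
    have "k s \<le> k y" using monotone_onD[OF k, of y s] y s by auto
    moreover have "dist (P y) (P s) < k s - P s" using y by (intro d) (auto simp: dist_real_def)
    ultimately show False using y by (auto simp: dist_real_def)
  qed
  moreover have "\<not> k s < P s"
  proof
    assume "k s < P s"
    then obtain d where d: "d > 0" "\<And>y. dist y s < d \<Longrightarrow> dist (P y) (P s) < P s - k s"
      using Pc unfolding continuous_at_eps_delta by (metis diff_gt_0_iff_gt)
    obtain y where y: "s < y" "y < min T (s + d)" "k y = P y"
      by (rule AE_interval_witness[OF ae, of s "min T (s + d)"]) (use s d(1) in auto)
    have "k y \<le> k s" using monotone_onD[OF k, of s y] y s by auto
    moreover have "dist (P y) (P s) < P s - k s" using y by (intro d) (auto simp: dist_real_def)
    ultimately show False using y by (auto simp: dist_real_def)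
  qed
  ultimately show ?thesis by simp
qed

text \<open>
  The weak derivative \<open>v\<close> of a nonincreasing kernel is nonpositive almost everywhere, because its primitive is nonincreasing on
  \<open>[0,T]\<close>.
\<close>

lemma W11_antimono_representation:
  assumes T: "0 < T" and k: "k \<in> W1p 1 T" "antimono_on {0<..<T} k"
  obtains a m where "integrable lborel m" "\<And>r. r \<notin> {0<..<T} \<Longrightarrow> m r = 0" "\<And>r. 0 \<le> m r"
    "\<And>s. s \<in> {0<..<T} \<Longrightarrow> k s = a - primitive m s"
proof -
  obtain k' v where k': "AE x\<in>{0<..<T} in lborel. k x = k' x"
    and v: "interval_function T v" "integrable lborel (\<lambda>x. norm (v x))"
    and P0: "\<And>c. \<exists>C. AE s\<in>{0<..<T} in lborel. k' s \<bullet> c = C + primitive (\<lambda>r. v r \<bullet> c) s"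
    by (rule W1p_representatives[OF T k(1)]) auto
  have vi: "integrable lborel v" using inner_interval_function(1)[OF v, where c=1] by simp
  obtain C where C: "AE s\<in>{0<..<T} in lborel. k' s = C + primitive v s" using P0[of 1] by auto
  have kP: "k s = C + primitive v s" if "s \<in> {0<..<T}" for s
  proof (rule antimono_AE_eq_continuous[OF k(2) _ _ that])
    show "continuous_on UNIV (\<lambda>s. C + primitive v s)" by (intro continuous_intros primitive_continuous vi)
    show "AE s\<in>{0<..<T} in lborel. k s = C + primitive v s"
      using k' C by eventually_elim auto
  qed
  have mono: "primitive v y \<le> primitive v x" if xy: "0 \<le> x" "x < y" "y \<le> T" for x y
  proof -
    \<comment> \<open>Shifts into the open interval, where \<open>k\<close> is known; at most a third of the length, so that the shifted points keep their order.\<close>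
    define d where "d n = (y - x) / 3 * inverse (real (Suc n))" for n
    have d: "0 < d n" "d n \<le> (y - x) / 3" for n
    proof -
      have "inverse (real (Suc n)) \<le> 1" by (simp add: field_simps)
      then show "d n \<le> (y - x) / 3" unfolding d_def using xy by (intro mult_left_le) auto
    qed (use xy in \<open>simp add: d_def\<close>)
    have d0: "d \<longlonglongrightarrow> 0" unfolding d_def by (rule tendsto_mult_right_zero[OF LIMSEQ_inverse_real_of_nat])
    have cont: "isCont (primitive v) z" for z
      using primitive_continuous[OF vi] by (simp add: continuous_on_eq_continuous_at)
    have "(\<lambda>n. primitive v (x + d n)) \<longlonglongrightarrow> primitive v (x + 0)"
      by (intro isCont_tendsto_compose[OF cont] tendsto_intros d0)
    moreover have "(\<lambda>n. primitive v (y - d n)) \<longlonglongrightarrow> primitive v (y - 0)"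
      by (intro isCont_tendsto_compose[OF cont] tendsto_intros d0)
    moreover have "primitive v (y - d n) \<le> primitive v (x + d n)" for n
    proof -
      have I: "x + d n \<in> {0<..<T}" "y - d n \<in> {0<..<T}" "x + d n \<le> y - d n"
        using d[of n] xy by (auto simp: field_simps)
      then have "k (y - d n) \<le> k (x + d n)" using k(2) by (simp add: monotone_on_def)
      then show ?thesis using kP[OF I(1)] kP[OF I(2)] by simp
    qed
    ultimately show ?thesis by (auto intro: LIMSEQ_le)
  qed
  have "AE x in lborel. 0 \<le> - v x"
  proof (rule AE_nonneg_if_interval_integrals_nonneg[of _ T])
    show "integrable lborel (\<lambda>x. - v x)" using vi by simp
    show "- v x = 0" if "\<bar>x\<bar> > T" for x
      using interval_functionD(2)[OF v(1), of x] that by (cases "x \<in> {0<..<T}") auto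
    show "0 \<le> (LBINT x. indicator {\<alpha><..<\<beta>} x * - v x)" if "\<alpha> < \<beta>" for \<alpha> \<beta>
      using interval_integral_eq_primitive_diff[OF T vi interval_functionD(2)[OF v(1)] that]
        mono[of "min T (max 0 \<alpha>)" "min T (max 0 \<beta>)"] T that
      by (cases "min T (max 0 \<alpha>) = min T (max 0 \<beta>)") (auto simp: min_def max_def split: if_splits)
  qed
  then have ae: "AE x in lborel. max 0 (- v x) = - v x" by eventually_elim auto
  define m where "m x = max 0 (- v x)" for x
  have mi: "integrable lborel m" unfolding m_def using vi by auto
  have "primitive m s = - primitive v s" for s
  proof -
    have "primitive m s = (LBINT r. - (indicator {0<..<s} r * v r))"
      unfolding primitive_def
      by (rule integral_cong_AE) (use ae vi mi in \<open>auto simp: m_def elim!: eventually_mono\<close>)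
    then show ?thesis by (simp add: primitive_def)
  qed
  then have "k s = C - primitive m s" if "s \<in> {0<..<T}" for s using kP[OF that] by simp
  moreover have "m r = 0" if "r \<notin> {0<..<T}" for r using interval_functionD(2)[OF v(1) that] by (simp add: m_def)
  ultimately show thesis using that[of m C] mi by (auto simp: m_def)
qed

text \<open>
  Here the pairing is that of the weak derivative itself, and the bound \<open>N\<close> on \<open>\<integral>\<^sub>0\<^sup>t k\<close> is the \<open>L\<^sup>1\<close> norm.
\<close>

lemma star_ineq_W11:
  fixes \<phi> :: "real \<Rightarrow> 'a::{real_inner,complete_space} \<Rightarrow> ereal"
  assumes t: "t \<in> {0<..T}" and \<epsilon>: "\<epsilon> \<in> {0<..<1}" and C: "0 \<le> C"
    and pair: "chain_rule_pair T C (real_of_ereal (\<phi> 0 u0)) w g' E"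
    and w: "AE s\<in>{0<..<T} in lborel. u s - u0 = w s"
    and g: "AE s\<in>{0<..<T} in lborel. g s = g' s"
    and E: "AE s\<in>{0<..<T} in lborel. energy \<phi> u s = E s"
    and k: "k \<in> W1p 1 T" "\<And>s. s \<in> {0<..<T} \<Longrightarrow> 0 \<le> k s" "antimono_on {0<..<T} k"
  shows "star_ineq T \<phi> u0 C k u g \<epsilon> t"
proof -
  note P = chain_rule_pairD[OF pair]
  have T: "0 < T" using t by simp
  obtain a m where m: "integrable lborel m" "\<And>r. r \<notin> {0<..<T} \<Longrightarrow> m r = 0" "\<And>r. 0 \<le> m r"
    and km: "\<And>s. s \<in> {0<..<T} \<Longrightarrow> k s = a - primitive m s"
    by (rule W11_antimono_representation[OF T k(1,3)]) blast
  note [measurable] = borel_measurable_integrable[OF m(1)] primitive_borel[OF m(1)] borel_measurable_integrable[OF P(5)]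
  define kb where "kb r = indicator {0<..<T} r * (a - primitive m r)" for r
  have kb0: "0 \<le> kb r" for r using k(2)[of r] km[of r] by (cases "r \<in> {0<..<T}") (simp_all add: kb_def)
  define Mx where "Mx = \<bar>a\<bar> + (LBINT r. \<bar>m r\<bar>)"
  have kbM: "\<bar>kb r\<bar> \<le> Mx" for r
    using primitive_bound[OF m(1), of r] primitive_bound[OF m(1), of 0] unfolding kb_def Mx_def
    by (cases "r \<in> {0<..<T}") (auto simp: abs_if split: if_splits)
  have [measurable]: "kb \<in> borel_measurable borel" unfolding kb_def[abs_def] by measurable
  have kbi: "integrable lborel kb"
  proof (rule Bochner_Integration.integrable_bound)
    show "integrable lborel (\<lambda>r. indicator {0<..<T} r * Mx)" by simp
    have "\<bar>kb r\<bar> \<le> \<bar>indicator {0<..<T} r * Mx\<bar>" for r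
      using kbM[of r] by (cases "r \<in> {0<..<T}") (auto simp: kb_def)
    then show "AE r in lborel. norm (kb r) \<le> norm (indicator {0<..<T} r * Mx)" by simp
  qed simp
  obtain B where B: "interval_function T B" "integrable lborel (\<lambda>x. (norm (B x))\<^sup>2)"
    "vec_conv k (\<lambda>s. u s - u0) \<in> W1p 2 T"
    "AE x\<in>{0<..<T} in lborel. weak_derivative T (vec_conv k (\<lambda>s. u s - u0)) x = B x"
    "AE s\<in>{0<..<T} in lborel. integrable lborel (\<lambda>r. \<bar>m (s - r)\<bar> * norm (w r)) \<and>
       (\<forall>c. B s \<bullet> c = a * (w s \<bullet> c) - (LBINT r. m (s - r) * (w r \<bullet> c)))"
    by (rule absolutely_continuous_kernel_W1p[OF T m(1,2) km P(1) w P(2)])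
  show ?thesis
  proof (rule star_ineq_from_representatives[OF t P(3,4) g _ E kbi _ _ kb0 B(3) B(1,2,4)])
    show "E \<in> borel_measurable borel" by measurable
    show "k r = kb r" if "r \<in> {0<..<T}" for r using km[OF that] that by (simp add: kb_def)
    show "kb r = 0" if "r \<notin> {0<..<T}" for r using that by (simp add: kb_def)
    have "integrable lborel (\<lambda>s. kb (t - s) * E s)"
    proof (rule Bochner_Integration.integrable_bound[OF integrable_mult_right[OF P(5), of Mx]])
      have "\<bar>kb (t - s)\<bar> * \<bar>E s\<bar> \<le> \<bar>Mx\<bar> * \<bar>E s\<bar>" for s
        using kbM[of "t - s"] by (intro mult_right_mono) auto
      then show "AE s in lborel. norm (kb (t - s) * E s) \<le> norm (Mx * E s)" by (simp add: abs_mult)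
    qed measurable
    then show "integrable lborel (\<lambda>s. indicator {0<..<t} s * (kb (t - s) * E s))"
      by (rule integrable_indicator_mult) simp
    show "(LBINT r. indicator {0<..<t} r * (kb (t - r) * E r))
      - real_of_ereal (\<phi> 0 u0) * (LBINT r. indicator {0<..<t} r * kb r)
      - \<epsilon> * C * (LBINT r. kb r) * (LBINT s. indicator {0<..<t} s * (norm (g' s))\<^sup>2)
      - C / \<epsilon> * t * (LBINT r. kb r) * (1 + \<bar>real_of_ereal (\<phi> 0 u0)\<bar>)
      - C / \<epsilon> * (LBINT r. kb r) * (LBINT s. indicator {0<..<t} s * \<bar>E s\<bar>)
      \<le> (LBINT s. indicator {0<..<t} s * (B s \<bullet> g' s))"
    proof (rule absolutely_continuous_kernel_inequality[OF pair C m _ kb0 t \<epsilon>])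
      show "kb r = a - primitive m r" if "r \<in> {0<..<T}" for r using that by (simp add: kb_def)
      show "(LBINT r. indicator {0<..<t} r * kb r) \<le> (LBINT r. kb r)"
        by (rule Bochner_Integration.integral_mono'[OF kbi]) (use kb0 in \<open>auto simp: indicator_def\<close>)
      show "integrable lborel (\<lambda>s. indicator {0<..<t} s * (B s \<bullet> g' s))"
        by (rule integrable_indicator_mult[OF interval_functions_inner_integrable[OF B(1,2) P(3,4)]]) simp
      show "AE s\<in>{0<..<t} in lborel. integrable lborel (\<lambda>r. m (s - r) * (w r \<bullet> g' s)) \<and>
        B s \<bullet> g' s = a * (w s \<bullet> g' s) - (LBINT r. m (s - r) * (w r \<bullet> g' s))"
        using B(5)
      proof eventually_elim
        case (elim s)
        show ?case
        proof
          assume "s \<in> {0<..<t}"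
          then have s: "s \<in> {0<..<T}" using t by auto
          then have i: "integrable lborel (\<lambda>r. \<bar>m (s - r)\<bar> * norm (w r))" using elim by simp
          have "integrable lborel (\<lambda>r. m (s - r) * (w r \<bullet> g' s))"
          proof (rule Bochner_Integration.integrable_bound[OF integrable_mult_left[OF i, of "norm (g' s)"]])
            have "(\<lambda>r. w r \<bullet> g' s) \<in> borel_measurable borel"
              using borel_measurable_inner_simple_limit[OF interval_functionD(1)[OF P(1)] simple_limit_const] by simp
            then show "(\<lambda>r. m (s - r) * (w r \<bullet> g' s)) \<in> borel_measurable lborel" by measurable
            have "\<bar>m (s - r)\<bar> * \<bar>w r \<bullet> g' s\<bar> \<le> \<bar>m (s - r)\<bar> * (norm (w r) * norm (g' s))" for r
              by (intro mult_left_mono Cauchy_Schwarz_ineq2) auto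
            then show "AE r in lborel. norm (m (s - r) * (w r \<bullet> g' s)) \<le> norm (\<bar>m (s - r)\<bar> * norm (w r) * norm (g' s))"
              by (simp add: abs_mult mult.assoc)
          qed
          then show "integrable lborel (\<lambda>r. m (s - r) * (w r \<bullet> g' s)) \<and>
            B s \<bullet> g' s = a * (w s \<bullet> g' s) - (LBINT r. m (s - r) * (w r \<bullet> g' s))" using elim s by simp
        qed
      qed
    qed
  qed
qed

section \<open>Completely positive kernel pairs on a bounded interval\<close>

lemma line_conv_commute: "line_conv a b s = line_conv b a s"
  unfolding line_conv_def using lborel_integral_real_affine[of "-1" "\<lambda>r. a (s - r) * b r" s]
  by (simp add: mult.commute)

text \<open>
  Associativity holds at almost every \<open>s\<close>. The exceptional set depends only on the majorant \<open>X\<close>, so that it serves all functions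
  \<open>r \<mapsto> B r \<bullet> c\<close> at once, with \<open>X = norm \<circ> B\<close>.
\<close>

lemma line_conv_assoc_dominated:
  fixes a b X :: "real \<Rightarrow> real"
  assumes a: "integrable lborel a" and b: "integrable lborel b" and X: "integrable lborel X"
  shows "AE s in lborel. \<forall>x\<in>borel_measurable borel. (\<exists>K. \<forall>r. \<bar>x r\<bar> \<le> K * X r) \<longrightarrow>
      line_conv a (line_conv b x) s = line_conv (line_conv a b) x s"
proof -
  have aa: "integrable lborel (\<lambda>r. \<bar>a r\<bar>)" "integrable lborel (\<lambda>r. \<bar>b r\<bar>)" using a b by auto
  note [measurable] = borel_measurable_integrable[OF a] borel_measurable_integrable[OF b] borel_measurable_integrable[OF X]
  note bX = line_conv_integrable[OF aa(2) X]
  from line_conv_integrable(2)[OF aa(1) bX(1)] show ?thesis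
  proof eventually_elim
    case (elim s)
    show ?case
    proof (intro ballI impI)
      fix x :: "real \<Rightarrow> real" assume [measurable]: "x \<in> borel_measurable borel" and "\<exists>K. \<forall>r. \<bar>x r\<bar> \<le> K * X r"
      then obtain K where K: "\<And>r. \<bar>x r\<bar> \<le> K * X r" by blast
      have ae: "AE q in lborel. integrable lborel (\<lambda>r. a (s - q) * (b (q - r) * x r))"
        using bX(2)
      proof eventually_elim
        case (elim q)
        show ?case
        proof (rule Bochner_Integration.integrable_bound[OF integrable_mult_right[OF elim, of "a (s - q) * K"]])
          have "\<bar>a (s - q) * (b (q - r) * x r)\<bar> \<le> \<bar>a (s - q) * K * (\<bar>b (q - r)\<bar> * X r)\<bar>" for r
          proof -
            have "\<bar>x r\<bar> \<le> \<bar>K * X r\<bar>" using K[of r] by linarith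
            then have "(\<bar>a (s - q)\<bar> * \<bar>b (q - r)\<bar>) * \<bar>x r\<bar> \<le> (\<bar>a (s - q)\<bar> * \<bar>b (q - r)\<bar>) * \<bar>K * X r\<bar>"
              by (intro mult_left_mono) auto
            then show ?thesis by (simp add: abs_mult mult_ac)
          qed
          then show "AE r in lborel. norm (a (s - q) * (b (q - r) * x r)) \<le> norm (a (s - q) * K * (\<bar>b (q - r)\<bar> * X r))" by simp
        qed measurable
      qed
      have I: "integrable (lborel \<Otimes>\<^sub>M lborel) (\<lambda>(q, r). a (s - q) * (b (q - r) * x r))"
      proof (rule lborel_pair.Fubini_integrable)
        show "AE q in lborel. integrable lborel (\<lambda>r. case (q, r) of (q, r) \<Rightarrow> a (s - q) * (b (q - r) * x r))"
          using ae by simp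
        show "integrable lborel (\<lambda>q. LBINT r. norm (case (q, r) of (q, r) \<Rightarrow> a (s - q) * (b (q - r) * x r)))"
        proof (rule Bochner_Integration.integrable_bound[OF integrable_mult_right[OF elim, of K]])
          show "AE q in lborel. norm (LBINT r. norm (case (q, r) of (q, r) \<Rightarrow> a (s - q) * (b (q - r) * x r)))
             \<le> norm (K * (\<bar>a (s - q)\<bar> * line_conv (\<lambda>r. \<bar>b r\<bar>) X q))"
            using bX(2)
          proof eventually_elim
            case (elim q)
            have "(LBINT r. norm (a (s - q) * (b (q - r) * x r))) \<le> (LBINT r. (K * \<bar>a (s - q)\<bar>) * (\<bar>b (q - r)\<bar> * X r))"
            proof (rule Bochner_Integration.integral_mono')
              show "integrable lborel (\<lambda>r. (K * \<bar>a (s - q)\<bar>) * (\<bar>b (q - r)\<bar> * X r))" using elim by simp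
              fix r
              have "(\<bar>a (s - q)\<bar> * \<bar>b (q - r)\<bar>) * \<bar>x r\<bar> \<le> (\<bar>a (s - q)\<bar> * \<bar>b (q - r)\<bar>) * (K * X r)"
                using K[of r] by (intro mult_left_mono) auto
              then show 1: "norm (a (s - q) * (b (q - r) * x r)) \<le> (K * \<bar>a (s - q)\<bar>) * (\<bar>b (q - r)\<bar> * X r)"
                by (simp add: abs_mult mult_ac)
              show "0 \<le> (K * \<bar>a (s - q)\<bar>) * (\<bar>b (q - r)\<bar> * X r)" by (rule order_trans[OF norm_ge_zero 1])
            qed
            also have "\<dots> = K * (\<bar>a (s - q)\<bar> * line_conv (\<lambda>r. \<bar>b r\<bar>) X q)" by (simp add: line_conv_def)
            finally show ?case by (simp add: Bochner_Integration.integral_nonneg)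
          qed
        qed measurable
      qed measurable
      have "line_conv a (line_conv b x) s = (LBINT q. (LBINT r. a (s - q) * (b (q - r) * x r)))"
        unfolding line_conv_def by simp
      also have "\<dots> = (LBINT r. (LBINT q. a (s - q) * (b (q - r) * x r)))"
        by (rule lborel_pair.Fubini_integral[OF I, symmetric])
      also have "\<dots> = (LBINT r. line_conv a b (s - r) * x r)"
      proof (rule Bochner_Integration.integral_cong[OF refl])
        fix r
        have "(LBINT q. a (s - q) * (b (q - r) * x r)) = (LBINT q. a (s - q) * b (q - r) * x r)" by (simp add: mult.assoc)
        also have "\<dots> = (LBINT q. a (s - q) * b (q - r)) * x r" by simp
        also have "(LBINT q. a (s - q) * b (q - r)) = line_conv a b (s - r)"
          unfolding line_conv_def using lborel_integral_real_affine[of 1 "\<lambda>q. a (s - q) * b (q - r)" r]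
          by (simp add: algebra_simps)
        finally show "(LBINT q. a (s - q) * (b (q - r) * x r)) = line_conv a b (s - r) * x r" .
      qed
      finally show "line_conv a (line_conv b x) s = line_conv (line_conv a b) x s" by (simp add: line_conv_def)
    qed
  qed
qed

lemma line_conv_assoc:
  fixes a b x :: "real \<Rightarrow> real"
  assumes "integrable lborel a" "integrable lborel b" "integrable lborel x"
  shows "AE s in lborel. line_conv a (line_conv b x) s = line_conv (line_conv a b) x s"
proof -
  have "integrable lborel (\<lambda>r. \<bar>x r\<bar>)" using assms by simp
  from line_conv_assoc_dominated[OF assms(1,2) this] show ?thesis
  proof eventually_elim
    case (elim s)
    have "x \<in> borel_measurable borel" using assms(3) by auto
    with elim show ?case by (auto intro!: exI[of _ 1])
  qed
qed

text \<open>
  A pair from \<open>PC\<close> restricted to \<open>(0,R)\<close> and extended by \<open>0\<close>. Monotonicity persists on the half-line because the kernels are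
  nonnegative, and \<open>k * l = 1\<close> persists on \<open>(0,R)\<close> by causality.
\<close>

definition kernel_pair :: "real \<Rightarrow> (real \<Rightarrow> real) \<Rightarrow> (real \<Rightarrow> real) \<Rightarrow> bool" where
  "kernel_pair R k l \<longleftrightarrow> integrable lborel k \<and> integrable lborel l \<and>
     (\<forall>r. r \<notin> {0<..<R} \<longrightarrow> k r = 0 \<and> l r = 0) \<and> (\<forall>r. 0 \<le> k r \<and> 0 \<le> l r) \<and>
     antimono_on {0<..} k \<and> antimono_on {0<..} l \<and>
     (\<forall>s\<in>{0<..<R}. line_conv k l s = 1)"

text \<open>
  Monotone functions are Borel, so the kernels serve as their own Borel representatives.
\<close>

lemma PC_kernel_pair:
  assumes "PC k l" "0 < R"
  shows "kernel_pair R (\<lambda>r. indicator {0<..<R} r * k r) (\<lambda>r. indicator {0<..<R} r * l r)"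
proof -
  let ?k = "\<lambda>r. indicator {0<..<R} r * k r" and ?l = "\<lambda>r. indicator {0<..<R} r * l r"
  have am: "antimono_on {0<..} k" "antimono_on {0<..} l" and pos: "\<And>t. 0 < t \<Longrightarrow> 0 \<le> k t" "\<And>t. 0 < t \<Longrightarrow> 0 \<le> l t"
    and int: "integrable (lebesgue_on {0<..<R}) k" "integrable (lebesgue_on {0<..<R}) l"
    and one: "\<And>t. 0 < t \<Longrightarrow> conv k l t = 1"
    using assms by (auto simp: PC_def)
  have meas: "(\<lambda>r. indicator A r * f r) \<in> borel_measurable borel"
    if "antimono_on {0<..} f" "A \<in> sets borel" "A \<subseteq> {0<..}" for f :: "real \<Rightarrow> real" and A
  proof -
    have "mono_on {0<..} (\<lambda>r. - f r)" using that by (auto simp: monotone_on_def)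
    then have "(\<lambda>r. - f r) \<in> borel_measurable (restrict_space borel {0<..})" by (rule borel_measurable_mono_on_fnc)
    then have "(\<lambda>r. indicator {0<..} r *\<^sub>R - f r) \<in> borel_measurable borel"
      by (subst (asm) borel_measurable_restrict_space_iff) auto
    then have "(\<lambda>r. - (indicator A r * (indicator {0<..} r *\<^sub>R - f r))) \<in> borel_measurable borel"
      using that(2) by measurable
    moreover have "(\<lambda>r. - (indicator A r * (indicator {0<..} r *\<^sub>R - f r))) = (\<lambda>r. indicator A r * f r)"
      using that(3) by (auto simp: indicator_def fun_eq_iff)
    ultimately show ?thesis by (simp only:)
  qed
  have mk[measurable]: "?k \<in> borel_measurable borel" "?l \<in> borel_measurable borel" by (rule meas[OF am(1)] meas[OF am(2)]; auto)+
  have i: "integrable lborel ?k" "integrable lborel ?l"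
    using integral_lebesgue_on_borel(1)[of "{0<..<R}" ?k k] integral_lebesgue_on_borel(1)[of "{0<..<R}" ?l l] int
    by (auto simp: mult.assoc[symmetric] indicator_inter_arith[symmetric])
  have amR: "antimono_on {0<..} (\<lambda>r. indicator {0<..<R} r * f r)"
    if "antimono_on {0<..} f" "\<And>t. 0 < t \<Longrightarrow> 0 \<le> f t" for f :: "real \<Rightarrow> real"
    using that by (auto simp: monotone_on_def indicator_def)
  have "line_conv ?k ?l s = 1" if s: "s \<in> {0<..<R}" for s
  proof -
    have "conv k l s = (LBINT r. indicator {0<..<s} r * (?k (s - r) * ?l r))"
      unfolding conv_def
    proof (rule integral_lebesgue_on_borel(2))
      show "AE r\<in>{0<..<s} in lborel. k (s - r) * l r = ?k (s - r) * ?l r"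
        using s by (auto simp: indicator_def)
      show "(\<lambda>r. ?k (s - r) * ?l r) \<in> borel_measurable lborel"
        using measurable_compose[OF _ mk(1), of "\<lambda>r. s - r" lborel] mk(2) by simp
    qed simp
    also have "\<dots> = line_conv ?k ?l s"
      unfolding line_conv_def by (rule Bochner_Integration.integral_cong[OF refl]) (auto simp: indicator_def)
    finally show ?thesis using one[of s] s by simp
  qed
  then show ?thesis
    unfolding kernel_pair_def using i pos amR[OF am(1) pos(1)] amR[OF am(2) pos(2)]
    by (auto simp: indicator_def)
qed

text \<open>
  The last property holds at every \<open>s\<close>, not just almost every one: a nonintegrable function would have integral \<open>0\<close>, and
  the integral is \<open>1\<close>.
\<close>

lemma kernel_pairD:
  assumes "kernel_pair R k l"
  shows "integrable lborel k" "integrable lborel l" "\<And>r. r \<notin> {0<..<R} \<Longrightarrow> k r = 0" "\<And>r. r \<notin> {0<..<R} \<Longrightarrow> l r = 0"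
    "\<And>r. 0 \<le> k r" "\<And>r. 0 \<le> l r" "\<And>x y. 0 < x \<Longrightarrow> x \<le> y \<Longrightarrow> k y \<le> k x" "\<And>x y. 0 < x \<Longrightarrow> x \<le> y \<Longrightarrow> l y \<le> l x"
    "\<And>s. s \<in> {0<..<R} \<Longrightarrow> line_conv k l s = 1" "\<And>s. s \<in> {0<..<R} \<Longrightarrow> integrable lborel (\<lambda>r. k (s - r) * l r)"
proof -
  show 1: "\<And>s. s \<in> {0<..<R} \<Longrightarrow> line_conv k l s = 1" using assms by (simp add: kernel_pair_def)
  show "integrable lborel (\<lambda>r. k (s - r) * l r)" if "s \<in> {0<..<R}" for s
    using 1[OF that] not_integrable_integral_eq[of lborel "\<lambda>r. k (s - r) * l r"] unfolding line_conv_def by fastforce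
qed (use assms in \<open>auto simp: kernel_pair_def monotone_on_def\<close>)

section \<open>Forward averages of a singular kernel\<close>

text \<open>
  The forward average \<open>(1/\<delta>) \<integral>\<^sub>r\<^sup>r\<^sup>+\<^sup>\<delta> k\<close>.
\<close>

definition avg_kernel :: "(real \<Rightarrow> real) \<Rightarrow> real \<Rightarrow> real \<Rightarrow> real" where
  "avg_kernel k \<delta> r = (primitive k (r + \<delta>) - primitive k r) / \<delta>"

text \<open>
  The negative derivative of the forward average on \<open>(0,T)\<close>.
\<close>

definition avg_slope :: "real \<Rightarrow> (real \<Rightarrow> real) \<Rightarrow> real \<Rightarrow> real \<Rightarrow> real" where
  "avg_slope T k \<delta> r = indicator {0<..<T} r * ((k r - k (r + \<delta>)) / \<delta>)"

text \<open>
  If \<open>w = l * f\<close>, then the derivative of \<open>k\<^sub>\<delta> * w\<close>, which is \<open>k\<^sub>\<delta>(0) w - m * w\<close> with \<open>m\<close> the slope, is the convolution of this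
  weight with \<open>f\<close>.
\<close>

definition avg_weight :: "real \<Rightarrow> (real \<Rightarrow> real) \<Rightarrow> (real \<Rightarrow> real) \<Rightarrow> real \<Rightarrow> real \<Rightarrow> real" where
  "avg_weight T k l \<delta> r = indicator {0<..<T} r * (avg_kernel k \<delta> 0 * l r - line_conv (avg_slope T k \<delta>) l r)"

lemma primitive_nonpos: "s \<le> 0 \<Longrightarrow> primitive v s = 0"
  by (simp add: primitive_def)

lemma primitive_diff:
  assumes v: "integrable lborel v" and r: "0 \<le> r" "0 < \<delta>"
  shows "primitive v (r + \<delta>) - primitive v r = (LBINT x. indicator {r<..<r + \<delta>} x * v x)"
proof -
  have "primitive v (r + \<delta>) - primitive v r = (LBINT x. indicator {0<..<r + \<delta>} x * v x - indicator {0<..<r} x * v x)"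
    unfolding primitive_def using integrable_indicator_mult[OF v] by simp
  also have "\<dots> = (LBINT x. indicator {r<..<r + \<delta>} x * v x)"
  proof (rule integral_cong_AE)
    show "AE x in lborel. indicator {0<..<r + \<delta>} x * v x - indicator {0<..<r} x * v x = indicator {r<..<r + \<delta>} x * v x"
      using AE_lborel_singleton[of r] by eventually_elim (use r in \<open>auto simp: indicator_def\<close>)
  qed (use v in auto)
  finally show ?thesis .
qed

lemma avg_kernel_bounds:
  assumes kp: "kernel_pair R k l" and \<delta>: "0 < \<delta>" and r: "0 < r"
  shows "k (r + \<delta>) \<le> avg_kernel k \<delta> r" "avg_kernel k \<delta> r \<le> k r" "0 \<le> avg_kernel k \<delta> r"
proof -
  note K = kernel_pairD[OF kp]
  let ?i = "indicat_real {r<..<r + \<delta>}"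
  have ik: "integrable lborel (\<lambda>x. ?i x * k x)" by (rule integrable_indicator_mult[OF K(1)]) simp
  have eq: "avg_kernel k \<delta> r = (LBINT x. ?i x * k x) / \<delta>"
    unfolding avg_kernel_def using primitive_diff[OF K(1), of r \<delta>] r \<delta> by simp
  have "\<delta> * k (r + \<delta>) = (LBINT x. ?i x * k (r + \<delta>))" using \<delta> by simp
  also have "\<dots> \<le> (LBINT x. ?i x * k x)"
  proof (rule integral_mono[OF _ ik])
    fix x show "?i x * k (r + \<delta>) \<le> ?i x * k x" using r K(7) by (auto simp: indicator_def)
  qed simp
  finally show 1: "k (r + \<delta>) \<le> avg_kernel k \<delta> r" unfolding eq using \<delta> by (simp add: field_simps)
  have "(LBINT x. ?i x * k x) \<le> (LBINT x. ?i x * k r)"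
  proof (rule integral_mono[OF ik])
    fix x show "?i x * k x \<le> ?i x * k r" using r K(7) by (auto simp: indicator_def)
  qed simp
  also have "\<dots> = \<delta> * k r" using \<delta> by simp
  finally show "avg_kernel k \<delta> r \<le> k r" unfolding eq using \<delta> by (simp add: field_simps)
  show "0 \<le> avg_kernel k \<delta> r" using 1 K(5)[of "r + \<delta>"] by simp
qed

text \<open>
  By the two-sided bounds, convergence holds at the points of continuity of \<open>k\<close>, and a monotone function has only countably many
  discontinuities.
\<close>

lemma avg_kernel_tendsto:
  assumes kp: "kernel_pair R k l"
  obtains N where "countable N"
    "\<And>r \<delta>. 0 < r \<Longrightarrow> r \<notin> N \<Longrightarrow> (\<And>n. 0 < \<delta> n) \<Longrightarrow> \<delta> \<longlonglongrightarrow> 0 \<Longrightarrow> (\<lambda>n::nat. avg_kernel k (\<delta> n) r) \<longlonglongrightarrow> k r"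
proof -
  note K = kernel_pairD[OF kp]
  have "mono_on {0<..} (\<lambda>r. - k r)" using K(7) by (auto simp: monotone_on_def)
  then have "countable {a \<in> {0<..}. \<not> isCont (\<lambda>r. - k r) a}" by (intro mono_on_ctble_discont_open) auto
  moreover have "(\<lambda>n::nat. avg_kernel k (\<delta> n) r) \<longlonglongrightarrow> k r"
    if r: "0 < r" "r \<notin> {a \<in> {0<..}. \<not> isCont (\<lambda>r. - k r) a}" and \<delta>: "\<And>n. 0 < \<delta> n" "\<delta> \<longlonglongrightarrow> 0" for r \<delta>
  proof (rule tendsto_sandwich[OF _ _ _ tendsto_const])
    have c: "isCont (\<lambda>r. - k r) r" using r by auto
    from isCont_minus[OF c] have "isCont k r" by simp
    then have "(\<lambda>n. k (r + \<delta> n)) \<longlonglongrightarrow> k (r)"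
      by (rule isCont_tendsto_compose) (use tendsto_add[OF tendsto_const \<delta>(2), of r] in simp)
    then show "(\<lambda>n. k (r + \<delta> n)) \<longlonglongrightarrow> k r" .
  qed (use avg_kernel_bounds[OF kp \<delta>(1) r(1)] in auto)
  ultimately show thesis by (rule that)
qed

lemma avg_slope_props:
  assumes kp: "kernel_pair R k l" and \<delta>: "0 < \<delta>"
  shows "integrable lborel (avg_slope T k \<delta>)" "\<And>r. r \<notin> {0<..<T} \<Longrightarrow> avg_slope T k \<delta> r = 0" "\<And>r. 0 \<le> avg_slope T k \<delta> r"
    "\<And>s. 0 < s \<Longrightarrow> s \<le> T \<Longrightarrow> avg_kernel k \<delta> s = avg_kernel k \<delta> 0 - primitive (avg_slope T k \<delta>) s"
proof -
  note K = kernel_pairD[OF kp]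
  have ks: "integrable lborel (\<lambda>r. k (r + \<delta>))"
    using lborel_integrable_real_affine[OF K(1), of 1 \<delta>] by (simp add: add.commute)
  show "integrable lborel (avg_slope T k \<delta>)"
    unfolding avg_slope_def by (rule integrable_indicator_mult) (use K(1) ks in auto)
  show "\<And>r. r \<notin> {0<..<T} \<Longrightarrow> avg_slope T k \<delta> r = 0" by (simp add: avg_slope_def)
  show "\<And>r. 0 \<le> avg_slope T k \<delta> r" using K(7) \<delta> by (auto simp: avg_slope_def indicator_def)
  fix s assume s: "0 < s" "s \<le> T"
  have "primitive (avg_slope T k \<delta>) s = (LBINT x. (indicator {0<..<s} x * k x - indicator {0<..<s} x * k (x + \<delta>)) / \<delta>)"
    unfolding primitive_def avg_slope_def
    by (rule Bochner_Integration.integral_cong[OF refl]) (use s in \<open>auto simp: indicator_def\<close>)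
  also have "\<dots> = (primitive k s - (LBINT x. indicator {0<..<s} x * k (x + \<delta>))) / \<delta>"
    using integrable_indicator_mult[OF K(1), of "{0<..<s}"] integrable_indicator_mult[OF ks, of "{0<..<s}"]
    by (simp add: primitive_def)
  also have "(LBINT x. indicator {0<..<s} x * k (x + \<delta>)) = (LBINT x. indicator {\<delta><..<\<delta> + s} x * k x)"
    using lborel_integral_real_affine[of 1 "\<lambda>x. indicator {\<delta><..<\<delta> + s} x * k x" \<delta>]
    by (simp add: indicator_def add.commute)
  also have "\<dots> = primitive k (\<delta> + s) - primitive k \<delta>" using primitive_diff[OF K(1), of \<delta> s] \<delta> s by simp
  finally show "avg_kernel k \<delta> s = avg_kernel k \<delta> 0 - primitive (avg_slope T k \<delta>) s"
    using \<delta> by (simp add: avg_kernel_def primitive_nonpos add.commute field_simps)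
qed

text \<open>
  Nonnegativity of the weight \<open>\<theta>\<close> is where both the resolvent relation and the monotonicity of \<open>l\<close> enter. Expanding the
  slope and using \<open>k * l = 1\<close> at \<open>\<sigma>\<close> and at \<open>\<sigma> + \<delta>\<close>,
  \<open>\<delta> (m * l)(\<sigma>) = 1 - \<integral>\<^sub>0\<^sup>\<sigma> k(\<sigma> + \<delta> - r) l(r) dr = \<integral>\<^sub>\<sigma>\<^sup>\<sigma>\<^sup>+\<^sup>\<delta> k(\<sigma> + \<delta> - r) l(r) dr \<le> l(\<sigma>) \<integral>\<^sub>0\<^sup>\<delta> k\<close>,
  and the right-hand side is \<open>\<delta> k\<^sub>\<delta>(0) l(\<sigma>)\<close>. The mass of \<open>\<theta>\<close> on \<open>(0,s)\<close> is \<open>(k\<^sub>\<delta> * l)(s)\<close>.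
\<close>

lemma avg_weight_props:
  assumes kp: "kernel_pair R k l" and \<delta>: "0 < \<delta>" "T + \<delta> < R" and T: "0 < T"
  shows "integrable lborel (avg_weight T k l \<delta>)" "\<And>r. r \<notin> {0<..<T} \<Longrightarrow> avg_weight T k l \<delta> r = 0"
    "\<And>r. 0 \<le> avg_weight T k l \<delta> r"
    "\<And>s. 0 < s \<Longrightarrow> s \<le> T \<Longrightarrow> primitive (avg_weight T k l \<delta>) s = (LBINT r. indicator {0<..<s} r * (avg_kernel k \<delta> (s - r) * l r))"
proof -
  note K = kernel_pairD[OF kp] and A = avg_slope_props[OF kp \<delta>(1), where T=T]
  let ?m = "avg_slope T k \<delta>" and ?a = "avg_kernel k \<delta> 0"
  note lc = line_conv_integrable(1)[OF A(1) K(2)]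
  show "integrable lborel (avg_weight T k l \<delta>)"
    unfolding avg_weight_def by (rule integrable_indicator_mult) (use K(2) lc in auto)
  show "\<And>r. r \<notin> {0<..<T} \<Longrightarrow> avg_weight T k l \<delta> r = 0" by (simp add: avg_weight_def)
  show "0 \<le> avg_weight T k l \<delta> \<sigma>" for \<sigma>
  proof (cases "\<sigma> \<in> {0<..<T}")
    case True
    let ?i = "indicat_real {0<..<\<sigma>}" and ?j = "indicat_real {\<sigma>..<\<sigma> + \<delta>}"
    have s1: "\<sigma> \<in> {0<..<R}" and s2: "\<sigma> + \<delta> \<in> {0<..<R}" using True \<delta> by auto
    have I2: "integrable lborel (\<lambda>r. ?i r * (k (\<sigma> + \<delta> - r) * l r))" "integrable lborel (\<lambda>r. ?j r * (k (\<sigma> + \<delta> - r) * l r))"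
      by (rule integrable_indicator_mult[OF K(10)[OF s2]]; simp)+
    have "1 = (LBINT r. k (\<sigma> + \<delta> - r) * l r)" using K(9)[OF s2] by (simp add: line_conv_def)
    also have "\<dots> = (LBINT r. ?i r * (k (\<sigma> + \<delta> - r) * l r) + ?j r * (k (\<sigma> + \<delta> - r) * l r))"
    proof (rule Bochner_Integration.integral_cong[OF refl])
      fix r
      show "k (\<sigma> + \<delta> - r) * l r = ?i r * (k (\<sigma> + \<delta> - r) * l r) + ?j r * (k (\<sigma> + \<delta> - r) * l r)"
        using K(3)[of "\<sigma> + \<delta> - r"] K(4)[of r] True by (cases "r \<le> 0"; cases "\<sigma> + \<delta> \<le> r") (auto simp: indicator_def)
    qed
    also have "\<dots> = (LBINT r. ?i r * (k (\<sigma> + \<delta> - r) * l r)) + (LBINT r. ?j r * (k (\<sigma> + \<delta> - r) * l r))"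
      using I2 by simp
    finally have one: "1 - (LBINT r. ?i r * (k (\<sigma> + \<delta> - r) * l r)) = (LBINT r. ?j r * (k (\<sigma> + \<delta> - r) * l r))" by simp
    have "\<delta> * line_conv ?m l \<sigma> = (LBINT r. \<delta> * (?m (\<sigma> - r) * l r))" by (simp add: line_conv_def)
    also have "\<dots> = (LBINT r. k (\<sigma> - r) * l r - ?i r * (k (\<sigma> + \<delta> - r) * l r))"
    proof (rule Bochner_Integration.integral_cong[OF refl])
      fix r
      have e: "k (\<sigma> - r + \<delta>) = k (\<sigma> + \<delta> - r)" by (simp add: algebra_simps)
      show "\<delta> * (?m (\<sigma> - r) * l r) = k (\<sigma> - r) * l r - ?i r * (k (\<sigma> + \<delta> - r) * l r)"
        using K(3)[of "\<sigma> - r"] K(4)[of r] True \<delta>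
        by (cases "r \<le> 0"; cases "\<sigma> \<le> r") (auto simp: indicator_def avg_slope_def left_diff_distrib e)
    qed
    also have "\<dots> = 1 - (LBINT r. ?i r * (k (\<sigma> + \<delta> - r) * l r))"
      using K(9,10)[OF s1] I2 by (simp add: line_conv_def)
    also have "\<dots> = (LBINT r. ?j r * (k (\<sigma> + \<delta> - r) * l r))" by (rule one)
    also have "\<dots> \<le> (LBINT r. ?j r * k (\<sigma> + \<delta> - r) * l \<sigma>)"
    proof (rule integral_mono[OF I2(2)])
      have "integrable lborel (\<lambda>r. k (\<sigma> + \<delta> - r))" using lborel_integrable_real_affine[OF K(1), of "-1" "\<sigma> + \<delta>"] by simp
      from integrable_indicator_mult[OF this, of "{\<sigma>..<\<sigma> + \<delta>}"]
      show "integrable lborel (\<lambda>r. ?j r * k (\<sigma> + \<delta> - r) * l \<sigma>)" by simp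
      fix r show "?j r * (k (\<sigma> + \<delta> - r) * l r) \<le> ?j r * k (\<sigma> + \<delta> - r) * l \<sigma>"
        using K(8)[of \<sigma> r] K(5)[of "\<sigma> + \<delta> - r"] True by (auto simp: indicator_def intro!: mult_left_mono)
    qed
    also have "\<dots> = (LBINT r. ?j r * k (\<sigma> + \<delta> - r)) * l \<sigma>" by simp
    also have "(LBINT r. ?j r * k (\<sigma> + \<delta> - r)) = (LBINT r. indicator {0<..\<delta>} r * k r)"
      using lborel_integral_real_affine[of "-1" "\<lambda>r. indicator {0<..\<delta>} r * k r" "\<sigma> + \<delta>"]
      by (simp add: indicator_def conj_commute less_diff_eq diff_le_eq add.commute cong: if_cong)
    also have "\<dots> = primitive k \<delta>"
      unfolding primitive_def
    proof (rule integral_cong_AE)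
      show "AE x in lborel. indicator {0<..\<delta>} x * k x = indicator {0<..<\<delta>} x * k x"
        using AE_lborel_singleton[of \<delta>] by eventually_elim (auto simp: indicator_def)
    qed (use K(1) in auto)
    also have "primitive k \<delta> * l \<sigma> = \<delta> * (?a * l \<sigma>)" using \<delta> by (simp add: avg_kernel_def primitive_nonpos)
    finally have "line_conv ?m l \<sigma> \<le> ?a * l \<sigma>" using \<delta>(1) by simp
    then show ?thesis using True by (simp add: avg_weight_def)
  qed (simp add: avg_weight_def)
  fix s assume s: "0 < s" "s \<le> T"
  have "primitive (avg_weight T k l \<delta>) s = (LBINT r. ?a * (indicator {0<..<s} r * l r) - indicator {0<..<s} r * line_conv ?m l r)"
    unfolding primitive_def avg_weight_def
    by (rule Bochner_Integration.integral_cong[OF refl]) (use s in \<open>auto simp: indicator_def\<close>)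
  also have "\<dots> = ?a * (LBINT r. indicator {0<..<s} r * l r) - (LBINT r. indicator {0<..<s} r * line_conv ?m l r)"
    using integrable_indicator_mult[OF K(2), of "{0<..<s}"] integrable_indicator_mult[OF lc, of "{0<..<s}"] by simp
  also have "(LBINT r. indicator {0<..<s} r * line_conv ?m l r) = (LBINT r. primitive ?m (s - r) * l r)"
    by (rule indicator_line_conv[OF A(1) _ K(2)]) (use A(2) K(4) in auto)
  also have "?a * (LBINT r. indicator {0<..<s} r * l r) - \<dots> = (LBINT r. ?a * (indicator {0<..<s} r * l r) - primitive ?m (s - r) * l r)"
  proof -
    note [measurable] = primitive_borel[OF A(1)] borel_measurable_integrable[OF K(2)]
    have "integrable lborel (\<lambda>r. primitive ?m (s - r) * l r)"
    proof (rule Bochner_Integration.integrable_bound[OF integrable_mult_right[OF K(2), of "LBINT r. \<bar>?m r\<bar>"]])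
      have "\<bar>primitive ?m (s - r)\<bar> * \<bar>l r\<bar> \<le> (LBINT r. \<bar>?m r\<bar>) * \<bar>l r\<bar>" for r
        by (intro mult_right_mono primitive_bound[OF A(1)]) auto
      then show "AE r in lborel. norm (primitive ?m (s - r) * l r) \<le> norm ((LBINT r. \<bar>?m r\<bar>) * l r)"
        by (simp add: abs_mult)
    qed measurable
    then show ?thesis using integrable_indicator_mult[OF K(2), of "{0<..<s}"] by simp
  qed
  also have "\<dots> = (LBINT r. indicator {0<..<s} r * (avg_kernel k \<delta> (s - r) * l r))"
  proof (rule Bochner_Integration.integral_cong[OF refl])
    fix r
    show "?a * (indicator {0<..<s} r * l r) - primitive ?m (s - r) * l r = indicator {0<..<s} r * (avg_kernel k \<delta> (s - r) * l r)"
    proof (cases "0 < r \<and> r < s")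
      case True
      then show ?thesis using A(4)[of "s - r"] s by (simp add: left_diff_distrib)
    next
      case False
      then show ?thesis using K(4)[of r] primitive_nonpos[of "s - r" ?m] by (cases "r \<le> 0") auto
    qed
  qed
  finally show "primitive (avg_weight T k l \<delta>) s = (LBINT r. indicator {0<..<s} r * (avg_kernel k \<delta> (s - r) * l r))" .
qed

lemma AE_reflect_not_in_countable:
  assumes "countable (N :: real set)" shows "AE r in lborel. s - r \<notin> N"
proof -
  have "countable ((\<lambda>x. s - x) ` N)" using assms by simp
  then have "(\<lambda>x. s - x) ` N \<in> null_sets lborel" by (rule countable_imp_null_set_lborel)
  from AE_not_in[OF this] show ?thesis
  proof eventually_elim
    case (elim r)
    show ?case
    proof
      assume "s - r \<in> N"
      then have "s - (s - r) \<in> (\<lambda>x. s - x) ` N" by (rule imageI)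
      with elim show False by simp
    qed
  qed
qed

text \<open>
  Since \<open>0 \<le> k\<^sub>\<delta> \<le> k\<close>, the mass \<open>(k\<^sub>\<delta> * l)(s)\<close> is dominated by \<open>(k * l)(s) = 1\<close> and converges to it.
\<close>

lemma avg_weight_mass:
  assumes kp: "kernel_pair R k l" and T: "0 < T" and s: "0 < s" "s \<le> T"
    and \<delta>: "\<And>n. 0 < \<delta> n" "\<And>n. T + \<delta> n < R" "\<delta> \<longlonglongrightarrow> 0"
  shows "primitive (avg_weight T k l (\<delta> n)) s \<le> 1" "(\<lambda>n::nat. primitive (avg_weight T k l (\<delta> n)) s) \<longlonglongrightarrow> 1"
proof -
  note K = kernel_pairD[OF kp]
  have sR: "s \<in> {0<..<R}" using s \<delta>(1,2)[of 0] by auto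
  have meas: "(\<lambda>r. indicator {0<..<s} r * (avg_kernel k (\<delta> n) (s - r) * l r)) \<in> borel_measurable lborel" for n
    using primitive_borel[OF K(1)] borel_measurable_integrable[OF K(2)] unfolding avg_kernel_def by measurable
  have bd: "\<bar>indicator {0<..<s} r * (avg_kernel k (\<delta> n) (s - r) * l r)\<bar> \<le> k (s - r) * l r" for n r
    using avg_kernel_bounds[OF kp \<delta>(1)[of n], of "s - r"] K(5)[of "s - r"] K(6)[of r]
    by (auto simp: indicator_def abs_mult intro!: mult_right_mono)
  have ii: "integrable lborel (\<lambda>r. indicator {0<..<s} r * (avg_kernel k (\<delta> n) (s - r) * l r))" for n
    by (rule Bochner_Integration.integrable_bound[OF K(10)[OF sR] meas])
      (use bd in \<open>auto intro!: AE_I2 order_trans[OF _ abs_ge_self]\<close>)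
  have eq: "primitive (avg_weight T k l (\<delta> n)) s = (LBINT r. indicator {0<..<s} r * (avg_kernel k (\<delta> n) (s - r) * l r))" for n
    by (rule avg_weight_props(4)[OF kp \<delta>(1,2) T s])
  have "(LBINT r. indicator {0<..<s} r * (avg_kernel k (\<delta> n) (s - r) * l r)) \<le> (LBINT r. k (s - r) * l r)"
    by (rule integral_mono[OF ii K(10)[OF sR]]) (rule order_trans[OF abs_ge_self bd])
  then show "primitive (avg_weight T k l (\<delta> n)) s \<le> 1" using K(9)[OF sR] eq by (simp add: line_conv_def)
  obtain N where N: "countable N" "\<And>r \<delta>. 0 < r \<Longrightarrow> r \<notin> N \<Longrightarrow> (\<And>n. 0 < \<delta> n) \<Longrightarrow> \<delta> \<longlonglongrightarrow> 0 \<Longrightarrow> (\<lambda>n::nat. avg_kernel k (\<delta> n) r) \<longlonglongrightarrow> k r"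
    by (rule avg_kernel_tendsto[OF kp]) blast
  have "(\<lambda>n. LBINT r. indicator {0<..<s} r * (avg_kernel k (\<delta> n) (s - r) * l r)) \<longlonglongrightarrow> (LBINT r. k (s - r) * l r)"
  proof (rule integral_dominated_convergence[where w="\<lambda>r. k (s - r) * l r"])
    show "AE r in lborel. (\<lambda>n. indicator {0<..<s} r * (avg_kernel k (\<delta> n) (s - r) * l r)) \<longlonglongrightarrow> k (s - r) * l r"
      using AE_reflect_not_in_countable[OF N(1), of s]
    proof eventually_elim
      case (elim r)
      show ?case
      proof (cases "0 < r \<and> r < s")
        case True
        then have "(\<lambda>n. avg_kernel k (\<delta> n) (s - r)) \<longlonglongrightarrow> k (s - r)" using elim \<delta> by (intro N(2)) auto
        then show ?thesis using True by (auto intro!: tendsto_mult)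
      next
        case False
        then have z: "k (s - r) * l r = 0" using K(3)[of "s - r"] K(4)[of r] by auto
        show ?thesis using False unfolding z by simp
      qed
    qed
    show "AE r in lborel. norm (indicator {0<..<s} r * (avg_kernel k (\<delta> n) (s - r) * l r)) \<le> k (s - r) * l r" for n
      using bd by simp
  qed (use K(10)[OF sR] meas in auto)
  then show "(\<lambda>n::nat. primitive (avg_weight T k l (\<delta> n)) s) \<longlonglongrightarrow> 1"
    unfolding eq using K(9)[OF sR] by (simp add: line_conv_def)
qed

text \<open>
  Masses tending to \<open>1\<close> on every interval \<open>(0,s)\<close> mean that the weights concentrate at \<open>0\<close>.
\<close>

lemma approximate_identity:
  fixes \<theta> :: "nat \<Rightarrow> real \<Rightarrow> real" and \<Phi> :: "real \<Rightarrow> real"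
  assumes T: "0 < T" and \<theta>: "\<And>n. integrable lborel (\<theta> n)" "\<And>n r. r \<notin> {0<..<T} \<Longrightarrow> \<theta> n r = 0" "\<And>n r. 0 \<le> \<theta> n r"
    and mass: "\<And>s. 0 < s \<Longrightarrow> s \<le> T \<Longrightarrow> (\<lambda>n. primitive (\<theta> n) s) \<longlonglongrightarrow> 1" "\<And>n. primitive (\<theta> n) T \<le> 1"
    and \<Phi>: "\<Phi> \<in> borel_measurable borel" "\<And>r. \<bar>\<Phi> r\<bar> \<le> K"
    and cont: "\<And>e. 0 < e \<Longrightarrow> \<exists>d>0. \<forall>r. 0 < r \<and> r < d \<longrightarrow> \<bar>\<Phi> r - \<Phi>0\<bar> \<le> e"
  shows "(\<lambda>n. LBINT r. \<theta> n r * \<Phi> r) \<longlonglongrightarrow> \<Phi>0"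
proof (rule LIMSEQ_I)
  fix e :: real assume e: "0 < e"
  have K0: "0 \<le> K" using \<Phi>(2)[of 0] by simp
  \<comment> \<open>The summand \<open>1\<close> only makes \<open>L\<close> a legitimate divisor.\<close>
  define L where "L = K + \<bar>\<Phi>0\<bar> + 1"
  have L: "0 < L" "\<bar>\<Phi>0\<bar> \<le> L" "\<And>r. \<bar>\<Phi> r - \<Phi>0\<bar> \<le> L"
    using K0 \<Phi>(2) unfolding L_def by (auto simp: abs_if split: if_splits) (smt (verit))+
  obtain d where d: "d > 0" "\<And>r. 0 < r \<Longrightarrow> r < d \<Longrightarrow> \<bar>\<Phi> r - \<Phi>0\<bar> \<le> e / 4" using cont[of "e/4"] e by auto
  define \<tau> where "\<tau> = min T d"
  have \<tau>: "0 < \<tau>" "\<tau> \<le> T" using T d by (auto simp: \<tau>_def)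
  have iT: "(LBINT r. \<theta> n r) = primitive (\<theta> n) T" for n
    unfolding primitive_def by (rule Bochner_Integration.integral_cong[OF refl]) (use \<theta>(2) in \<open>auto simp: indicator_def\<close>)
  have "\<forall>\<^sub>F n in sequentially. \<bar>primitive (\<theta> n) T - 1\<bar> < e / (8 * L)"
    using LIMSEQ_D[OF mass(1)[OF T order_refl], of "e / (8 * L)"] e L by (auto simp: eventually_sequentially)
  moreover have "\<forall>\<^sub>F n in sequentially. \<bar>primitive (\<theta> n) \<tau> - 1\<bar> < e / (8 * L)"
    using LIMSEQ_D[OF mass(1)[OF \<tau>], of "e / (8 * L)"] e L by (auto simp: eventually_sequentially)
  ultimately have "\<forall>\<^sub>F n in sequentially. norm ((LBINT r. \<theta> n r * \<Phi> r) - \<Phi>0) < e"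
  proof eventually_elim
    case (elim n)
    note [measurable] = \<Phi>(1) borel_measurable_integrable[OF \<theta>(1)]
    have ind: "integrable lborel (\<lambda>r. indicator {0<..<\<tau>} r * \<theta> n r)" by (rule integrable_indicator_mult[OF \<theta>(1)]) simp
    have i1: "integrable lborel (\<lambda>r. \<theta> n r * \<Phi> r)"
      by (rule Bochner_Integration.integrable_bound[OF integrable_mult_left[OF \<theta>(1)[of n], of K]])
        (use \<Phi>(2) \<theta>(3) K0 in \<open>auto simp: abs_mult intro!: AE_I2 mult_left_mono\<close>)
    have "\<bar>(LBINT r. \<theta> n r * (\<Phi> r - \<Phi>0))\<bar> \<le> (LBINT r. \<bar>\<theta> n r * (\<Phi> r - \<Phi>0)\<bar>)"
      using integral_norm_bound[of lborel "\<lambda>r. \<theta> n r * (\<Phi> r - \<Phi>0)"] by simp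
    also have "\<dots> \<le> (LBINT r. e / 4 * \<theta> n r + L * (\<theta> n r - indicator {0<..<\<tau>} r * \<theta> n r))"
    proof (rule Bochner_Integration.integral_mono')
      show "integrable lborel (\<lambda>r. e / 4 * \<theta> n r + L * (\<theta> n r - indicator {0<..<\<tau>} r * \<theta> n r))" using \<theta>(1) ind by simp
      fix r
      show 1: "\<bar>\<theta> n r * (\<Phi> r - \<Phi>0)\<bar> \<le> e / 4 * \<theta> n r + L * (\<theta> n r - indicator {0<..<\<tau>} r * \<theta> n r)"
      proof (cases "r \<in> {0<..<\<tau>}")
        case True
        then have "\<bar>\<Phi> r - \<Phi>0\<bar> \<le> e / 4" by (intro d) (auto simp: \<tau>_def)
        then have "\<theta> n r * \<bar>\<Phi> r - \<Phi>0\<bar> \<le> \<theta> n r * (e / 4)" by (intro mult_left_mono \<theta>(3))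
        then show ?thesis using True \<theta>(3)[of n r] by (simp add: abs_mult mult.commute)
      next
        case False
        have "\<theta> n r * \<bar>\<Phi> r - \<Phi>0\<bar> \<le> \<theta> n r * L" by (intro mult_left_mono \<theta>(3) L)
        then show ?thesis using False \<theta>(3)[of n r] e by (simp add: abs_mult mult.commute add_increasing)
      qed
      show "0 \<le> e / 4 * \<theta> n r + L * (\<theta> n r - indicator {0<..<\<tau>} r * \<theta> n r)" by (rule order_trans[OF abs_ge_zero 1])
    qed
    also have "\<dots> = e / 4 * primitive (\<theta> n) T + L * (primitive (\<theta> n) T - primitive (\<theta> n) \<tau>)"
      using \<theta>(1) ind iT by (simp add: primitive_def[of "\<theta> n" \<tau>])
    also have "\<dots> \<le> e / 4 * 1 + L * (e / (4 * L))"
    proof (intro add_mono mult_left_mono mass(2))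
      have "e / (4 * L) = e / (8 * L) + e / (8 * L)" using L by (simp add: field_simps)
      then show "primitive (\<theta> n) T - primitive (\<theta> n) \<tau> \<le> e / (4 * L)" using elim by (auto simp: abs_if split: if_splits)
    qed (use e L in auto)
    also have "\<dots> = e / 2" using L by simp
    finally have a: "\<bar>(LBINT r. \<theta> n r * (\<Phi> r - \<Phi>0))\<bar> \<le> e / 2" .
    have "(LBINT r. \<theta> n r * \<Phi> r) - \<Phi>0 = (LBINT r. \<theta> n r * (\<Phi> r - \<Phi>0)) + \<Phi>0 * (primitive (\<theta> n) T - 1)"
      using i1 \<theta>(1) iT by (simp add: right_diff_distrib mult.commute)
    moreover have "\<bar>\<Phi>0 * (primitive (\<theta> n) T - 1)\<bar> \<le> L * (e / (8 * L))"
      unfolding abs_mult using elim(1) L e by (intro mult_mono) auto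
    moreover have "L * (e / (8 * L)) = e / 8" using L by simp
    ultimately show ?case using a e by (simp add: abs_if split: if_splits)
  qed
  then show "\<exists>no. \<forall>n\<ge>no. norm ((LBINT r. \<theta> n r * \<Phi> r) - \<Phi>0) < e" by (simp add: eventually_sequentially)
qed

section \<open>Inversion of the convolution\<close>

lemma line_conv_nonpos:
  assumes "\<And>r. r \<le> 0 \<Longrightarrow> a r = 0" "\<And>r. r \<le> 0 \<Longrightarrow> b r = 0" "s \<le> 0"
  shows "line_conv a b s = 0"
proof -
  have e: "a (s - r) * b r = 0" for r using assms(1)[of "s - r"] assms(2)[of r] assms(3) by (cases "r \<le> 0") auto
  show ?thesis unfolding line_conv_def e by simp
qed

text \<open>
  Convolving \<open>k * x = 1 * y\<close> with \<open>l\<close> gives \<open>1 * x = 1 * (l * y)\<close>, and primitives determine their integrands. The function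
  \<open>1\<close> is represented by the indicator \<open>J\<close> of \<open>[0,T]\<close>.
\<close>

lemma invert_convolution:
  fixes x y :: "real \<Rightarrow> real"
  assumes kp: "kernel_pair R k l" and T: "0 < T" "T \<le> R"
    and x: "integrable lborel x" "\<And>r. r \<notin> {0<..<T} \<Longrightarrow> x r = 0"
    and y: "integrable lborel y" "\<And>r. r \<notin> {0<..<T} \<Longrightarrow> y r = 0"
    and eq: "AE s\<in>{0<..<T} in lborel. line_conv k x s = primitive y s"
  shows "AE s\<in>{0<..<T} in lborel. x s = line_conv l y s"
proof -
  note K = kernel_pairD[OF kp]
  have k0: "k r = 0" "l r = 0" "x r = 0" "y r = 0" if "r \<le> 0" for r using K(3,4)[of r] x(2)[of r] y(2)[of r] that by auto
  define J where "J = indicat_real {0..T}"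
  have J: "integrable lborel J" by (simp add: J_def)
  note [measurable] = borel_measurable_integrable[OF K(1)] borel_measurable_integrable[OF K(2)] borel_measurable_integrable[OF x(1)]
     borel_measurable_integrable[OF y(1)] borel_measurable_integrable[OF J]
  define D where "D = line_conv l y"
  have D: "integrable lborel D" unfolding D_def by (rule line_conv_integrable(1)[OF K(2) y(1)])
  have D0: "D r = 0" if "r \<le> 0" for r unfolding D_def by (rule line_conv_nonpos[OF k0(2,4) that])
  \<comment> \<open>The difference of the two sides of the claim; its primitive will be shown to vanish.\<close>
  define x' where "x' r = x r - indicator {0<..<T} r * D r" for r
  have iD: "integrable lborel (\<lambda>r. indicator {0<..<T} r * D r)" by (rule integrable_indicator_mult[OF D]) simp
  have lJ: "line_conv l J = line_conv J l" by (rule ext) (rule line_conv_commute)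
  have ae2: "AE q in lborel. q < T \<longrightarrow> line_conv k x q = line_conv J y q"
    using eq
  proof eventually_elim
    case (elim q)
    show ?case
    proof
      assume q: "q < T"
      show "line_conv k x q = line_conv J y q"
      proof (cases "q \<le> 0")
        case True
        have e: "J (q - r) * y r = 0" for r using k0(4)[of r] True by (cases "r \<le> 0") (auto simp: J_def)
        have "line_conv J y q = 0" unfolding line_conv_def e by simp
        then show ?thesis using line_conv_nonpos[OF k0(1,3) True] by simp
      next
        case False
        then show ?thesis using elim q primitive_eq_line_conv[OF y, where s=q] by (simp add: J_def)
      qed
    qed
  qed
  have "AE s\<in>{0<..<T} in lborel. primitive x' s = 0"
    using line_conv_assoc[OF K(2) K(1) x(1)] line_conv_assoc[OF K(2) J y(1)] line_conv_assoc[OF J K(2) y(1)]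
  proof eventually_elim
    case (elim s)
    show ?case
    proof
      assume s: "s \<in> {0<..<T}"
      have "line_conv (line_conv l k) x s = primitive x s"
        unfolding line_conv_def[of "line_conv l k"] primitive_def
      proof (rule Bochner_Integration.integral_cong[OF refl])
        fix r
        have "line_conv l k (s - r) = 1" if "0 < r" "r < s"
          using line_conv_commute[of l k] K(9)[of "s - r"] s T that by simp
        moreover have "line_conv l k (s - r) = 0" if "s \<le> r" using line_conv_nonpos[OF k0(2,1)] that by simp
        ultimately show "line_conv l k (s - r) * x r = indicator {0<..<s} r * x r"
          using k0(3)[of r] by (cases "r \<le> 0"; cases "s \<le> r") auto
      qed
      moreover have "line_conv l (line_conv k x) s = line_conv l (line_conv J y) s"
        unfolding line_conv_def[of l]
      proof (rule integral_cong_AE)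
        show "AE q in lborel. l (s - q) * line_conv k x q = l (s - q) * line_conv J y q"
          using ae2
        proof eventually_elim
          case (elim q)
          then show ?case using k0(2)[of "s - q"] s by (cases "q < T") auto
        qed
      qed measurable
      moreover have "line_conv J D s = primitive (\<lambda>r. indicator {0<..<T} r * D r) s"
        unfolding line_conv_def primitive_def
      proof (rule integral_cong_AE)
        show "AE r in lborel. J (s - r) * D r = indicator {0<..<s} r * (indicator {0<..<T} r * D r)"
          using AE_lborel_singleton[of s]
          by eventually_elim (use s D0 in \<open>auto simp: J_def indicator_def\<close>)
      qed (use D in auto)
      ultimately have "primitive x s = primitive (\<lambda>r. indicator {0<..<T} r * D r) s"
        using elim lJ by (simp add: D_def)
      moreover have "primitive x' s = primitive x s - primitive (\<lambda>r. indicator {0<..<T} r * D r) s"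
        unfolding x'_def primitive_def right_diff_distrib
        using integrable_indicator_mult[OF x(1), of "{0<..<s}"] integrable_indicator_mult[OF iD, of "{0<..<s}"] by simp
      ultimately show "primitive x' s = 0" by simp
    qed
  qed
  moreover have "integrable lborel x'" unfolding x'_def using x(1) iD by simp
  moreover have "x' r = 0" if "r \<notin> {0<..<T}" for r using x(2)[OF that] that by (simp add: x'_def)
  ultimately have "AE s in lborel. x' s = 0" by (intro primitive_determined[OF T(1)])
  then show ?thesis by eventually_elim (auto simp: x'_def D_def)
qed

text \<open>
  The scalar result for each \<open>c\<close> has its own null set; comparison with the vector-valued convolution of \<open>l\<close> and \<open>B\<close> gives a
  common one.
\<close>

lemma invert_vector_convolution:
  fixes w B :: "real \<Rightarrow> 'a::{real_inner,complete_space}"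
  assumes kp: "kernel_pair R k l" and T: "0 < T" "T \<le> R"
    and w: "interval_function T w" "integrable lborel (\<lambda>r. norm (w r))"
    and B: "interval_function T B" "integrable lborel (\<lambda>r. norm (B r))"
    and eq: "\<And>c. AE s\<in>{0<..<T} in lborel. line_conv k (\<lambda>r. w r \<bullet> c) s = primitive (\<lambda>r. B r \<bullet> c) s"
  shows "AE s\<in>{0<..<T} in lborel. (\<forall>c. w s \<bullet> c = line_conv l (\<lambda>r. B r \<bullet> c) s)"
proof -
  obtain V where V: "simple_limit lborel V"
    "AE s in lborel. integrable lborel (\<lambda>r. \<bar>l (s - r)\<bar> * norm (B r)) \<and>
       (\<forall>c. V s \<bullet> c = (LBINT r. l (s - r) * (B r \<bullet> c)))"
    by (rule vector_convolution[OF kernel_pairD(2)[OF kp] interval_functionD(1)[OF B(1)] B(2)])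
  \<comment> \<open>Comparison with the convolution that satisfies its identity for all \<open>c\<close> at once.\<close>
  define z where "z s = indicator {0<..<T} s *\<^sub>R (w s - V s)" for s
  have "simple_limit lborel z" unfolding z_def
    by (intro simple_limit_indicator simple_limit_diff V(1) interval_functionD(1)[OF w(1)]) simp
  moreover have "AE s in lborel. z s \<bullet> c = 0" for c
  proof -
    have "AE s\<in>{0<..<T} in lborel. w s \<bullet> c = line_conv l (\<lambda>r. B r \<bullet> c) s"
      by (rule invert_convolution[OF kp T inner_interval_function[OF w] inner_interval_function[OF B] eq])
    with V(2) show ?thesis
    proof eventually_elim
      case (elim s)
      then show ?case by (cases "s \<in> {0<..<T}") (auto simp: z_def inner_diff_left line_conv_def)
    qed
  qed
  ultimately have "AE s in lborel. z s = 0" by (rule AE_vector_zero_if_inner_zero)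
  with V(2) show ?thesis
  proof eventually_elim
    case (elim s)
    show ?case
    proof (intro impI allI)
      fix c assume "s \<in> {0<..<T}"
      then have "w s = V s" using elim by (simp add: z_def)
      then show "w s \<bullet> c = line_conv l (\<lambda>r. B r \<bullet> c) s" using elim by (simp add: line_conv_def)
    qed
  qed
qed

text \<open>
  The derivative of \<open>k\<^sub>\<delta> * w\<close> equals \<open>\<theta>\<^sub>\<delta> * B\<close>: substitute \<open>w = l * B\<close> in \<open>k\<^sub>\<delta>(0) w - m * w\<close> and use associativity.
\<close>

lemma avg_weight_representation:
  fixes w B :: "real \<Rightarrow> 'a::{real_inner,complete_space}"
  assumes kp: "kernel_pair R k l" and T: "0 < T" and \<delta>: "0 < \<delta>" "T + \<delta> < R"
    and w: "interval_function T w" "integrable lborel (\<lambda>r. norm (w r))"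
    and B: "interval_function T B" "integrable lborel (\<lambda>r. norm (B r))"
    and W: "AE s\<in>{0<..<T} in lborel. (\<forall>c. w s \<bullet> c = line_conv l (\<lambda>r. B r \<bullet> c) s)"
  shows "AE s\<in>{0<..<T} in lborel. (\<forall>c. integrable lborel (\<lambda>r. avg_slope T k \<delta> (s - r) * (w r \<bullet> c)) \<and>
     avg_kernel k \<delta> 0 * (w s \<bullet> c) - (LBINT r. avg_slope T k \<delta> (s - r) * (w r \<bullet> c))
     = (LBINT r. avg_weight T k l \<delta> (s - r) * (B r \<bullet> c)))"
proof -
  note K = kernel_pairD[OF kp] and A = avg_slope_props[OF kp \<delta>(1), where T=T]
  let ?m = "avg_slope T k \<delta>" and ?a = "avg_kernel k \<delta> 0" and ?\<theta> = "avg_weight T k l \<delta>"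
  define M where "M = line_conv ?m l"
  have M: "integrable lborel M" unfolding M_def by (rule line_conv_integrable(1)[OF A(1) K(2)])
  have z: "l r = 0" "?m r = 0" if "r \<le> 0" for r using K(4)[of r] A(2)[of r] that by auto
  have M0: "M r = 0" if "r \<le> 0" for r unfolding M_def by (rule line_conv_nonpos[OF z(2,1) that])
  note [measurable] = borel_measurable_integrable[OF K(2)] borel_measurable_integrable[OF A(1)] borel_measurable_integrable[OF M]
  have dom: "integrable lborel (\<lambda>r. a (s - r) * (f r \<bullet> c))"
    if f: "interval_function T f" and a: "a \<in> borel_measurable borel" and i: "integrable lborel (\<lambda>r. a (s - r) * norm (f r))"
    for a :: "real \<Rightarrow> real" and f :: "real \<Rightarrow> 'a" and s c
  proof (rule Bochner_Integration.integrable_bound[OF integrable_mult_left[OF i, of "norm c"]])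
    have "(\<lambda>r. f r \<bullet> c) \<in> borel_measurable borel"
      using borel_measurable_inner_simple_limit[OF interval_functionD(1)[OF f] simple_limit_const] by simp
    then show "(\<lambda>r. a (s - r) * (f r \<bullet> c)) \<in> borel_measurable lborel" using a by measurable
    have "\<bar>a (s - r)\<bar> * \<bar>f r \<bullet> c\<bar> \<le> \<bar>a (s - r)\<bar> * (norm (f r) * norm c)" for r
      by (intro mult_left_mono Cauchy_Schwarz_ineq2) auto
    then show "AE r in lborel. norm (a (s - r) * (f r \<bullet> c)) \<le> norm (a (s - r) * norm (f r) * norm c)"
      by (simp add: abs_mult mult.assoc)
  qed
  from W line_conv_assoc_dominated[OF A(1) K(2) B(2)] line_conv_integrable(2)[OF A(1) w(2)]
    line_conv_integrable(2)[OF K(2) B(2)] line_conv_integrable(2)[OF M B(2)]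
  show ?thesis
  proof eventually_elim
    case (elim s)
    show ?case
    proof (intro impI allI conjI)
      fix c assume s: "s \<in> {0<..<T}"
      let ?x = "\<lambda>r. B r \<bullet> c"
      have xm: "?x \<in> borel_measurable borel"
        using borel_measurable_inner_simple_limit[OF interval_functionD(1)[OF B(1)] simple_limit_const] by simp
      have wm: "(\<lambda>r. w r \<bullet> c) \<in> borel_measurable borel"
        using borel_measurable_inner_simple_limit[OF interval_functionD(1)[OF w(1)] simple_limit_const] by simp
      have x0: "?x r = 0" if "r \<le> 0" for r using interval_functionD(2)[OF B(1), of r] that by simp
      have xb: "\<exists>K. \<forall>r. \<bar>?x r\<bar> \<le> K * norm (B r)"
      proof (intro exI[of _ "norm c"] allI)
        fix r show "\<bar>?x r\<bar> \<le> norm c * norm (B r)" using Cauchy_Schwarz_ineq2[of "B r" c] by (simp add: mult.commute)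
      qed
      show i1: "integrable lborel (\<lambda>r. ?m (s - r) * (w r \<bullet> c))" by (rule dom[OF w(1) _ elim(3)]) measurable
      have "(LBINT r. ?m (s - r) * (w r \<bullet> c)) = line_conv ?m (line_conv l ?x) s"
        unfolding line_conv_def[of ?m]
      proof (rule integral_cong_AE)
        show "AE r in lborel. ?m (s - r) * (w r \<bullet> c) = ?m (s - r) * line_conv l ?x r"
          using W
        proof eventually_elim
          case (elim r)
          consider "r \<le> 0" | "r \<in> {0<..<T}" | "T \<le> r" by force
          then show ?case
          proof cases
            case 1
            then show ?thesis using line_conv_nonpos[OF z(1) x0 1] interval_functionD(2)[OF w(1), of r] by simp
          next
            case 2
            then show ?thesis using elim by simp
          next
            case 3
            then show ?thesis using z(2)[of "s - r"] s by simp
          qed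
        qed
        show "(\<lambda>r. ?m (s - r) * line_conv l ?x r) \<in> borel_measurable lborel" using xm by measurable
      qed (use i1 in auto)
      also have "\<dots> = line_conv M ?x s" using elim(2) xm xb by (auto simp: M_def)
      finally have e2: "(LBINT r. ?m (s - r) * (w r \<bullet> c)) = line_conv M ?x s" .
      have i2: "integrable lborel (\<lambda>r. l (s - r) * ?x r)" by (rule dom[OF B(1) _ elim(4)]) measurable
      have i3: "integrable lborel (\<lambda>r. M (s - r) * ?x r)" by (rule dom[OF B(1) _ elim(5)]) measurable
      have "?a * (w s \<bullet> c) - (LBINT r. ?m (s - r) * (w r \<bullet> c)) = (LBINT r. ?a * (l (s - r) * ?x r) - M (s - r) * ?x r)"
        unfolding e2 using elim(1) s i2 i3 by (simp add: line_conv_def)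
      also have "\<dots> = (LBINT r. ?\<theta> (s - r) * ?x r)"
      proof (rule Bochner_Integration.integral_cong[OF refl])
        fix r
        show "?a * (l (s - r) * ?x r) - M (s - r) * ?x r = ?\<theta> (s - r) * ?x r"
          using x0[of r] z(1)[of "s - r"] M0[of "s - r"] s
          by (cases "r \<le> 0"; cases "s \<le> r") (auto simp: avg_weight_def M_def algebra_simps)
      qed
      finally show "?a * (w s \<bullet> c) - (LBINT r. ?m (s - r) * (w r \<bullet> c)) = (LBINT r. ?\<theta> (s - r) * ?x r)" .
    qed
  qed
qed

section \<open>Passage to the limit for singular kernels\<close>

text \<open>
  The correlation \<open>\<Phi>(q) = \<integral>\<^sub>A (B(s - q), g(s)) ds\<close> turns the pairing of \<open>\<theta> * B\<close> with \<open>g\<close> into \<open>\<integral> \<theta> \<Phi>\<close>. It is continuous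
  at \<open>0\<close> by continuity of translation in \<open>L\<^sup>2\<close>, so an approximate identity \<open>\<theta>\<close> recovers \<open>\<Phi>(0) = \<integral>\<^sub>A (B(s), g(s)) ds\<close>.
\<close>

lemma correlation_props:
  fixes B g :: "real \<Rightarrow> 'a::real_inner"
  assumes B: "interval_function T B" "integrable lborel (\<lambda>s. (norm (B s))\<^sup>2)"
    and g: "interval_function T g" "integrable lborel (\<lambda>s. (norm (g s))\<^sup>2)"
    and A: "A \<in> sets borel"
  defines "\<Phi> \<equiv> \<lambda>q. LBINT s. indicator A s * (B (s - q) \<bullet> g s)"
  shows "\<Phi> \<in> borel_measurable borel"
    "\<And>q. \<bar>\<Phi> q\<bar> \<le> (LBINT s. (norm (B s))\<^sup>2) + (LBINT s. (norm (g s))\<^sup>2)"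
    "\<And>e. 0 < e \<Longrightarrow> \<exists>d>0. \<forall>q. \<bar>q\<bar> < d \<longrightarrow> \<bar>\<Phi> q - \<Phi> 0\<bar> \<le> e"
    "\<And>\<theta>. integrable lborel \<theta> \<Longrightarrow>
       integrable lborel (\<lambda>s. indicator A s * (LBINT r. \<theta> (s - r) * (B r \<bullet> g s))) \<and>
       (LBINT s. indicator A s * (LBINT r. \<theta> (s - r) * (B r \<bullet> g s))) = (LBINT q. \<theta> q * \<Phi> q)"
proof -
  note Bs = interval_functionD(1)[OF B(1)] and gs = interval_functionD(1)[OF g(1)]
  have c1: "(\<lambda>p. fst p - snd p) \<in> measurable (lborel \<Otimes>\<^sub>M lborel) (lborel::real measure)" by measurable
  have c2: "fst \<in> measurable (lborel \<Otimes>\<^sub>M lborel) (lborel::real measure)" by measurable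
  have pm[measurable]: "(\<lambda>p. B (fst p - snd p) \<bullet> g (fst p)) \<in> borel_measurable (lborel \<Otimes>\<^sub>M lborel)"
    by (rule borel_measurable_inner_simple_limit[OF simple_limit_comp[OF c1 Bs] simple_limit_comp[OF c2 gs]])
  have pm'[measurable]: "(\<lambda>p. B (snd p - fst p) \<bullet> g (snd p)) \<in> borel_measurable (lborel \<Otimes>\<^sub>M lborel)"
  proof -
    have "(\<lambda>p. (snd p, fst p)) \<in> measurable (lborel \<Otimes>\<^sub>M lborel) (lborel \<Otimes>\<^sub>M (lborel :: real measure))" by measurable
    from measurable_compose[OF this pm] show ?thesis by simp
  qed
  note [measurable] = A interval_functionD(4)[OF B(1)] interval_functionD(4)[OF g(1)]
  show \<Phi>m: "\<Phi> \<in> borel_measurable borel"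
  proof -
    have "(\<lambda>(q, s). indicator A s * (B (s - q) \<bullet> g s)) \<in> borel_measurable (lborel \<Otimes>\<^sub>M lborel)"
      using pm' by (simp add: case_prod_beta')
    then have "\<Phi> \<in> borel_measurable lborel"
      unfolding \<Phi>_def by (rule lborel.borel_measurable_lebesgue_integral)
    then show ?thesis by simp
  qed
  have CS: "\<bar>B (s - q) \<bullet> g s\<bar> \<le> (norm (B (s - q)))\<^sup>2 + (norm (g s))\<^sup>2" for s q
  proof -
    have "\<bar>B (s - q) \<bullet> g s\<bar> \<le> norm (B (s - q)) * norm (g s)" by (rule Cauchy_Schwarz_ineq2)
    also have "\<dots> \<le> (norm (B (s - q)))\<^sup>2 + (norm (g s))\<^sup>2"
      using zero_le_power2[of "norm (B (s - q)) - norm (g s)"] mult_nonneg_nonneg[OF norm_ge_zero norm_ge_zero, of "B (s - q)" "g s"]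
      unfolding power2_diff by linarith
    finally show ?thesis .
  qed
  have shift: "integrable lborel (\<lambda>s. (norm (B (s - q)))\<^sup>2)" "(LBINT s. (norm (B (s - q)))\<^sup>2) = (LBINT s. (norm (B s))\<^sup>2)" for q
    using lborel_integrable_real_affine[OF B(2), of 1 "-q"] lborel_integral_real_affine[of 1 "\<lambda>s. (norm (B s))\<^sup>2" "-q"] by simp_all
  have Bqm: "(\<lambda>s. B (s - q) \<bullet> g s) \<in> borel_measurable lborel" for q
    by (rule borel_measurable_inner_simple_limit[OF simple_limit_comp[OF _ Bs] gs]) measurable
  have iB: "integrable lborel (\<lambda>s. B (s - q) \<bullet> g s)" for q
    by (rule Bochner_Integration.integrable_bound[OF Bochner_Integration.integrable_add[OF shift(1) g(2)] Bqm])
      (use CS in \<open>auto intro!: AE_I2 order_trans[OF _ abs_ge_self]\<close>)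
  have iA: "integrable lborel (\<lambda>s. indicator A s * (B (s - q) \<bullet> g s))" for q
    by (rule integrable_indicator_mult[OF iB A])
  show "\<bar>\<Phi> q\<bar> \<le> (LBINT s. (norm (B s))\<^sup>2) + (LBINT s. (norm (g s))\<^sup>2)" for q
  proof -
    have "\<bar>\<Phi> q\<bar> \<le> (LBINT s. \<bar>indicator A s * (B (s - q) \<bullet> g s)\<bar>)"
      unfolding \<Phi>_def using integral_norm_bound[of lborel "\<lambda>s. indicator A s * (B (s - q) \<bullet> g s)"] by simp
    also have "\<dots> \<le> (LBINT s. (norm (B (s - q)))\<^sup>2 + (norm (g s))\<^sup>2)"
    proof (rule integral_mono)
      fix s show "\<bar>indicator A s * (B (s - q) \<bullet> g s)\<bar> \<le> (norm (B (s - q)))\<^sup>2 + (norm (g s))\<^sup>2"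
        using CS[of s q] by (auto simp: indicator_def)
    qed (use iA shift g(2) in auto)
    also have "\<dots> = (LBINT s. (norm (B s))\<^sup>2) + (LBINT s. (norm (g s))\<^sup>2)" using shift g(2) by simp
    finally show ?thesis .
  qed
  show "\<exists>d>0. \<forall>q. \<bar>q\<bar> < d \<longrightarrow> \<bar>\<Phi> q - \<Phi> 0\<bar> \<le> e" if e: "0 < e" for e
  proof -
    define G where "G = (LBINT s. (norm (g s))\<^sup>2)"
    have G: "0 \<le> G" unfolding G_def by (rule Bochner_Integration.integral_nonneg) simp
    \<comment> \<open>Parameter of Young's inequality \<open>X Y \<le> X\<^sup>2 / h + h Y\<^sup>2\<close>; it makes the second term at most \<open>e/2\<close>.\<close>
    define h where "h = e / (2 * (G + 1))"
    have h: "0 < h" "h * G \<le> e / 2"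
    proof -
      show h0: "0 < h" using e G by (simp add: h_def)
      have "h * G \<le> h * (G + 1)" using h0 by simp
      also have "\<dots> = e / 2" using G by (simp add: h_def field_simps)
      finally show "h * G \<le> e / 2" .
    qed
    have B0: "B x = 0" if "\<bar>T\<bar> < \<bar>x\<bar>" for x
    proof -
      have "x \<notin> {0<..<T}" using that by auto
      then show ?thesis by (rule interval_functionD(2)[OF B(1)])
    qed
    have he: "0 < h * e / 2" using h e by simp
    obtain d where d: "d > 0"
      "\<And>r. \<bar>r\<bar> < d \<Longrightarrow> (\<integral>\<^sup>+x. ennreal (norm (B (x + r) - B x) ^ 2) \<partial>lborel) \<le> ennreal (h * e / 2)"
      by (rule translate_Lp[where p=2, OF Bs B0 B(2) he]) auto
    show ?thesis
    proof (intro exI[of _ d] conjI d(1) allI impI)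
      fix q assume q: "\<bar>q\<bar> < d"
      have dm: "(\<lambda>s. (norm (B (s - q) - B s))\<^sup>2) \<in> borel_measurable lborel"
        using borel_measurable_norm_simple_limit[OF simple_limit_diff[OF simple_limit_comp[OF _ Bs] Bs], of "\<lambda>s. s - q"] by simp
      have nn: "(\<integral>\<^sup>+s. ennreal ((norm (B (s - q) - B s))\<^sup>2) \<partial>lborel) \<le> ennreal (h * e / 2)" using d(2)[of "-q"] q by simp
      then have id: "integrable lborel (\<lambda>s. (norm (B (s - q) - B s))\<^sup>2)"
        using dm unfolding integrable_iff_bounded by (auto intro: le_less_trans[OF _ ennreal_less_top])
      have le: "(LBINT s. (norm (B (s - q) - B s))\<^sup>2) \<le> h * e / 2"
        using nn h e nn_integral_eq_integral[OF id] by (simp add: ennreal_le_iff)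
      have "\<Phi> q - \<Phi> 0 = (LBINT s. indicator A s * (B (s - q) \<bullet> g s) - indicator A s * (B (s - 0) \<bullet> g s))"
        unfolding \<Phi>_def by (rule Bochner_Integration.integral_diff[symmetric, OF iA iA])
      then have "\<bar>\<Phi> q - \<Phi> 0\<bar> \<le> (LBINT s. \<bar>indicator A s * (B (s - q) \<bullet> g s) - indicator A s * (B (s - 0) \<bullet> g s)\<bar>)"
        using integral_norm_bound[of lborel "\<lambda>s. indicator A s * (B (s - q) \<bullet> g s) - indicator A s * (B (s - 0) \<bullet> g s)"] by simp
      also have "\<dots> \<le> (LBINT s. (norm (B (s - q) - B s))\<^sup>2 / h + h * (norm (g s))\<^sup>2)"
      proof (rule integral_mono)
        fix s
        have "\<bar>(B (s - q) - B s) \<bullet> g s\<bar> \<le> (norm (B (s - q) - B s))\<^sup>2 / h + h * (norm (g s))\<^sup>2"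
        proof -
          define X Y where "X = norm (B (s - q) - B s)" and "Y = norm (g s)"
          have XY: "0 \<le> X" "0 \<le> Y" by (auto simp: X_def Y_def)
          have "0 \<le> (X - h * Y)\<^sup>2" by simp
          then have "2 * (h * (X * Y)) \<le> X\<^sup>2 + h * (h * Y\<^sup>2)" by (simp add: power2_diff power_mult_distrib power2_eq_square algebra_simps)
          moreover have "0 \<le> h * (X * Y)" using h XY by simp
          ultimately have "h * (X * Y) \<le> h * (X\<^sup>2 / h + h * Y\<^sup>2)" using h by (simp add: distrib_left)
          then have "X * Y \<le> X\<^sup>2 / h + h * Y\<^sup>2" using h by simp
          then show ?thesis using Cauchy_Schwarz_ineq2[of "B (s - q) - B s" "g s"] by (simp add: X_def Y_def)
        qed
        moreover have "0 \<le> (norm (B (s - q) - B s))\<^sup>2 / h + h * (norm (g s))\<^sup>2" using h by simp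
        ultimately show "\<bar>indicator A s * (B (s - q) \<bullet> g s) - indicator A s * (B (s - 0) \<bullet> g s)\<bar>
            \<le> (norm (B (s - q) - B s))\<^sup>2 / h + h * (norm (g s))\<^sup>2"
          by (auto simp: indicator_def inner_diff_left)
      qed (use iA[of q] iA[of 0] id g(2) in auto)
      also have "\<dots> = (LBINT s. (norm (B (s - q) - B s))\<^sup>2) / h + h * G" using id g(2) by (simp add: G_def)
      also have "\<dots> \<le> (h * e / 2) / h + e / 2" using le h by (intro add_mono divide_right_mono) auto
      also have "\<dots> = e" using h by simp
      finally show "\<bar>\<Phi> q - \<Phi> 0\<bar> \<le> e" .
    qed
  qed
  fix \<theta> :: "real \<Rightarrow> real" assume \<theta>: "integrable lborel \<theta>"
  note [measurable] = borel_measurable_integrable[OF \<theta>]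
  have I: "integrable (lborel \<Otimes>\<^sub>M lborel) (\<lambda>(s, q). \<theta> q * (indicator A s * (B (s - q) \<bullet> g s)))"
  proof (rule Bochner_Integration.integrable_bound)
    have a\<theta>: "integrable lborel (\<lambda>q. \<bar>\<theta> q\<bar>)" using \<theta> by simp
    have 1: "integrable (lborel \<Otimes>\<^sub>M lborel) (\<lambda>(s, q). (norm (B (s - q)))\<^sup>2 * \<bar>\<theta> q\<bar>)"
      using convolution_integrand_integrable[OF B(2) a\<theta>, of "\<lambda>_ _. 1" 1] by simp
    have 2: "integrable (lborel \<Otimes>\<^sub>M lborel) (\<lambda>(s, q). (norm (g s))\<^sup>2 * \<bar>\<theta> q\<bar>)"
    proof (rule lborel_pair.Fubini_integrable)
      show "(\<lambda>(s, q). (norm (g s))\<^sup>2 * \<bar>\<theta> q\<bar>) \<in> borel_measurable (lborel \<Otimes>\<^sub>M lborel)" by measurable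
      show "integrable lborel (\<lambda>s. LBINT q. norm (case (s, q) of (s, q) \<Rightarrow> (norm (g s))\<^sup>2 * \<bar>\<theta> q\<bar>))"
        using g(2) by (simp add: abs_mult)
      show "AE s in lborel. integrable lborel (\<lambda>q. case (s, q) of (s, q) \<Rightarrow> (norm (g s))\<^sup>2 * \<bar>\<theta> q\<bar>)"
        using a\<theta> by simp
    qed
    show "integrable (lborel \<Otimes>\<^sub>M lborel) (\<lambda>p. (case p of (s, q) \<Rightarrow> (norm (B (s - q)))\<^sup>2 * \<bar>\<theta> q\<bar>) + (case p of (s, q) \<Rightarrow> (norm (g s))\<^sup>2 * \<bar>\<theta> q\<bar>))"
      by (rule Bochner_Integration.integrable_add[OF 1 2])
    show "(\<lambda>(s, q). \<theta> q * (indicator A s * (B (s - q) \<bullet> g s))) \<in> borel_measurable (lborel \<Otimes>\<^sub>M lborel)"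
      using pm by (simp add: case_prod_beta')
    show "AE p in lborel \<Otimes>\<^sub>M lborel. norm (case p of (s, q) \<Rightarrow> \<theta> q * (indicator A s * (B (s - q) \<bullet> g s)))
      \<le> norm ((case p of (s, q) \<Rightarrow> (norm (B (s - q)))\<^sup>2 * \<bar>\<theta> q\<bar>) + (case p of (s, q) \<Rightarrow> (norm (g s))\<^sup>2 * \<bar>\<theta> q\<bar>))"
    proof (rule AE_I2, clarify)
      fix s q
      have "\<bar>indicator A s * (B (s - q) \<bullet> g s)\<bar> \<le> (norm (B (s - q)))\<^sup>2 + (norm (g s))\<^sup>2"
        using CS[of s q] by (auto simp: indicator_def)
      then have "\<bar>\<theta> q\<bar> * \<bar>indicator A s * (B (s - q) \<bullet> g s)\<bar> \<le> \<bar>\<theta> q\<bar> * ((norm (B (s - q)))\<^sup>2 + (norm (g s))\<^sup>2)"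
        by (rule mult_left_mono) simp
      also have "\<dots> = (norm (B (s - q)))\<^sup>2 * \<bar>\<theta> q\<bar> + (norm (g s))\<^sup>2 * \<bar>\<theta> q\<bar>" by (simp add: algebra_simps)
      finally show "norm (\<theta> q * (indicator A s * (B (s - q) \<bullet> g s))) \<le> norm ((norm (B (s - q)))\<^sup>2 * \<bar>\<theta> q\<bar> + (norm (g s))\<^sup>2 * \<bar>\<theta> q\<bar>)"
        unfolding real_norm_def abs_mult[of "\<theta> q"] by (rule order_trans[OF _ abs_ge_self])
    qed
  qed
  have eq: "indicator A s * (LBINT r. \<theta> (s - r) * (B r \<bullet> g s)) = (LBINT q. \<theta> q * (indicator A s * (B (s - q) \<bullet> g s)))" for s
  proof -
    have "(LBINT r. \<theta> (s - r) * (B r \<bullet> g s)) = (LBINT q. \<theta> q * (B (s - q) \<bullet> g s))"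
      using lborel_integral_real_affine[of "-1" "\<lambda>r. \<theta> (s - r) * (B r \<bullet> g s)" s] by simp
    then show ?thesis by (subst mult.left_commute) simp
  qed
  have "(LBINT q. (LBINT s. \<theta> q * (indicator A s * (B (s - q) \<bullet> g s)))) = (LBINT q. \<theta> q * \<Phi> q)"
    unfolding \<Phi>_def by simp
  with lborel_pair.Fubini_integral[OF I] lborel_pair.integrable_fst'[OF I]
  show "integrable lborel (\<lambda>s. indicator A s * (LBINT r. \<theta> (s - r) * (B r \<bullet> g s))) \<and>
       (LBINT s. indicator A s * (LBINT r. \<theta> (s - r) * (B r \<bullet> g s))) = (LBINT q. \<theta> q * \<Phi> q)"
    unfolding eq by simp
qed

text \<open>
  The function \<open>E\<close> is not sign-definite, but \<open>E + p\<close> is nonnegative with \<open>kb p\<close> integrable. Fatou's lemma for \<open>E + p\<close> gives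
  integrability of \<open>kb E\<close>; then dominated convergence applies.
\<close>

lemma Fatou_limit_inequality:
  fixes \<kappa> :: "nat \<Rightarrow> 'x \<Rightarrow> real" and kb E p :: "'x \<Rightarrow> real"
  assumes m: "\<And>n. \<kappa> n \<in> borel_measurable M" "kb \<in> borel_measurable M" "E \<in> borel_measurable M" "p \<in> borel_measurable M"
    and \<kappa>: "\<And>n s. 0 \<le> \<kappa> n s" "\<And>n s. \<kappa> n s \<le> kb s" "AE s in M. (\<lambda>n. \<kappa> n s) \<longlonglongrightarrow> kb s"
    and p: "integrable M (\<lambda>s. kb s * p s)" "\<And>s. 0 \<le> p s"
    and E: "AE s in M. - p s \<le> E s" "\<And>n. integrable M (\<lambda>s. \<kappa> n s * E s)"
    and U: "\<And>n. (\<integral>s. \<kappa> n s * E s \<partial>M) \<le> U n" "U \<longlonglongrightarrow> V"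
  shows "integrable M (\<lambda>s. kb s * E s) \<and> (\<integral>s. kb s * E s \<partial>M) \<le> V"
proof -
  note [measurable] = m
  have kb0: "0 \<le> kb s" for s using \<kappa>(1,2)[of 0 s] by linarith
  have ip: "integrable M (\<lambda>s. \<kappa> n s * p s)" for n
    by (rule Bochner_Integration.integrable_bound[OF p(1)])
      (use \<kappa> p(2) kb0 in \<open>auto simp: abs_mult intro!: AE_I2 mult_right_mono\<close>)
  define P where "P = (\<integral>s. kb s * p s \<partial>M)"
  have lim: "AE s in M. ennreal (kb s * (E s + p s)) \<le> liminf (\<lambda>n. ennreal (\<kappa> n s * (E s + p s)))"
    using \<kappa>(3)
  proof eventually_elim
    case (elim s)
    have "(\<lambda>n. \<kappa> n s * (E s + p s)) \<longlonglongrightarrow> kb s * (E s + p s)" by (intro tendsto_intros elim)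
    then have "(\<lambda>n. ennreal (\<kappa> n s * (E s + p s))) \<longlonglongrightarrow> ennreal (kb s * (E s + p s))" by (rule tendsto_ennrealI)
    then show ?case by (simp add: lim_imp_Liminf)
  qed
  have "(\<integral>\<^sup>+s. ennreal (kb s * (E s + p s)) \<partial>M) \<le> (\<integral>\<^sup>+s. liminf (\<lambda>n. ennreal (\<kappa> n s * (E s + p s))) \<partial>M)"
    by (rule nn_integral_mono_AE[OF lim])
  also have "\<dots> \<le> liminf (\<lambda>n. \<integral>\<^sup>+s. ennreal (\<kappa> n s * (E s + p s)) \<partial>M)"
    by (rule nn_integral_liminf) measurable
  also have "\<dots> \<le> liminf (\<lambda>n. ennreal (U n + P))"
  proof (rule Liminf_mono, rule always_eventually, rule allI)
    fix n
    have i: "integrable M (\<lambda>s. \<kappa> n s * (E s + p s))" using E(2) ip by (simp add: distrib_left)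
    have nn: "AE s in M. 0 \<le> \<kappa> n s * (E s + p s)"
      using E(1) by eventually_elim (use \<kappa>(1) in \<open>auto intro!: mult_nonneg_nonneg\<close>)
    have "(\<integral>\<^sup>+s. ennreal (\<kappa> n s * (E s + p s)) \<partial>M) = ennreal (\<integral>s. \<kappa> n s * (E s + p s) \<partial>M)"
      by (rule nn_integral_eq_integral[OF i nn])
    also have "\<dots> \<le> ennreal (U n + P)"
    proof (rule ennreal_leI)
      have "(\<integral>s. \<kappa> n s * p s \<partial>M) \<le> P"
        unfolding P_def by (rule integral_mono[OF ip p(1)]) (use \<kappa> p(2) in \<open>auto intro!: mult_right_mono\<close>)
      then show "(\<integral>s. \<kappa> n s * (E s + p s) \<partial>M) \<le> U n + P" using U(1)[of n] E(2) ip by (simp add: distrib_left)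
    qed
    finally show "(\<integral>\<^sup>+s. ennreal (\<kappa> n s * (E s + p s)) \<partial>M) \<le> ennreal (U n + P)" .
  qed
  also have "liminf (\<lambda>n. ennreal (U n + P)) = ennreal (V + P)"
    by (rule lim_imp_Liminf) (auto intro!: tendsto_ennrealI tendsto_intros U)
  finally have fin: "(\<integral>\<^sup>+s. ennreal (kb s * (E s + p s)) \<partial>M) \<le> ennreal (V + P)" .
  have "integrable M (\<lambda>s. kb s * (E s + p s))"
  proof (rule integrableI_nonneg)
    show "AE s in M. 0 \<le> kb s * (E s + p s)"
      using E(1) by eventually_elim (use kb0 in \<open>auto intro!: mult_nonneg_nonneg\<close>)
    show "(\<integral>\<^sup>+s. ennreal (kb s * (E s + p s)) \<partial>M) < \<infinity>" using fin by (auto intro: le_less_trans)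
  qed measurable
  then have "integrable M (\<lambda>s. kb s * (E s + p s) - kb s * p s)" using p(1) by (rule Bochner_Integration.integrable_diff)
  then have i: "integrable M (\<lambda>s. kb s * E s)" by (simp add: distrib_left)
  have "(\<lambda>n. \<integral>s. \<kappa> n s * E s \<partial>M) \<longlonglongrightarrow> (\<integral>s. kb s * E s \<partial>M)"
  proof (rule integral_dominated_convergence[where w="\<lambda>s. \<bar>kb s * E s\<bar>"])
    show "AE s in M. (\<lambda>n. \<kappa> n s * E s) \<longlonglongrightarrow> kb s * E s"
      using \<kappa>(3) by eventually_elim (intro tendsto_intros)
    show "AE s in M. norm (\<kappa> n s * E s) \<le> \<bar>kb s * E s\<bar>" for n
      using \<kappa> kb0 by (auto simp: abs_mult intro!: AE_I2 mult_right_mono)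
  qed (use i in auto)
  from LIMSEQ_le[OF this U(2)] U(1) have "(\<integral>s. kb s * E s \<partial>M) \<le> V" by blast
  with i show ?thesis by blast
qed

text \<open>
  The derivative \<open>B\<close> of \<open>k * w\<close> satisfies \<open>k * w = C + 1 * B\<close> with a constant \<open>C\<close>. The continuous representative vanishes at
  \<open>0\<close> for elements of \<open>D(\<B>)\<close>, so \<open>C = 0\<close>.
\<close>

lemma dom_B_convolution_primitive:
  fixes w0 :: "real \<Rightarrow> 'a::{real_inner,complete_space}"
  assumes T: "0 < T" "T \<le> R" and dom: "w0 \<in> dom_B T k"
    and w: "interval_function T w" "integrable lborel (\<lambda>r. norm (w r))" "AE s\<in>{0<..<T} in lborel. w0 s = w s"
    and k1: "integrable lborel k1" "\<And>r. r \<in> {0<..<R} \<Longrightarrow> k r = k1 r" "\<And>r. r \<notin> {0<..<R} \<Longrightarrow> k1 r = 0"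
  obtains B where "interval_function T B" "integrable lborel (\<lambda>s. (norm (B s))\<^sup>2)"
    "AE s\<in>{0<..<T} in lborel. weak_derivative T (vec_conv k w0) s = B s"
    "\<And>c. AE s\<in>{0<..<T} in lborel. line_conv k1 (\<lambda>r. w r \<bullet> c) s = primitive (\<lambda>r. B r \<bullet> c) s"
proof -
  note W = interval_functionD[OF w(1)]
  have Ib: "{0<..<T} \<in> sets borel" by simp
  have vW: "vec_conv k w0 \<in> W1p 2 T" using dom by (simp add: dom_B_def)
  obtain h where h: "continuous_on {0..T} h" "AE s\<in>{0<..<T} in lborel. h s = vec_conv k w0 s" "h 0 = 0"
    using dom unfolding dom_B_def AE_lebesgue_on_iff[OF Ib] by blast
  obtain F' B where F': "AE x\<in>{0<..<T} in lborel. vec_conv k w0 x = F' x"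
    and B: "interval_function T B" "AE x\<in>{0<..<T} in lborel. weak_derivative T (vec_conv k w0) x = B x"
      "integrable lborel (\<lambda>x. (norm (B x))\<^sup>2)"
    and FB: "\<And>c. \<exists>C. AE s\<in>{0<..<T} in lborel. F' s \<bullet> c = C + primitive (\<lambda>r. B r \<bullet> c) s"
    by (rule W1p_representatives[OF T(1) vW]) auto
  have B1: "integrable lborel (\<lambda>x. norm (B x))" by (rule interval_function_L1_if_L2[OF B(1,3)])
  have "AE s\<in>{0<..<T} in lborel. line_conv k1 (\<lambda>r. w r \<bullet> c) s = primitive (\<lambda>r. B r \<bullet> c) s" for c
  proof -
    obtain C where C: "AE s\<in>{0<..<T} in lborel. F' s \<bullet> c = C + primitive (\<lambda>r. B r \<bullet> c) s" using FB by blast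
    have "h 0 \<bullet> c - (C + primitive (\<lambda>r. B r \<bullet> c) 0) = 0"
    proof (rule continuous_AE_const[where d="\<lambda>s. h s \<bullet> c - (C + primitive (\<lambda>r. B r \<bullet> c) s)" and s=0])
      show "continuous_on {0..T} (\<lambda>s. h s \<bullet> c - (C + primitive (\<lambda>r. B r \<bullet> c) s))"
        by (intro continuous_intros h(1) continuous_on_subset[OF primitive_continuous[OF inner_interval_function(1)[OF B(1) B1]]]) simp
      show "AE s\<in>{0<..<T} in lborel. h s \<bullet> c - (C + primitive (\<lambda>r. B r \<bullet> c) s) = 0"
        using h(2) F' C by eventually_elim auto
    qed (use T in auto)
    then have C0: "C = 0" using h(3) by (simp add: primitive_nonpos)
    note [measurable] = borel_measurable_integrable[OF k1(1)]
    have ak: "integrable lborel (\<lambda>r. \<bar>k1 r\<bar>)" using k1(1) by simp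
    show ?thesis
      using F' C line_conv_integrable(2)[OF ak w(2)]
    proof eventually_elim
      case (elim s)
      show ?case
      proof
        assume s: "s \<in> {0<..<T}"
        have "vec_conv k w0 s \<bullet> c = (LBINT r. indicator {0<..<s} r * (k1 (s - r) *\<^sub>R w r \<bullet> c))"
          unfolding vec_conv_def
        proof (rule vec_integral_inner)
          show "simple_limit lborel (\<lambda>r. k1 (s - r) *\<^sub>R w r)" by (rule simple_limit_scaleR[OF _ W(1)]) measurable
          show "AE x\<in>{0<..<s} in lborel. k (s - x) *\<^sub>R w0 x = k1 (s - x) *\<^sub>R w x"
            using w(3) by eventually_elim (use s T k1(2) in auto)
          have "integrable lborel (\<lambda>r. norm (k1 (s - r) *\<^sub>R w r))" using elim(3) by simp
          then show "integrable lborel (\<lambda>x. indicator {0<..<s} x * norm (k1 (s - x) *\<^sub>R w x))"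
            by (rule integrable_indicator_mult) simp
        qed simp
        also have "\<dots> = line_conv k1 (\<lambda>r. w r \<bullet> c) s"
          unfolding line_conv_def
        proof (rule Bochner_Integration.integral_cong[OF refl])
          fix r
          show "indicator {0<..<s} r * (k1 (s - r) *\<^sub>R w r \<bullet> c) = k1 (s - r) * (w r \<bullet> c)"
            using W(2)[of r] k1(3)[of "s - r"] by (cases "r \<le> 0"; cases "s \<le> r") auto
        qed
        finally show "line_conv k1 (\<lambda>r. w r \<bullet> c) s = primitive (\<lambda>r. B r \<bullet> c) s" using elim(1,2) s C0 by simp
      qed
    qed
  qed
  then show thesis using that B by blast
qed

text \<open>
  As \<open>norm (w r)\<close> is at most \<open>(l * \<parallel>B\<parallel>)(r)\<close>, Tonelli bounds the integral by \<open>(k * l * \<parallel>B\<parallel>)(t) = (1 * \<parallel>B\<parallel>)(t)\<close>. The bound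
  holds at every \<open>t\<close> because \<open>k * l = 1\<close> does. It makes the negative part of the energy integrable against \<open>k(t - s)\<close>.
\<close>

lemma kernel_times_resolvent_integrable:
  fixes w B :: "real \<Rightarrow> 'a::{real_inner,complete_space}"
  assumes kp: "kernel_pair R k l" and T: "0 < T" "T < R" and t: "t \<in> {0<..T}"
    and w: "interval_function T w"
    and B: "interval_function T B" "integrable lborel (\<lambda>r. norm (B r))"
    and W: "AE s\<in>{0<..<T} in lborel. (\<forall>c. w s \<bullet> c = line_conv l (\<lambda>r. B r \<bullet> c) s)"
  shows "integrable lborel (\<lambda>r. k (t - r) * norm (w r))"
proof -
  note K = kernel_pairD[OF kp]
  note [measurable] = borel_measurable_integrable[OF K(1)] borel_measurable_integrable[OF K(2)]
    interval_functionD(4)[OF w] interval_functionD(4)[OF B(1)]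
  have le: "AE r in lborel. norm (w r) \<le> line_conv l (\<lambda>r. norm (B r)) r \<and> integrable lborel (\<lambda>q. l (r - q) * norm (B q))"
    using W line_conv_integrable(2)[OF K(2) B(2)]
  proof eventually_elim
    case (elim r)
    show ?case
    proof (cases "r \<in> {0<..<T}")
      case False
      then have "w r = 0" by (rule interval_functionD(2)[OF w])
      then show ?thesis using K(6) elim by (simp add: line_conv_def Bochner_Integration.integral_nonneg)
    next
      case True
      have "norm (w r) * norm (w r) = line_conv l (\<lambda>q. B q \<bullet> w r) r"
        using elim(1) True by (simp only: power2_norm_eq_inner power2_eq_square[symmetric] simp_thms)
      also have "\<dots> \<le> (LBINT q. l (r - q) * norm (B q) * norm (w r))"
        unfolding line_conv_def
      proof (rule Bochner_Integration.integral_mono')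
        show "integrable lborel (\<lambda>q. l (r - q) * norm (B q) * norm (w r))" using elim by simp
        fix q
        have "B q \<bullet> w r \<le> norm (B q) * norm (w r)" by (rule norm_cauchy_schwarz)
        then show "l (r - q) * (B q \<bullet> w r) \<le> l (r - q) * norm (B q) * norm (w r)"
          using K(6) by (simp add: mult.assoc mult_left_mono)
        show "0 \<le> l (r - q) * norm (B q) * norm (w r)" using K(6) by simp
      qed
      finally have "norm (w r) * norm (w r) \<le> line_conv l (\<lambda>r. norm (B r)) r * norm (w r)" by (simp add: line_conv_def)
      moreover have "0 \<le> line_conv l (\<lambda>r. norm (B r)) r"
        unfolding line_conv_def using K(6) by (intro Bochner_Integration.integral_nonneg) auto
      ultimately have "norm (w r) \<le> line_conv l (\<lambda>r. norm (B r)) r"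
        by (cases "norm (w r) = 0") (auto simp: mult_le_cancel_right)
      then show ?thesis using elim by simp
    qed
  qed
  show ?thesis
  proof (rule integrableI_nonneg)
    have "(\<integral>\<^sup>+r. ennreal (k (t - r) * norm (w r)) \<partial>lborel)
        \<le> (\<integral>\<^sup>+r. (\<integral>\<^sup>+q. ennreal (k (t - r)) * (ennreal (l (r - q)) * ennreal (norm (B q))) \<partial>lborel) \<partial>lborel)"
    proof (rule nn_integral_mono_AE)
      show "AE r in lborel. ennreal (k (t - r) * norm (w r))
          \<le> (\<integral>\<^sup>+q. ennreal (k (t - r)) * (ennreal (l (r - q)) * ennreal (norm (B q))) \<partial>lborel)"
        using le
      proof eventually_elim
        case (elim r)
        have "ennreal (k (t - r) * norm (w r)) \<le> ennreal (k (t - r)) * ennreal (line_conv l (\<lambda>r. norm (B r)) r)"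
          using elim K(5) by (simp add: ennreal_mult mult_left_mono ennreal_leI)
        also have "ennreal (line_conv l (\<lambda>r. norm (B r)) r) = (\<integral>\<^sup>+q. ennreal (l (r - q) * norm (B q)) \<partial>lborel)"
          unfolding line_conv_def using elim K(6) by (intro nn_integral_eq_integral[symmetric]) auto
        also have "\<dots> = (\<integral>\<^sup>+q. ennreal (l (r - q)) * ennreal (norm (B q)) \<partial>lborel)"
          using K(6) by (simp add: ennreal_mult)
        also have "ennreal (k (t - r)) * \<dots> = (\<integral>\<^sup>+q. ennreal (k (t - r)) * (ennreal (l (r - q)) * ennreal (norm (B q))) \<partial>lborel)"
          by (rule nn_integral_cmult[symmetric]) measurable
        finally show ?case .
      qed
    qed
    also have "\<dots> = (\<integral>\<^sup>+q. (\<integral>\<^sup>+r. ennreal (k (t - r)) * (ennreal (l (r - q)) * ennreal (norm (B q))) \<partial>lborel) \<partial>lborel)"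
      by (rule lborel_pair.Fubini') measurable
    also have "\<dots> \<le> (\<integral>\<^sup>+q. ennreal (norm (B q)) \<partial>lborel)"
    proof (rule nn_integral_mono)
      fix q
      have "(\<integral>\<^sup>+r. ennreal (k (t - r)) * (ennreal (l (r - q)) * ennreal (norm (B q))) \<partial>lborel)
          = (\<integral>\<^sup>+r. ennreal (k (t - r) * l (r - q)) * ennreal (norm (B q)) \<partial>lborel)"
        using K(5,6) by (simp add: ennreal_mult mult.assoc)
      also have "\<dots> = (\<integral>\<^sup>+r. ennreal (k (t - r) * l (r - q)) \<partial>lborel) * ennreal (norm (B q))"
        by (rule nn_integral_multc) measurable
      also have "(\<integral>\<^sup>+r. ennreal (k (t - r) * l (r - q)) \<partial>lborel) = (\<integral>\<^sup>+x. ennreal (k (t - q - x) * l x) \<partial>lborel)"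
        using nn_integral_real_affine[of "\<lambda>r. ennreal (k (t - r) * l (r - q))" 1 q] by (simp add: algebra_simps)
      also have "\<dots> * ennreal (norm (B q)) \<le> 1 * ennreal (norm (B q))"
      proof (cases "q \<in> {0<..<t}")
        case True
        then have s: "t - q \<in> {0<..<R}" using t T by auto
        have "(\<integral>\<^sup>+x. ennreal (k (t - q - x) * l x) \<partial>lborel) = ennreal (LBINT x. k (t - q - x) * l x)"
          using K(5,6) by (intro nn_integral_eq_integral K(10)[OF s]) auto
        then show ?thesis using K(9)[OF s] by (simp add: line_conv_def)
      next
        case False
        show ?thesis
        proof (cases "q \<le> 0")
          case True
          then show ?thesis using interval_functionD(2)[OF B(1), of q] by simp
        next
          case q: False
          have e: "k (t - q - x) * l x = 0" for x using K(3)[of "t - q - x"] K(4)[of x] False q by (cases "x \<le> 0") auto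
          show ?thesis unfolding e by simp
        qed
      qed
      finally show "(\<integral>\<^sup>+r. ennreal (k (t - r)) * (ennreal (l (r - q)) * ennreal (norm (B q))) \<partial>lborel) \<le> ennreal (norm (B q))" by simp
    qed
    also have "\<dots> < \<infinity>" using B(2) unfolding integrable_iff_bounded by simp
    finally show "(\<integral>\<^sup>+r. ennreal (k (t - r) * norm (w r)) \<partial>lborel) < \<infinity>" .
  qed (use K(5) in auto)
qed

text \<open>
  The inequality for the averaged kernels has the form \<open>\<integral> \<kappa>\<^sub>n E \<le> U\<^sub>n\<close>, where \<open>U\<^sub>n\<close> collects the pairing, the initial energy and
  the errors \<open>D\<close>. The pairings converge by the approximate identity, the initial terms by dominated convergence, and the left-hand
  sides are treated by Fatou's lemma.
\<close>

lemma star_ineq_PC: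
  fixes \<phi> :: "real \<Rightarrow> 'a::{real_inner,complete_space} \<Rightarrow> ereal"
  assumes t: "t \<in> {0<..T}" and \<epsilon>: "\<epsilon> \<in> {0<..<1}" and C: "0 \<le> C"
    and pair: "chain_rule_pair T C (real_of_ereal (\<phi> 0 u0)) w g' E"
    and w: "AE s\<in>{0<..<T} in lborel. u s - u0 = w s"
    and g: "AE s\<in>{0<..<T} in lborel. g s = g' s"
    and E: "AE s\<in>{0<..<T} in lborel. energy \<phi> u s = E s"
    and L: "0 \<le> L" "AE s\<in>{0<..<T} in lborel. - L * (1 + norm (u0 + w s)) \<le> E s"
    and k: "PC k l" and dom: "(\<lambda>s. u s - u0) \<in> dom_B T k"
  shows "star_ineq T \<phi> u0 C k u g \<epsilon> t"
proof -
  note P = chain_rule_pairD[OF pair]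
  have T: "0 < T" using t by simp
  \<comment> \<open>The averages look ahead by \<open>\<delta> \<le> 1\<close>, so the kernels are needed slightly beyond \<open>T\<close>.\<close>
  define R where "R = T + 2"
  define k1 l1 where "k1 r = indicator {0<..<R} r * k r" and "l1 r = indicator {0<..<R} r * l r" for r
  have R: "0 < R" "T < R" "T \<le> R" using T by (auto simp: R_def)
  have kp: "kernel_pair R k1 l1"
    using PC_kernel_pair[OF k R(1)] by (simp add: k1_def[abs_def] l1_def[abs_def])
  note K = kernel_pairD[OF kp]
  have w1: "integrable lborel (\<lambda>r. norm (w r))" by (rule interval_function_L1_if_L2[OF P(1,2)])
  obtain B where B: "interval_function T B" "integrable lborel (\<lambda>s. (norm (B s))\<^sup>2)"
    "AE s\<in>{0<..<T} in lborel. weak_derivative T (vec_conv k (\<lambda>s. u s - u0)) s = B s"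
    and star: "\<And>c. AE s\<in>{0<..<T} in lborel. line_conv k1 (\<lambda>r. w r \<bullet> c) s = primitive (\<lambda>r. B r \<bullet> c) s"
    by (rule dom_B_convolution_primitive[OF T R(3) dom P(1) w1 w K(1)]) (auto simp: k1_def)
  have B1: "integrable lborel (\<lambda>r. norm (B r))" by (rule interval_function_L1_if_L2[OF B(1,2)])
  have W: "AE s\<in>{0<..<T} in lborel. (\<forall>c. w s \<bullet> c = line_conv l1 (\<lambda>r. B r \<bullet> c) s)"
    by (rule invert_vector_convolution[OF kp T R(3) P(1) w1 B(1) B1 star])
  define \<delta> where "\<delta> n = 1 / real (Suc n)" for n
  have \<delta>: "0 < \<delta> n" "T + \<delta> n < R" for n
  proof -
    show "0 < \<delta> n" by (simp add: \<delta>_def)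
    have "\<delta> n \<le> 1" by (simp add: \<delta>_def)
    then show "T + \<delta> n < R" by (simp add: R_def)
  qed
  have \<delta>0: "\<delta> \<longlonglongrightarrow> 0" unfolding \<delta>_def using LIMSEQ_inverse_real_of_nat by (simp only: inverse_eq_divide)
  let ?I = "indicat_real {0<..<t}" and ?E0 = "real_of_ereal (\<phi> 0 u0)"
  have It: "{0<..<t} \<in> sets borel" by simp
  define kb where "kb r = indicator {0<..<T} r * k1 r" for r
  have kb: "integrable lborel kb" unfolding kb_def by (rule integrable_indicator_mult[OF K(1)]) simp
  have kb0: "0 \<le> kb r" for r using K(5) by (simp add: kb_def)
  note [measurable] = borel_measurable_integrable[OF kb] borel_measurable_integrable[OF K(1)] primitive_borel[OF K(1)]
    borel_measurable_integrable[OF P(5)] interval_functionD(4)[OF P(1)]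
  have avm[measurable]: "avg_kernel k1 d \<in> borel_measurable borel" for d unfolding avg_kernel_def[abs_def] by measurable
  define N where "N = (LBINT r. kb r)"
  define \<theta> where "\<theta> n = avg_weight T k1 l1 (\<delta> n)" for n
  define \<Phi> where "\<Phi> q = (LBINT s. ?I s * (B (s - q) \<bullet> g' s))" for q
  define b where "b n s = (LBINT r. \<theta> n (s - r) * (B r \<bullet> g' s))" for n s
  note AW = avg_weight_props[OF kp \<delta> T]
  note cor = correlation_props[OF B(1,2) P(3,4) It]
  have bint: "integrable lborel (\<lambda>s. ?I s * b n s)" "(LBINT s. ?I s * b n s) = (LBINT q. \<theta> n q * \<Phi> q)" for n
    using cor(4)[OF AW(1)[of n]] unfolding b_def \<Phi>_def \<theta>_def by auto
  have blim: "(\<lambda>n. LBINT s. ?I s * b n s) \<longlonglongrightarrow> \<Phi> 0"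
    unfolding bint(2)
  proof (rule approximate_identity[OF T])
    show "integrable lborel (\<theta> n)" "0 \<le> \<theta> n r" for n r unfolding \<theta>_def using AW(1,3) by auto
    show "\<theta> n r = 0" if "r \<notin> {0<..<T}" for n r unfolding \<theta>_def by (rule AW(2)[OF that])
    show "(\<lambda>n. primitive (\<theta> n) s) \<longlonglongrightarrow> 1" if "0 < s" "s \<le> T" for s
      unfolding \<theta>_def by (rule avg_weight_mass(2)[OF kp T that \<delta> \<delta>0])
    show "primitive (\<theta> n) T \<le> 1" for n
      unfolding \<theta>_def by (rule avg_weight_mass(1)[OF kp T T order_refl \<delta> \<delta>0])
    show "\<Phi> \<in> borel_measurable borel" using cor(1) unfolding \<Phi>_def .
    show "\<bar>\<Phi> r\<bar> \<le> (LBINT s. (norm (B s))\<^sup>2) + (LBINT s. (norm (g' s))\<^sup>2)" for r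
      using cor(2) unfolding \<Phi>_def .
    show "\<exists>d>0. \<forall>r. 0 < r \<and> r < d \<longrightarrow> \<bar>\<Phi> r - \<Phi> 0\<bar> \<le> e" if "0 < e" for e
      using cor(3)[OF that] unfolding \<Phi>_def by auto
  qed
  define \<kappa> where "\<kappa> n s = ?I s * avg_kernel k1 (\<delta> n) (t - s)" for n s
  define D where "D = \<epsilon> * C * N * (LBINT s. ?I s * (norm (g' s))\<^sup>2) + C / \<epsilon> * t * N * (1 + \<bar>?E0\<bar>)
      + C / \<epsilon> * N * (LBINT s. ?I s * \<bar>E s\<bar>)"
  have Ik: "integrable lborel (\<lambda>r. ?I r * kb r)" by (rule integrable_indicator_mult[OF kb It])
  have Ikav: "\<bar>?I r * avg_kernel k1 (\<delta> n) r\<bar> \<le> ?I r * kb r" for n r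
    using avg_kernel_bounds(2,3)[OF kp \<delta>(1)[of n], of r] t by (auto simp: indicator_def kb_def)
  have Iav: "integrable lborel (\<lambda>r. ?I r * avg_kernel k1 (\<delta> n) r)" for n
    by (rule Bochner_Integration.integrable_bound[OF Ik])
      (use Ikav in \<open>auto intro!: AE_I2 order_trans[OF _ abs_ge_self]\<close>)
  define U where "U n = (LBINT s. ?I s * b n s) + ?E0 * (LBINT r. ?I r * avg_kernel k1 (\<delta> n) r) + D" for n
  have ineq: "(LBINT s. \<kappa> n s * E s) \<le> U n" for n
  proof -
    note A = avg_slope_props[OF kp \<delta>(1)[of n], where T=T]
    have "(LBINT s. ?I s * b n s) \<ge>
      (LBINT r. ?I r * (avg_kernel k1 (\<delta> n) (t - r) * E r)) - ?E0 * (LBINT r. ?I r * avg_kernel k1 (\<delta> n) r)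
      - \<epsilon> * C * N * (LBINT s. ?I s * (norm (g' s))\<^sup>2) - C / \<epsilon> * t * N * (1 + \<bar>?E0\<bar>)
      - C / \<epsilon> * N * (LBINT s. ?I s * \<bar>E s\<bar>)"
    proof (rule absolutely_continuous_kernel_inequality[OF pair C A(1-3) _ _ t \<epsilon> _ bint(1)])
      show "avg_kernel k1 (\<delta> n) r = avg_kernel k1 (\<delta> n) 0 - primitive (avg_slope T k1 (\<delta> n)) r" if "r \<in> {0<..<T}" for r
        using A(4)[of r] that by simp
      show "0 \<le> avg_kernel k1 (\<delta> n) r" if "r \<in> {0<..<T}" for r using avg_kernel_bounds(3)[OF kp \<delta>(1)] that by simp
      have "(LBINT r. ?I r * avg_kernel k1 (\<delta> n) r) \<le> (LBINT r. kb r)"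
      proof (rule integral_mono[OF Iav kb])
        fix r show "?I r * avg_kernel k1 (\<delta> n) r \<le> kb r"
          using Ikav[of r n] kb0[of r] by (auto simp: indicator_def split: if_splits)
      qed
      then show "(LBINT r. ?I r * avg_kernel k1 (\<delta> n) r) \<le> N" by (simp add: N_def)
      show "AE s\<in>{0<..<t} in lborel. integrable lborel (\<lambda>r. avg_slope T k1 (\<delta> n) (s - r) * (w r \<bullet> g' s)) \<and>
        b n s = avg_kernel k1 (\<delta> n) 0 * (w s \<bullet> g' s) - (LBINT r. avg_slope T k1 (\<delta> n) (s - r) * (w r \<bullet> g' s))"
        using avg_weight_representation[OF kp T \<delta>(1)[of n] \<delta>(2)[of n] P(1) w1 B(1) B1 W]
        by eventually_elim (use t in \<open>auto simp: b_def \<theta>_def\<close>)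
    qed
    then show ?thesis unfolding U_def D_def \<kappa>_def by (simp add: mult.assoc)
  qed
  obtain Nn where Nn: "countable Nn"
    "\<And>r \<delta>. 0 < r \<Longrightarrow> r \<notin> Nn \<Longrightarrow> (\<And>n. 0 < \<delta> n) \<Longrightarrow> \<delta> \<longlonglongrightarrow> 0 \<Longrightarrow> (\<lambda>n::nat. avg_kernel k1 (\<delta> n) r) \<longlonglongrightarrow> k1 r"
    by (rule avg_kernel_tendsto[OF kp]) blast
  have "(\<lambda>n. LBINT r. ?I r * avg_kernel k1 (\<delta> n) r) \<longlonglongrightarrow> (LBINT r. ?I r * kb r)"
  proof (rule integral_dominated_convergence[where w="\<lambda>r. ?I r * kb r"])
    show "AE r in lborel. (\<lambda>n. ?I r * avg_kernel k1 (\<delta> n) r) \<longlonglongrightarrow> ?I r * kb r"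
      using AE_not_in[OF countable_imp_null_set_lborel[OF Nn(1)]]
    proof eventually_elim
      case (elim r)
      show ?case
      proof (cases "r \<in> {0<..<t}")
        case True
        then have "(\<lambda>n. avg_kernel k1 (\<delta> n) r) \<longlonglongrightarrow> k1 r" using elim \<delta>(1) \<delta>0 by (intro Nn(2)) auto
        then show ?thesis using True t by (simp add: kb_def)
      qed simp
    qed
    show "AE r in lborel. norm (?I r * avg_kernel k1 (\<delta> n) r) \<le> ?I r * kb r" for n using Ikav by simp
  qed (use Ik Iav in auto)
  then have Ulim: "U \<longlonglongrightarrow> \<Phi> 0 + ?E0 * (LBINT r. ?I r * kb r) + D"
    unfolding U_def by (intro tendsto_intros blim)
  define kt where "kt s = ?I s * kb (t - s)" for s
  \<comment> \<open>The uniform lower bound of the functionals gives \<open>- p \<le> E\<close>.\<close>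
  define p where "p r = indicator {0<..<T} r * (L * (1 + norm u0 + norm (w r)))" for r
  have fat: "integrable lborel (\<lambda>s. kt s * E s) \<and> (LBINT s. kt s * E s) \<le> \<Phi> 0 + ?E0 * (LBINT r. ?I r * kb r) + D"
  proof (rule Fatou_limit_inequality[where \<kappa>=\<kappa> and p=p and U=U])
    show "\<kappa> n \<in> borel_measurable lborel" for n unfolding \<kappa>_def[abs_def] by measurable
    show "kt \<in> borel_measurable lborel" unfolding kt_def[abs_def] by measurable
    show "E \<in> borel_measurable lborel" by measurable
    show "p \<in> borel_measurable lborel" unfolding p_def[abs_def] by measurable
    show "0 \<le> \<kappa> n s" for n s using avg_kernel_bounds(3)[OF kp \<delta>(1)[of n], of "t - s"] by (auto simp: \<kappa>_def indicator_def)
    show "\<kappa> n s \<le> kt s" for n s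
      using avg_kernel_bounds(2)[OF kp \<delta>(1)[of n], of "t - s"] t by (auto simp: \<kappa>_def kt_def kb_def indicator_def)
    show "AE s in lborel. (\<lambda>n. \<kappa> n s) \<longlonglongrightarrow> kt s"
      using AE_reflect_not_in_countable[OF Nn(1), of t]
    proof eventually_elim
      case (elim s)
      show ?case
      proof (cases "s \<in> {0<..<t}")
        case True
        then have "(\<lambda>n. avg_kernel k1 (\<delta> n) (t - s)) \<longlonglongrightarrow> k1 (t - s)" using elim \<delta>(1) \<delta>0 by (intro Nn(2)) auto
        then show ?thesis using True t by (simp add: \<kappa>_def kt_def kb_def)
      qed (simp add: \<kappa>_def kt_def)
    qed
    show "0 \<le> p s" for s using L(1) by (simp add: p_def)
    show "integrable lborel (\<lambda>s. kt s * p s)"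
    proof -
      have i1: "integrable lborel (\<lambda>s. k1 (t - s))" using lborel_integrable_real_affine[OF K(1), of "-1" t] by simp
      have i2: "integrable lborel (\<lambda>s. k1 (t - s) * norm (w s))"
        by (rule kernel_times_resolvent_integrable[OF kp T R(2) t P(1) B(1) B1 W])
      have "integrable lborel (\<lambda>s. L * (1 + norm u0) * k1 (t - s) + L * (k1 (t - s) * norm (w s)))"
        using i1 i2 by simp
      from integrable_indicator_mult[OF this It]
      have "integrable lborel (\<lambda>s. ?I s * (L * (1 + norm u0) * k1 (t - s) + L * (k1 (t - s) * norm (w s))))" .
      moreover have "?I s * (L * (1 + norm u0) * k1 (t - s) + L * (k1 (t - s) * norm (w s))) = kt s * p s" for s
        using t by (auto simp: kt_def p_def kb_def indicator_def algebra_simps)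
      ultimately show ?thesis by (simp only:)
    qed
    show "AE s in lborel. - p s \<le> E s"
      using L(2)
    proof eventually_elim
      case (elim s)
      show ?case
      proof (cases "s \<in> {0<..<T}")
        case True
        have "L * (1 + norm (u0 + w s)) \<le> L * (1 + norm u0 + norm (w s))"
          using L(1) norm_triangle_ineq[of u0 "w s"] by (intro mult_left_mono) auto
        then show ?thesis using elim True by (simp add: p_def)
      qed (use P(6) in \<open>simp add: p_def\<close>)
    qed
    show "integrable lborel (\<lambda>s. \<kappa> n s * E s)" for n
    proof -
      note A = avg_slope_props[OF kp \<delta>(1)[of n], where T=T]
      define Mx where "Mx = \<bar>avg_kernel k1 (\<delta> n) 0\<bar> + (LBINT r. \<bar>avg_slope T k1 (\<delta> n) r\<bar>)"
      have bd: "\<bar>\<kappa> n s\<bar> \<le> Mx" for s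
      proof (cases "s \<in> {0<..<t}")
        case True
        then have "avg_kernel k1 (\<delta> n) (t - s) = avg_kernel k1 (\<delta> n) 0 - primitive (avg_slope T k1 (\<delta> n)) (t - s)"
          using t by (intro A(4)) auto
        then show ?thesis using True primitive_bound[OF A(1), of "t - s"] by (simp add: \<kappa>_def Mx_def)
      next
        case False
        have "0 \<le> Mx" unfolding Mx_def by (intro add_nonneg_nonneg Bochner_Integration.integral_nonneg) auto
        then show ?thesis using False by (simp add: \<kappa>_def)
      qed
      show ?thesis
      proof (rule Bochner_Integration.integrable_bound[OF integrable_mult_right[OF P(5), of Mx]])
        show "(\<lambda>s. \<kappa> n s * E s) \<in> borel_measurable lborel" unfolding \<kappa>_def by measurable
        have "\<bar>\<kappa> n s\<bar> * \<bar>E s\<bar> \<le> \<bar>Mx\<bar> * \<bar>E s\<bar>" for s using bd[of s] by (intro mult_right_mono) auto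
        then show "AE s in lborel. norm (\<kappa> n s * E s) \<le> norm (Mx * E s)" by (simp add: abs_mult)
      qed
    qed
    show "(LBINT s. \<kappa> n s * E s) \<le> U n" for n by (rule ineq)
    show "U \<longlonglongrightarrow> \<Phi> 0 + ?E0 * (LBINT r. ?I r * kb r) + D" by (rule Ulim)
  qed
  show ?thesis
  proof (rule star_ineq_from_representatives[OF t P(3,4) g _ E kb _ _ kb0 _ B])
    show "E \<in> borel_measurable borel" by measurable
    show "k r = kb r" if "r \<in> {0<..<T}" for r using that R by (simp add: kb_def k1_def)
    show "kb r = 0" if "r \<notin> {0<..<T}" for r using that by (simp add: kb_def)
    show "vec_conv k (\<lambda>s. u s - u0) \<in> W1p 2 T" using dom by (simp add: dom_B_def)
    show "integrable lborel (\<lambda>s. ?I s * (kb (t - s) * E s))" using conjunct1[OF fat] by (simp add: kt_def mult.assoc)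
    have "(LBINT s. ?I s * (B s \<bullet> g' s)) = \<Phi> 0" by (simp add: \<Phi>_def)
    moreover have "(LBINT s. ?I s * (kb (t - s) * E s)) = (LBINT s. kt s * E s)" by (simp add: kt_def mult.assoc)
    ultimately show "(LBINT r. ?I r * (kb (t - r) * E r)) - ?E0 * (LBINT r. ?I r * kb r)
      - \<epsilon> * C * (LBINT r. kb r) * (LBINT s. ?I s * (norm (g' s))\<^sup>2)
      - C / \<epsilon> * t * (LBINT r. kb r) * (1 + \<bar>?E0\<bar>)
      - C / \<epsilon> * (LBINT r. kb r) * (LBINT s. ?I s * \<bar>E s\<bar>)
      \<le> (LBINT s. ?I s * (B s \<bullet> g' s))"
      using conjunct2[OF fat] unfolding D_def N_def by linarith
  qed
qed

section \<open>The two chain-rule inequalities\<close>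

theorem lemma4p6:
  fixes T :: real
    and \<phi> :: "real \<Rightarrow> 'a::{real_inner, complete_space} \<Rightarrow> ereal"
    and u0 :: 'a
  assumes "0 < T"
    and "\<And>t. t \<in> {0..T} \<Longrightarrow> proper_lsc_convex (\<phi> t)"
    and "cond_A1 T \<phi>"
    and "cond_A2 T \<phi>"
    and "u0 \<in> eff_dom (\<phi> 0)"
  shows
    "(\<exists>c\<ge>0.
        (\<forall>k u g. k \<in> W1p 1 T \<longrightarrow> (\<forall>s\<in>{0<..<T}. 0 \<le> k s) \<longrightarrow> antimono_on {0<..<T} k \<longrightarrow>
           admissible T \<phi> u g \<longrightarrow>
           (\<forall>\<epsilon>\<in>{0<..<1}. \<forall>t\<in>{0<..T}. star_ineq T \<phi> u0 c k u g \<epsilon> t)) \<and>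
        (\<forall>k l u g. PC k l \<longrightarrow> admissible T \<phi> u g \<longrightarrow> (\<lambda>s. u s - u0) \<in> dom_B T k \<longrightarrow>
           (\<forall>\<epsilon>\<in>{0<..<1}. \<forall>t\<in>{0<..T}. star_ineq T \<phi> u0 c k u g \<epsilon> t))) \<and>
     (\<forall>k l. PC k l \<longrightarrow>
        (\<exists>C\<ge>0. \<forall>u g. admissible T \<phi> u g \<longrightarrow> (\<lambda>s. u s - u0) \<in> dom_B T k \<longrightarrow>
           (\<forall>\<epsilon>\<in>{0<..<1}. \<forall>t\<in>{0<..T}.
              terms_exist T \<phi> u0 k u g t \<and>
              (\<integral>s. weak_derivative T (vec_conv k (\<lambda>s. u s - u0)) s \<bullet> g s \<partial>lebesgue_on {0<..<t}) \<ge>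
                conv k (energy \<phi> u) t
                - real_of_ereal (\<phi> 0 u0) * (\<integral>s. k s \<partial>lebesgue_on {0<..<t})
                - \<epsilon> * C * (\<integral>s. (norm (g s))\<^sup>2 \<partial>lebesgue_on {0<..<t})
                - C / \<epsilon> * (T * (1 + \<bar>real_of_ereal (\<phi> 0 u0)\<bar>)
                           + (\<integral>s. \<bar>energy \<phi> u s\<bar> \<partial>lebesgue_on {0<..<t})))))"
proof -
  obtain c where c: "c \<ge> 0" and A: "\<And>s t z. s \<in> {0..T} \<Longrightarrow> t \<in> {0..T} \<Longrightarrow> s \<le> t \<Longrightarrow> z \<in> eff_dom (\<phi> s) \<Longrightarrow>
     \<exists>z'\<in>eff_dom (\<phi> t).
        norm (z' - z) \<le> c * \<bar>t - s\<bar> * sqrt (1 + \<bar>real_of_ereal (\<phi> s z)\<bar>) \<and>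
        \<phi> t z' \<le> \<phi> s z + ereal (c * \<bar>t - s\<bar> * (1 + \<bar>real_of_ereal (\<phi> s z)\<bar>))"
    using \<open>cond_A1 T \<phi>\<close> unfolding cond_A1_def by blast
  obtain L where L: "L \<ge> 0"
    "\<And>s z. s \<in> {0..T} \<Longrightarrow> z \<in> eff_dom (\<phi> s) \<Longrightarrow> - L * (1 + norm z) \<le> real_of_ereal (\<phi> s z)"
    using uniform_linear_lower_bound[OF \<open>0 < T\<close> assms(2) \<open>cond_A1 T \<phi>\<close>] by blast
  have c2: "0 \<le> 2 * c" using c by simp
  have W11: "star_ineq T \<phi> u0 (2 * c) k u g \<epsilon> t"
    if "k \<in> W1p 1 T" "\<And>s. s \<in> {0<..<T} \<Longrightarrow> 0 \<le> k s" "antimono_on {0<..<T} k" "admissible T \<phi> u g"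
      "\<epsilon> \<in> {0<..<1}" "t \<in> {0<..T}" for k u g \<epsilon> t
  proof -
    note adm = that(4)
    obtain w g' E where pair: "chain_rule_pair T (2 * c) (real_of_ereal (\<phi> 0 u0)) w g' E"
      and reps: "AE s in lborel. s \<in> {0<..<T} \<longrightarrow> u s - u0 = w s"
        "AE s in lborel. s \<in> {0<..<T} \<longrightarrow> g s = g' s"
        "AE s in lborel. s \<in> {0<..<T} \<longrightarrow> energy \<phi> u s = E s"
      and low: "AE s in lborel. s \<in> {0<..<T} \<longrightarrow> - L * (1 + norm (u0 + w s)) \<le> E s"
      by (rule admissible_chain_rule_pair[OF \<open>0 < T\<close> assms(2) c A L(2) \<open>u0 \<in> eff_dom (\<phi> 0)\<close> adm]) blast+
    show ?thesis by (rule star_ineq_W11[OF that(6,5) c2 pair reps that(1-3)])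
  qed
  have PC: "star_ineq T \<phi> u0 (2 * c) k u g \<epsilon> t"
    if "PC k l" "admissible T \<phi> u g" "(\<lambda>s. u s - u0) \<in> dom_B T k" "\<epsilon> \<in> {0<..<1}" "t \<in> {0<..T}"
    for k l u g \<epsilon> t
  proof -
    note adm = that(2)
    obtain w g' E where pair: "chain_rule_pair T (2 * c) (real_of_ereal (\<phi> 0 u0)) w g' E"
      and reps: "AE s in lborel. s \<in> {0<..<T} \<longrightarrow> u s - u0 = w s"
        "AE s in lborel. s \<in> {0<..<T} \<longrightarrow> g s = g' s"
        "AE s in lborel. s \<in> {0<..<T} \<longrightarrow> energy \<phi> u s = E s"
      and low: "AE s in lborel. s \<in> {0<..<T} \<longrightarrow> - L * (1 + norm (u0 + w s)) \<le> E s"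
      by (rule admissible_chain_rule_pair[OF \<open>0 < T\<close> assms(2) c A L(2) \<open>u0 \<in> eff_dom (\<phi> 0)\<close> adm]) blast+
    show ?thesis by (rule star_ineq_PC[OF that(5,4) c2 pair reps L(1) low that(1,3)])
  qed
  have L1: "0 \<le> L1_norm T k" for k
    unfolding L1_norm_def by (rule Bochner_Integration.integral_nonneg) simp
  show ?thesis
  proof (intro conjI allI impI)
    show "\<exists>c\<ge>0.
        (\<forall>k u g. k \<in> W1p 1 T \<longrightarrow> (\<forall>s\<in>{0<..<T}. 0 \<le> k s) \<longrightarrow> antimono_on {0<..<T} k \<longrightarrow>
           admissible T \<phi> u g \<longrightarrow>
           (\<forall>\<epsilon>\<in>{0<..<1}. \<forall>t\<in>{0<..T}. star_ineq T \<phi> u0 c k u g \<epsilon> t)) \<and>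
        (\<forall>k l u g. PC k l \<longrightarrow> admissible T \<phi> u g \<longrightarrow> (\<lambda>s. u s - u0) \<in> dom_B T k \<longrightarrow>
           (\<forall>\<epsilon>\<in>{0<..<1}. \<forall>t\<in>{0<..T}. star_ineq T \<phi> u0 c k u g \<epsilon> t))"
      using c2 W11 PC by blast
  next
    fix k l assume k: "PC k l"
    \<comment> \<open>The norm of the fixed kernel goes into the constant, and \<open>t \<le> T\<close>.\<close>
    define C where "C = 2 * c * L1_norm T k"
    show "\<exists>C\<ge>0. \<forall>u g. admissible T \<phi> u g \<longrightarrow> (\<lambda>s. u s - u0) \<in> dom_B T k \<longrightarrow>
           (\<forall>\<epsilon>\<in>{0<..<1}. \<forall>t\<in>{0<..T}.
              terms_exist T \<phi> u0 k u g t \<and>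
              (\<integral>s. weak_derivative T (vec_conv k (\<lambda>s. u s - u0)) s \<bullet> g s \<partial>lebesgue_on {0<..<t}) \<ge>
                conv k (energy \<phi> u) t
                - real_of_ereal (\<phi> 0 u0) * (\<integral>s. k s \<partial>lebesgue_on {0<..<t})
                - \<epsilon> * C * (\<integral>s. (norm (g s))\<^sup>2 \<partial>lebesgue_on {0<..<t})
                - C / \<epsilon> * (T * (1 + \<bar>real_of_ereal (\<phi> 0 u0)\<bar>)
                           + (\<integral>s. \<bar>energy \<phi> u s\<bar> \<partial>lebesgue_on {0<..<t})))"
    proof (intro exI[of _ C] conjI allI impI ballI)
      show C0: "0 \<le> C" unfolding C_def using c L1 by simp
      fix u g :: "real \<Rightarrow> 'a" and \<epsilon> t :: real
      assume adm: "admissible T \<phi> u g" "(\<lambda>s. u s - u0) \<in> dom_B T k" and \<epsilon>: "\<epsilon> \<in> {0<..<1}" and t: "t \<in> {0<..T}"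
      have star: "star_ineq T \<phi> u0 (2 * c) k u g \<epsilon> t" by (rule PC[OF k adm \<epsilon> t])
      then show "terms_exist T \<phi> u0 k u g t" by (simp add: star_ineq_def)
      define e where "e = \<bar>real_of_ereal (\<phi> 0 u0)\<bar>"
      have e0: "0 \<le> e" unfolding e_def by (rule abs_ge_zero)
      define I where "I = (\<integral>s. \<bar>energy \<phi> u s\<bar> \<partial>lebesgue_on {0<..<t})"
      define G where "G = (\<integral>s. (norm (g s))\<^sup>2 \<partial>lebesgue_on {0<..<t})"
      have "C / \<epsilon> * (t * (1 + e)) \<le> C / \<epsilon> * (T * (1 + e))"
        using t \<epsilon> C0 e0 by (intro mult_left_mono mult_right_mono) auto
      moreover have "\<epsilon> * (2 * c) * L1_norm T k * G = \<epsilon> * C * G" by (simp add: C_def)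
      moreover have "2 * c / \<epsilon> * t * L1_norm T k * (1 + e) = C / \<epsilon> * (t * (1 + e))" by (simp add: C_def)
      moreover have "2 * c / \<epsilon> * L1_norm T k * I = C / \<epsilon> * I" by (simp add: C_def)
      moreover have "C / \<epsilon> * (T * (1 + e) + I) = C / \<epsilon> * (T * (1 + e)) + C / \<epsilon> * I" by (rule distrib_left)
      ultimately show "(\<integral>s. weak_derivative T (vec_conv k (\<lambda>s. u s - u0)) s \<bullet> g s \<partial>lebesgue_on {0<..<t}) \<ge>
                conv k (energy \<phi> u) t
                - real_of_ereal (\<phi> 0 u0) * (\<integral>s. k s \<partial>lebesgue_on {0<..<t})
                - \<epsilon> * C * (\<integral>s. (norm (g s))\<^sup>2 \<partial>lebesgue_on {0<..<t})
                - C / \<epsilon> * (T * (1 + \<bar>real_of_ereal (\<phi> 0 u0)\<bar>)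
                           + (\<integral>s. \<bar>energy \<phi> u s\<bar> \<partial>lebesgue_on {0<..<t}))"
        using star unfolding star_ineq_def e_def[symmetric] I_def[symmetric] G_def[symmetric] by linarith
    qed
  qed
qed

end
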